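(* Let $n\ge4$ be even, let $(M,[g])$ be an $n$-dimensional conformally Einstein manifold of arbitrary signature, and let $\sigma$ be an Einstein scale. For $k\in\{1,\dots,\frac n2-1\}$, in the Einstein scale $\sigma$ the conformally invariant detour operator $L_k:\mathcal E^k\to\mathcal E_k$ is given, up to a nonzero scalar multiple, by $$L_k=\delta\prod_{i=1}^{\frac{n-2k-2}{2}}\Big(d\delta+\frac{2i(n-2k-i-1)}{n}J\Big)d .$$ (Moreover one sets $L_{n/2}=0$.)
   Context: Conventions. $\mathcal E^k$ is the space of smooth $k$-forms, $\mathcal E^k[w]$ the $k$-forms of conformal weight $w$, $\mathcal E_k:=\mathcal E^k[2k-n]$. $\boldsymbol g$ is the conformal metric (tautological section of $S^2T^*M\otimes E[2]$). An Einstein scale is a nowhere vanishing $\sigma\in\mathcal E[1]$ with $g=\sigma^{-2}\boldsymbol g$ Einstein; working in the scale $\sigma$ means using $g$ and trivialising density bundles by $\sigma$. $d$ is the exterior derivative, $\delta$ its formal adjoint ($(\delta f)_{a_2\cdots a_k}=-\nabla^{a_1}f_{a_1a_2\cdots a_k}$), $J=\mathrm{Sc}/(2(n-1))$ is the trace of the Schouten tensor of $g$ (constant). The operator $L_k$ is the Branson–Gover operator $L_k=\delta Q_{k+1}^\sigma d$, where $Q^\sigma_j:\mathcal E^j\to\mathcal E_j$ ($1\le j\le n/2$) is the Branson–Gover $Q$-operator, described as follows. Ambient metric. Let $\pi:\mathcal Q\to M$ be the ray bundle of metrics in $[g]$, with $\mathbb R_+$-action $\rho(s)(x,g_x)=(x,s^2g_x)$.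 An ambient manifold is an $(n+2)$-manifold $\tilde M\supset\mathcal Q$ with a free $\mathbb R_+$-action extending $\rho$, generated by a vector field $\boldsymbol X$. Since $[g]$ is conformally Einstein there is a Ricci-flat ambient metric $\boldsymbol h$ on $\tilde M$: $\mathcal L_{\boldsymbol X}\boldsymbol h=2\boldsymbol h$; at $u=(x,g_x)\in\mathcal Q$, $\boldsymbol h$ restricts to $\pi^*g_x$ on $T_u\mathcal Q$; and $Q:=\boldsymbol h(\boldsymbol X,\boldsymbol X)$ is a defining function for $\mathcal Q$ with $2\boldsymbol h(\boldsymbol X,\cdot)=dQ$. Let $\tilde\nabla$, $\tilde R$ be its Levi-Civita connection and curvature. An ambient tensor $F$ has weight $w$ if $\tilde\nabla_{\boldsymbol X}F=wF$. Restrictions to $\mathcal Q$ of ambient $j$-forms of weight $w$ are identified with weight-$w$ tractor $j$-forms $\mathcal T^j[w]$ on $M$. Put $\Delta^\sharp:=-\tilde\nabla^A\tilde\nabla_A-\tilde R\sharp\sharp$, where $(\tilde R\sharp\sharp F)_{A_1\cdots A_j}=\sum_{i\ne l}\tilde R_{A_i}{}^P{}_{A_l}{}^QF_{\cdots P\cdots Q\cdots}$ ($P,Q$ in slots $i,l$; sign such that on forms $\Delta^\sharp$ is the ambient form Laplacian), and $D^\sharp F:=(n+2w-2)\tilde\nabla F+\boldsymbol X\otimes\Delta^\sharp F$ for $F$ of weight $w$. Given $f\in\mathcal E^j$, let $F$ be an ambient $j$-form of weight $-j$ whose pullback to $\mathcal Q$ is $\pi^*f$; along $\mathcal Q$, $\boldsymbol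 X^\flat\wedge F$ depends only on $f$. With $\iota(D^\sharp)$ the contraction of $D^\sharp_A$ into the first index of a form, $\mathbb L_jf:=(\Delta^\sharp)^{n/2-j}\iota(D^\sharp)(\boldsymbol X^\flat\wedge F)|_{\mathcal Q}\in\mathcal T^j[j-n]$ is well defined and conformally invariant. In a scale $g$ the standard tractor bundle splits as $E[1]\oplus T^*M[1]\oplus E[-1]$ with projectors $Y_A,Z_A{}^a,X_A$, where $X_A$ is induced by $\boldsymbol X$; up to a fixed nonzero constant, $G_j^\sigma f\in\mathcal E_{j-1}$ is the component of $\mathbb L_jf$ along $X_{[A^1}Z_{A^2}{}^{a^2}\cdots Z_{A^j]}{}^{a^j}$. $Q_j^\sigma$ is a differential operator, formally self-adjoint for the pairing $(\varphi,\psi)\mapsto\int_M\varphi\cdot\psi$ of $\mathcal E^j$ with $\mathcal E_j$, and satisfies $G_j^\sigma=\delta Q_j^\sigma$; these properties determine its action on closed $j$-forms. *)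

theory Defs
  imports "HOL-Analysis.Analysis"
begin

section \<open>Smooth maps between open subsets of Euclidean spaces\<close>

primrec C_on :: "nat \<Rightarrow> 'a::real_normed_vector set \<Rightarrow> ('a \<Rightarrow> 'b::real_normed_vector) \<Rightarrow> bool" where
  "C_on 0 S f \<longleftrightarrow> continuous_on S f"
| "C_on (Suc r) S f \<longleftrightarrow> continuous_on S f \<and> (\<forall>x\<in>S. f differentiable (at x)) \<and>
     (\<forall>v. C_on r S (\<lambda>x. frechet_derivative f (at x) v))"

text \<open>Only used for open \<open>S\<close> in finite dimension, where \<^term>\<open>C_on r S f\<close> is the usual notion
  of an \<open>r\<close> times continuously differentiable map.\<close>

definition smooth_on :: "'a::real_normed_vector set \<Rightarrow> ('a \<Rightarrow> 'b::real_normed_vector) \<Rightarrow> bool" where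
  "smooth_on S f \<longleftrightarrow> (\<forall>r. C_on r S f)"

section \<open>Tensor calculus on a Euclidean domain\<close>

text \<open>A covariant tensor at a point eats the list of its arguments, and only lists of the
  appropriate length matter.  A tensor field is a function of the point.\<close>

type_synonym 'e tensor = "'e list \<Rightarrow> real"
type_synonym 'e tfield = "'e \<Rightarrow> 'e tensor"

definition multilin :: "nat \<Rightarrow> 'e::real_vector tensor \<Rightarrow> bool" where
  "multilin k t \<longleftrightarrow> (\<forall>vs i. length vs = k \<and> i < k \<longrightarrow> linear (\<lambda>v. t (vs[i := v])))"

definition alternating :: "nat \<Rightarrow> 'e tensor \<Rightarrow> bool" where
  "alternating k t \<longleftrightarrow> (\<forall>vs i j. length vs = k \<and> i < j \<and> j < k \<and> vs ! i = vs ! j \<longrightarrow> t vs = 0)"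

definition omit :: "nat \<Rightarrow> 'a list \<Rightarrow> 'a list" where
  "omit i vs = take i vs @ drop (Suc i) vs"

definition dirderiv :: "'e::real_normed_vector tfield \<Rightarrow> 'e \<Rightarrow> 'e \<Rightarrow> 'e tensor" where
  "dirderiv T x v vs = frechet_derivative (\<lambda>y. T y vs) (at x) v"

definition ext_d_loc :: "'e::real_normed_vector tfield \<Rightarrow> 'e tfield" where
  "ext_d_loc T x vs = (\<Sum>i<length vs. (-1) ^ i * dirderiv T x (vs ! i) (omit i vs))"

text \<open>With \<open>b\<close> running through the orthonormal basis of the coordinate space and regarded as a
  coordinate covector \<open>e\<^sup>b\<close>, the vector \<^term>\<open>raise g b\<close> is \<open>g\<^sup>a\<^sup>b e\<^sub>a\<close>.  Hence a metric contraction is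
  \<open>\<Sum>b\<in>Basis. B b (raise g b)\<close>.\<close>

definition raise :: "'e::euclidean_space tensor \<Rightarrow> 'e \<Rightarrow> 'e" where
  "raise g b = (THE z. \<forall>u. g [z, u] = b \<bullet> u)"

definition christoffel :: "'e::euclidean_space tfield \<Rightarrow> 'e \<Rightarrow> 'e \<Rightarrow> 'e \<Rightarrow> 'e" where
  "christoffel g x v w = (\<Sum>b\<in>Basis.
     ((dirderiv g x v [w, b] + dirderiv g x w [v, b] - dirderiv g x b [v, w]) / 2) *\<^sub>R raise (g x) b)"

text \<open>The differentiation index of \<^term>\<open>nabla g T\<close> is the first slot.\<close>

definition nabla :: "'e::euclidean_space tfield \<Rightarrow> 'e tfield \<Rightarrow> 'e tfield" where
  "nabla g T x us = (case us of [] \<Rightarrow> 0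
     | v # vs \<Rightarrow> dirderiv T x v vs - (\<Sum>i<length vs. T x (vs[i := christoffel g x v (vs ! i)])))"

definition codiff_loc :: "'e::euclidean_space tfield \<Rightarrow> 'e tfield \<Rightarrow> 'e tfield" where
  "codiff_loc g T x vs = - (\<Sum>b\<in>Basis. nabla g T x (b # raise (g x) b # vs))"

text \<open>\<open>R(u,v)w = \<nabla>\<^sub>u\<nabla>\<^sub>v w - \<nabla>\<^sub>v\<nabla>\<^sub>u w\<close> for coordinate fields; \<open>R\<^sub>a\<^sub>b\<^sub>c\<^sub>d = g(R(e\<^sub>a,e\<^sub>b)e\<^sub>d, e\<^sub>c)\<close>, so that the unit
  sphere has \<open>R\<^sub>a\<^sub>b\<^sub>c\<^sub>d = g\<^sub>a\<^sub>c g\<^sub>b\<^sub>d - g\<^sub>a\<^sub>d g\<^sub>b\<^sub>c\<close> and positive Ricci curvature.\<close>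

definition curv :: "'e::euclidean_space tfield \<Rightarrow> 'e \<Rightarrow> 'e \<Rightarrow> 'e \<Rightarrow> 'e \<Rightarrow> 'e" where
  "curv g x u v w =
     frechet_derivative (\<lambda>y. christoffel g y v w) (at x) u
     - frechet_derivative (\<lambda>y. christoffel g y u w) (at x) v
     + christoffel g x u (christoffel g x v w) - christoffel g x v (christoffel g x u w)"

definition Riem :: "'e::euclidean_space tfield \<Rightarrow> 'e \<Rightarrow> 'e \<Rightarrow> 'e \<Rightarrow> 'e \<Rightarrow> 'e \<Rightarrow> real" where
  "Riem g x a b c d = g x [curv g x a b d, c]"

definition Ric :: "'e::euclidean_space tfield \<Rightarrow> 'e \<Rightarrow> 'e \<Rightarrow> 'e \<Rightarrow> real" where
  "Ric g x v w = (\<Sum>b\<in>Basis. b \<bullet> curv g x b v w)"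

definition Scal :: "'e::euclidean_space tfield \<Rightarrow> 'e \<Rightarrow> real" where
  "Scal g x = (\<Sum>b\<in>Basis. Ric g x b (raise (g x) b))"

definition schouten_J :: "'e::euclidean_space tfield \<Rightarrow> 'e \<Rightarrow> real" where
  "schouten_J g x = Scal g x / (2 * (real DIM('e) - 1))"

definition curv_sharp :: "'e::euclidean_space tfield \<Rightarrow> 'e tfield \<Rightarrow> 'e tfield" where
  "curv_sharp g T x vs = (\<Sum>i<length vs. \<Sum>l\<in>{..<length vs} - {i}. \<Sum>p\<in>Basis. \<Sum>q\<in>Basis.
     Riem g x (vs ! i) p (vs ! l) q * T x (vs[i := raise (g x) p, l := raise (g x) q]))"

text \<open>With the sign of \<^const>\<open>Riem\<close> above, this is \<open>d\<delta> + \<delta>d\<close> on forms if \<open>g\<close> is Ricci-flat.\<close>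

definition Delta_sharp_loc :: "'e::euclidean_space tfield \<Rightarrow> 'e tfield \<Rightarrow> 'e tfield" where
  "Delta_sharp_loc g T x vs =
     - (\<Sum>b\<in>Basis. nabla g (nabla g T) x (b # raise (g x) b # vs)) - curv_sharp g T x vs"

text \<open>\<open>n\<close> is the dimension of the underlying conformal manifold, not that of the ambient space in
  which the fields \<open>h, X, T\<close> live; \<open>w\<close> is the weight of \<open>T\<close>.\<close>

definition D_sharp_loc ::
    "nat \<Rightarrow> real \<Rightarrow> 'e::euclidean_space tfield \<Rightarrow> ('e \<Rightarrow> 'e) \<Rightarrow> 'e tfield \<Rightarrow> 'e tfield" where
  "D_sharp_loc n w h X T x us = (case us of [] \<Rightarrow> 0
     | v # vs \<Rightarrow> (real n + 2 * w - 2) * nabla h T x (v # vs)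
                + h x [X x, v] * Delta_sharp_loc h T x vs)"

definition iota_D_sharp_loc ::
    "nat \<Rightarrow> real \<Rightarrow> 'e::euclidean_space tfield \<Rightarrow> ('e \<Rightarrow> 'e) \<Rightarrow> 'e tfield \<Rightarrow> 'e tfield" where
  "iota_D_sharp_loc n w h X T x vs =
     (\<Sum>b\<in>Basis. D_sharp_loc n w h X T x (b # raise (h x) b # vs))"

definition flat_wedge_loc ::
    "'e::euclidean_space tfield \<Rightarrow> ('e \<Rightarrow> 'e) \<Rightarrow> 'e tfield \<Rightarrow> 'e tfield" where
  "flat_wedge_loc h X T x vs = (\<Sum>i<length vs. (-1) ^ i * h x [X x, vs ! i] * T x (omit i vs))"

definition lie_deriv_loc :: "('e::real_normed_vector \<Rightarrow> 'e) \<Rightarrow> 'e tfield \<Rightarrow> 'e tfield" where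
  "lie_deriv_loc X T x vs = dirderiv T x (X x) vs
     + (\<Sum>i<length vs. T x (vs[i := frechet_derivative X (at x) (vs ! i)]))"

section \<open>Manifolds, tensor fields and metrics\<close>

type_synonym ('p, 'e) chart = "'p set \<times> ('p \<Rightarrow> 'e)"

record ('p, 'e) mfd =
  mtop :: "'p topology"
  atlas :: "('p, 'e) chart set"

definition chart_dom :: "('p, 'e) chart \<Rightarrow> 'e set" where
  "chart_dom c = snd c ` fst c"

definition chart_pt :: "('p, 'e) chart \<Rightarrow> 'e \<Rightarrow> 'p" where
  "chart_pt c = inv_into (fst c) (snd c)"

definition smooth_manifold :: "('p, 'e::euclidean_space) mfd \<Rightarrow> bool" where
  "smooth_manifold M \<longleftrightarrow> Hausdorff_space (mtop M) \<and> second_countable (mtop M) \<and>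
     (\<Union>c\<in>atlas M. fst c) = topspace (mtop M) \<and>
     (\<forall>c\<in>atlas M. openin (mtop M) (fst c) \<and> open (chart_dom c) \<and>
        homeomorphic_map (subtopology (mtop M) (fst c)) (top_of_set (chart_dom c)) (snd c)) \<and>
     (\<forall>c\<in>atlas M. \<forall>c'\<in>atlas M. smooth_on (snd c ` (fst c \<inter> fst c')) (snd c' \<circ> chart_pt c))"

definition smooth_into :: "('p, 'e::euclidean_space) mfd \<Rightarrow> 'a::euclidean_space set \<Rightarrow> ('a \<Rightarrow> 'p) \<Rightarrow> bool" where
  "smooth_into M S f \<longleftrightarrow> f ` S \<subseteq> topspace (mtop M) \<and>
     (\<forall>c\<in>atlas M. open {x\<in>S. f x \<in> fst c} \<and> smooth_on {x\<in>S. f x \<in> fst c} (\<lambda>x. snd c (f x)))"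

text \<open>A tensor field on a manifold is given by its coordinate expressions in all charts.  The values
  outside the relevant coordinate domains, and on lists of the wrong length, are irrelevant.\<close>

type_synonym ('p, 'e) mfield = "('p, 'e) chart \<Rightarrow> 'e tfield"

definition tensor_field ::
    "('p, 'e::euclidean_space) mfd \<Rightarrow> 'p set \<Rightarrow> nat \<Rightarrow> ('p, 'e) mfield \<Rightarrow> bool" where
  "tensor_field M W k T \<longleftrightarrow> openin (mtop M) W \<and>
     (\<forall>c\<in>atlas M.
        (\<forall>vs. length vs = k \<longrightarrow> smooth_on (snd c ` (fst c \<inter> W)) (\<lambda>x. T c x vs)) \<and>
        (\<forall>x\<in>snd c ` (fst c \<inter> W). multilin k (T c x))) \<and>
     (\<forall>c\<in>atlas M. \<forall>c'\<in>atlas M. \<forall>p\<in>fst c \<inter> fst c' \<inter> W. \<forall>vs. length vs = k \<longrightarrow>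
        T c (snd c p) vs = T c' (snd c' p)
          (map (frechet_derivative (snd c' \<circ> chart_pt c) (at (snd c p))) vs))"

definition form_on ::
    "('p, 'e::euclidean_space) mfd \<Rightarrow> 'p set \<Rightarrow> nat \<Rightarrow> ('p, 'e) mfield \<Rightarrow> bool" where
  "form_on M W k T \<longleftrightarrow> tensor_field M W k T \<and>
     (\<forall>c\<in>atlas M. \<forall>x\<in>snd c ` (fst c \<inter> W). alternating k (T c x))"

abbreviation kform :: "('p, 'e::euclidean_space) mfd \<Rightarrow> nat \<Rightarrow> ('p, 'e) mfield \<Rightarrow> bool" where
  "kform M k \<equiv> form_on M (topspace (mtop M)) k"

definition form_eq ::
    "('p, 'e) mfd \<Rightarrow> nat \<Rightarrow> ('p, 'e) mfield \<Rightarrow> ('p, 'e) mfield \<Rightarrow> bool" where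
  "form_eq M k T T' \<longleftrightarrow> (\<forall>c\<in>atlas M. \<forall>x\<in>chart_dom c. \<forall>vs. length vs = k \<longrightarrow> T c x vs = T' c x vs)"

text \<open>Pseudo-Riemannian metrics, of arbitrary signature.\<close>

definition pseudo_metric :: "('p, 'e::euclidean_space) mfd \<Rightarrow> ('p, 'e) mfield \<Rightarrow> bool" where
  "pseudo_metric M g \<longleftrightarrow> tensor_field M (topspace (mtop M)) 2 g \<and>
     (\<forall>c\<in>atlas M. \<forall>x\<in>chart_dom c. (\<forall>u v. g c x [u, v] = g c x [v, u]) \<and>
        (\<forall>u. (\<forall>v. g c x [u, v] = 0) \<longrightarrow> u = 0))"

definition einstein_metric :: "('p, 'e::euclidean_space) mfd \<Rightarrow> ('p, 'e) mfield \<Rightarrow> bool" where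
  "einstein_metric M g \<longleftrightarrow> pseudo_metric M g \<and>
     (\<exists>l. \<forall>c\<in>atlas M. \<forall>x\<in>chart_dom c. \<forall>u v. Ric (g c) x u v = l * g c x [u, v])"

definition ext_d :: "('p, 'e::euclidean_space) mfield \<Rightarrow> ('p, 'e) mfield" where
  "ext_d T c = ext_d_loc (T c)"

definition codiff :: "('p, 'e::euclidean_space) mfield \<Rightarrow> ('p, 'e) mfield \<Rightarrow> ('p, 'e) mfield" where
  "codiff g T c = codiff_loc (g c) (T c)"

section \<open>Conformal structures, densities and Einstein scales\<close>

text \<open>The conformal class is represented by one of its metrics \<open>g\<close>.  A point of the ray bundle is a
  pair of a point \<open>p\<close> and a metric \<open>t\<^sup>2 g\<^sub>p\<close> on the tangent space at \<open>p\<close>, given by its coordinate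
  expressions; it is made independent of the irrelevant values of \<open>g\<close>, so that \<open>ray_bundle\<close>
  depends on the conformal class of \<open>g\<close> only.\<close>

type_synonym ('p, 'e) ray = "'p \<times> (('p, 'e) chart \<Rightarrow> 'e tensor)"

definition ray_pt :: "('p, 'e) mfd \<Rightarrow> ('p, 'e) mfield \<Rightarrow> real \<Rightarrow> 'p \<Rightarrow> ('p, 'e) ray" where
  "ray_pt M g t p = (p, \<lambda>c vs. if c \<in> atlas M \<and> p \<in> fst c \<and> length vs = 2
                              then t\<^sup>2 * g c (snd c p) vs else 0)"

definition ray_bundle :: "('p, 'e) mfd \<Rightarrow> ('p, 'e) mfield \<Rightarrow> ('p, 'e) ray set" where
  "ray_bundle M g = {ray_pt M g t p | t p. 0 < t \<and> p \<in> topspace (mtop M)}"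

definition ray_act :: "real \<Rightarrow> ('p, 'e) ray \<Rightarrow> ('p, 'e) ray" where
  "ray_act s u = (fst u, \<lambda>c vs. s\<^sup>2 * snd u c vs)"

text \<open>The local parametrization \<open>(x, t) \<mapsto> t\<^sup>2 g\<^sub>x\<close> of the ray bundle over a chart.\<close>

definition ray_param ::
    "('p, 'e) mfd \<Rightarrow> ('p, 'e) mfield \<Rightarrow> ('p, 'e) chart \<Rightarrow> 'e \<times> real \<Rightarrow> ('p, 'e) ray" where
  "ray_param M g c z = ray_pt M g (snd z) (chart_pt c (fst z))"

text \<open>A section of \<open>E[w]\<close> is a function on the ray bundle that is homogeneous of degree \<open>w\<close>.\<close>

definition density ::
    "('p, 'e::euclidean_space) mfd \<Rightarrow> ('p, 'e) mfield \<Rightarrow> real \<Rightarrow> (('p, 'e) ray \<Rightarrow> real) \<Rightarrow> bool" where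
  "density M g w \<sigma> \<longleftrightarrow>
     (\<forall>u\<in>ray_bundle M g. \<forall>s>0. \<sigma> (ray_act s u) = s powr w * \<sigma> u) \<and>
     (\<forall>c\<in>atlas M. smooth_on (chart_dom c) (\<lambda>x. \<sigma> (ray_param M g c (x, 1))))"

text \<open>The metric \<open>\<sigma>\<^sup>-\<^sup>2 \<bold>g\<close>: as the conformal metric \<open>\<bold>g\<close> is tautological, it is \<open>\<sigma>(g\<^sub>p)\<^sup>-\<^sup>2 g\<^sub>p\<close> at
  \<open>p\<close>, whichever metric \<open>g\<close> of the conformal class is used.\<close>

definition scale_metric ::
    "('p, 'e) mfd \<Rightarrow> ('p, 'e) mfield \<Rightarrow> (('p, 'e) ray \<Rightarrow> real) \<Rightarrow> ('p, 'e) mfield" where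
  "scale_metric M g \<sigma> c x vs = g c x vs / (\<sigma> (ray_param M g c (x, 1)))\<^sup>2"

definition einstein_scale ::
    "('p, 'e::euclidean_space) mfd \<Rightarrow> ('p, 'e) mfield \<Rightarrow> (('p, 'e) ray \<Rightarrow> real) \<Rightarrow> bool" where
  "einstein_scale M g \<sigma> \<longleftrightarrow> density M g 1 \<sigma> \<and> (\<forall>u\<in>ray_bundle M g. \<sigma> u \<noteq> 0) \<and>
     einstein_metric M (scale_metric M g \<sigma>)"

section \<open>Ricci-flat ambient metrics\<close>

text \<open>\<open>tot\<close> is the ambient manifold, \<open>act\<close> the action of the positive reals, \<open>emb\<close> the inclusion of
  the ray bundle and \<open>hmet\<close> the ambient metric.\<close>

record ('p, 'e, 'q, 'f) ambient =
  tot :: "('q, 'f) mfd"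
  act :: "real \<Rightarrow> 'q \<Rightarrow> 'q"
  emb :: "('p, 'e) ray \<Rightarrow> 'q"
  hmet :: "('q, 'f) mfield"

definition gen_X :: "('p, 'e, 'q, 'f::euclidean_space) ambient \<Rightarrow> ('q, 'f) chart \<Rightarrow> 'f \<Rightarrow> 'f" where
  "gen_X A c y = vector_derivative (\<lambda>s. snd c (act A s (chart_pt c y))) (at 1)"

text \<open>The coordinate expression of \<open>emb\<close>, in the chart \<open>c\<close> below and the chart \<open>c'\<close> above.\<close>

definition emb_coord ::
    "('p, 'e) mfd \<Rightarrow> ('p, 'e) mfield \<Rightarrow> ('p, 'e, 'q, 'f) ambient \<Rightarrow>
     ('p, 'e) chart \<Rightarrow> ('q, 'f) chart \<Rightarrow> 'e \<times> real \<Rightarrow> 'f" where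
  "emb_coord M g A c c' z = snd c' (emb A (ray_param M g c z))"

definition ambient_manifold ::
    "('p, 'e::euclidean_space) mfd \<Rightarrow> ('p, 'e) mfield \<Rightarrow> ('p, 'e, 'q, 'f::euclidean_space) ambient \<Rightarrow> bool" where
  "ambient_manifold M g A \<longleftrightarrow>
     DIM('f) = DIM('e) + 2 \<and> smooth_manifold (tot A) \<and>
     (\<forall>p\<in>topspace (mtop (tot A)). act A 1 p = p \<and>
        (\<forall>s>0. \<forall>t>0. act A s (act A t p) = act A (s * t) p) \<and>
        (\<forall>s>0. act A s p = p \<longrightarrow> s = 1)) \<and>
     (\<forall>c\<in>atlas (tot A). smooth_into (tot A) ({0<..} \<times> chart_dom c) (\<lambda>z. act A (fst z) (chart_pt c (snd z)))) \<and>
     inj_on (emb A) (ray_bundle M g) \<and>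
     (\<forall>u\<in>ray_bundle M g. \<forall>s>0. emb A (ray_act s u) = act A s (emb A u)) \<and>
     (\<forall>c\<in>atlas M. smooth_into (tot A) (chart_dom c \<times> {0<..}) (\<lambda>z. emb A (ray_param M g c z))) \<and>
     (\<forall>c\<in>atlas M. \<forall>c'\<in>atlas (tot A). \<forall>z\<in>chart_dom c \<times> {0<..}. emb A (ray_param M g c z) \<in> fst c' \<longrightarrow>
        inj (frechet_derivative (emb_coord M g A c c') (at z)))"

text \<open>The clause on the zero set of \<open>\<bold>h(X,X)\<close> says that \<open>\<bold>h(X,X)\<close> is a defining function of the ray
  bundle; together with the injective immersion \<open>emb\<close> it makes the ray bundle a closed embedded
  hypersurface.\<close>

definition ambient_metric ::
    "('p, 'e::euclidean_space) mfd \<Rightarrow> ('p, 'e) mfield \<Rightarrow> ('p, 'e, 'q, 'f::euclidean_space) ambient \<Rightarrow> bool" where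
  "ambient_metric M g A \<longleftrightarrow> pseudo_metric (tot A) (hmet A) \<and>
     (\<forall>c\<in>atlas (tot A). \<forall>y\<in>chart_dom c.
        (\<forall>u v. lie_deriv_loc (gen_X A c) (hmet A c) y [u, v] = 2 * hmet A c y [u, v]) \<and>
        (\<forall>v. 2 * hmet A c y [gen_X A c y, v] =
           frechet_derivative (\<lambda>z. hmet A c z [gen_X A c z, gen_X A c z]) (at y) v) \<and>
        (\<forall>u v. Ric (hmet A c) y u v = 0) \<and>
        (hmet A c y [gen_X A c y, gen_X A c y] = 0 \<longleftrightarrow> chart_pt c y \<in> emb A ` ray_bundle M g) \<and>
        (hmet A c y [gen_X A c y, gen_X A c y] = 0 \<longrightarrow>
           (\<exists>v. frechet_derivative (\<lambda>z. hmet A c z [gen_X A c z, gen_X A c z]) (at y) v \<noteq> 0))) \<and>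
     (\<forall>c\<in>atlas M. \<forall>c'\<in>atlas (tot A). \<forall>x\<in>chart_dom c. \<forall>t>0. emb A (ray_param M g c (x, t)) \<in> fst c' \<longrightarrow>
        (\<forall>u v. hmet A c' (emb_coord M g A c c' (x, t))
             (map (frechet_derivative (emb_coord M g A c c') (at (x, t))) [u, v])
           = t\<^sup>2 * g c x [fst u, fst v]))"

definition ricci_flat_ambient_space ::
    "('p, 'e::euclidean_space) mfd \<Rightarrow> ('p, 'e) mfield \<Rightarrow> ('p, 'e, 'q, 'f::euclidean_space) ambient \<Rightarrow> bool" where
  "ricci_flat_ambient_space M g A \<longleftrightarrow> ambient_manifold M g A \<and> ambient_metric M g A"

definition has_weight ::
    "('p, 'e, 'q, 'f::euclidean_space) ambient \<Rightarrow> 'q set \<Rightarrow> nat \<Rightarrow> real \<Rightarrow> ('q, 'f) mfield \<Rightarrow> bool" where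
  "has_weight A W k w F \<longleftrightarrow> (\<forall>c\<in>atlas (tot A). \<forall>y\<in>snd c ` (fst c \<inter> W). \<forall>vs. length vs = k \<longrightarrow>
     nabla (hmet A c) (F c) y (gen_X A c y # vs) = w * F c y vs)"

section \<open>The operators of Branson and Gover\<close>

text \<open>\<open>F\<close> is an ambient \<open>j\<close>-form of weight \<open>-j\<close>, defined on an open set \<open>W\<close>, whose pullback to the ray
  bundle is \<open>\<pi>\<^sup>*f\<close>.\<close>

definition ambient_lift ::
    "('p, 'e::euclidean_space) mfd \<Rightarrow> ('p, 'e) mfield \<Rightarrow> ('p, 'e, 'q, 'f::euclidean_space) ambient \<Rightarrow>
     nat \<Rightarrow> ('p, 'e) mfield \<Rightarrow> 'q set \<Rightarrow> ('q, 'f) mfield \<Rightarrow> bool" where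
  "ambient_lift M g A j f W F \<longleftrightarrow> form_on (tot A) W j F \<and> has_weight A W j (- real j) F \<and>
     (\<forall>c\<in>atlas M. \<forall>c'\<in>atlas (tot A). \<forall>x\<in>chart_dom c. \<forall>t>0.
        emb A (ray_param M g c (x, t)) \<in> fst c' \<inter> W \<longrightarrow>
        (\<forall>us. length us = j \<longrightarrow>
           F c' (emb_coord M g A c c' (x, t))
             (map (frechet_derivative (emb_coord M g A c c') (at (x, t))) us)
           = f c x (map fst us)))"

text \<open>\<open>(\<Delta>\<^sup>\<sharp>)\<^bsup>n/2-j\<^esup> \<iota>(D\<^sup>\<sharp>) (X\<^sup>\<flat> \<and> F)\<close>; the form \<open>X\<^sup>\<flat> \<and> F\<close> has weight \<open>1 - j\<close>.\<close>

definition bbL ::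
    "nat \<Rightarrow> ('p, 'e, 'q, 'f::euclidean_space) ambient \<Rightarrow> nat \<Rightarrow> ('q, 'f) mfield \<Rightarrow> ('q, 'f) mfield" where
  "bbL n A j F c = (Delta_sharp_loc (hmet A c) ^^ (n div 2 - j))
     (iota_D_sharp_loc n (1 - real j) (hmet A c) (gen_X A c)
        (flat_wedge_loc (hmet A c) (gen_X A c) (F c)))"

text \<open>In the scale \<open>g\<close>, tractors at \<open>p\<close> are ambient tensors at \<open>g\<^sub>p\<close>.  The section \<open>p \<mapsto> g\<^sub>p\<close> of the ray
  bundle has the derivative \<open>H = Z\<close>, and \<open>Y\<close> is the null vector with \<open>\<bold>h(X,Y) = 1\<close> orthogonal to the
  range of \<open>H\<close>.  As \<open>X\<^sub>A Y\<^sup>A = 1\<close> and \<open>Y\<^sub>A Y\<^sup>A = Z\<^sub>A\<^sup>a Y\<^sup>A = 0\<close>, inserting \<open>Y\<close> and then vectors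
  \<open>H v\<close> into a \<open>j\<close>-form extracts the component along \<open>X\<^bsub>[A1\<^esub> Z\<^bsub>A2\<^esub> \<cdots> Z\<^bsub>Aj]\<^esub>\<close> up to a constant, which is
  absorbed into the normalization \<open>\<kappa>\<close>.  The choices of \<open>c'\<close> and \<open>F\<close> do not matter; \<open>F\<close> need
  only be defined near the point in question, where it always exists.\<close>

definition G_op ::
    "('p, 'e::euclidean_space) mfd \<Rightarrow> ('p, 'e) mfield \<Rightarrow> ('p, 'e, 'q, 'f::euclidean_space) ambient \<Rightarrow>
     real \<Rightarrow> nat \<Rightarrow> ('p, 'e) mfield \<Rightarrow> ('p, 'e) mfield" where
  "G_op M g A \<kappa> j f c x vs =
     (let u = emb A (ray_param M g c (x, 1));
          c' = (SOME c'. c' \<in> atlas (tot A) \<and> u \<in> fst c');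
          F = (SOME F. \<exists>W. u \<in> W \<and> ambient_lift M g A j f W F);
          y = snd c' u;
          H = (\<lambda>v. frechet_derivative (emb_coord M g A c c') (at (x, 1)) (v, 0));
          Y = (THE Y. hmet A c' y [Y, Y] = 0 \<and> hmet A c' y [gen_X A c' y, Y] = 1 \<and>
                 (\<forall>v. hmet A c' y [Y, H v] = 0))
      in \<kappa> * bbL DIM('e) A j F c' y (Y # map H vs))"

text \<open>The iterated partial derivative along a list of directions.\<close>

primrec iter_deriv :: "'e::real_normed_vector list \<Rightarrow> ('e \<Rightarrow> real) \<Rightarrow> 'e \<Rightarrow> real" where
  "iter_deriv [] f = f"
| "iter_deriv (v # vs) f = (\<lambda>x. frechet_derivative (iter_deriv vs f) (at x) v)"

definition diff_operator ::
    "('p, 'e::euclidean_space) mfd \<Rightarrow> nat \<Rightarrow> (('p, 'e) mfield \<Rightarrow> ('p, 'e) mfield) \<Rightarrow> bool" where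
  "diff_operator M j P \<longleftrightarrow> (\<forall>f. kform M j f \<longrightarrow> kform M j (P f)) \<and>
     (\<exists>r. \<forall>c\<in>atlas M. \<exists>a.
        (\<forall>vs ds es. length vs = j \<longrightarrow> smooth_on (chart_dom c) (\<lambda>x. a vs ds es x)) \<and>
        (\<forall>f. kform M j f \<longrightarrow> (\<forall>x\<in>chart_dom c. \<forall>vs. length vs = j \<longrightarrow>
           P f c x vs =
             (\<Sum>ds\<in>{ds. set ds \<subseteq> Basis \<and> length ds \<le> r}. \<Sum>es\<in>{es. set es \<subseteq> Basis \<and> length es = j}.
                a vs ds es x * iter_deriv ds (\<lambda>z. f c z es) x))))"

definition vol_density :: "(real ^ 'n) tensor \<Rightarrow> real" where
  "vol_density g = sqrt \<bar>det (\<chi> i j. g [axis i 1, axis j 1])\<bar>"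

definition vol_measure :: "('p, real ^ 'n) mfd \<Rightarrow> ('p, real ^ 'n) mfield \<Rightarrow> 'p measure" where
  "vol_measure M g = (THE \<mu>. space \<mu> = topspace (mtop M) \<and>
     sets \<mu> = sigma_sets (topspace (mtop M)) {U. openin (mtop M) U} \<and>
     (\<forall>c\<in>atlas M. \<forall>B\<in>sets \<mu>. B \<subseteq> fst c \<longrightarrow>
        emeasure \<mu> B = (\<integral>\<^sup>+ x. ennreal (vol_density (g c x)) * indicator (snd c ` B) x \<partial>lborel)))"

definition form_pairing ::
    "('p, 'e::euclidean_space) mfd \<Rightarrow> ('p, 'e) mfield \<Rightarrow> nat \<Rightarrow> ('p, 'e) mfield \<Rightarrow> ('p, 'e) mfield \<Rightarrow> 'p \<Rightarrow> real" where
  "form_pairing M g j \<phi> \<psi> p =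
     (let c = (SOME c. c \<in> atlas M \<and> p \<in> fst c); x = snd c p
      in \<Sum>es\<in>{es. set es \<subseteq> Basis \<and> length es = j}. \<phi> c x es * \<psi> c x (map (raise (g c x)) es))"

definition compactly_supported ::
    "('p, 'e::euclidean_space) mfd \<Rightarrow> nat \<Rightarrow> ('p, 'e) mfield \<Rightarrow> bool" where
  "compactly_supported M j \<phi> \<longleftrightarrow> (\<exists>K. compactin (mtop M) K \<and>
     (\<forall>c\<in>atlas M. \<forall>p\<in>fst c - K. \<forall>vs. length vs = j \<longrightarrow> \<phi> c (snd c p) vs = 0))"

definition formally_self_adjoint ::
    "('p, real ^ 'n) mfd \<Rightarrow> ('p, real ^ 'n) mfield \<Rightarrow> nat \<Rightarrow>
     (('p, real ^ 'n) mfield \<Rightarrow> ('p, real ^ 'n) mfield) \<Rightarrow> bool" where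
  "formally_self_adjoint M g j P \<longleftrightarrow>
     (\<forall>\<phi> \<psi>. kform M j \<phi> \<and> kform M j \<psi> \<and> compactly_supported M j \<phi> \<and> compactly_supported M j \<psi> \<longrightarrow>
        integral\<^sup>L (vol_measure M g) (form_pairing M g j \<phi> (P \<psi>)) =
        integral\<^sup>L (vol_measure M g) (form_pairing M g j \<psi> (P \<phi>)))"

text \<open>\<open>g\<close> is the metric of the scale in which one works.  It trivializes all density bundles, so that
  \<open>\<E>\<^sub>j\<close> is identified with the \<open>j\<close>-forms and the conformally invariant pairing is integration of
  the \<open>g\<close>-inner product against the volume density of \<open>g\<close>.\<close>

definition branson_gover_Q ::
    "('p, real ^ 'n) mfd \<Rightarrow> ('p, real ^ 'n) mfield \<Rightarrow> ('p, real ^ 'n, 'q, 'f::euclidean_space) ambient \<Rightarrow>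
     real \<Rightarrow> nat \<Rightarrow> (('p, real ^ 'n) mfield \<Rightarrow> ('p, real ^ 'n) mfield) \<Rightarrow> bool" where
  "branson_gover_Q M g A \<kappa> j P \<longleftrightarrow> diff_operator M j P \<and> formally_self_adjoint M g j P \<and>
     (\<forall>f. kform M j f \<longrightarrow> form_eq M (j - 1) (G_op M g A \<kappa> j f) (codiff g (P f)))"

text \<open>\<open>L\<^sub>k = \<delta> Q\<^bsub>k+1\<^esub> d\<close>, with the convention \<open>L\<^bsub>n/2\<^esub> = 0\<close>.\<close>

definition detour_L ::
    "('p, 'e::euclidean_space) mfield \<Rightarrow> (nat \<Rightarrow> ('p, 'e) mfield \<Rightarrow> ('p, 'e) mfield) \<Rightarrow>
     nat \<Rightarrow> ('p, 'e) mfield \<Rightarrow> ('p, 'e) mfield" where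
  "detour_L g Q k f = (if 2 * k = DIM('e) then (\<lambda>c x vs. 0) else codiff g (Q (k + 1) (ext_d f)))"

definition einstein_factor ::
    "('p, 'e::euclidean_space) mfield \<Rightarrow> nat \<Rightarrow> nat \<Rightarrow> ('p, 'e) mfield \<Rightarrow> ('p, 'e) mfield" where
  "einstein_factor g k i \<omega> = (\<lambda>c x vs. ext_d (codiff g \<omega>) c x vs
     + 2 * real i * (real DIM('e) - 2 * real k - real i - 1) / real DIM('e)
       * schouten_J (g c) x * \<omega> c x vs)"

text \<open>The factors commute, so their order is immaterial.\<close>

definition einstein_product ::
    "('p, 'e::euclidean_space) mfield \<Rightarrow> nat \<Rightarrow> ('p, 'e) mfield \<Rightarrow> ('p, 'e) mfield" where
  "einstein_product g k = foldr (einstein_factor g k) [1..<(DIM('e) - 2 * k - 2) div 2 + 1]"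

end

theory Submission
 imports Defs "HOL-Library.Function_Algebras" "HOL-Library.Multiset"
begin

text \<open>On closed forms the Branson-Gover operators satisfy \<open>\<delta> Q\<^sub>j = G\<^sub>j\<close>, so that \<open>L\<^sub>k f = G\<^sub>k\<^sub>+\<^sub>1 (d f)\<close>: what has to be found is
  the component of \<open>\<Delta>\<^sup>m \<iota>(D) (X \<and> F)\<close>, with \<open>m = n/2 - k - 1\<close>, that is picked out by \<open>G\<close>, for a lift \<open>F\<close> of \<open>d f\<close>
  to the Ricci-flat ambient space.  Here \<open>X\<close> is the infinitesimal dilation, so that \<open>\<nabla>X = id\<close>, and \<open>Q = h(X,X)\<close>
  vanishes exactly on the cone.  Ricci-flatness makes \<open>\<Delta>\<close> the form Laplacian \<open>d\<delta> + \<delta>d\<close> (\<open>DL_loc\<close>); it commutes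
  with \<open>d\<close> and \<open>\<delta>\<close>, and its commutators with \<open>Q\<close>, with \<open>\<iota>\<^sub>X\<close> and with exterior multiplication by \<open>X\<close> are of first order.
  (These operators are called \<open>dx\<close>, \<open>dl\<close>, \<open>DL\<close>, \<open>ii X\<close> and \<open>E\<close>, and \<open>\<nabla>\<close> in constant directions is \<open>N\<close>.)

  Let \<open>F\<close> be closed and annihilated by \<open>\<iota>\<^sub>X\<close>, and put \<open>C\<^sub>l = (d\<delta>)\<^sup>l F\<close> (\<open>CC F l\<close>).  The commutators give (\<open>DL_pow_iotaD\<close>)
  \<open>\<Delta>\<^sup>l \<iota>(D) (X \<and> F) = a\<^sub>l C\<^sub>l + (2m+2) X \<and> \<delta>C\<^sub>l + Q C\<^sub>l\<^sub>+\<^sub>1\<close> with \<open>a\<^sub>m = 0\<close>, so that the component wanted is \<open>2m+2\<close> times the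
  pullback of \<open>\<delta>C\<^sub>m\<close> to the section \<open>e\<close> of the cone that belongs to the Einstein metric.  Another choice of the lift only
  adds a multiple of \<open>Q\<close> (\<open>iotaD_Q_zero\<close>).

  To pull back \<open>\<delta>C\<^sub>l\<close> one has to know \<open>C\<^sub>l\<close> in the direction transversal to the cone.  This is where the Einstein scale
  enters.  It extends to a function \<open>\<tau>\<close> on the ambient space that is homogeneous of degree one and harmonic up to
  \<open>O(Q\<^sup>n\<^sup>/\<^sup>2)\<close> (\<open>tau_exists\<close>).  By the Gauss equation and the Einstein condition its Hessian vanishes on the cone
  (\<open>hessian_section\<close>), and hence to order \<open>n/2 - 1\<close>, because it solves an equation of Laplace type (\<open>lap_hessian\<close>,
  \<open>hessian_order\<close>).  So the gradient \<open>I\<close> of \<open>\<tau>\<close> is parallel to high order.  One may choose the lift such that \<open>\<iota>\<^sub>I F\<close>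
  vanishes to the same order (\<open>adapted_lift\<close>), and each Laplacian costs only one order (\<open>ord_commutator\<close>).  Therefore
  \<open>\<iota>\<^sub>I C\<^sub>l\<close> vanishes on the cone for all \<open>l \<le> m\<close> (\<open>CC_orders\<close>).  Along the section \<open>I = Y - \<lambda> X\<close> with the second null
  normal \<open>Y\<close> and \<open>\<lambda> = J/n\<close>, and \<open>\<iota>\<^sub>X C\<^sub>l = -2l \<delta>C\<^sub>l\<^sub>-\<^sub>1\<close>; this determines the transversal components and yields (\<open>dl_section\<close>)
  \<open>e\<^sup>*\<delta>C\<^sub>l = (\<delta>d + 2\<lambda>p(2m+1-p)) e\<^sup>*\<delta>C\<^sub>l\<^sub>-\<^sub>1\<close> with \<open>p = 2l\<close>.  The coefficients are symmetric under \<open>p \<mapsto> 2m+1-p\<close>, so the factors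
  for \<open>p = 2, 4, ..., 2m\<close> are those for \<open>p = 1, ..., m\<close> in another order (\<open>fac_perm\<close>), which is the asserted product.

  These computations take place in a small open set of one ambient chart (\<open>local_cone\<close>).  The inverse function theorem
  provides it with coordinates in which the dilations act on the second coordinate and the cone is the zero set of the
  third one (\<open>local_model\<close>).  Then functions vanishing on the cone are divisible by \<open>Q\<close> (\<open>hadamard_division\<close>), and forms
  on \<open>M\<close> are lifted by pullback along the first coordinate (\<open>lift_exists\<close>).\<close>

section \<open>Smooth maps between Euclidean spaces\<close>

text \<open>Almost all sums below run over the basis of the coordinate space.\<close>

abbreviation sum_basis :: "('a::euclidean_space => 'b::comm_monoid_add) => 'b" (binder "SUM " 10) where
 "sum_basis f == sum f Basis"

named_theorems smooth_intros

abbreviation fd :: "('a::real_normed_vector => 'b::real_normed_vector) => 'a => 'a => 'b" where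
 "fd f x == frechet_derivative f (at x)"

lemma pt: "S = T ==> S x y = T x y" by simp

lemma fd_eqI: "(f has_derivative D) (at x) ==> fd f x = D"
 by (metis frechet_derivative_at)

lemma fd_cong:
 assumes "open S" "x \<in> S" "!!y. y \<in> S ==> f y = g y"
 shows "fd f x = fd g x"
proof -
 have "(f has_derivative D) (at x) \<longleftrightarrow> (g has_derivative D) (at x)" for D
  using has_derivative_transform_within_open[OF _ assms(1,2)] assms(3) by metis
 thus ?thesis by (simp add: frechet_derivative_def)
qed

lemma C_on_cong:
 assumes "open S" "!!x. x \<in> S ==> f x = g x"
 shows "C_on r S f \<longleftrightarrow> C_on r S g"
 using assms(2)
proof (induction r arbitrary: f g)
 case 0
 thus ?case using continuous_on_cong[of S S f g] by simp
next
 case (Suc r)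
 have 1: "continuous_on S f \<longleftrightarrow> continuous_on S g"
  using continuous_on_cong[of S S f g] Suc.prems by simp
 have 2: "f differentiable at x \<longleftrightarrow> g differentiable at x" if "x \<in> S" for x
  unfolding differentiable_def
  using has_derivative_transform_within_open[OF _ assms(1) that] Suc.prems by metis
 have 3: "C_on r S (%x. fd f x v) \<longleftrightarrow> C_on r S (%x. fd g x v)" for v
  by (rule Suc.IH) (use fd_cong[OF assms(1)] Suc.prems in metis)
 show ?case using 1 2 3 by simp
qed

lemma smooth_on_cong:
 assumes "open S" "!!x. x \<in> S ==> f x = g x"
 shows "smooth_on S f \<longleftrightarrow> smooth_on S g"
 using C_on_cong[OF assms] by (simp add: smooth_on_def)

lemma smooth_differentiable: "smooth_on S f ==> x \<in> S ==> f differentiable at x"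
 unfolding smooth_on_def using C_on.simps(2) by blast

lemma smooth_has_fd: "smooth_on S f ==> x \<in> S ==> (f has_derivative fd f x) (at x)"
 using smooth_differentiable frechet_derivative_works by blast

lemma smooth_fd: "smooth_on S f ==> smooth_on S (%x. fd f x v)"
 unfolding smooth_on_def using C_on.simps(2) by blast

lemma smooth_continuous: "smooth_on S f ==> continuous_on S f"
 unfolding smooth_on_def using C_on.simps(1) by blast

lemma C_on_SucI:
 assumes "open S" "!!x. x \<in> S ==> (f has_derivative D x) (at x)" "!!v. C_on r S (%x. D x v)"
 shows "C_on (Suc r) S f"
proof -
 have "C_on r S (%x. fd f x v) \<longleftrightarrow> C_on r S (%x. D x v)" for v
  by (rule C_on_cong[OF assms(1)]) (use fd_eqI[OF assms(2)] in auto)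
 thus ?thesis using assms
  by (auto simp: differentiable_def intro!: continuous_at_imp_continuous_on has_derivative_continuous)
qed

lemma smooth_onI:
 assumes "open S" "!!x. x \<in> S ==> (f has_derivative D x) (at x)" "!!v. smooth_on S (%x. D x v)"
 shows "smooth_on S f"
 unfolding smooth_on_def
proof
 fix r show "C_on r S f"
 proof (cases r)
  case 0
  thus ?thesis using C_on_SucI[OF assms(1,2), of 0] assms(3) unfolding smooth_on_def
   using C_on.simps(1,2) by blast
 next
  case (Suc s)
  thus ?thesis using C_on_SucI[OF assms(1,2), of s] assms(3) unfolding smooth_on_def by blast
 qed
qed

lemma C_on_mono: "C_on (Suc r) S f ==> C_on r S f"
 by (induction r arbitrary: f) auto

lemma C_on_subset:
 "C_on r S f ==> T <= S ==> C_on r T f"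
 by (induction r arbitrary: f) (auto intro: continuous_on_subset)

lemma smooth_subset: "smooth_on S f ==> T <= S ==> smooth_on T f"
 unfolding smooth_on_def using C_on_subset by blast

lemma C_on_local:
 "(!!x. x \<in> S ==> \<exists>T. open T & x \<in> T & C_on r T f) ==> C_on r S f"
proof (induction r arbitrary: f)
 case 0
 thus ?case by simp (metis continuous_at_imp_continuous_on continuous_on_eq_continuous_at)
next
 case (Suc r)
 have "C_on r S (%x. fd f x v)" for v by (rule Suc.IH) (use Suc.prems in \<open>simp, blast\<close>)
 moreover have "continuous_on S f"
  using Suc.prems by simp (metis continuous_at_imp_continuous_on continuous_on_eq_continuous_at)
 moreover have "\<forall>x\<in>S. f differentiable at x" using Suc.prems by simp blast
 ultimately show ?case by simp
qed

lemma smooth_local: "(!!x. x \<in> S ==> \<exists>T. open T & x \<in> T & smooth_on T f) ==> smooth_on S f"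
 unfolding smooth_on_def by (intro allI C_on_local) blast

lemma C_on_const: "open S ==> C_on r S (%x. c)"
proof (induction r arbitrary: c)
 case 0 thus ?case by simp
next
 case (Suc r) thus ?case by (intro C_on_SucI[where D="%_ _. 0"]) auto
qed

lemma smooth_const [simp, smooth_intros]: "open S ==> smooth_on S (%x. c)"
 by (simp add: smooth_on_def C_on_const)

lemma smooth_bounded_linear:
 "open S ==> bounded_linear f ==> smooth_on S f"
 by (rule smooth_onI[where D="%_. f"]) (auto intro: bounded_linear_imp_has_derivative)

lemma smooth_linear: "open S ==> linear (f::'a::euclidean_space => 'b::real_normed_vector) ==> smooth_on S f"
 by (simp add: smooth_bounded_linear linear_conv_bounded_linear)

lemma C_on_add:
 "open S ==> C_on r S f ==> C_on r S g ==> C_on r S (%x. f x + g x)"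
proof (induction r arbitrary: f g)
 case 0 thus ?case by (auto intro: continuous_intros)
next
 case (Suc r)
 show ?case
 proof (rule C_on_SucI[where D="%x v. fd f x v + fd g x v"])
  fix x assume "x \<in> S"
  hence "(f has_derivative fd f x) (at x)" "(g has_derivative fd g x) (at x)"
   using Suc.prems by (auto simp: frechet_derivative_works)
  thus "((%x. f x + g x) has_derivative (%v. fd f x v + fd g x v)) (at x)"
   by (rule has_derivative_add)
 qed (use Suc in auto)
qed

lemma smooth_add [smooth_intros]:
 "open S ==> smooth_on S f ==> smooth_on S g ==> smooth_on S (%x. f x + g x)"
 by (simp add: smooth_on_def C_on_add)

lemma smooth_sum [smooth_intros]:
 "open S ==> (!!i. i \<in> A ==> smooth_on S (f i)) ==> smooth_on S (%x. \<Sum>i\<in>A. f i x)"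
 by (induction A rule: infinite_finite_induct) (auto intro: smooth_intros)

lemma (in bounded_bilinear) C_on_prod:
 "open S ==> C_on r S f ==> C_on r S g ==> C_on r S (%x. prod (f x) (g x))"
proof (induction r arbitrary: f g)
 case 0 thus ?case by (auto intro: continuous_on)
next
 case (Suc r)
 show ?case
 proof (rule C_on_SucI[where D="%x v. prod (f x) (fd g x v) + prod (fd f x v) (g x)"])
  fix x assume "x \<in> S"
  hence "(f has_derivative fd f x) (at x)" "(g has_derivative fd g x) (at x)"
   using Suc.prems by (auto simp: frechet_derivative_works)
  thus "((%x. prod (f x) (g x)) has_derivative
    (%v. prod (f x) (fd g x v) + prod (fd f x v) (g x))) (at x)"
   by (rule FDERIV)
 next
  show "C_on r S (%x. prod (f x) (fd g x v) + prod (fd f x v) (g x))" for v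
   by (intro C_on_add Suc.IH) (use Suc.prems C_on_mono[OF Suc.prems(2)] C_on_mono[OF Suc.prems(3)] in auto)
 qed (use Suc in auto)
qed

lemma (in bounded_bilinear) smooth_prod:
 "open S ==> smooth_on S f ==> smooth_on S g ==> smooth_on S (%x. prod (f x) (g x))"
 by (simp add: smooth_on_def C_on_prod)

lemmas smooth_mult [smooth_intros] =
 bounded_bilinear.smooth_prod[OF bounded_bilinear_mult[where 'a=real]]
lemmas smooth_scaleR [smooth_intros] = bounded_bilinear.smooth_prod[OF bounded_bilinear_scaleR]
lemmas smooth_inner [smooth_intros] = bounded_bilinear.smooth_prod[OF bounded_bilinear_inner]

lemma smooth_minus [smooth_intros]: "open S ==> smooth_on S f ==> smooth_on S (%x. - f x)"
 using smooth_scaleR[of S "%_. -1" f] by simp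

lemma smooth_diff [smooth_intros]:
 "open S ==> smooth_on S f ==> smooth_on S g ==> smooth_on S (%x. f x - g x)"
 using smooth_add[of S f "%x. - g x"] by (auto intro: smooth_intros)

lemma smooth_power [smooth_intros]:
 "open S ==> smooth_on S f ==> smooth_on S (%x. f x ^ k :: real)"
 by (induction k) (auto intro: smooth_intros)

lemma smooth_euclidean:
 fixes f :: "'a::real_normed_vector => 'b::euclidean_space"
 assumes "open S" "!!b. b \<in> Basis ==> smooth_on S (%x. f x \<bullet> b)"
 shows "smooth_on S f"
proof -
 have "smooth_on S (%x. SUM b. (f x \<bullet> b) *\<^sub>R b)"
  by (intro smooth_intros assms)
 thus ?thesis by (simp add: euclidean_representation)
qed

lemma C_on_sum:
 "open S ==> (!!i. i \<in> A ==> C_on r S (f i)) ==> C_on r S (%x. \<Sum>i\<in>A. f i x)"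
 by (induction A rule: infinite_finite_induct) (auto intro: C_on_add C_on_const)

lemma linear_expand:
 "linear f ==> f v = (SUM b. (v \<bullet> b) *\<^sub>R f b)" for v :: "'a::euclidean_space" and f :: "'a => 'b::real_vector"
 using linear_sum[of f "%b. (v \<bullet> b) *\<^sub>R b" Basis] by (simp add: linear_scale euclidean_representation)

lemma C_on_compose:
 fixes g :: "'a::real_normed_vector => 'b::euclidean_space" and f :: "'b => 'c::real_normed_vector"
 assumes "open S" "open T" "g ` S <= T"
 shows "C_on r S g ==> C_on r T f ==> C_on r S (%x. f (g x))"
proof (induction r arbitrary: f)
 case 0
 thus ?case using continuous_on_compose2[of T f S g] assms(3) by simp
next
 case (Suc r)
 show ?case
 proof (rule C_on_SucI[where D="%x v. SUM b. (fd g x v \<bullet> b) *\<^sub>R fd f (g x) b"])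
  fix x assume x: "x \<in> S"
  hence gx: "g x \<in> T" using assms(3) by auto
  hence d: "(f has_derivative fd f (g x)) (at (g x))"
   using Suc.prems by (auto simp: frechet_derivative_works)
  have dg: "(g has_derivative fd g x) (at x)"
   using Suc.prems x by (auto simp: frechet_derivative_works)
  have "fd f (g x) (fd g x v) = (SUM b. (fd g x v \<bullet> b) *\<^sub>R fd f (g x) b)" for v
   by (rule linear_expand[OF has_derivative_linear[OF d]])
  thus "((%x. f (g x)) has_derivative
    (%v. SUM b. (fd g x v \<bullet> b) *\<^sub>R fd f (g x) b)) (at x)"
   using has_derivative_compose[OF dg d] by simp
 next
  have "C_on r S (%x. fd f (g x) b)" for b
   by (rule Suc.IH) (use Suc.prems C_on_mono[OF Suc.prems(1)] in auto)
  moreover have "C_on r S (%x. fd g x v \<bullet> b)" for v b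
   by (intro bounded_bilinear.C_on_prod[OF bounded_bilinear_inner] assms C_on_const)
    (use Suc.prems in auto)
  ultimately show "C_on r S (%x. SUM b. (fd g x v \<bullet> b) *\<^sub>R fd f (g x) b)" for v
   by (intro C_on_sum bounded_bilinear.C_on_prod[OF bounded_bilinear_scaleR] assms)
 qed (use assms in auto)
qed

lemma smooth_compose:
 fixes g :: "'a::real_normed_vector => 'b::euclidean_space" and f :: "'b => 'c::real_normed_vector"
 assumes "open S" "open T" "smooth_on S g" "smooth_on T f" "g ` S <= T"
 shows "smooth_on S (%x. f (g x))"
 using C_on_compose[OF assms(1,2,5)] assms(3,4) unfolding smooth_on_def by blast

lemma smooth_inverse_real: "smooth_on (- {0::real}) inverse"
 unfolding smooth_on_def
proof
 have o: "open (- {0::real})" by auto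
 show "C_on r (- {0::real}) inverse" for r
 proof (induction r)
  case 0
  thus ?case by (auto intro!: continuous_intros)
 next
  case (Suc r)
  show ?case
  proof (rule C_on_SucI[where D="%x v. - (inverse x * v * inverse x)"])
   show "C_on r (- {0::real}) (%x. - (inverse x * v * inverse x))" for v
   proof -
    have "C_on r (- {0::real}) (%x. (inverse x * (- v)) * inverse x)"
     by (intro bounded_bilinear.C_on_prod[OF bounded_bilinear_mult] o Suc C_on_const)
    thus ?thesis by simp
   qed
  qed (auto intro!: has_derivative_inverse' )
 qed
qed

lemma smooth_inverse [smooth_intros]:
 "open S ==> smooth_on S f ==> (!!x. x \<in> S ==> f x ~= 0) ==> smooth_on S (%x. inverse (f x :: real))"
 by (rule smooth_compose[OF _ _ _ smooth_inverse_real]) auto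

lemma smooth_divide [smooth_intros]:
 "open S ==> smooth_on S f ==> smooth_on S g ==> (!!x. x \<in> S ==> g x ~= 0) ==>
  smooth_on S (%x. f x / g x :: real)"
 by (simp add: divide_inverse smooth_intros)

lemma smooth_id [simp, smooth_intros]: "open S ==> smooth_on S (%x. x)"
 by (rule smooth_bounded_linear) auto

lemma smooth_fst [smooth_intros]: "open S ==> smooth_on S f ==> smooth_on S (%x. fst (f x :: 'a::euclidean_space \<times> 'b::euclidean_space))"
 by (rule smooth_compose[where T=UNIV and f=fst]) (auto intro: smooth_bounded_linear bounded_linear_fst)

lemma smooth_snd [smooth_intros]: "open S ==> smooth_on S f ==> smooth_on S (%x. snd (f x :: 'a::euclidean_space \<times> 'b::euclidean_space))"
 by (rule smooth_compose[where T=UNIV and f=snd]) (auto intro: smooth_bounded_linear bounded_linear_snd)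

lemma smooth_Pair [smooth_intros]:
 assumes "open S" "smooth_on S f" "smooth_on S g"
 shows "smooth_on S (%x. (f x :: 'a::euclidean_space, g x :: 'b::euclidean_space))"
 proof (rule smooth_euclidean[OF assms(1)])
 fix b :: "'a \<times> 'b"
 have "smooth_on S (%x. f x \<bullet> fst b + g x \<bullet> snd b)"
  by (intro smooth_intros assms)
 thus "smooth_on S (%x. (f x, g x) \<bullet> b)" by (simp add: inner_prod_def)
qed

lemma fd_linear: "smooth_on S f ==> x \<in> S ==> linear (fd f x)"
 using smooth_has_fd has_derivative_linear by blast

lemma fd_const [simp]: "fd (%x. c) x v = 0"
 by (simp add: frechet_derivative_const)

lemma fd_add: "smooth_on S f ==> smooth_on S g ==> x \<in> S ==> fd (%x. f x + g x) x v = fd f x v + fd g x v"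
 by (simp add: fd_eqI[OF has_derivative_add[OF smooth_has_fd[of S f] smooth_has_fd[of S g]]])

lemma fd_diff: "smooth_on S f ==> smooth_on S g ==> x \<in> S ==> fd (%x. f x - g x) x v = fd f x v - fd g x v"
 by (simp add: fd_eqI[OF has_derivative_diff[OF smooth_has_fd[of S f] smooth_has_fd[of S g]]])

lemma fd_minus: "smooth_on S f ==> x \<in> S ==> fd (%x. - f x) x v = - fd f x v"
 by (simp add: fd_eqI[OF has_derivative_minus[OF smooth_has_fd[of S f]]])

lemma fd_sum: "(!!i. i \<in> A ==> smooth_on S (f i)) ==> x \<in> S ==> fd (%x. \<Sum>i\<in>A. f i x) x v = (\<Sum>i\<in>A. fd (f i) x v)"
 by (subst fd_eqI[OF has_derivative_sum[of A f "%i. fd (f i) x" "at x"]]) (auto intro: smooth_has_fd)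

lemma fd_mult: "smooth_on S f ==> smooth_on S g ==> x \<in> S ==>
 fd (%x. f x * g x :: real) x v = f x * fd g x v + fd f x v * g x"
 by (simp add: fd_eqI[OF has_derivative_mult[OF smooth_has_fd[of S f] smooth_has_fd[of S g]]])

lemma fd_scaleR: "smooth_on S f ==> smooth_on S g ==> x \<in> S ==>
 fd (%x. f x *\<^sub>R g x) x v = f x *\<^sub>R fd g x v + fd f x v *\<^sub>R g x"
 by (simp add: fd_eqI[OF has_derivative_scaleR[OF smooth_has_fd[of S f] smooth_has_fd[of S g]]])

lemma fd_inner: "smooth_on S f ==> smooth_on S g ==> x \<in> S ==>
 fd (%x. f x \<bullet> g x) x v = f x \<bullet> fd g x v + fd f x v \<bullet> g x"
 by (simp add: fd_eqI[OF has_derivative_inner[OF smooth_has_fd[of S f] smooth_has_fd[of S g]]])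

lemma fd_compose: "smooth_on S g ==> smooth_on T f ==> x \<in> S ==> g x \<in> T ==>
 fd (%x. f (g x)) x v = fd f (g x) (fd g x v)"
 by (simp add: fd_eqI[OF has_derivative_compose[OF smooth_has_fd[of S g] smooth_has_fd[of T f]]])

lemma linear_fd_family:
 assumes W: "open W" and A: "!!z. z \<in> W ==> linear (A z)" "!!v. smooth_on W (%z. A z v)" and x: "x \<in> W"
 shows "linear (%v. fd (%z. A z v) x w)"
proof (rule linearI)
 fix u v c
 show "fd (%z. A z (u + v)) x w = fd (%z. A z u) x w + fd (%z. A z v) x w"
  unfolding fd_add[OF A(2,2) x, symmetric] by (rule fun_cong[OF fd_cong[OF W x linear_add[OF A(1)]]])
 have "fd (%z. A z (c *\<^sub>R v)) x w = fd (%z. c *\<^sub>R A z v) x w"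
  by (rule fun_cong[OF fd_cong[OF W x linear_scale[OF A(1)]]])
 thus "fd (%z. A z (c *\<^sub>R v)) x w = c *\<^sub>R fd (%z. A z v) x w"
  by (simp add: fd_scaleR[OF smooth_const[OF W] A(2) x])
qed

text \<open>Expanding the argument in a basis reduces both claims to products of a scalar and a vector function.\<close>

lemma
 fixes A :: "'c::euclidean_space => 'v::euclidean_space => 'r::real_normed_vector" and e :: "'a::real_normed_vector => 'c"
 assumes U: "open U" and W: "open W" and A: "!!z. z \<in> W ==> linear (A z)" "!!v. smooth_on W (%z. A z v)"
  and e: "smooth_on U e" "!!x. x \<in> U ==> e x \<in> W" and V: "smooth_on U V"
 shows smooth_family: "smooth_on U (%x. A (e x) (V x))"
  and fd_family: "x \<in> U ==> fd (%x. A (e x) (V x)) x u = fd (%z. A z (V x)) (e x) (fd e x u) + A (e x) (fd V x u)"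
proof -
 have ex: "A (e y) (V y) = (SUM b. (V y \<bullet> b) *\<^sub>R A (e y) b)" if "y \<in> U" for y
  by (rule linear_expand[OF A(1)[OF e(2)[OF that]]])
 have s: "smooth_on U (%y. A (e y) b)" "smooth_on U (%y. V y \<bullet> b)" for b
  by (rule smooth_compose[OF U W e(1) A(2)], use e(2) in blast, intro smooth_inner U V smooth_const)
 show "smooth_on U (%x. A (e x) (V x))"
  by (rule iffD2[OF smooth_on_cong[OF U ex]], assumption) (intro smooth_sum smooth_scaleR s U)
 assume x: "x \<in> U"
 note ex' = e(2)[OF x]
 have "fd (%x. A (e x) (V x)) x u = fd (%y. SUM b. (V y \<bullet> b) *\<^sub>R A (e y) b) x u"
  by (rule fun_cong[OF fd_cong[OF U x ex]])
 also have "... = (SUM b. (V x \<bullet> b) *\<^sub>R fd (%z. A z b) (e x) (fd e x u) + (fd V x u \<bullet> b) *\<^sub>R A (e x) b)"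
  by (subst fd_sum[OF _ x], intro smooth_scaleR s U)
   (simp add: fd_scaleR[OF s(2,1) x] fd_compose[OF e(1) A(2) x ex'] fd_inner[OF V smooth_const[OF U] x])
 finally show "fd (%x. A (e x) (V x)) x u = fd (%z. A z (V x)) (e x) (fd e x u) + A (e x) (fd V x u)"
  by (simp add: linear_expand[OF linear_fd_family[OF W A ex'], of "V x"] sum.distrib linear_expand[OF A(1)[OF ex'], of "fd V x u", symmetric])
qed

lemma smooth_fd_compose:
 fixes f :: "'b::euclidean_space => 'c::real_normed_vector" and g :: "'a::euclidean_space => 'b"
 assumes "open S" "open T" "smooth_on S g" "smooth_on S v" "smooth_on T f" "g ` S <= T"
 shows "smooth_on S (%x. fd f (g x) (v x))"
 by (rule smooth_family[where A="fd f", OF assms(1,2) fd_linear[OF assms(5)] smooth_fd[OF assms(5)] assms(3) _ assms(4)])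
  (use assms(6) in auto)

lemma fd_power: "smooth_on S f ==> x \<in> S ==>
 fd (%x. f x ^ k :: real) x v = real k * f x ^ (k - 1) * fd f x v"
 by (simp add: fd_eqI[OF has_derivative_power[OF smooth_has_fd[of S f]]])

text \<open>Both iterated derivatives are the derivative in the second direction of
  \<open>\<integral>\<^sub>0\<^sup>t \<partial>\<^sub>v \<partial>\<^sub>w f\<close>, because one may differentiate under the integral.\<close>

lemma fd_symmetric:
 fixes f :: "'a::euclidean_space => real"
 assumes S: "open S" "smooth_on S f" "x \<in> S"
 shows "fd (%y. fd f y v) x w = fd (%y. fd f y w) x v"
proof -
 define p where "p s t = x + s *\<^sub>R v + t *\<^sub>R w" for s t :: real
 have "open ((%z. p (fst z) (snd z)) -` S)" unfolding p_def by (intro open_vimage S continuous_intros)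
 then obtain U T where U: "open U" "open T" "0 \<in> U" "0 \<in> T" "U \<times> T <= (%z. p (fst z) (snd z)) -` S"
  by (rule open_prod_elim[of _ "(0, 0)"]) (use S(3) in \<open>auto simp: p_def\<close>)
 obtain a b where a: "a > 0" "ball 0 a <= U" and b: "b > 0" "cball 0 b <= T" using U openE open_contains_cball by metis
 define I where "I = {0..b}"
 have pS: "p s t \<in> S" if "s \<in> ball 0 a" "t \<in> I" for s t
  using that a b U(5) by (auto simp: I_def subset_iff)
 have d: "((%s. F (p s t)) has_real_derivative fd F (p s t) v) (at s)" "((%t. F (p s t)) has_real_derivative fd F (p s t) w) (at t)"
  if F: "smooth_on S F" and st: "s \<in> ball 0 a" "t \<in> I" for F and s t
 proof -
  note c = smooth_has_fd[OF F pS[OF st]] and l = linear_scale[OF fd_linear[OF F pS[OF st]]]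
  have "((%s. p s t) has_derivative (%r. r *\<^sub>R v)) (at s)" "((%t. p s t) has_derivative (%r. r *\<^sub>R w)) (at t)"
   unfolding p_def by (auto intro!: derivative_eq_intros)
  from has_derivative_compose[OF this(1) c] has_derivative_compose[OF this(2) c]
  show "((%s. F (p s t)) has_real_derivative fd F (p s t) v) (at s)" "((%t. F (p s t)) has_real_derivative fd F (p s t) w) (at t)"
   by (simp_all add: has_field_derivative_def l mult_commute_abs)
 qed
 let ?A = "%y. fd f y v" and ?B = "%y. fd f y w" and ?BV = "%y. fd (%y. fd f y w) y v"
 note sB = smooth_fd[OF S(2), of w] and sA = smooth_fd[OF S(2), of v]
 have cp: "continuous_on (ball 0 a \<times> I) (%(s, t). F (p s t))" if "smooth_on S F" for F :: "'a => real"
  unfolding case_prod_beta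
  by (rule continuous_on_compose2[OF smooth_continuous[OF that]]) (use pS in \<open>auto simp: p_def intro!: continuous_intros\<close>)
 have co: "continuous_on I (%t. F (p s t))" if "smooth_on S F" "s \<in> ball 0 a" for F :: "'a => real" and s
  by (rule continuous_on_compose2[OF smooth_continuous[OF that(1)]]) (use pS that in \<open>auto simp: p_def intro!: continuous_intros\<close>)
 have 0: "0 \<in> I" "0 \<in> ball 0 a" using a(1) b(1) by (auto simp: I_def)
 have K: "?A (p 0 t) - ?A (p 0 0) = integral {0..t} (%\<tau>. ?BV (p 0 \<tau>))" if t: "t \<in> I" for t
 proof -
  have I: "\<tau> \<in> I" if "\<tau> \<in> cbox 0 t" for \<tau> using that t by (auto simp: I_def)
  have "((%s. integral (cbox 0 t) (%\<tau>. ?B (p s \<tau>))) has_real_derivative integral (cbox 0 t) (%\<tau>. ?BV (p 0 \<tau>))) (at 0 within ball 0 a)"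
  proof (rule leibniz_rule_field_derivative)
   show "((%s. ?B (p s \<tau>)) has_real_derivative ?BV (p s \<tau>)) (at s within ball 0 a)" if "s \<in> ball 0 a" "\<tau> \<in> cbox 0 t" for s \<tau>
    by (rule has_field_derivative_at_within[OF d(1)[OF sB that(1) I[OF that(2)]]])
   show "(%\<tau>. ?B (p s \<tau>)) integrable_on cbox 0 t" if "s \<in> ball 0 a" for s
    by (rule integrable_continuous[OF continuous_on_subset[OF co[OF sB that]]]) (use I in blast)
   show "continuous_on (ball 0 a \<times> cbox 0 t) (%(s, \<tau>). ?BV (p s \<tau>))"
    by (rule continuous_on_subset[OF cp[OF smooth_fd[OF sB]]]) (use I in blast)
  qed (use a(1) in auto)
  moreover have "integral (cbox 0 t) (%\<tau>. ?B (p s \<tau>)) = f (p s t) - f (p s 0)" if "s \<in> ball 0 a" for s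
  proof -
   have "((%\<tau>. ?B (p s \<tau>)) has_integral f (p s t) - f (p s 0)) {0..t}"
   proof (rule fundamental_theorem_of_calculus)
    show "((%\<tau>. f (p s \<tau>)) has_vector_derivative ?B (p s \<tau>)) (at \<tau> within {0..t})" if "\<tau> \<in> {0..t}" for \<tau>
     by (rule has_vector_derivative_at_within[OF d(2)[OF S(2) \<open>s \<in> ball 0 a\<close>, unfolded has_real_derivative_iff_has_vector_derivative]])
      (use that I in simp)
   qed (use t in \<open>simp add: I_def\<close>)
   thus ?thesis by (simp add: integral_unique)
  qed
  ultimately have "((%s. f (p s t) - f (p s 0)) has_real_derivative integral (cbox 0 t) (%\<tau>. ?BV (p 0 \<tau>))) (at 0)"
   unfolding at_within_open[OF 0(2) open_ball] by (rule has_field_derivative_transform_within_open[OF _ open_ball 0(2)])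
  moreover have "((%s. f (p s t) - f (p s 0)) has_real_derivative ?A (p 0 t) - ?A (p 0 0)) (at 0)"
   by (intro DERIV_diff d(1) S(2) 0 t)
  ultimately show ?thesis using DERIV_unique unfolding cbox_interval by blast
 qed
 have "((%t. integral {0..t} (%\<tau>. ?BV (p 0 \<tau>))) has_real_derivative ?BV (p 0 0)) (at 0 within I)"
  using co[OF smooth_fd[OF sB] 0(2)] 0(1) unfolding I_def by (rule integral_has_real_derivative)
 moreover have "((%t. ?A (p 0 t) - ?A (p 0 0)) has_real_derivative fd ?A (p 0 0) w) (at 0 within I)"
  using has_field_derivative_at_within[OF DERIV_diff[OF d(2)[OF sA 0(2,1)] DERIV_const]] by simp
 hence "((%t. integral {0..t} (%\<tau>. ?BV (p 0 \<tau>))) has_real_derivative fd ?A (p 0 0) w) (at 0 within I)"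
  by (rule has_field_derivative_transform_within[OF _ zero_less_one 0(1)]) (rule K)
 ultimately have "?BV (p 0 0) = fd ?A (p 0 0) w"
  using b(1) 0(1) vector_derivative_unique_within_closed_interval[of 0 b 0]
  unfolding has_real_derivative_iff_has_vector_derivative I_def cbox_interval by blast
 thus ?thesis by (simp add: p_def)
qed

lemma linear_inj_inv:
 fixes f :: "'e::euclidean_space => 'e"
 assumes "linear f" "inj f"
 shows "linear (inv f)" "f (inv f x) = x" "inv f (f x) = x"
proof -
 have "surj f" using assms linear_injective_imp_surjective by blast
 thus "f (inv f x) = x" "inv f (f x) = x" using assms by (auto simp: surj_f_inv_f)
 show "linear (inv f)" using assms by (rule inj_linear_imp_inv_linear)
qed

text \<open>Induction on the order, since the derivative of \<open>G\<^sup>-\<^sup>1\<close> is \<open>- G\<^sup>-\<^sup>1 G' G\<^sup>-\<^sup>1\<close>.\<close>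

lemma C_on_linear_inverse:
 fixes G :: "'a::euclidean_space => 'e::euclidean_space => 'e"
 assumes S: "open S" and lin: "!!x. x \<in> S ==> linear (G x)" and inj: "!!x. x \<in> S ==> inj (G x)"
  and sm: "!!v. smooth_on S (%x. G x v)"
 shows "C_on r S (%x. inv (G x) b)"
proof -
 define DG where "DG x v z = fd (%y. G y z) x v" for x v z
 let ?F = "%p. (fst p, G (fst p) (snd p))"
 let ?F' = "%p w. (fst w, DG (fst p) (fst w) (snd p) + G (fst p) (snd w))"
 let ?I = "%p. (fst p, inv (G (fst p)) (snd p))"
 let ?I' = "%p w. (fst w, inv (G (fst p)) (snd w - DG (fst p) (fst w) (snd p)))"
 have o: "open (S \<times> (UNIV::'e set))" using S by (simp add: open_Times)
 have dF: "(?F has_derivative ?F' p) (at p)" if p: "p \<in> S \<times> UNIV" for p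
 proof -
  have f: "smooth_on (S \<times> (UNIV :: 'e set)) fst" "smooth_on (S \<times> (UNIV :: 'e set)) snd"
   using smooth_fst[OF o smooth_id[OF o]] smooth_snd[OF o smooth_id[OF o]] by simp_all
  have "fst q \<in> S" if "q \<in> S \<times> (UNIV :: 'e set)" for q using that by auto
  note F = o S lin sm f(1) this f(2)
  have "(fst :: 'a \<times> 'e => _) = fd fst p" "(snd :: 'a \<times> 'e => _) = fd snd p"
   by (auto intro!: fd_eqI[symmetric] derivative_eq_intros)
  hence "fd (%p. G (fst p) (snd p)) p = (%w. DG (fst p) (fst w) (snd p) + G (fst p) (snd w))"
   using fd_family[where A=G and x=p, OF F] p by (simp add: DG_def fun_eq_iff)
  hence "((%p. G (fst p) (snd p)) has_derivative (%w. DG (fst p) (fst w) (snd p) + G (fst p) (snd w))) (at p)"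
   using smooth_has_fd[OF smooth_family[where A=G, OF F] p] by simp
  thus ?thesis by (intro has_derivative_Pair has_derivative_fst has_derivative_ident)
 qed
 have dI: "(?I has_derivative ?I' p) (at (?F p))" if p: "p \<in> S \<times> UNIV" for p
 proof -
  have 1: "?I (?F q) = q" if "q \<in> S \<times> UNIV" for q :: "'a \<times> 'e"
  proof -
   have x: "fst q \<in> S" using that by auto
   show ?thesis by (simp add: linear_inj_inv[OF lin[OF x] inj[OF x]])
  qed
  have x: "fst p \<in> S" using p by auto
  have 2: "?F' p \<circ> ?I' p = id"
   by (auto simp: fun_eq_iff linear_inj_inv[OF lin[OF x] inj[OF x]])
  show ?thesis
   by (rule has_derivative_inverse_on[where f="?F" and g="?I" and f'="?F'" and g'="?I'", OF o])
    (use dF 1 2 p in auto)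
 qed
 have d: "((%x. inv (G x) b) has_derivative (%v. - inv (G x) (DG x v (inv (G x) b)))) (at x)" if x: "x \<in> S" for x b
 proof -
  have 1: "((%x. (x, b)) has_derivative (%v. (v, 0))) (at x)"
   by (auto intro!: derivative_eq_intros)
  have 2: "?F (x, inv (G x) b) = (x, b)" by (simp add: linear_inj_inv[OF lin[OF x] inj[OF x]])
  have "(?I has_derivative ?I' (x, inv (G x) b)) (at (x, b))"
   using dI[of "(x, inv (G x) b)"] x 2 by simp
  from has_derivative_snd[OF has_derivative_compose[OF 1 this]]
  show ?thesis using linear_neg[OF linear_inj_inv(1)[OF lin[OF x] inj[OF x]]] by simp
 qed
 show ?thesis
 proof (induction r arbitrary: b)
  case 0
  show ?case using d by (auto intro!: continuous_at_imp_continuous_on has_derivative_continuous)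
 next
  case (Suc r)
  show ?case
  proof (rule C_on_SucI[OF S d])
   fix v
   have eq: "- inv (G x) (DG x v (inv (G x) b)) =
     (SUM c. (SUM d. - ((inv (G x) b \<bullet> d) * (fd (%y. G y d) x v \<bullet> c))) *\<^sub>R inv (G x) c)" if x: "x \<in> S" for x
   proof -
    have "DG x v z = (SUM d. (z \<bullet> d) *\<^sub>R fd (%y. G y d) x v)" for z
     unfolding DG_def by (rule linear_expand[OF linear_fd_family[OF S lin sm x]])
    thus ?thesis
     unfolding linear_expand[OF linear_inj_inv(1)[OF lin[OF x] inj[OF x]], of "DG x v (inv (G x) b)"]
     by (simp add: inner_sum_left sum_negf)
   qed
   have "C_on r S (%x. fd (%y. G y d) x v \<bullet> c)" for d c
    using smooth_inner[OF S smooth_fd[OF sm] smooth_const[OF S]] unfolding smooth_on_def by blast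
   moreover have "C_on r S (%x. inv (G x) b \<bullet> d)" for d
    by (intro bounded_bilinear.C_on_prod[OF bounded_bilinear_inner] S C_on_const Suc)
   ultimately have *: "C_on r S (%x. SUM c. (SUM d. (-1) * ((inv (G x) b \<bullet> d) * (fd (%y. G y d) x v \<bullet> c))) *\<^sub>R inv (G x) c)"
    by (intro C_on_sum bounded_bilinear.C_on_prod[OF bounded_bilinear_scaleR]
      bounded_bilinear.C_on_prod[OF bounded_bilinear_mult] S Suc C_on_const)
   show "C_on r S (%x. - inv (G x) (DG x v (inv (G x) b)))"
    by (subst C_on_cong[OF S eq]) (use * in simp_all)
  qed auto
 qed
qed

lemma smooth_linear_inverse:
 fixes G :: "'a::euclidean_space => 'e::euclidean_space => 'e"
 assumes "open S" "!!x. x \<in> S ==> linear (G x)" "!!x. x \<in> S ==> inj (G x)"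
  and "!!v. smooth_on S (%x. G x v)"
 shows "smooth_on S (%x. inv (G x) b)"
 using C_on_linear_inverse[OF assms] by (simp add: smooth_on_def)

section \<open>Alternating tensors given by their first argument\<close>

text \<open>Tensors are zero on lists of the wrong length, so that equality of tensors is equality of functions.\<close>

definition ten :: "nat => 'e::real_vector tensor => bool" where
 "ten j t \<longleftrightarrow> multilin j t & (\<forall>vs. length vs ~= j --> t vs = 0)"

lemma ten_0: "ten 0 t \<longleftrightarrow> (\<forall>v vs. t (v # vs) = 0)"
 by (auto simp: ten_def multilin_def neq_Nil_conv)

text \<open>With the next lemmas this reduces statements about tensors to inductions over the list of arguments.\<close>

lemma ten_Suc:
 "ten (Suc j) t \<longleftrightarrow> t [] = 0 & (\<forall>v. ten j (%vs. t (v # vs))) & (\<forall>vs. linear (%v. t (v # vs)))"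
proof
 assume t: "ten (Suc j) t"
 have "linear (%v. t (v # vs))" for vs
 proof (cases "length vs = j")
  case True
  hence "linear (%v. t ((undefined # vs)[0 := v]))"
   using t unfolding ten_def multilin_def by (metis length_Cons zero_less_Suc)
  thus ?thesis by simp
 next
  case False
  hence "(%v. t (v # vs)) = (%v. 0)" using t by (auto simp: ten_def)
  thus ?thesis by (simp add: linear_zero)
 qed
 moreover have "ten j (%vs. t (v # vs))" for v
  unfolding ten_def multilin_def
 proof (intro conjI allI impI)
  fix vs :: "'a list" and i assume "length vs = j & i < j"
  hence "linear (%u. t ((v # vs)[Suc i := u]))"
   using t unfolding ten_def multilin_def by (metis Suc_less_eq length_Cons)
  thus "linear (%u. t (v # vs[i := u]))" by simp
 qed (use t in \<open>auto simp: ten_def\<close>)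
 ultimately show "t [] = 0 & (\<forall>v. ten j (%vs. t (v # vs))) & (\<forall>vs. linear (%v. t (v # vs)))"
  using t by (auto simp: ten_def)
next
 assume r: "t [] = 0 & (\<forall>v. ten j (%vs. t (v # vs))) & (\<forall>vs. linear (%v. t (v # vs)))"
 show "ten (Suc j) t"
  unfolding ten_def multilin_def
 proof (intro conjI allI impI)
  fix vs :: "'a list" and i assume *: "length vs = Suc j & i < Suc j"
  then obtain u us where us: "vs = u # us" "length us = j" by (cases vs) auto
  show "linear (%v. t (vs[i := v]))"
  proof (cases i)
   case 0 thus ?thesis using r us by simp
  next
   case (Suc i')
   hence "linear (%v. (%vs. t (u # vs)) (us[i' := v]))"
    using r us * unfolding ten_def multilin_def by blast
   thus ?thesis using us Suc by simp
  qed
 next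
  fix vs :: "'a list" assume "length vs ~= Suc j"
  thus "t vs = 0" using r by (cases vs) (auto simp: ten_def)
 qed
qed

lemma ten_linear: "ten j t ==> linear (%v. t (v # vs))"
 by (cases j) (auto simp: ten_Suc ten_0 linear_zero)

lemma ten_tl: "ten (Suc j) t ==> ten j (%vs. t (v # vs))" by (simp add: ten_Suc)

text \<open>Total in \<open>j\<close>, so that inductions over argument lists need not single out \<open>j = 0\<close>.\<close>

lemma ten_hd: "ten j t ==> ten (j - 1) (%vs. t (v # vs))"
 by (cases j) (auto simp: ten_Suc ten_0)

lemma linear_mult_const: "linear f ==> linear (%x. c * f x :: real)"
 using linear_compose_scale_right[of f c] by simp

lemma ten_add [intro]: "ten j s ==> ten j t ==> ten j (%vs. s vs + t vs)"
 by (auto simp: ten_def multilin_def intro: linear_compose_add)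

lemma ten_scale [intro]: "ten j t ==> ten j (%vs. (c::real) * t vs)"
 by (auto simp: ten_def multilin_def intro: linear_mult_const)

definition alt :: "nat => 'e::real_vector tensor => bool" where
 "alt j t \<longleftrightarrow> ten j t & alternating j t"

lemma alt_ten: "alt j t ==> ten j t" by (simp add: alt_def)

lemma alt_tl: "alt (Suc j) t ==> alt j (%vs. t (v # vs))"
 unfolding alt_def alternating_def using ten_tl
 by (auto) (metis Suc_less_eq length_Cons nth_Cons_Suc)

lemma alt_rep: "alt j t ==> t (v # v # vs) = 0"
 unfolding alt_def alternating_def ten_def
 by (metis length_Cons nth_Cons_0 nth_Cons_Suc zero_less_Suc Suc_less_eq)

lemma alt_0: "alt 0 t \<longleftrightarrow> ten 0 t" by (simp add: alt_def alternating_def)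

lemma alt_hd: "alt j t ==> alt (j - 1) (%vs. t (v # vs))"
 by (cases j) (auto simp: alt_tl alt_0 ten_0)

lemma alt_swap: 
 assumes "alt j t" shows "t (v # w # vs) = - t (w # v # vs)"
proof -
 have l: "linear (%v. t (v # vs))" for vs by (rule ten_linear[OF alt_ten[OF assms]])
 have l2: "linear (%w. t (v # w # vs))" for v
  by (rule ten_linear[OF ten_hd[OF alt_ten[OF assms]]])
 have "t ((v + w) # (v + w) # vs) = 0" using alt_rep[OF assms] .
 hence "t (v # v # vs) + t (v # w # vs) + t (w # v # vs) + t (w # w # vs) = 0"
  using linear_add[OF l] linear_add[OF l2] by simp
 thus ?thesis using alt_rep[OF assms] by simp
qed

text \<open>Equal arguments are exchanged with their neighbours until both are among the first two or in the tail.\<close>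

lemma alt_Suc:
 "alt (Suc j) t \<longleftrightarrow> ten (Suc j) t & (\<forall>v. alt j (%vs. t (v # vs))) & (\<forall>v vs. t (v # v # vs) = 0)"
proof
 assume "alt (Suc j) t"
 thus "ten (Suc j) t & (\<forall>v. alt j (%vs. t (v # vs))) & (\<forall>v vs. t (v # v # vs) = 0)"
  using alt_tl alt_rep alt_ten by blast
next
 assume r: "ten (Suc j) t & (\<forall>v. alt j (%vs. t (v # vs))) & (\<forall>v vs. t (v # v # vs) = 0)"
 have l: "linear (%v. t (v # vs))" for vs using r ten_linear by blast
 have l2: "linear (%w. t (v # w # vs))" for v vs
  using r ten_linear[of j "%vs. t (v # vs)"] by (auto simp: alt_def)
 have sw: "t (v # w # vs) = - t (w # v # vs)" for v w vs
 proof -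
  have "t ((v + w) # (v + w) # vs) = 0" using r by blast
  hence "t (v # v # vs) + t (v # w # vs) + t (w # v # vs) + t (w # w # vs) = 0"
   using linear_add[OF l] linear_add[OF l2] by simp
  thus ?thesis using r by simp
 qed
 have "t vs = 0" if vs: "length vs = Suc j" and ij: "i < k" "k < Suc j" "vs ! i = vs ! k" for vs i k
 proof -
  obtain u us where us: "vs = u # us" "length us = j" using vs by (cases vs) auto
  obtain k' where k': "k = Suc k'" "k' < j" using ij by (cases k) auto
  show ?thesis
  proof (cases i)
   case (Suc i')
   hence "(%vs. t (u # vs)) us = 0"
    using r us k' ij unfolding alt_def alternating_def by (metis Suc_less_eq nth_Cons_Suc)
   thus ?thesis using us by simp
  next
   case 0
   obtain w ws where ws: "us = w # ws" using us k' by (cases us) auto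
   show ?thesis
   proof (cases k')
    case 0
    thus ?thesis using r us ws \<open>i = 0\<close> ij k' by simp
   next
    case (Suc k'')
    have "(%vs. t (w # vs)) (u # ws) = 0"
     using r us ws k' ij Suc \<open>i = 0\<close> unfolding alt_def alternating_def
     by (metis length_Cons nth_Cons_0 nth_Cons_Suc zero_less_Suc)
    thus ?thesis using sw[of u w ws] us ws by simp
   qed
  qed
 qed
 thus "alt (Suc j) t" using r unfolding alt_def alternating_def by blast
qed

lemma alt_add [intro]: "alt j s ==> alt j t ==> alt j (%vs. s vs + t vs)"
 by (auto simp: alt_def alternating_def)
lemma alt_scale [intro]: "alt j t ==> alt j (%vs. (c::real) * t vs)"
 by (auto simp: alt_def alternating_def)

lemma omit_0 [simp]: "omit 0 (v # vs) = vs" by (simp add: omit_def)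
lemma omit_Suc [simp]: "omit (Suc i) (v # vs) = v # omit i vs" by (simp add: omit_def)
lemma length_omit: "i < length vs ==> length (omit i vs) = length vs - 1" by (auto simp: omit_def)

lemma alt_move:
 "alt j t ==> i < length vs ==> t (vs[i := w]) = (-1) ^ i * t (w # omit i vs)"
proof (induction vs arbitrary: t i j)
 case (Cons u us)
 show ?case
 proof (cases i)
  case (Suc i')
  have "t (u # us[i' := w]) = (-1) ^ i' * t (u # w # omit i' us)"
   using Cons.IH[OF alt_hd[OF Cons.prems(1)], of i' u] Cons.prems(2) Suc by simp
  thus ?thesis using alt_swap[OF Cons.prems(1), of u w] Suc by simp
 qed simp
qed simp

subsection \<open>Pointwise operations\<close>

text \<open>Exterior multiplication by the covector \<open>\<lambda>v. a \<bullet> v\<close>.\<close>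

definition tep :: "'e::real_inner => 'e tensor => 'e tensor" where
 "tep a t vs = (\<Sum>i<length vs. (-1) ^ i * (a \<bullet> vs ! i) * t (omit i vs))"

text \<open>The derivation of the tensor algebra that extends an endomorphism; the action on the algebra is from the right.\<close>

definition tact :: "('e => 'e) => 'e tensor => 'e tensor" where
 "tact A t vs = (\<Sum>i<length vs. t (vs[i := A (vs ! i)]))"

lemma tep_simps [simp]:
 "tep a t [] = 0"
 "tep a t (v # vs) = (a \<bullet> v) * t vs - tep a (%us. t (v # us)) vs"
 by (simp_all add: tep_def sum.lessThan_Suc_shift sum_negf del: sum.lessThan_Suc)

lemma tact_simps [simp]:
 "tact A t [] = 0"
 "tact A t (v # vs) = t (A v # vs) + tact A (%us. t (v # us)) vs"
 by (simp_all add: tact_def sum.lessThan_Suc_shift del: sum.lessThan_Suc)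

lemma tep_add: "tep a (%vs. s vs + t vs) vs = tep a s vs + tep a t vs"
 by (simp add: tep_def algebra_simps sum.distrib)
lemma tep_diff: "tep a (%vs. s vs - t vs) vs = tep a s vs - tep a t vs"
 by (simp add: tep_def algebra_simps sum_subtractf)
lemma tep_scale: "tep a (%vs. c * t vs) vs = c * tep a t vs"
 by (simp add: tep_def sum_distrib_left mult.left_commute mult.assoc)
lemma tep_zero [simp]: "tep a (%vs. 0) vs = 0" by (simp add: tep_def)
lemma tep_add_left: "tep (a + b) t vs = tep a t vs + tep b t vs"
 by (simp add: tep_def inner_left_distrib algebra_simps sum.distrib)
lemma tep_scale_left: "tep (c *\<^sub>R a) t vs = c * tep a t vs"
 by (simp add: tep_def sum_distrib_left mult.left_commute mult.assoc)

lemma tact_add: "tact A (%vs. s vs + t vs) vs = tact A s vs + tact A t vs"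
 by (simp add: tact_def sum.distrib)
lemma tact_diff: "tact A (%vs. s vs - t vs) vs = tact A s vs - tact A t vs"
 by (simp add: tact_def sum_subtractf)
lemma tact_zero [simp]: "tact A (%vs. 0) vs = 0" by (simp add: tact_def)
lemma tact_scale: "tact A (%vs. c * t vs) vs = c * tact A t vs"
 by (simp add: tact_def sum_distrib_left)

lemma tep_anti: "tep a (tep b t) vs = - tep b (tep a t) vs"
proof (induction vs arbitrary: t)
 case (Cons v vs)
 thus ?case by (simp add: tep_diff tep_scale)
qed simp

lemma ten_tep: "ten j t ==> ten (Suc j) (tep a t)"
proof (induction j arbitrary: t)
 case 0
 have "tep a t vs = 0" if "length vs ~= 1" for vs
 proof -
  have "omit i vs ~= []" if "i < length vs" for i
   using that \<open>length vs ~= 1\<close> length_omit[OF that] by auto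
  thus ?thesis using 0 by (auto simp: tep_def ten_def intro!: sum.neutral)
 qed
 thus ?case
  using 0 by (auto simp: ten_Suc ten_0 linear_iff inner_right_distrib algebra_simps length_Suc_conv
    intro!: ten_def[THEN iffD2])
next
 case (Suc j)
 have 1: "linear (%v. tep a t (v # vs))" for vs
 proof -
  have "linear (%v. tep a (%us. t (v # us)) vs)"
   unfolding tep_def
   by (intro linear_compose_sum ballI linear_mult_const ten_linear[OF Suc.prems])
  moreover have "linear (%v. (a \<bullet> v) * t vs)"
   by (simp add: linear_iff inner_right_distrib algebra_simps)
  ultimately show ?thesis by (simp add: linear_compose_sub)
 qed
 have 2: "ten (Suc j) (%vs. tep a t (v # vs))" for v
  using ten_add[OF ten_scale[OF Suc.prems, of "a \<bullet> v"] ten_scale[OF Suc.IH[OF ten_tl[OF Suc.prems]], of "-1"]]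
  by simp
 show ?case using 1 2 by (subst ten_Suc) simp
qed

lemma alt_tep: "alt j t ==> alt (Suc j) (tep a t)"
proof (induction j arbitrary: t)
 case 0
 thus ?case using ten_tep[of 0 t a]
  by (auto simp: alt_Suc[of 0] alt_0 ten_0 ten_Suc)
next
 case (Suc j)
 have 2: "alt (Suc j) (%vs. tep a t (v # vs))" for v
  using alt_add[OF alt_scale[OF Suc.prems, of "a \<bullet> v"] alt_scale[OF Suc.IH[OF alt_tl[OF Suc.prems]], of "-1"]]
  by simp
 have "tep a t (v # v # vs) = 0" for v vs
  using alt_rep[OF Suc.prems] by simp
 thus ?case using 2 ten_tep[OF alt_ten[OF Suc.prems]] by (subst alt_Suc) blast
qed

lemma tact_linear_slot:
 assumes "ten j t" "linear A" shows "linear (%v. tact A t (v # vs))"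
 using linear_compose_add[OF linear_compose[OF assms(2) ten_linear[OF assms(1), of vs]], of "%v. tact A (%us. t (v # us)) vs"]
 by (simp add: comp_def) (simp add: tact_def linear_compose_sum ten_linear[OF assms(1)])

lemma ten_slot_linear: "ten j t ==> i < length vs ==> linear (%v. t (vs[i := v]))"
 by (cases "length vs = j") (auto simp: ten_def multilin_def linear_zero)

lemma tact_add_left: "ten j t ==> tact (%v. A v + B v) t vs = tact A t vs + tact B t vs"
 by (simp add: tact_def sum.distrib[symmetric] linear_add[OF ten_slot_linear])

lemma tact_sum_left: "ten j t ==> tact (%v. \<Sum>b\<in>B. c b *\<^sub>R A b v) t vs = (\<Sum>b\<in>B. c b * tact (A b) t vs)"
 by (simp add: tact_def sum_distrib_left linear_sum[OF ten_slot_linear] linear_scale[OF ten_slot_linear] sum.swap[of _ B])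

lemma tact_scale_left: "ten j t ==> tact (%v. c *\<^sub>R A v) t vs = c * tact A t vs"
 by (simp add: tact_def sum_distrib_left linear_scale[OF ten_slot_linear])

lemma ten_tact: "ten j t ==> linear A ==> ten j (tact A t)"
proof (induction j arbitrary: t)
 case 0
 thus ?case by (simp add: ten_0)
next
 case (Suc j)
 have 2: "ten j (%vs. tact A t (v # vs))" for v
  using ten_add[OF ten_tl[OF Suc.prems(1), of "A v"] Suc.IH[OF ten_tl[OF Suc.prems(1), of v] Suc.prems(2)]]
  by simp
 show ?case using 2 tact_linear_slot[OF Suc.prems] by (subst ten_Suc) simp
qed

lemma alt_tact: "alt j t ==> linear A ==> alt j (tact A t)"
proof (induction j arbitrary: t)
 case 0
 thus ?case using ten_tact by (simp add: alt_0)
next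
 case (Suc j)
 have 2: "alt j (%vs. tact A t (v # vs))" for v
  using alt_add[OF alt_tl[OF Suc.prems(1), of "A v"] Suc.IH[OF alt_tl[OF Suc.prems(1), of v] Suc.prems(2)]]
  by simp
 have "tact A t (v # v # vs) = 0" for v vs
 proof -
  have "tact A (%us. t (v # v # us)) vs = 0" using alt_rep[OF Suc.prems(1)] by (simp add: tact_def)
  thus ?thesis using alt_swap[OF Suc.prems(1), of "A v" v] by simp
 qed
 thus ?case using 2 ten_tact[OF alt_ten[OF Suc.prems(1)] Suc.prems(2)] by (subst alt_Suc) blast
qed

text \<open>Moving the changed slot to the front by \<open>alt_move\<close> produces the signs of the exterior multiplication.\<close>

lemma tact_tep:
 fixes t :: "'e::euclidean_space tensor"
 assumes "alt j t" "linear A"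
 shows "tact A t vs = (SUM b. tep b (%us. t (A b # us)) vs)"
proof -
 have "tep b (%us. t (A b # us)) vs = (\<Sum>i<length vs. (b \<bullet> vs ! i) * t (vs[i := A b]))" for b
  using alt_move[OF assms(1)] by (auto simp: tep_def intro!: sum.cong)
 hence "(SUM b. tep b (%us. t (A b # us)) vs) =
   (\<Sum>i<length vs. SUM b. (b \<bullet> vs ! i) * t (vs[i := A b]))"
  by (simp add: sum.swap[of _ "{..<length vs}"])
 also have "... = (\<Sum>i<length vs. t (vs[i := A (vs ! i)]))"
 proof (rule sum.cong[OF refl])
  fix i assume i: "i \<in> {..<length vs}"
  have "linear (%v. t (vs[i := v]))" using ten_slot_linear[OF alt_ten[OF assms(1)]] i by simp
  from linear_compose[OF assms(2) this] have l: "linear (%v. t (vs[i := A v]))" by (simp add: o_def)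
  show "(SUM b. (b \<bullet> vs ! i) * t (vs[i := A b])) = t (vs[i := A (vs ! i)])"
   using linear_expand[OF l, of "vs ! i"] by (simp add: inner_commute)
 qed
 finally show ?thesis by (simp add: tact_def)
qed

lemma tact_commutator:
 assumes "ten j t"
 shows "tact A (tact B t) vs - tact B (tact A t) vs = tact (%v. B (A v) - A (B v)) t vs"
 using assms
proof (induction vs arbitrary: t j)
 case (Cons v vs)
 have l: "t ((B (A v) - A (B v)) # vs) = t (B (A v) # vs) - t (A (B v) # vs)"
  using linear_diff[OF ten_linear[OF Cons.prems]] .
 show ?case
  using Cons.IH[OF ten_hd[OF Cons.prems], of v] l
   tact_add[of A "%us. t (B v # us)" "tact B (%us. t (v # us))" vs] tact_add[of B "%us. t (A v # us)" "tact A (%us. t (v # us))" vs]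
  by simp
qed simp

lemma tact_tep_commute:
 fixes t :: "'e::euclidean_space tensor"
 assumes "linear A"
 shows "tact A (tep a t) vs = tep a (tact A t) vs + tep (SUM c. (a \<bullet> A c) *\<^sub>R c) t vs"
proof (induction vs arbitrary: t)
 case (Cons v vs)
 have "(SUM c. (a \<bullet> A c) *\<^sub>R c) \<bullet> v = a \<bullet> A (SUM c. (v \<bullet> c) *\<^sub>R c)"
  by (simp only: linear_sum[OF assms] linear_scale[OF assms])
   (simp add: inner_sum_left inner_sum_right inner_commute mult.commute)
 hence "(SUM c. (a \<bullet> A c) *\<^sub>R c) \<bullet> v = a \<bullet> A v" by (simp add: euclidean_representation)
 thus ?case
  using Cons[of "%us. t (v # us)"]
  by (simp add: tact_diff tact_scale tep_add)
qed simp

text \<open>A symmetric second derivative drops out of an exterior derivative.\<close>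

lemma alt_symmetric_sum:
 assumes "alt j t" "!!u v. B u v = B v u"
 shows "(\<Sum>i<length vs. (-1) ^ i * (\<Sum>l<length vs - 1. t ((map H (omit i vs))[l := B (vs ! i) (omit i vs ! l)]))) = 0"
 using assms(1)
proof (induction vs arbitrary: t j)
 case (Cons v vs)
 let ?K = "%t vs. (\<Sum>i<length vs. (-1) ^ i * (\<Sum>l<length vs - 1. t ((map H (omit i vs))[l := B (vs ! i) (omit i vs ! l)])))"
 have om: "map H (omit i vs) = omit i (map H vs)" for i by (simp add: omit_def take_map drop_map)
 have mv: "(\<Sum>l<length vs. t ((map H vs)[l := B v (vs ! l)])) = (\<Sum>i<length vs. (-1) ^ i * t (B (vs ! i) v # map H (omit i vs)))"
  using alt_move[OF Cons.prems, of _ "map H vs"] assms(2) om by (auto intro!: sum.cong)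
 have "?K t (v # vs) = (\<Sum>l<length vs. t ((map H vs)[l := B v (vs ! l)]))
   - (\<Sum>i<length vs. (-1) ^ i * (\<Sum>l<length vs. t ((map H (omit (Suc i) (v # vs)))[l := B (vs ! i) (omit (Suc i) (v # vs) ! l)])))"
  by (simp add: sum.lessThan_Suc_shift sum_negf del: sum.lessThan_Suc)
 also have "(\<Sum>i<length vs. (-1) ^ i * (\<Sum>l<length vs. t ((map H (omit (Suc i) (v # vs)))[l := B (vs ! i) (omit (Suc i) (v # vs) ! l)])))
   = (\<Sum>i<length vs. (-1) ^ i * t (B (vs ! i) v # map H (omit i vs))) + ?K (%us. t (H v # us)) vs"
  unfolding sum.distrib[symmetric]
 proof (rule sum.cong[OF refl])
  fix i assume "i \<in> {..<length vs}"
  then obtain m where m: "length vs = Suc m" by (cases vs) auto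
  show "(- 1) ^ i * (\<Sum>l<length vs. t ((map H (omit (Suc i) (v # vs)))[l := B (vs ! i) (omit (Suc i) (v # vs) ! l)])) =
   (- 1) ^ i * t (B (vs ! i) v # map H (omit i vs)) +
   (- 1) ^ i * (\<Sum>l<length vs - 1. t (H v # (map H (omit i vs))[l := B (vs ! i) (omit i vs ! l)]))"
   by (simp add: m sum.lessThan_Suc_shift algebra_simps del: sum.lessThan_Suc)
 qed
 also have "?K (%us. t (H v # us)) vs = 0" by (rule Cons.IH[OF alt_hd[OF Cons.prems]])
 finally show ?case using mv by simp
qed simp

section \<open>Operators on tensor fields over a coordinate domain\<close>

text \<open>Multiplication by a function, exterior multiplication by a covector field (a covector is a vector through the
  Euclidean inner product), interior product, and the derivation given by a field of endomorphisms.\<close>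

definition sm :: "('e => real) => 'e tfield => 'e tfield" where "sm \<phi> T x vs = \<phi> x * T x vs"
definition ep :: "('e => 'e::euclidean_space) => 'e tfield => 'e tfield" where "ep a T x = tep (a x) (T x)"
definition ii :: "('e => 'e) => 'e tfield => 'e tfield" where "ii V T x vs = T x (V x # vs)"
definition dact :: "('e => 'e => 'e) => 'e tfield => 'e tfield" where "dact A T x = tact (A x) (T x)"

abbreviation cf :: "'e => 'e => 'e" where "cf b == (%_. b)"

lemma sum_fun_app [simp]: "(\<Sum>i\<in>A. f i) x = (\<Sum>i\<in>A. f i x)" for f :: "'i => 'a => 'b::comm_monoid_add"
 by (induction A rule: infinite_finite_induct) auto

lemma self_neg_zero: "(T::'e tfield) = - T ==> T = 0"
 by (intro ext) (metis equal_neg_zero fun_Compl_def zero_fun_apply)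

lemma sm_app [simp]: "sm \<phi> T x vs = \<phi> x * T x vs" by (simp add: sm_def)
lemma ii_app [simp]: "ii V T x vs = T x (V x # vs)" by (simp add: ii_def)
lemma ep_app [simp]: "ep a T x = tep (a x) (T x)" by (simp add: ep_def)
lemma act_app [simp]: "dact A T x = tact (A x) (T x)" by (simp add: dact_def)

lemma tep_fun: "tep a (s + t) = tep a s + tep a t" "tep a (s - t) = tep a s - tep a t" "tep a (- t) = - tep a t"
 and tact_fun: "tact A (s + t) = tact A s + tact A t" "tact A (s - t) = tact A s - tact A t" "tact A (- t) = - tact A t"
 by (intro ext; simp add: tep_def tact_def sum.distrib sum_subtractf sum_negf algebra_simps)+
lemma tep_0 [simp]: "tep a 0 = 0" by (intro ext) (simp add: tep_def)
lemma tact_0 [simp]: "tact a 0 = 0" by (intro ext) (simp add: tact_def)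

lemma op_add:
 "ep a (S + T) = ep a S + ep a T" "ii V (S + T) = ii V S + ii V T"
 "sm \<phi> (S + T) = sm \<phi> S + sm \<phi> T" "dact A (S + T) = dact A S + dact A T"
 by (intro ext; simp add: tep_fun tact_fun algebra_simps)+
lemma op_diff:
 "ep a (S - T) = ep a S - ep a T" "ii V (S - T) = ii V S - ii V T"
 "sm \<phi> (S - T) = sm \<phi> S - sm \<phi> T" "dact A (S - T) = dact A S - dact A T"
 by (intro ext; simp add: tep_fun tact_fun algebra_simps)+
lemma op_minus:
 "ep a (- T) = - ep a T" "ii V (- T) = - ii V T" "sm \<phi> (- T) = - sm \<phi> T" "dact A (- T) = - dact A T"
 by (intro ext; simp add: tep_fun tact_fun)+
lemma op_zero [simp]: "ep a 0 = 0" "ii V 0 = 0" "sm \<phi> 0 = 0" "dact A 0 = 0"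
 by (intro ext; simp)+
lemma op_sum:
 "ep a (\<Sum>i\<in>A. T i) = (\<Sum>i\<in>A. ep a (T i))" "ii V (\<Sum>i\<in>A. T i) = (\<Sum>i\<in>A. ii V (T i))"
 "sm \<phi> (\<Sum>i\<in>A. T i) = (\<Sum>i\<in>A. sm \<phi> (T i))" "dact B (\<Sum>i\<in>A. T i) = (\<Sum>i\<in>A. dact B (T i))"
 by (induction A rule: infinite_finite_induct) (simp_all add: op_add)

lemma tep_tm: "tep a (%vs. c * t vs) = (%vs. c * tep a t vs)" by (intro ext) (rule tep_scale)
lemma tact_tm: "tact a (%vs. c * t vs) = (%vs. c * tact a t vs)" by (intro ext) (rule tact_scale)

lemma sm_eta: "sm \<phi> T x = (%vs. \<phi> x * T x vs)" by (intro ext) simp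
lemma op_sm:
 "ep a (sm \<phi> T) = sm \<phi> (ep a T)" "ii V (sm \<phi> T) = sm \<phi> (ii V T)" "dact A (sm \<phi> T) = sm \<phi> (dact A T)"
 by (intro ext; simp add: sm_eta tep_tm tact_tm)+

lemma sm_sm: "sm \<phi> (sm \<psi> T) = sm (%x. \<phi> x * \<psi> x) T" by (intro ext) simp
lemma sm_1 [simp]: "sm (%x. 1) T = T" by (intro ext) simp
lemma sm_minus_left: "sm (%x. - \<phi> x) T = - sm \<phi> T" by (intro ext) simp
lemma sm_zero_left [simp]: "sm (%x. 0) T = 0" by (intro ext) simp
lemma ep_ep: "ep a (ep b T) = - ep b (ep a T)"
 by (intro ext) (simp add: tep_anti[of "a _"])
lemma ii_ep: "ii V (ep a T) = sm (%x. a x \<bullet> V x) T - ep a (ii V T)"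
proof (intro ext)
 fix x vs
 have "(%us. T x (V x # us)) = ii V T x" by (intro ext) simp
 thus "ii V (ep a T) x vs = (sm (%x. a x \<bullet> V x) T - ep a (ii V T)) x vs" by simp
qed
lemma ep_add_left: "ep (%x. a x + b x) T = ep a T + ep b T"
 by (intro ext) (simp add: tep_add_left)
lemma ep_scale_left: "ep (%x. c x *\<^sub>R a x) T = sm c (ep a T)"
 by (intro ext) (simp add: tep_scale_left)
lemma ep_zero_left [simp]: "ep (%x. 0) T = 0"
 by (intro ext) (simp add: tep_def)
lemma ep_sum_left: "ep (%x. \<Sum>i\<in>A. a i x) T = (\<Sum>i\<in>A. ep (a i) T)"
proof (intro ext)
 fix x vs
 have "tep (\<Sum>i\<in>A. a i x) (T x) vs = (\<Sum>i\<in>A. tep (a i x) (T x) vs)"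
  by (simp add: tep_def inner_sum_left sum_distrib_left sum_distrib_right) (rule sum.swap)
 thus "ep (%x. \<Sum>i\<in>A. a i x) T x vs = (\<Sum>i\<in>A. ep (a i) T) x vs" by simp
qed

named_theorems tint

locale region =
 fixes W :: "'e::euclidean_space set"
 assumes open_W [simp, smooth_intros]: "open W"
begin

lemmas cf_smooth = smooth_const[OF open_W]

text \<open>Fields are extended by zero outside \<open>W\<close>, again in order that they are equal as functions.\<close>

definition Ten :: "nat => 'e tfield => bool" where
 "Ten j T \<longleftrightarrow> (\<forall>x vs. x \<notin> W --> T x vs = 0) & (\<forall>x. ten j (T x)) & (\<forall>vs. smooth_on W (%x. T x vs))"

definition Frm :: "nat => 'e tfield => bool" where
 "Frm j T \<longleftrightarrow> Ten j T & (\<forall>x. alt j (T x))"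

definition mf :: "('e => 'e => 'e) => bool" where
 "mf A \<longleftrightarrow> (\<forall>x\<in>W. linear (A x)) & (\<forall>v. smooth_on W (%x. A x v))"

definition DD :: "('e => 'e) => 'e tfield => 'e tfield" where
 "DD V T x vs = (if x \<in> W then fd (%y. T y vs) x (V x) else 0)"

lemma Frm_Ten: "Frm j T ==> Ten j T" by (simp add: Frm_def)

lemma Ten_off: "Ten j T ==> x \<notin> W ==> T x = 0" by (intro ext) (simp add: Ten_def)
lemma Ten_len: "Ten j T ==> length vs ~= j ==> T x vs = 0" by (simp add: Ten_def ten_def)
lemma Ten_smooth: "Ten j T ==> smooth_on W (%x. T x vs)" by (simp add: Ten_def)
lemma Ten_linear: "Ten j T ==> linear (%v. T x (v # vs))" by (auto simp: Ten_def intro: ten_linear)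
lemma Ten_ten: "Ten j T ==> ten j (T x)" by (simp add: Ten_def)
lemma Frm_alt: "Frm j T ==> alt j (T x)" by (simp add: Frm_def)

lemma DD_off: "x \<notin> W ==> DD V T x = 0" by (intro ext) (simp add: DD_def)

lemma Ten_eqI:
 assumes "Ten j S" "Ten j T" "!!x vs. x \<in> W ==> length vs = j ==> S x vs = T x vs"
 shows "S = T"
proof (intro ext)
 fix x vs show "S x vs = T x vs"
  using assms by (cases "x \<in> W & length vs = j") (auto simp: Ten_off[of j] Ten_len[of j])
qed

lemma Ten_zero [tint]: "Ten j 0"
 by (auto simp: Ten_def ten_def multilin_def linear_zero)
lemma Frm_zero [tint]: "Frm j 0" by (auto simp: Frm_def alt_def alternating_def tint Ten_def[of j 0] ten_def multilin_def linear_zero)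

lemma Ten_add [tint]: "Ten j S ==> Ten j T ==> Ten j (S + T)"
 unfolding Ten_def by (auto simp: plus_fun_def intro!: smooth_intros ten_add)
lemma Frm_add [tint]: "Frm j S ==> Frm j T ==> Frm j (S + T)"
 unfolding Frm_def by (auto simp: plus_fun_def intro!: Ten_add[unfolded plus_fun_def] alt_add)

lemma Ten_sm [tint]: "Ten j T ==> smooth_on W \<phi> ==> Ten j (sm \<phi> T)"
 unfolding Ten_def by (auto simp: sm_eta intro!: smooth_intros ten_scale)
lemma Frm_sm [tint]: "Frm j T ==> smooth_on W \<phi> ==> Frm j (sm \<phi> T)"
 unfolding Frm_def by (auto simp: Ten_sm sm_eta intro!: alt_scale)

lemma minus_sm: "- T = sm (%x. -1) T" by (intro ext) simp
lemma Ten_minus [tint]: "Ten j T ==> Ten j (- T)" by (simp add: minus_sm Ten_sm)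
lemma Frm_minus [tint]: "Frm j T ==> Frm j (- T)" by (simp add: minus_sm Frm_sm)
lemma Ten_diff [tint]: "Ten j S ==> Ten j T ==> Ten j (S - T)"
 using Ten_add[OF _ Ten_minus] by (metis add_uminus_conv_diff)
lemma Frm_diff [tint]: "Frm j S ==> Frm j T ==> Frm j (S - T)"
 using Frm_add[OF _ Frm_minus] by (metis add_uminus_conv_diff)
lemma Ten_sum [tint]: "(!!i. i \<in> A ==> Ten j (T i)) ==> Ten j (\<Sum>i\<in>A. T i)"
 by (induction A rule: infinite_finite_induct) (auto intro: tint)
lemma Frm_sum [tint]: "(!!i. i \<in> A ==> Frm j (T i)) ==> Frm j (\<Sum>i\<in>A. T i)"
 by (induction A rule: infinite_finite_induct) (auto intro: tint)

lemma Ten_expand: "Ten j T ==> T x (v # vs) = (SUM b. (v \<bullet> b) * T x (b # vs))"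
 using linear_expand[OF Ten_linear] by simp

lemma ii_expand: "Ten j T ==> ii V T = (SUM b. sm (%x. V x \<bullet> b) (ii (cf b) T))"
 by (intro ext) (simp, rule Ten_expand)

lemma Ten_ii_cf: "Ten (Suc j) T ==> Ten j (ii (cf v) T)"
 unfolding Ten_def using ten_tl by (force simp: ii_def[abs_def])

lemma Ten_ii [tint]: "Ten (Suc j) T ==> smooth_on W V ==> Ten j (ii V T)"
 by (subst ii_expand, assumption) (auto intro!: tint smooth_intros Ten_ii_cf)

lemma Frm_ii [tint]: "Frm (Suc j) T ==> smooth_on W V ==> Frm j (ii V T)"
 unfolding Frm_def using Ten_ii by (auto simp: ii_def[abs_def] alt_tl)

lemma ii_0: "Ten 0 T ==> ii V T = 0"
 by (intro ext) (simp add: Ten_len)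

lemma Ten_ep [tint]: "Ten j T ==> smooth_on W a ==> Ten (Suc j) (ep a T)"
 unfolding Ten_def
 by (auto simp: ten_tep) (auto simp: tep_def intro!: smooth_intros)

lemma Frm_ep [tint]: "Frm j T ==> smooth_on W a ==> Frm (Suc j) (ep a T)"
 unfolding Frm_def by (auto simp: Ten_ep alt_tep)

text \<open>As for \<open>ten_hd\<close>, the case of functions is included.\<close>

lemma Ten_ii': "Ten j T ==> smooth_on W V ==> Ten (j - 1) (ii V T)"
 by (cases j) (simp_all add: ii_0 Ten_zero Ten_ii)
lemma Frm_ii': "Frm j T ==> smooth_on W V ==> Frm (j - 1) (ii V T)"
 by (cases j) (simp_all add: ii_0[OF Frm_Ten] Frm_zero Frm_ii)
lemma Ten_hd: "Ten j T ==> Ten (j - 1) (ii (cf v) T)"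
 by (cases j) (auto simp: ii_0 Ten_zero Ten_ii_cf)

subsection \<open>Derivatives along a map\<close>

lemma DD_ii_cf: "DD V (ii (cf v) T) = ii (cf v) (DD V T)" by (intro ext) (simp add: DD_def)

context
 fixes U :: "'b::euclidean_space set" and e :: "'b => 'e"
 assumes U: "open U" and e: "smooth_on U e" "!!x. x \<in> U ==> e x \<in> W"
begin

lemma smooth_on_pullback:
 "Ten j C ==> (!!V. V \<in> set Vs ==> smooth_on U V) ==> smooth_on U (%x. C (e x) (map (%V. V x) Vs))"
proof (induction Vs arbitrary: j C)
 case Nil
 show ?case using smooth_compose[OF U open_W e(1) Ten_smooth[OF Nil(1)]] e(2) by auto
next
 case (Cons V Vs)
 show ?case
  using smooth_family[where A="%x v. C (e x) (v # map (%V. V x) Vs)" and e="%x. x", OF U U Ten_linear[OF Cons.prems(1)]]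
   Cons.IH[OF Ten_hd[OF Cons.prems(1)]] Cons.prems(2) U by simp
qed

lemma fd_pullback:
 "Ten j C ==> (!!V. V \<in> set Vs ==> smooth_on U V) ==> x \<in> U ==>
  fd (%x. C (e x) (map (%V. V x) Vs)) x u = DD (cf (fd e x u)) C (e x) (map (%V. V x) Vs)
   + (\<Sum>i<length Vs. C (e x) ((map (%V. V x) Vs)[i := fd (Vs ! i) x u]))"
proof (induction Vs arbitrary: j C)
 case Nil
 thus ?case
  using fd_compose[OF e(1) Ten_smooth[OF Nil(1), of "[]"] _ e(2)] e(2) by (simp add: DD_def)
next
 case (Cons V Vs)
 have sV: "smooth_on U V" "!!V. V \<in> set Vs ==> smooth_on U V" using Cons.prems(2) by simp_all
 have s: "smooth_on U (%x. C (e x) (v # map (%V. V x) Vs))" for v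
  using smooth_on_pullback[OF Ten_hd[OF Cons.prems(1), of v] sV(2)] by simp
 have id: "fd (%x. x) x = (%w. w)" by (rule fd_eqI) simp
 have "fd (%x. C (e x) (V x # map (%V. V x) Vs)) x u
   = fd (%z. C (e z) (V x # map (%V. V z) Vs)) x u + C (e x) (fd V x u # map (%V. V x) Vs)"
  using fd_family[where A="%x v. C (e x) (v # map (%V. V x) Vs)" and e="%x. x" and x=x and u=u,
   OF U U Ten_linear[OF Cons.prems(1)] s smooth_id[OF U] _ sV(1) Cons.prems(3)] by (simp add: id)
 thus ?case
  using Cons.IH[OF Ten_hd[OF Cons.prems(1), of "V x"] sV(2) Cons.prems(3), unfolded DD_ii_cf]
  by (simp add: sum.lessThan_Suc_shift del: sum.lessThan_Suc)
qed

end

lemma fd_slots: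
 assumes "Ten j T" "!!V. V \<in> set Vs ==> smooth_on W V" "x \<in> W"
 shows "fd (%x. T x (map (%V. V x) Vs)) x u = fd (%y. T y (map (%V. V x) Vs)) x u
   + (\<Sum>i<length Vs. T x ((map (%V. V x) Vs)[i := fd (Vs ! i) x u]))"
proof -
 have "fd (%x. x) x = (%w. w)" by (rule fd_eqI) simp
 thus ?thesis using fd_pullback[OF open_W smooth_id[OF open_W] _ assms, where u=u] assms(3) by (simp add: DD_def)
qed

lemma smooth_tact:
 assumes "mf A" "Ten j T" shows "smooth_on W (%x. tact (A x) (T x) vs)"
 unfolding tact_def
proof (intro smooth_sum open_W)
 fix i assume "i \<in> {..<length vs}"
 have "smooth_on W (%x. T x (map (%V. V x) ((map (%v _. v) vs)[i := %x. A x (vs ! i)])))"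
  by (rule smooth_on_pullback[OF open_W smooth_id[OF open_W] _ assms(2)])
   (use assms(1) set_update_subset_insert in \<open>fastforce simp: mf_def\<close>)+
 thus "smooth_on W (%x. T x (vs[i := A x (vs ! i)]))" by (simp add: map_update comp_def)
qed

lemma Ten_act [tint]: assumes "Ten j T" "mf A" shows "Ten j (dact A T)"
 unfolding Ten_def
proof (intro conjI allI impI)
 fix x
 show "ten j (dact A T x)"
 proof (cases "x \<in> W")
  case True
  thus ?thesis using assms by (auto simp: mf_def Ten_def intro!: ten_tact)
 next
  case False
  thus ?thesis using Ten_off[OF assms(1)] Ten_ten[OF Ten_zero] by (metis act_app tact_0 zero_fun_apply)
 qed
qed (use assms Ten_off[OF assms(1)] smooth_tact in \<open>auto\<close>)

lemma Frm_act [tint]: assumes "Frm j T" "mf A" shows "Frm j (dact A T)"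
 unfolding Frm_def
proof (intro conjI allI)
 fix x
 show "alt j (dact A T x)"
 proof (cases "x \<in> W")
  case True
  thus ?thesis using assms by (auto simp: mf_def Frm_def intro!: alt_tact)
 next
  case False
  thus ?thesis using Ten_off[OF Frm_Ten[OF assms(1)]] Frm_alt[OF Frm_zero] by (metis act_app tact_0 zero_fun_apply)
 qed
qed (intro Ten_act Frm_Ten assms)

lemma ten_fd: "Ten j T ==> x \<in> W ==> ten j (%vs. fd (%y. T y vs) x u)"
proof (induction j arbitrary: T)
 case 0
 thus ?case by (simp add: ten_0 Ten_len)
next
 case (Suc j)
 have "linear (%v. fd (%y. T y (v # vs)) x u)" for vs
  by (rule linear_fd_family[OF open_W Ten_linear[OF Suc.prems(1)] Ten_smooth[OF Suc.prems(1)] Suc.prems(2)])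
 moreover have "ten j (%vs. fd (%y. T y (v # vs)) x u)" for v
  using Suc.IH[OF Ten_ii_cf[OF Suc.prems(1)] Suc.prems(2), of v] by simp
 ultimately show ?case using Suc.prems(1) by (simp add: ten_Suc Ten_len)
qed

lemma smooth_DD: "smooth_on W f ==> smooth_on W V ==> smooth_on W (%x. fd f x (V x))"
 by (rule smooth_fd_compose[of W W "%x. x"]) auto

lemma Ten_DD [tint]: assumes "Ten j T" "smooth_on W V" shows "Ten j (DD V T)"
 unfolding Ten_def
proof (intro conjI allI impI)
 fix x show "ten j (DD V T x)"
 proof (cases "x \<in> W")
  case True
  hence "DD V T x = (%vs. fd (%y. T y vs) x (V x))" by (intro ext) (simp add: DD_def)
  thus ?thesis using ten_fd[OF assms(1) True] by simp
 next
  case False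
  hence "DD V T x = 0" by (intro ext) (simp add: DD_def)
  thus ?thesis using Ten_ten[OF Ten_zero] by (metis zero_fun_apply)
 qed
next
 fix vs
 have "smooth_on W (%x. fd (%y. T y vs) x (V x))"
  by (rule smooth_DD[OF Ten_smooth[OF assms(1)] assms(2)])
 thus "smooth_on W (%x. DD V T x vs)"
  by (subst smooth_on_cong[OF open_W]) (auto simp: DD_def)
qed (simp add: DD_def)

lemma Frm_DD [tint]: assumes "Frm j T" "smooth_on W V" shows "Frm j (DD V T)"
 unfolding Frm_def alt_def
proof (intro conjI allI)
 fix x
 show "alternating j (DD V T x)"
  unfolding alternating_def
 proof (intro allI impI)
  fix vs :: "'e list" and i k assume "length vs = j & i < k & k < j & vs ! i = vs ! k"
  hence "T y vs = 0" for y using Frm_alt[OF assms(1)] unfolding alt_def alternating_def by blast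
  thus "DD V T x vs = 0" by (simp add: DD_def)
 qed
qed (use assms Ten_DD in \<open>auto simp: Frm_def Ten_ten\<close>)

lemma DD_add: "Ten j S ==> Ten j T ==> DD V (S + T) = DD V S + DD V T"
 by (intro ext) (simp add: DD_def fd_add[OF Ten_smooth Ten_smooth])
lemma DD_zero [simp]: "DD V 0 = 0" by (intro ext) (simp add: DD_def)
lemma DD_sm: "Ten j T ==> smooth_on W \<phi> ==> DD V (sm \<phi> T) = sm \<phi> (DD V T) + sm (%x. fd \<phi> x (V x)) T"
 by (intro ext) (auto simp: DD_def fd_mult[OF _ Ten_smooth] Ten_off)
lemma DD_minus: "Ten j T ==> DD V (- T) = - DD V T"
 by (intro ext) (simp add: DD_def fd_minus[OF Ten_smooth])
lemma DD_diff: "Ten j S ==> Ten j T ==> DD V (S - T) = DD V S - DD V T"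
 by (intro ext) (simp add: DD_def fd_diff[OF Ten_smooth Ten_smooth])
lemma DD_sum: "(!!i. i \<in> A ==> Ten j (T i)) ==> DD V (\<Sum>i\<in>A. T i) = (\<Sum>i\<in>A. DD V (T i))"
 by (induction A rule: infinite_finite_induct) (auto simp: DD_add[of j] tint)

lemma DD_ii: 
 assumes "Ten j T" "smooth_on W V"
 shows "DD U (ii V T) = ii V (DD U T) + ii (%x. fd V x (U x)) T"
proof (intro ext)
 fix x vs
 show "DD U (ii V T) x vs = (ii V (DD U T) + ii (%x. fd V x (U x)) T) x vs"
 proof (cases "x \<in> W")
  case True
  have "fd (%x. x) x = (%w. w)" by (rule fd_eqI) simp
  thus ?thesis
   using fd_family[where A="%x v. T x (v # vs)" and e="%x. x" and x=x and u="U x",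
    OF open_W open_W Ten_linear[OF assms(1)] Ten_smooth[OF assms(1)] _ _ assms(2) True] True by (simp add: DD_def)
 qed (use Ten_off[OF assms(1)] in \<open>simp add: DD_off\<close>)
qed

lemma DD_ep:
 assumes "Ten j T" "smooth_on W a"
 shows "DD U (ep a T) = ep a (DD U T) + ep (%x. fd a x (U x)) T"
proof (intro ext)
 fix x vs
 show "DD U (ep a T) x vs = (ep a (DD U T) + ep (%x. fd a x (U x)) T) x vs"
 proof (cases "x \<in> W")
  case True
  have "fd (%y. (-1) ^ i * (a y \<bullet> vs ! i) * T y (omit i vs)) x (U x) = (-1) ^ i * (a x \<bullet> vs ! i) * fd (%y. T y (omit i vs)) x (U x)
    + (-1) ^ i * (fd a x (U x) \<bullet> vs ! i) * T x (omit i vs)" for i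
   using fd_mult[OF smooth_mult[OF open_W cf_smooth smooth_inner[OF open_W assms(2) cf_smooth]] Ten_smooth[OF assms(1)] True]
    fd_mult[OF cf_smooth smooth_inner[OF open_W assms(2) cf_smooth] True]
    fd_inner[OF assms(2) cf_smooth True] by simp
  moreover have "fd (%y. tep (a y) (T y) vs) x (U x) = (\<Sum>i<length vs. fd (%y. (-1) ^ i * (a y \<bullet> vs ! i) * T y (omit i vs)) x (U x))"
   unfolding tep_def by (rule fd_sum[of _ W]) (auto intro!: smooth_intros Ten_smooth[OF assms(1)] assms True)
  ultimately show ?thesis using True by (simp add: DD_def tep_def sum.distrib)
 qed (use Ten_off[OF assms(1)] in \<open>simp add: DD_off\<close>)
qed

lemma fd_tact:
 assumes "Ten j T" "mf A" "x \<in> W"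
 shows "fd (%y. tact (A y) (T y) vs) x u =
  tact (A x) (%us. fd (%y. T y us) x u) vs + tact (%v. fd (%y. A y v) x u) (T x) vs"
proof -
 let ?Vs = "%i. (map (%v _. v) vs)[i := %x. A x (vs ! i)]"
 have V: "V \<in> set (?Vs i) ==> smooth_on W V" for i V
  using assms(2) set_update_subset_insert by (fastforce simp: mf_def)
 have "smooth_on W (%x. T x (vs[i := A x (vs ! i)]))" for i
  using smooth_on_pullback[OF open_W smooth_id[OF open_W] _ assms(1), of "?Vs i"] V[of _ i] by (simp add: map_update comp_def)
 hence "fd (%y. tact (A y) (T y) vs) x u = (\<Sum>i<length vs. fd (%y. T y (vs[i := A y (vs ! i)])) x u)"
  unfolding tact_def by (rule fd_sum[OF _ assms(3)])
 also have "... = (\<Sum>i<length vs. fd (%y. T y (vs[i := A x (vs ! i)])) x u + T x (vs[i := fd (%y. A y (vs ! i)) x u]))"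
 proof (rule sum.cong[OF refl])
  fix i assume i: "i \<in> {..<length vs}"
  have "T x (vs[i := A x (vs ! i), l := fd (?Vs i ! l) x u]) = (if l = i then T x (vs[i := fd (%y. A y (vs ! i)) x u]) else 0)" if "l < length vs" for l
   using that linear_0[OF ten_slot_linear[OF Ten_ten[OF assms(1)], of l "vs[i := A x (vs ! i)]" x]] by (simp add: fd_const[abs_def])
  thus "fd (%y. T y (vs[i := A y (vs ! i)])) x u = fd (%y. T y (vs[i := A x (vs ! i)])) x u + T x (vs[i := fd (%y. A y (vs ! i)) x u])"
   using fd_slots[OF assms(1) _ assms(3), of "?Vs i" u] V[of _ i] i by (simp add: map_update comp_def)
 qed
 finally show ?thesis by (simp add: tact_def sum.distrib)
qed

lemma DD_act:
 assumes "Ten j T" "mf A"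
 shows "DD U (dact A T) = dact A (DD U T) + dact (%x v. fd (%y. A y v) x (U x)) T"
proof (intro ext)
 fix x vs
 show "DD U (dact A T) x vs = (dact A (DD U T) + dact (%x v. fd (%y. A y v) x (U x)) T) x vs"
 proof (cases "x \<in> W")
  case True
  hence "DD U T x = (%us. fd (%y. T y us) x (U x))" by (intro ext) (simp add: DD_def)
  thus ?thesis using fd_tact[OF assms True] True by (simp add: DD_def)
 next
  case False
  hence "DD U T x = 0" by (intro ext) (simp add: DD_def)
  thus ?thesis using Ten_off[OF assms(1) False] False by (simp add: DD_def[of U "dact A T"])
 qed
qed

lemma DD_commute: "Ten j T ==> DD (cf a) (DD (cf b) T) = DD (cf b) (DD (cf a) T)"
proof (intro ext)
 fix x vs assume T: "Ten j T"
 show "DD (cf a) (DD (cf b) T) x vs = DD (cf b) (DD (cf a) T) x vs"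
 proof (cases "x \<in> W")
  case True
  have "fd (%y. DD (cf b) T y vs) x = fd (%y. fd (%y. T y vs) y b) x" for b
   by (rule fd_cong[OF open_W True]) (simp add: DD_def)
  thus ?thesis using fd_symmetric[OF open_W Ten_smooth[OF T] True, of vs a b] True by (simp add: DD_def)
 qed (simp add: DD_def)
qed

lemma DD_lin: "Ten j T ==> DD V T = (SUM b. sm (%x. V x \<bullet> b) (DD (cf b) T))"
proof (intro ext)
 fix x vs assume T: "Ten j T"
 show "DD V T x vs = (SUM b. sm (%x. V x \<bullet> b) (DD (cf b) T)) x vs"
 proof (cases "x \<in> W")
  case True
  show ?thesis using True linear_expand[OF fd_linear[OF Ten_smooth[OF T, of vs] True], of "V x"] by (simp add: DD_def)
 qed (simp add: DD_def)
qed

lemma ii_cong: "Ten j T ==> (!!x. x \<in> W ==> V x = V' x) ==> ii V T = ii V' T"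
 by (intro ext) (metis Ten_off ii_app zero_fun_apply)
lemma act_cong: "Ten j T ==> (!!x v. x \<in> W ==> A x v = A' x v) ==> dact A T = dact A' T"
proof (intro ext)
 fix x vs assume *: "Ten j T" "!!x v. x \<in> W ==> A x v = A' x v"
 show "dact A T x vs = dact A' T x vs"
 proof (cases "x \<in> W")
  case True hence "A x = A' x" using * by auto
  thus ?thesis by simp
 next
  case False thus ?thesis using Ten_off[OF *(1)] by simp
 qed
qed
lemma sm_cong: "Ten j T ==> (!!x. x \<in> W ==> f x = g x) ==> sm f T = sm g T"
 by (intro ext) (metis Ten_off sm_app zero_fun_apply mult_zero_right)
lemma ep_cong: "Ten j T ==> (!!x. x \<in> W ==> f x = g x) ==> ep f T = ep g T"
 by (intro ext) (metis Ten_off ep_app tep_0)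
lemma ii_add_left: "Ten j T ==> ii (%x. U x + V x) T = ii U T + ii V T"
 by (intro ext) (simp add: linear_add[OF Ten_linear])
lemma ii_scale_left: "Ten j T ==> ii (%x. c x *\<^sub>R V x) T = sm c (ii V T)"
 by (intro ext) (simp add: linear_scale[OF Ten_linear])
lemma ii_zero_left: "Ten j T ==> ii (%x. 0) T = 0"
 by (intro ext) (simp add: linear_0[OF Ten_linear])
lemma ii_sum_left: "Ten j T ==> ii (%x. \<Sum>i\<in>A. V i x) T = (\<Sum>i\<in>A. ii (V i) T)"
 by (intro ext) (simp add: linear_sum[OF Ten_linear])
lemma ii_ii: "Frm j T ==> ii U (ii V T) = - ii V (ii U T)"
 by (intro ext) (simp, erule alt_swap[OF Frm_alt])

lemma act_ii: "Ten j T ==> dact A (ii V T) = ii V (dact A T) - ii (%x. A x (V x)) T"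
 by (intro ext) (simp add: ii_def[abs_def])
lemma act_ep: "mf A ==> Ten j T ==> dact A (ep a T) = ep a (dact A T) + ep (%x. SUM c. (a x \<bullet> A x c) *\<^sub>R c) T"
proof (intro ext)
 fix x vs assume A: "mf A" "Ten j T"
 show "dact A (ep a T) x vs = (ep a (dact A T) + ep (%x. SUM c. (a x \<bullet> A x c) *\<^sub>R c) T) x vs"
  using A Ten_off[OF A(2)] by (cases "x \<in> W") (auto simp: tact_tep_commute mf_def)
qed
lemma act_act: "Ten j T ==> dact A (dact B T) - dact B (dact A T) = dact (%x v. B x (A x v) - A x (B x v)) T"
 by (intro ext) (simp add: tact_commutator[OF Ten_ten])
lemma act_as_ep: "Frm j T ==> mf A ==> dact A T = (SUM b. ep (cf b) (ii (%x. A x b) T))"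
proof (intro ext)
 fix x vs assume A: "Frm j T" "mf A"
 show "dact A T x vs = (SUM b. ep (cf b) (ii (%x. A x b) T)) x vs"
 proof (cases "x \<in> W")
  case True
  thus ?thesis using A by (simp add: tact_tep[OF Frm_alt[OF A(1)]] mf_def ii_def[abs_def])
 next
  case False
  thus ?thesis using Ten_off[OF Frm_Ten[OF A(1)] False] by (simp add: ii_def[abs_def])
 qed
qed
lemma act_add_left: "Ten j T ==> dact (%x v. A x v + B x v) T = dact A T + dact B T"
 by (intro ext) (simp add: tact_add_left[OF Ten_ten])
lemma act_scale_left: "Ten j T ==> dact (%x v. c x *\<^sub>R A x v) T = sm c (dact A T)"
 by (intro ext) (simp add: tact_scale_left[OF Ten_ten])

end

lemma ep_diff_left: "ep (%x. a x - b x) T = ep a T - ep b T"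
 using ep_add_left[of a "%x. - b x" T] ep_scale_left[of "%_. -1" b T] by (simp add: sm_minus_left)

lemma fd_symmetric_euclidean:
 fixes V :: "'b::euclidean_space => 'e::euclidean_space"
 assumes U: "open U" and V: "smooth_on U V" and x: "x \<in> U"
 shows "fd (%y. fd V y v) x w = fd (%y. fd V y w) x v"
proof (rule euclidean_eqI)
 fix b :: 'e
 have 1: "fd (%y. V y \<bullet> b) y u = fd V y u \<bullet> b" if "y \<in> U" for y u
  using fd_inner[OF V smooth_const[OF U] that] by simp
 have 2: "fd (%y. fd V y u \<bullet> b) x u' = fd (%y. fd V y u) x u' \<bullet> b" for u u'
  using fd_inner[OF smooth_fd[OF V] smooth_const[OF U] x] by simp
 have 3: "fd (%y. fd (%y. V y \<bullet> b) y u) x = fd (%y. fd V y u \<bullet> b) x" for u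
  by (rule fd_cong[OF U x 1])
 have "smooth_on U (%y. V y \<bullet> b)" by (intro smooth_inner V smooth_const U)
 thus "fd (%y. fd V y v) x w \<bullet> b = fd (%y. fd V y w) x v \<bullet> b"
  using fd_symmetric[OF U _ x, of "%y. V y \<bullet> b" v w] by (simp add: 2[symmetric] 3[symmetric])
qed

context region begin

lemma act_minus_left: "Ten j T ==> dact (%x v. - A x v) T = - dact A T"
 using act_scale_left[of j T "%_. -1" A] by (simp add: sm_minus_left)
lemma act_diff_left: "Ten j T ==> dact (%x v. A x v - B x v) T = dact A T - dact B T"
 using act_add_left[of j T A "%x v. - B x v"] act_minus_left[of j T B] by simp

lemma mf_expand: "mf A ==> x \<in> W ==> A x v = (SUM b. (v \<bullet> b) *\<^sub>R A x b)"
 unfolding mf_def using linear_expand[of "A x" v] by blast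

lemma
 assumes A: "mf A" and V: "smooth_on W V"
 shows mf_app: "smooth_on W (%x. A x (V x))"
  and fd_mf: "x \<in> W ==> fd (%y. A y (V y)) x u = fd (%y. A y (V x)) x u + A x (fd V x u)"
proof -
 have A': "!!x. x \<in> W ==> linear (A x)" "!!v. smooth_on W (%x. A x v)" using A by (simp_all add: mf_def)
 note * = open_W open_W A' smooth_id[OF open_W] _ V
 show "smooth_on W (%x. A x (V x))" by (rule smooth_family[where A=A, OF *])
 have "fd (%x. x) x = (%w. w)" by (rule fd_eqI) simp
 thus "fd (%y. A y (V y)) x u = fd (%y. A y (V x)) x u + A x (fd V x u)" if "x \<in> W"
  using fd_family[where A=A, OF * that, of u] by simp
qed

end

section \<open>The Levi-Civita connection\<close>

locale pmetric = region W for W :: "'e::euclidean_space set" +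
 fixes h :: "'e tfield"
 assumes h_mult: "!!x. x \<in> W ==> multilin 2 (h x)"
  and h_smooth: "!!vs. length vs = 2 ==> smooth_on W (%x. h x vs)"
  and h_sym: "!!x u v. x \<in> W ==> h x [u, v] = h x [v, u]"
  and h_nd: "!!x u. x \<in> W ==> (!!v. h x [u, v] = 0) ==> u = 0"
begin

definition hT :: "'e tfield" where "hT x vs = (if x \<in> W & length vs = 2 then h x vs else 0)"

lemma hT_eq: "x \<in> W ==> hT x [u, v] = h x [u, v]" by (simp add: hT_def)

lemma Ten_hT [tint]: "Ten 2 hT"
 unfolding Ten_def
proof (intro conjI allI impI)
 fix x show "ten 2 (hT x)"
  using h_mult by (cases "x \<in> W") (auto simp: ten_def hT_def multilin_def linear_zero)
next
 fix vs show "smooth_on W (%x. hT x vs)"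
 proof (cases "length vs = 2")
  case True
  thus ?thesis using h_smooth[OF True] by (subst smooth_on_cong[OF open_W]) (auto simp: hT_def)
 qed (simp add: hT_def)
qed (simp add: hT_def)

lemma h_lin: "x \<in> W ==> linear (%u. h x [u, v])"
 using Ten_linear[OF Ten_hT, of x "[v]"] by (simp add: hT_def)
lemma h_lin2: "x \<in> W ==> linear (%v. h x [u, v])"
 using h_lin[of x u] h_sym by simp

lemmas h_add = linear_add[OF h_lin] linear_add[OF h_lin2]
lemmas h_diff = linear_diff[OF h_lin] linear_diff[OF h_lin2]
lemmas h_scale = linear_scale[OF h_lin] linear_scale[OF h_lin2]
lemmas h_neg = linear_neg[OF h_lin] linear_neg[OF h_lin2]
lemmas h_zero = linear_0[OF h_lin] linear_0[OF h_lin2]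
lemmas h_sum = linear_sum[OF h_lin] linear_sum[OF h_lin2]

lemma h_eqI: "x \<in> W ==> (!!v. h x [u, v] = h x [u', v]) ==> u = u'"
 using h_nd[of x "u - u'"] by (simp add: h_diff)

definition Gm :: "'e => 'e => 'e" where "Gm x v = (SUM b. h x [v, b] *\<^sub>R b)"

lemma Gm_inner: assumes "x \<in> W" shows "Gm x v \<bullet> u = h x [v, u]"
 using linear_expand[OF h_lin2[OF assms], of v u] by (simp add: Gm_def inner_sum_left inner_commute[of u] mult.commute)

lemma Gm_linear: "x \<in> W ==> linear (Gm x)"
 unfolding Gm_def by (rule linearI) (simp_all add: h_add h_scale scaleR_left_distrib sum.distrib scaleR_right.sum)

lemma mf_Gm: "mf Gm"
 unfolding mf_def Gm_def[abs_def] using Gm_linear[unfolded Gm_def[abs_def]]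
 by (auto intro!: smooth_intros h_smooth)

lemma fl_smooth [smooth_intros]: "smooth_on W V ==> smooth_on W (%x. Gm x (V x))"
 by (rule mf_app[OF mf_Gm])

lemma Gm_inj: "x \<in> W ==> inj (Gm x)"
 by (rule injI) (metis Gm_inner h_eqI)

abbreviation sh :: "'e => 'e => 'e" where "sh b x == raise (h x) b"

text \<open>The musical isomorphism \<^term>\<open>Gm x\<close> is injective, hence invertible, so that the description of \<^const>\<open>raise\<close> is proper
  and \<^term>\<open>raise (h x) b\<close> depends smoothly on \<open>x\<close>.\<close>

lemma raise_inv: assumes "x \<in> W" shows "sh b x = inv (Gm x) b"
 unfolding raise_def
proof (rule the_equality)
 show "\<forall>u. h x [inv (Gm x) b, u] = b \<bullet> u"
  using Gm_inner[OF assms] linear_inj_inv(2)[OF Gm_linear[OF assms] Gm_inj[OF assms]] by metis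
next
 fix z assume z: "\<forall>u. h x [z, u] = b \<bullet> u"
 have "Gm x z = b" using z Gm_inner[OF assms] by (metis inner_eq_zero_iff inner_diff_left right_minus_eq)
 thus "z = inv (Gm x) b" using linear_inj_inv(3)[OF Gm_linear[OF assms] Gm_inj[OF assms]] by metis
qed

lemma h_sh: "x \<in> W ==> h x [sh b x, u] = b \<bullet> u"
 using Gm_inner[of x "sh b x" u] linear_inj_inv(2)[OF Gm_linear Gm_inj] by (simp add: raise_inv)
lemma h_sh2: "x \<in> W ==> h x [u, sh b x] = b \<bullet> u" using h_sh h_sym by metis

lemma sh_smooth [smooth_intros]: "smooth_on W (sh b)"
proof -
 have "smooth_on W (%x. inv (Gm x) b)"
  using smooth_linear_inverse[OF open_W Gm_linear Gm_inj] mf_Gm by (simp add: mf_def)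
 thus ?thesis by (subst smooth_on_cong[OF open_W raise_inv])
qed

lemma sh_expand: assumes "x \<in> W" shows "(SUM b. h x [b, w] *\<^sub>R sh b x) = w"
proof (rule h_eqI[OF assms])
 fix v
 have "(SUM b. h x [b, w] * (b \<bullet> v)) = Gm x w \<bullet> v"
  by (simp add: Gm_def inner_sum_left h_sym[OF assms])
 thus "h x [SUM b. h x [b, w] *\<^sub>R sh b x, v] = h x [w, v]"
  using assms by (simp add: h_sum h_scale h_sh Gm_inner)
qed

text \<open>Contraction with the metric can be carried out in any pair of dual bases.\<close>

lemma trace_dual:
 assumes "x \<in> W" "!!Z. Z = (\<Sum>i\<in>I. h x [Z, w i] *\<^sub>R u i)" 
  and l: "!!v. linear (%u. B u v)" "!!u. linear (%v. B u v)"
 shows "(SUM b. B b (sh b x)) = (\<Sum>i\<in>I. B (u i) (w i) :: real)"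
proof -
 have "(SUM b. B b (sh b x)) = (SUM b. \<Sum>i\<in>I. h x [b, w i] * B (u i) (sh b x))"
  by (subst assms(2)) (simp add: linear_sum[OF l(1)] linear_scale[OF l(1)])
 also have "... = (\<Sum>i\<in>I. B (u i) (SUM b. h x [b, w i] *\<^sub>R sh b x))"
  by (subst sum.swap) (simp add: linear_sum[OF l(2)] linear_scale[OF l(2)])
 finally show ?thesis by (simp add: sh_expand[OF assms(1)])
qed

lemma trace_flip:
 assumes "x \<in> W" and l: "!!v. linear (%u. B u v)" "!!u. linear (%v. B u v)"
 shows "(SUM b. B b (sh b x)) = (SUM b. B (sh b x) b :: real)"
proof -
 have "Z = (SUM i. h x [Z, i] *\<^sub>R sh i x)" for Z
  using sh_expand[OF assms(1), of Z] h_sym[OF assms(1)] by simp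
 thus ?thesis using trace_dual[OF assms(1) _ l, where I=Basis and w="%b. b" and u="%b. sh b x"] by blast
qed

subsection \<open>Christoffel symbols\<close>

abbreviation \<Gamma> :: "'e => 'e => 'e => 'e" where "\<Gamma> == christoffel h"

definition Dh :: "'e => 'e => 'e => 'e => real" where "Dh x u v w = fd (%y. h y [v, w]) x u"

lemma Dh_hT: "x \<in> W ==> Dh x u v w = fd (%y. hT y [v, w]) x u"
 unfolding Dh_def using fd_cong[OF open_W, of x "%y. h y [v, w]" "%y. hT y [v, w]"] by (simp add: hT_eq)

lemma Dh_sym: "x \<in> W ==> Dh x u v w = Dh x u w v"
 unfolding Dh_def using fd_cong[OF open_W, of x "%y. h y [v, w]" "%y. h y [w, v]"] h_sym by simp

lemma Dh_lin2: assumes "x \<in> W" shows "linear (%v. Dh x u v w)"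
 using ten_linear[OF ten_fd[OF Ten_hT assms, of u], of "[w]"] assms by (simp add: Dh_hT)
lemma Dh_lin3: "x \<in> W ==> linear (%w. Dh x u v w)"
 using Dh_lin2[of x u v] Dh_sym by simp
lemma Dh_lin1: "x \<in> W ==> linear (%u. Dh x u v w)"
 unfolding Dh_def by (rule fd_linear[OF h_smooth]) auto
lemmas Dh_add = linear_add[OF Dh_lin1] linear_add[OF Dh_lin2] linear_add[OF Dh_lin3]
lemmas Dh_scale = linear_scale[OF Dh_lin1] linear_scale[OF Dh_lin2] linear_scale[OF Dh_lin3]

lemma christoffel_eq: "\<Gamma> x v w = (SUM b. ((Dh x v w b + Dh x w v b - Dh x b v w) / 2) *\<^sub>R sh b x)"
 by (simp add: christoffel_def dirderiv_def Dh_def)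

text \<open>The Koszul formula.\<close>

lemma h_christoffel: assumes "x \<in> W"
 shows "h x [\<Gamma> x v w, u] = (Dh x v w u + Dh x w v u - Dh x u v w) / 2"
proof -
 let ?f = "%u. (Dh x v w u + Dh x w v u - Dh x u v w) / 2"
 have l: "linear ?f"
  by (rule linearI) (simp_all add: Dh_add[OF assms] Dh_scale[OF assms] field_simps)
 have "h x [\<Gamma> x v w, u] = (SUM b. ?f b * (b \<bullet> u))"
  using assms by (simp add: christoffel_eq h_sum h_scale h_sh)
 thus ?thesis unfolding linear_expand[OF l, of u] by (simp add: inner_commute mult.commute)
qed

lemma \<Gamma>_sym: "x \<in> W ==> \<Gamma> x v w = \<Gamma> x w v"
 by (rule h_eqI) (auto simp: h_christoffel Dh_sym[of x _ v w])

lemma \<Gamma>_lin2: assumes x: "x \<in> W" shows "linear (\<Gamma> x v)"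
proof (rule linearI; rule h_eqI[OF x])
 fix b c u
 show "h x [\<Gamma> x v (b + c), u] = h x [\<Gamma> x v b + \<Gamma> x v c, u]"
  by (simp add: h_add[OF x] h_christoffel[OF x] Dh_add[OF x]) (simp add: field_simps)
next
 fix r b u
 show "h x [\<Gamma> x v (r *\<^sub>R b), u] = h x [r *\<^sub>R \<Gamma> x v b, u]"
  by (simp add: h_scale[OF x] h_christoffel[OF x] Dh_scale[OF x]) (simp add: field_simps)
qed
lemma \<Gamma>_lin1: assumes "x \<in> W" shows "linear (%v. \<Gamma> x v w)"
proof -
 have "(%v. \<Gamma> x v w) = \<Gamma> x w" by (intro ext) (rule \<Gamma>_sym[OF assms])
 thus ?thesis using \<Gamma>_lin2[OF assms] by simp
qed

lemma h_compat_const: "x \<in> W ==> Dh x u v w = h x [\<Gamma> x u v, w] + h x [v, \<Gamma> x u w]"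
 using h_sym[of x v "\<Gamma> x u w"] by (simp add: h_christoffel Dh_sym[of x _ w v] Dh_sym[of x v w u] Dh_sym[of x w v u] field_simps)

lemma \<Gamma>_smooth: "smooth_on W (%x. \<Gamma> x v w)"
 unfolding christoffel_eq Dh_def
 by (auto intro!: smooth_intros smooth_fd h_smooth)

lemma mf_\<Gamma>_const [tint]: "mf (%x. \<Gamma> x v)" by (simp add: mf_def \<Gamma>_lin2 \<Gamma>_smooth)
lemma mf_\<Gamma> [tint]: assumes "smooth_on W V" shows "mf (%x. \<Gamma> x (V x))"
proof -
 have "mf (%x v. \<Gamma> x v w)" for w by (simp add: mf_def \<Gamma>_lin1 \<Gamma>_smooth)
 from mf_app[OF this assms] show ?thesis by (simp add: mf_def \<Gamma>_lin2)
qed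

lemma \<Gamma>_app [smooth_intros]: "smooth_on W U ==> smooth_on W V ==> smooth_on W (%x. \<Gamma> x (U x) (V x))"
 by (rule mf_app[OF mf_\<Gamma>])

subsection \<open>Covariant derivatives\<close>

text \<open>The covariant derivatives of a tensor field, of a vector field and of a covector field.\<close>

definition NN :: "('e => 'e) => 'e tfield => 'e tfield" where
 "NN V T = DD V T - dact (%x. \<Gamma> x (V x)) T"
definition cv :: "('e => 'e) => ('e => 'e) => 'e => 'e" where
 "cv U V x = fd V x (U x) + \<Gamma> x (U x) (V x)"
definition cw :: "('e => 'e) => ('e => 'e) => 'e => 'e" where
 "cw U a x = fd a x (U x) - (SUM c. (a x \<bullet> \<Gamma> x (U x) c) *\<^sub>R c)"

lemma nabla_NN: "Ten j T ==> x \<in> W ==> V x = v ==> nabla h T x (v # vs) = NN V T x vs"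
 by (simp add: NN_def nabla_def dirderiv_def DD_def tact_def)

lemma Ten_NN [tint]: "Ten j T ==> smooth_on W V ==> Ten j (NN V T)"
 unfolding NN_def by (auto intro!: tint)
lemma Frm_NN [tint]: "Frm j T ==> smooth_on W V ==> Frm j (NN V T)"
 unfolding NN_def by (auto intro!: tint)
lemma cv_smooth [smooth_intros]: "smooth_on W U ==> smooth_on W V ==> smooth_on W (cv U V)"
 unfolding cv_def[abs_def] by (auto intro!: smooth_intros smooth_DD)

lemma NN_add: "Ten j S ==> Ten j T ==> NN V (S + T) = NN V S + NN V T"
 by (simp add: NN_def DD_add op_add)
lemma NN_diff: "Ten j S ==> Ten j T ==> NN V (S - T) = NN V S - NN V T"
 by (simp add: NN_def DD_diff op_diff)
lemma NN_minus: "Ten j T ==> NN V (- T) = - NN V T"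
 by (simp add: NN_def DD_minus op_minus)
lemma NN_zero [simp]: "NN V 0 = 0" by (simp add: NN_def)
lemma NN_sum: "(!!i. i \<in> A ==> Ten j (T i)) ==> NN V (\<Sum>i\<in>A. T i) = (\<Sum>i\<in>A. NN V (T i))"
 by (simp only: NN_def DD_sum[of A j] op_sum sum_subtractf)
lemma NN_sm: "Ten j T ==> smooth_on W \<phi> ==> NN V (sm \<phi> T) = sm \<phi> (NN V T) + sm (%x. fd \<phi> x (V x)) T"
 by (simp add: NN_def DD_sm op_sm op_diff)
lemma NN_ii: assumes "Ten j T" "smooth_on W V"
 shows "NN U (ii V T) = ii V (NN U T) + ii (cv U V) T"
proof -
 have "ii (cv U V) T = ii (%x. fd V x (U x)) T + ii (%x. \<Gamma> x (U x) (V x)) T"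
  unfolding cv_def[abs_def] by (rule ii_add_left[OF assms(1)])
 thus ?thesis by (simp add: NN_def DD_ii[OF assms] act_ii[OF assms(1)] op_diff)
qed
lemma NN_ep: assumes "Ten j T" "smooth_on W a" "smooth_on W U"
 shows "NN U (ep a T) = ep a (NN U T) + ep (cw U a) T"
 by (simp add: NN_def DD_ep[OF assms(1,2)] act_ep[OF mf_\<Gamma>[OF assms(3)] assms(1)] op_diff
   cw_def[abs_def] ep_diff_left)
lemma NN_act: assumes "Ten j T" "mf A"
 shows "NN U (dact A T) = dact A (NN U T) +
  dact (%x v. fd (%y. A y v) x (U x) + \<Gamma> x (U x) (A x v) - A x (\<Gamma> x (U x) v)) T"
proof -
 have "dact (%x v. fd (%y. A y v) x (U x) + \<Gamma> x (U x) (A x v) - A x (\<Gamma> x (U x) v)) T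
   = dact (%x v. fd (%y. A y v) x (U x)) T + dact (%x v. \<Gamma> x (U x) (A x v) - A x (\<Gamma> x (U x) v)) T"
  using act_add_left[OF assms(1), of "%x v. fd (%y. A y v) x (U x)" "%x v. \<Gamma> x (U x) (A x v) - A x (\<Gamma> x (U x) v)"]
  by (simp add: add_diff_eq)
 hence "dact (%x v. fd (%y. A y v) x (U x) + \<Gamma> x (U x) (A x v) - A x (\<Gamma> x (U x) v)) T
   = dact (%x v. fd (%y. A y v) x (U x)) T + (dact A (dact (%x. \<Gamma> x (U x)) T) - dact (%x. \<Gamma> x (U x)) (dact A T))"
  by (simp only: act_act[OF assms(1), of A "%x. \<Gamma> x (U x)"])
 moreover have "a + b - g = a - c + (b + (c - g))" for a b c g :: "'e tfield" by simp
 ultimately show ?thesis by (simp only: NN_def DD_act[OF assms] op_diff)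
qed
lemma NN_lin: "Ten j T ==> smooth_on W V ==> NN V T = (SUM b. sm (%x. V x \<bullet> b) (NN (cf b) T))"
proof -
 assume T: "Ten j T" and V: "smooth_on W V"
 have "dact (%x. \<Gamma> x (V x)) T = (SUM b. sm (%x. V x \<bullet> b) (dact (%x. \<Gamma> x b) T))"
 proof (intro ext)
  fix x vs show "dact (%x. \<Gamma> x (V x)) T x vs = (SUM b. sm (%x. V x \<bullet> b) (dact (%x. \<Gamma> x b) T)) x vs"
  proof (cases "x \<in> W")
   case True
   have "\<Gamma> x (V x) = (%v. SUM b. (V x \<bullet> b) *\<^sub>R \<Gamma> x b v)" by (rule ext) (rule linear_expand[OF \<Gamma>_lin1[OF True]])
   thus ?thesis using tact_sum_left[OF Ten_ten[OF T]] by simp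
  qed (simp add: Ten_off[OF T])
 qed
 thus ?thesis by (simp only: NN_def DD_lin[OF T, of V] op_diff sum_subtractf)
qed

lemma NN_hT: "NN V hT = 0"
proof (intro ext)
 fix x vs
 show "NN V hT x vs = 0 x vs"
 proof (cases "x \<in> W & length vs = 2")
  case True
  then obtain u v where vs: "vs = [u, v]" by (auto simp: numeral_2_eq_2 length_Suc_conv)
  show ?thesis using True h_compat_const[of x "V x" u v]
   by (simp add: vs NN_def DD_def Dh_hT hT_eq)
 next
  case False
  thus ?thesis using Ten_len[OF Ten_NN[OF Ten_hT]]
   by (auto simp: NN_def DD_off Ten_off[OF Ten_hT] DD_def Ten_len[OF Ten_hT] tact_def)
 qed
qed

lemma h_compat:
 assumes "x \<in> W" "smooth_on W V" "smooth_on W Z"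
 shows "fd (%y. h y [V y, Z y]) x u = h x [cv (cf u) V x, Z x] + h x [V x, cv (cf u) Z x]"
proof -
 have T1: "Ten 1 (ii V hT)" using assms Ten_hT by (auto intro!: tint simp: numeral_2_eq_2[symmetric])
 have "NN (cf u) (ii Z (ii V hT)) x [] = hT x [V x, cv (cf u) Z x] + hT x [cv (cf u) V x, Z x]"
  by (simp add: NN_ii[OF T1 assms(3)] NN_ii[OF Ten_hT assms(2)] NN_hT op_add)
 moreover have "NN (cf u) (ii Z (ii V hT)) x [] = fd (%y. hT y [V y, Z y]) x u"
  using assms(1) by (simp add: NN_def DD_def)
 moreover have "fd (%y. hT y [V y, Z y]) x u = fd (%y. h y [V y, Z y]) x u"
  using fd_cong[OF open_W assms(1), of "%y. hT y [V y, Z y]" "%y. h y [V y, Z y]"] by (simp add: hT_eq)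
 ultimately show ?thesis using assms(1) by (simp add: hT_eq)
qed

lemma h_smooth_fields [smooth_intros]:
 assumes "smooth_on W V" "smooth_on W Z" shows "smooth_on W (%x. h x [V x, Z x])"
 by (rule iffD1[OF smooth_on_cong[OF open_W Gm_inner]], assumption) (intro smooth_intros assms)

lemma cv_sh: assumes "x \<in> W"
 shows "cv U (sh b) x = - (SUM c. (b \<bullet> \<Gamma> x (U x) c) *\<^sub>R sh c x)"
proof (rule h_eqI[OF assms])
 fix w
 have "fd (%y. h y [sh b y, w]) x = fd (%y. b \<bullet> w) x"
  by (rule fd_cong[OF open_W assms]) (simp add: h_sh)
 hence "0 = h x [cv (cf (U x)) (sh b) x, w] + h x [sh b x, cv (cf (U x)) (cf w) x]"
  using h_compat[OF assms sh_smooth[of b] cf_smooth[of w], of "U x"] by simp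
 hence 1: "h x [cv U (sh b) x, w] = - (b \<bullet> \<Gamma> x (U x) w)"
  using h_sh[OF assms, of b] by (simp add: cv_def)
 have "b \<bullet> \<Gamma> x (U x) w = b \<bullet> (SUM c. (w \<bullet> c) *\<^sub>R \<Gamma> x (U x) c)"
  using mf_expand[OF mf_\<Gamma>_const assms, of "U x" w] by simp
 thus "h x [cv U (sh b) x, w] = h x [- (SUM c. (b \<bullet> \<Gamma> x (U x) c) *\<^sub>R sh c x), w]"
  using assms by (simp add: 1 h_neg h_sum h_scale h_sh inner_sum_right inner_commute mult.commute)
qed

abbreviation fl :: "('e => 'e) => 'e => 'e" where "fl V x == Gm x (V x)"

lemma cw_fl: assumes "x \<in> W" "smooth_on W V" shows "cw U (fl V) x = fl (cv U V) x"
proof (rule euclidean_eqI)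
 fix w :: 'e
 have "fd (%y. fl V y \<bullet> w) x = fd (%y. h y [V y, w]) x"
  by (rule fd_cong[OF open_W assms(1)]) (simp add: Gm_inner)
 moreover have "fd (%y. fl V y \<bullet> w) x (U x) = fd (fl V) x (U x) \<bullet> w"
  by (subst fd_inner[of W]) (auto intro!: smooth_intros tint assms)
 ultimately have "fd (fl V) x (U x) \<bullet> w = h x [cv U V x, w] + h x [V x, \<Gamma> x (U x) w]"
  using h_compat[OF assms(1,2) cf_smooth[of w], of "U x"] by (simp add: cv_def)
 moreover have "(SUM c. (fl V x \<bullet> \<Gamma> x (U x) c) *\<^sub>R c) \<bullet> w = h x [V x, \<Gamma> x (U x) w]"
  unfolding mf_expand[OF mf_\<Gamma>_const assms(1), of "U x" w]
  by (simp only: inner_sum_left Gm_inner[OF assms(1)] h_sum[OF assms(1)] h_scale[OF assms(1)])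
   (simp add: inner_commute mult.commute)
 ultimately show "cw U (fl V) x \<bullet> w = fl (cv U V) x \<bullet> w"
  by (simp add: cw_def inner_diff_left Gm_inner[OF assms(1)])
qed

lemma NN_fl: assumes "Ten j T" "smooth_on W V" "smooth_on W U"
 shows "NN U (ep (fl V) T) = ep (fl V) (NN U T) + ep (fl (cv U V)) T"
 using NN_ep[OF assms(1) _ assms(3), of "fl V"] ep_cong[OF assms(1) cw_fl[OF _ assms(2)]] assms
 by (simp add: mf_app[OF mf_Gm])

end

lemma lin_basis: "linear f ==> (SUM b. (b \<bullet> v) * f b) = (f (v::'e::euclidean_space) :: real)"
 using linear_expand[of f v] by (simp add: inner_commute)

lemma tact_lin:
 assumes "ten j t" "!!v. linear (%a. A a v)" shows "linear (%a. tact (A a) t vs)"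
 unfolding tact_def
proof (intro linear_compose_sum ballI)
 fix i assume "i \<in> {..<length vs}"
 thus "linear (%a. t (vs[i := A a (vs ! i)]))"
  using linear_compose[OF assms(2) ten_slot_linear[OF assms(1)], of i vs "vs ! i"] by (simp add: o_def)
qed

text \<open>Exchanging two slots changes the sign of the tensor but not of the coefficients; for the cyclic sum one rotates three
  slots, which preserves the sign.\<close>

lemma sym_contract:
 assumes "alt j t" "!!b c. b \<in> B ==> c \<in> B ==> S b c = S c b"
 shows "(\<Sum>b\<in>B. \<Sum>c\<in>B. S b c * t (f c # f b # vs)) = 0"
proof -
 have "(\<Sum>b\<in>B. \<Sum>c\<in>B. S b c * t (f c # f b # vs)) = (\<Sum>c\<in>B. \<Sum>b\<in>B. S b c * t (f c # f b # vs))"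
  by (rule sum.swap)
 also have "... = (\<Sum>c\<in>B. \<Sum>b\<in>B. - (S c b * t (f b # f c # vs)))"
 proof (intro sum.cong refl)
  fix b c assume bc: "c \<in> B" "b \<in> B"
  have "t (f c # f b # vs) = - t (f b # f c # vs)" by (rule alt_swap[OF assms(1)])
  thus "S b c * t (f c # f b # vs) = - (S c b * t (f b # f c # vs))"
   using assms(2)[OF bc] by simp
 qed
 finally show ?thesis by (simp add: sum_negf)
qed

lemma cyc_contract:
 assumes "alt j t" "!!a b c. a \<in> B ==> b \<in> B ==> c \<in> B ==> \<rho> a b c + \<rho> b c a + \<rho> c a b = 0"
 shows "(\<Sum>a\<in>B. \<Sum>b\<in>B. \<Sum>c\<in>B. \<rho> a b c * t (f b # f a # f c # vs)) = 0"
proof -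
 let ?S = "%\<rho>. \<Sum>a\<in>B. \<Sum>b\<in>B. \<Sum>c\<in>B. \<rho> a b c * t (f b # f a # f c # vs)"
 have t2: "t (u # v # w # vs) = - t (u # w # v # vs)" for u v w
  using alt_swap[OF alt_hd[OF assms(1)], of u v w vs] by simp
 have cyc: "t (f c # f b # f a # vs) = t (f b # f a # f c # vs)" for a b c
 proof -
  have "t (f c # f b # f a # vs) = - t (f b # f c # f a # vs)" by (rule alt_swap[OF assms(1)])
  also have "... = t (f b # f a # f c # vs)" using t2[of "f b" "f c" "f a"] by simp
  finally show ?thesis .
 qed
 have 1: "?S \<rho> = ?S (%a b c. \<rho> b c a)" for \<rho>
 proof -
  have "?S (%a b c. \<rho> b c a) = (\<Sum>b\<in>B. \<Sum>c\<in>B. \<Sum>a\<in>B. \<rho> b c a * t (f b # f a # f c # vs))"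
   by (subst sum.swap) (intro sum.cong refl sum.swap)
  also have "... = (\<Sum>b\<in>B. \<Sum>c\<in>B. \<Sum>a\<in>B. \<rho> b c a * t (f c # f b # f a # vs))"
   by (simp only: cyc)
  finally show ?thesis by simp
 qed
 have "?S \<rho> + ?S (%a b c. \<rho> b c a) + ?S (%a b c. \<rho> c a b) = 0"
  using assms(2) by (simp add: sum.distrib[symmetric] distrib_right[symmetric])
 thus ?thesis using 1[of \<rho>] 1[of "%a b c. \<rho> b c a"] by simp
qed

context pmetric begin

lemma sh_expand_lin: assumes "x \<in> W" "linear (f :: 'e => real)" shows "f w = (SUM c. h x [c, w] * f (sh c x))"
 by (subst (1) sh_expand[OF assms(1), of w, symmetric]) (simp add: linear_sum[OF assms(2)] linear_scale[OF assms(2)])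

section \<open>Exterior derivative and codifferential\<close>

abbreviation N :: "'e => 'e tfield => 'e tfield" where "N b == NN (%_. b)"

text \<open>With a torsion-free connection \<open>d\<close> may be written with covariant derivatives, which makes it comparable with \<open>\<delta>\<close>.\<close>

definition dx :: "'e tfield => 'e tfield" where "dx T = (SUM b. ep (cf b) (N b T))"
definition dl :: "'e tfield => 'e tfield" where "dl T = - (SUM b. ii (sh b) (N b T))"

lemma Frm_dx [tint]: "Frm j T ==> Frm (Suc j) (dx T)"
 unfolding dx_def by (auto intro!: tint smooth_intros)
lemma Frm_dl [tint]: "Frm (Suc j) T ==> Frm j (dl T)"
 unfolding dl_def by (auto intro!: tint smooth_intros)
lemma Ten_dl': "Ten j T ==> Ten (j - 1) (dl T)"
 unfolding dl_def by (intro Ten_minus Ten_sum Ten_ii'[OF Ten_NN sh_smooth] smooth_const open_W)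
lemma Frm_dl': "Frm j T ==> Frm (j - 1) (dl T)"
 unfolding dl_def by (intro Frm_minus Frm_sum Frm_ii'[OF Frm_NN sh_smooth] smooth_const open_W)
lemma dx_add: "Ten j S ==> Ten j T ==> dx (S + T) = dx S + dx T"
 by (simp only: dx_def NN_add op_add sum.distrib)
lemma dx_diff: "Ten j S ==> Ten j T ==> dx (S - T) = dx S - dx T"
 by (simp only: dx_def NN_diff op_diff sum_subtractf)
lemma dx_minus: "Ten j T ==> dx (- T) = - dx T"
 by (simp only: dx_def NN_minus op_minus sum_negf)
lemma dx_zero [simp]: "dx 0 = 0" by (simp only: dx_def NN_zero op_zero sum.neutral_const)
lemma dl_add: "Ten j S ==> Ten j T ==> dl (S + T) = dl S + dl T"
 by (simp only: dl_def NN_add op_add sum.distrib minus_add_distrib)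
lemma dl_minus: "Ten j T ==> dl (- T) = - dl T"
 by (simp only: dl_def NN_minus op_minus sum_negf)
lemma dl_diff: "Ten j S ==> Ten j T ==> dl (S - T) = dl S - dl T"
 using dl_add[of j S "- T"] dl_minus[of j T] Ten_minus[of j T] by (metis add_uminus_conv_diff)
lemma dl_zero [simp]: "dl 0 = 0" by (simp only: dl_def NN_zero op_zero sum.neutral_const minus_zero)

lemma dl_0: assumes "Ten 0 T" shows "dl T = 0"
proof -
 have "ii (sh b) (N b T) = 0" for b
  using ii_0[OF Ten_NN[OF assms cf_smooth]] .
 thus ?thesis by (simp only: dl_def sum.neutral_const minus_zero)
qed

definition dv :: "('e => real) => 'e => 'e" where "dv \<phi> x = (SUM b. fd \<phi> x b *\<^sub>R b)"
definition gr :: "('e => real) => 'e => 'e" where "gr \<phi> x = (SUM b. fd \<phi> x b *\<^sub>R sh b x)"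

lemma gr_smooth [smooth_intros]: "smooth_on W \<phi> ==> smooth_on W (gr \<phi>)"
 unfolding gr_def[abs_def] by (auto intro!: smooth_intros smooth_fd)

lemma h_gr: assumes "smooth_on W \<phi>" "x \<in> W" shows "h x [gr \<phi> x, v] = fd \<phi> x v"
 using lin_basis[OF fd_linear[OF assms], of v] assms(2)
 by (simp add: gr_def h_sum h_scale h_sh mult.commute)

lemma dx_sm: assumes "Ten j T" "smooth_on W \<phi>" shows "dx (sm \<phi> T) = sm \<phi> (dx T) + ep (dv \<phi>) T"
proof -
 have "ep (dv \<phi>) T = (SUM b. sm (%x. fd \<phi> x b) (ep (cf b) T))"
  unfolding dv_def[abs_def] by (simp only: ep_sum_left ep_scale_left)
 thus ?thesis by (simp only: dx_def NN_sm[OF assms] op_add op_sm op_sum sum.distrib)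
qed

lemma dl_sm: assumes "Ten j T" "smooth_on W \<phi>" shows "dl (sm \<phi> T) = sm \<phi> (dl T) - ii (gr \<phi>) T"
proof -
 have "ii (gr \<phi>) T = (SUM b. sm (%x. fd \<phi> x b) (ii (sh b) T))"
  unfolding gr_def[abs_def] by (simp only: ii_sum_left[OF assms(1)] ii_scale_left[OF assms(1)])
 thus ?thesis
  by (simp only: dl_def NN_sm[OF assms] op_add op_sm op_sum sum.distrib op_minus minus_add_distrib) simp
qed

text \<open>\<open>\<Gamma>\<close> is symmetric in its two lower indices.\<close>

lemma christoffel_drop: assumes "Frm j T" shows "(SUM b. ep (cf b) (dact (%x. \<Gamma> x b) T)) = 0"
proof (intro ext)
 fix x vs
 show "(SUM b. ep (cf b) (dact (%x. \<Gamma> x b) T)) x vs = 0 x vs"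
 proof (cases "x \<in> W")
  case True
  note tn = alt_ten[OF Frm_alt[OF assms]]
  have "(SUM b. tep b (tact (\<Gamma> x b) (T x)) vs)
    = (\<Sum>i<length vs. (-1) ^ i * (SUM b. (b \<bullet> vs ! i) * tact (\<Gamma> x b) (T x) (omit i vs)))"
   unfolding tep_def by (subst sum.swap) (simp add: sum_distrib_left mult.assoc)
  also have "... = (\<Sum>i<length vs. (-1) ^ i * tact (\<Gamma> x (vs ! i)) (T x) (omit i vs))"
   by (simp only: lin_basis[OF tact_lin[OF tn \<Gamma>_lin1[OF True]]])
  also have "... = (\<Sum>i<length vs. (-1) ^ i * (\<Sum>l<length vs - 1. T x ((map id (omit i vs))[l := \<Gamma> x (vs ! i) (omit i vs ! l)])))"
   by (intro sum.cong refl) (simp add: tact_def length_omit)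
  also have "... = 0" by (rule alt_symmetric_sum[OF Frm_alt[OF assms] \<Gamma>_sym[OF True]])
  finally show ?thesis by simp
 qed (simp add: Ten_off[OF Frm_Ten[OF assms]])
qed

lemma dx_DD: "Frm j T ==> dx T = (SUM b. ep (cf b) (DD (cf b) T))"
 by (simp only: dx_def NN_def op_diff sum_subtractf christoffel_drop diff_0_right)

lemma dx_loc: assumes "Frm j T" "x \<in> W" shows "dx T x vs = ext_d_loc T x vs"
proof -
 note s = Ten_smooth[OF Frm_Ten[OF assms(1)]]
 have "dx T x vs = (SUM b. \<Sum>i<length vs. (- 1) ^ i * (b \<bullet> vs ! i) * fd (%y. T y (omit i vs)) x b)"
  using assms(2) by (simp add: dx_DD[OF assms(1)] tep_def DD_def)
 also have "... = (\<Sum>i<length vs. (-1) ^ i * (SUM b. (b \<bullet> vs ! i) * fd (%y. T y (omit i vs)) x b))"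
  by (subst sum.swap) (simp add: sum_distrib_left mult.assoc)
 finally show ?thesis by (simp only: lin_basis[OF fd_linear[OF s assms(2)]] ext_d_loc_def dirderiv_def)
qed

lemma dx_dx: assumes "Frm j T" shows "dx (dx T) = 0"
proof -
 have F: "Frm j (DD (cf b) T)" for b using assms by (auto intro: tint)
 have "dx (dx T) = (SUM a. ep (cf a) (DD (cf a) (SUM b. ep (cf b) (DD (cf b) T))))"
  by (subst dx_DD[OF Frm_dx[OF assms]]) (simp only: dx_DD[OF assms])
 also have "... = (SUM a b. ep (cf a) (ep (cf b) (DD (cf a) (DD (cf b) T))))"
 proof (intro sum.cong refl)
  fix a :: 'e
  have "DD (cf a) (SUM b. ep (cf b) (DD (cf b) T)) = (SUM b. DD (cf a) (ep (cf b) (DD (cf b) T)))"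
   by (rule DD_sum[of _ "Suc j"]) (auto intro!: tint Frm_Ten[OF F] smooth_intros)
  also have "... = (SUM b. ep (cf b) (DD (cf a) (DD (cf b) T)))"
   by (intro sum.cong refl) (simp only: DD_ep[OF Frm_Ten[OF F] cf_smooth] fd_const ep_zero_left add_0_right)
  finally show "ep (cf a) (DD (cf a) (SUM b. ep (cf b) (DD (cf b) T))) = (SUM b. ep (cf a) (ep (cf b) (DD (cf a) (DD (cf b) T))))"
   by (simp only: op_sum)
 qed
 finally have 1: "dx (dx T) = (SUM a b. ep (cf a) (ep (cf b) (DD (cf a) (DD (cf b) T))))" .
 also have "... = (SUM b a. ep (cf a) (ep (cf b) (DD (cf a) (DD (cf b) T))))"
  by (rule sum.swap)
 also have "... = (SUM b a. - ep (cf b) (ep (cf a) (DD (cf b) (DD (cf a) T))))"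
 proof (intro sum.cong refl)
  fix a b :: 'e
  show "ep (cf a) (ep (cf b) (DD (cf a) (DD (cf b) T))) = - ep (cf b) (ep (cf a) (DD (cf b) (DD (cf a) T)))"
   by (subst ep_ep) (simp only: DD_commute[OF Frm_Ten[OF assms], of a b])
 qed
 also have "... = - dx (dx T)" by (simp only: 1 sum_negf)
 finally show ?thesis by (rule self_neg_zero)
qed

lemma mf_cv [tint]: assumes "smooth_on W V" shows "mf (%x v. cv (cf v) V x)"
 unfolding mf_def cv_def
proof (intro conjI ballI allI)
 fix x assume "x \<in> W"
 thus "linear (%v. fd V x v + \<Gamma> x v (V x))"
  by (intro linear_compose_add fd_linear[OF assms] \<Gamma>_lin1)
qed (auto intro!: smooth_intros smooth_fd assms)

text \<open>Without torsion the Lie derivative along \<open>V\<close> is \<open>\<nabla>\<^sub>V\<close> plus the derivation extending \<open>\<nabla>V\<close>.\<close>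

lemma cartan: assumes "Frm j T" "smooth_on W V"
 shows "dx (ii V T) + ii V (dx T) = NN V T + dact (%x v. cv (cf v) V x) T"
proof -
 note T = Frm_Ten[OF assms(1)]
 have "dx (ii V T) = (SUM b. ep (cf b) (ii V (N b T))) + (SUM b. ep (cf b) (ii (cv (cf b) V) T))"
  by (simp only: dx_def NN_ii[OF T assms(2)] op_add sum.distrib)
 also have "(SUM b. ep (cf b) (ii (cv (cf b) V) T)) = dact (%x v. cv (cf v) V x) T"
  by (simp only: act_as_ep[OF assms(1) mf_cv[OF assms(2)]])
 finally have 1: "dx (ii V T) = (SUM b. ep (cf b) (ii V (N b T))) + dact (%x v. cv (cf v) V x) T" .
 have 2: "ii V (dx T) = NN V T - (SUM b. ep (cf b) (ii V (N b T)))"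
  by (simp only: dx_def op_sum ii_ep sum_subtractf NN_lin[OF T assms(2)] inner_commute)
 have "(A + D) + (C - A) = C + D" for A C D :: "'e tfield" by simp
 thus ?thesis by (simp only: 1 2)
qed

text \<open>The remaining term contracts \<open>\<nabla>K\<close>, which is symmetric, into two slots of an alternating tensor.\<close>

lemma dl_ii: assumes "Frm j T" "smooth_on W K"
 and sa: "!!x u v. x \<in> W ==> h x [cv (cf u) K x, v] = h x [u, cv (cf v) K x]"
 shows "dl (ii K T) = - ii K (dl T)"
proof -
 note T = Frm_Ten[OF assms(1)]
 have z: "(SUM b. ii (sh b) (ii (cv (cf b) K) T)) = 0"
 proof (intro ext)
  fix x vs
  show "(SUM b. ii (sh b) (ii (cv (cf b) K) T)) x vs = 0 x vs"
  proof (cases "x \<in> W")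
   case True
   have "T x (cv (cf b) K x # sh b x # vs) = (SUM c. h x [c, cv (cf b) K x] * T x (sh c x # sh b x # vs))" for b
    by (rule sh_expand_lin[OF True Ten_linear[OF T]])
   moreover have "(SUM b c. h x [c, cv (cf b) K x] * T x (sh c x # sh b x # vs)) = 0"
    by (rule sym_contract[OF Frm_alt[OF assms(1)]]) (rule trans[OF sa[OF True, symmetric] h_sym[OF True]])
   ultimately show ?thesis by (simp only: sum_fun_app ii_app zero_fun_apply)
  qed (simp add: Ten_off[OF T])
 qed
 have "dl (ii K T) = - ((SUM b. ii (sh b) (ii K (N b T))) + (SUM b. ii (sh b) (ii (cv (cf b) K) T)))"
  by (simp only: dl_def NN_ii[OF T assms(2)] op_add sum.distrib)
 also have "(SUM b. ii (sh b) (ii K (N b T))) = (SUM b. - ii K (ii (sh b) (N b T)))"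
  by (intro sum.cong refl ii_ii[OF Frm_NN[OF assms(1) cf_smooth]])
 finally show ?thesis by (simp only: z dl_def op_sum op_minus sum_negf add_0_right)
qed

lemma dl_fl: assumes "Ten j T" "smooth_on W K"
 shows "dl (ep (fl K) T) = - NN K T - ep (fl K) (dl T) - (SUM b. ii (sh b) (ep (fl (cv (cf b) K)) T))"
proof -
 have "(SUM b. ii (sh b) (ep (fl K) (N b T))) = NN K T - ep (fl K) (SUM b. ii (sh b) (N b T))"
 proof -
  have "sm (%x. fl K x \<bullet> sh b x) (N b T) = sm (%x. K x \<bullet> b) (N b T)" for b
   by (rule sm_cong[of j]) (use assms in \<open>auto intro!: tint simp: Gm_inner h_sh2 inner_commute[of b]\<close>)
  thus ?thesis by (simp only: ii_ep sum_subtractf op_sum NN_lin[OF assms])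
 qed
 thus ?thesis
  by (simp only: dl_def NN_fl[OF assms cf_smooth] op_add sum.distrib op_minus minus_add_distrib) simp
qed

section \<open>Curvature\<close>

lemma mf_fd: assumes "mf A" shows "mf (%x v. fd (%y. A y v) x (u::'e))"
 unfolding mf_def
 using assms by (auto simp: mf_def intro: smooth_fd linear_fd_family[OF open_W])

abbreviation RR :: "'e => 'e => 'e => 'e => 'e" where "RR a b x == curv h x a b"

lemma mf_curv [tint]: "mf (%x. RR a b x)"
proof -
 have c: "linear (%v. \<Gamma> x a (\<Gamma> x b v))" if "x \<in> W" for x a b
  using linear_compose[OF \<Gamma>_lin2[OF that, of b] \<Gamma>_lin2[OF that, of a]] by (simp add: o_def)
 show ?thesis
  unfolding mf_def curv_def
  using mf_fd[OF mf_\<Gamma>_const, of b a] mf_fd[OF mf_\<Gamma>_const, of a b]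
  by (auto simp: mf_def intro!: linear_compose_sub linear_compose_add c smooth_intros)
qed

lemma curv_anti: "RR a b x v = - RR b a x v" by (simp add: curv_def)

lemma curv_lin1: assumes "x \<in> W" shows "linear (%a. RR a b x v)"
proof -
 have "mf (%x a. \<Gamma> x a v)" by (simp add: mf_def \<Gamma>_lin1[of _ v] \<Gamma>_smooth)
 from mf_fd[OF this] have 1: "linear (%a. fd (%y. \<Gamma> y a v) x b)" using assms by (simp add: mf_def)
 have 2: "linear (%a. \<Gamma> x b (\<Gamma> x a v))"
  using linear_compose[OF \<Gamma>_lin1[OF assms, of v] \<Gamma>_lin2[OF assms, of b]] by (simp add: o_def)
 show ?thesis unfolding curv_def
  by (intro linear_compose_sub linear_compose_add 1 2 \<Gamma>_lin1[OF assms] fd_linear[OF \<Gamma>_smooth assms])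
qed
lemma curv_lin2: assumes "x \<in> W" shows "linear (%b. RR a b x v)"
proof -
 have "(%b. RR a b x v) = (%b. - RR b a x v)" by (intro ext) (rule curv_anti)
 thus ?thesis using linear_compose_neg[OF curv_lin1[OF assms, of a v]] by simp
qed
lemma curv_lin3: "x \<in> W ==> linear (RR a b x)" using mf_curv[of a b] by (simp add: mf_def)

lemma bianchi1: assumes "x \<in> W" shows "RR a b x c + RR b c x a + RR c a x b = 0"
proof -
 have s: "fd (%y. \<Gamma> y u v) x = fd (%y. \<Gamma> y v u) x" for u v
  by (rule fd_cong[OF open_W assms \<Gamma>_sym])
 show ?thesis
  using s[of a b] s[of b c] s[of a c] \<Gamma>_sym[OF assms, of a b] \<Gamma>_sym[OF assms, of b c] \<Gamma>_sym[OF assms, of a c]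
  by (simp add: curv_def)
qed

lemma ricci_id: assumes "Ten j T"
 shows "N a (N b T) - N b (N a T) = - dact (%x. RR a b x) T"
proof -
 let ?G = "%b. dact (%x. \<Gamma> x b)" and ?D = "%a. DD (cf a)" and ?F = "%a b. dact (%x v. fd (%y. \<Gamma> y b v) x a) T"
 have e: "N a (N b T) = ?D a (?D b T) - ?G b (?D a T) - ?F a b - ?G a (?D b T) + ?G a (?G b T)" for a b
 proof -
  have "?D a (N b T) = ?D a (?D b T) - ?D a (?G b T)"
   unfolding NN_def by (rule DD_diff) (use assms in \<open>auto intro!: tint\<close>)
  also have "?D a (?G b T) = ?G b (?D a T) + ?F a b" by (rule DD_act[OF assms mf_\<Gamma>_const])
  finally have "?D a (N b T) = ?D a (?D b T) - (?G b (?D a T) + ?F a b)" .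
  moreover have "p - (q + r) - (s - t) = p - q - r - s + t" for p q r s t :: "'e tfield" by simp
  ultimately show ?thesis by (simp only: NN_def[of "cf a"] NN_def[of "cf b" T] op_diff)
 qed
 have "dact (%x. RR a b x) T = ?F a b - ?F b a - (?G a (?G b T) - ?G b (?G a T))"
 proof -
  have "dact (%x. RR a b x) T = dact (%x v. (fd (%y. \<Gamma> y b v) x a - fd (%y. \<Gamma> y a v) x b) - (\<Gamma> x b (\<Gamma> x a v) - \<Gamma> x a (\<Gamma> x b v))) T"
   by (rule act_cong[OF assms]) (simp add: curv_def)
  also have "... = ?F a b - ?F b a - dact (%x v. \<Gamma> x b (\<Gamma> x a v) - \<Gamma> x a (\<Gamma> x b v)) T"
   by (simp only: act_diff_left[OF assms])
  finally show ?thesis by (simp only: act_act[OF assms])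
 qed
 moreover have "(p - q - r - s + t) - (p - s - u - q + v) = - (r - u - (t - v))" for p q r s t u v :: "'e tfield" by simp
 ultimately show ?thesis by (simp only: e DD_commute[OF assms, of a b])
qed

lemma ricci_vec: assumes "x \<in> W" "smooth_on W V"
 shows "cv (cf a) (cv (cf b) V) x - cv (cf b) (cv (cf a) V) x = RR a b x (V x)"
proof -
 have e: "cv (cf a) (cv (cf b) V) x = fd (%y. fd V y b) x a + fd (%y. \<Gamma> y b (V x)) x a + \<Gamma> x b (fd V x a)
   + \<Gamma> x a (fd V x b) + \<Gamma> x a (\<Gamma> x b (V x))" for a b
 proof -
  have "fd (cv (cf b) V) x a = fd (%y. fd V y b + \<Gamma> y b (V y)) x a" by (simp add: cv_def[abs_def])
  also have "... = fd (%y. fd V y b) x a + fd (%y. \<Gamma> y b (V y)) x a"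
   by (rule fd_add[OF smooth_fd[OF assms(2)] _ assms(1)]) (auto intro!: smooth_intros assms)
  also have "fd (%y. \<Gamma> y b (V y)) x a = fd (%y. \<Gamma> y b (V x)) x a + \<Gamma> x b (fd V x a)"
   by (rule fd_mf[OF mf_\<Gamma>_const assms(2,1)])
  finally have *: "fd (cv (cf b) V) x a = fd (%y. fd V y b) x a + (fd (%y. \<Gamma> y b (V x)) x a + \<Gamma> x b (fd V x a))" .
  show ?thesis
   by (simp only: cv_def[of "cf a" "cv (cf b) V" x] * cv_def[of "cf b" V x] linear_add[OF \<Gamma>_lin2[OF assms(1)]] add.assoc)
 qed
 show ?thesis by (simp add: e curv_def fd_symmetric_euclidean[OF open_W assms(2,1), of b a])
qed

lemma curv_skew: assumes "x \<in> W" shows "h x [RR a b x c, d] = - h x [c, RR a b x d]"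
proof -
 have "dact (%x. RR a b x) hT = 0" using ricci_id[OF Ten_hT, of a b] by (simp add: NN_hT)
 hence "dact (%x. RR a b x) hT x [c, d] = 0" by simp
 thus ?thesis using assms by (simp add: hT_eq)
qed

lemma curv_pair: assumes "x \<in> W" shows "h x [RR a b x c, d] = h x [RR c d x a, b]"
proof -
 let ?R = "%a b c d. h x [RR a b x c, d]"
 have b: "?R a b c d + ?R b c a d + ?R c a b d = 0" for a b c d
  using bianchi1[OF assms, of a b c] h_add(1)[OF assms, symmetric] h_zero[OF assms] by simp
 have s: "?R a b c d = - ?R a b d c" for a b c d
  using curv_skew[OF assms] h_sym[OF assms] by metis
 have an: "?R a b c d = - ?R b a c d" for a b c d
  unfolding curv_anti[of x a b c] h_neg[OF assms] ..
 show ?thesis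
  using b[of a b c d] b[of b c d a] b[of c d a b] b[of d a b c]
   s[of a b c d] s[of b c a d] s[of c a b d] s[of b c d a] s[of c d b a] s[of d b c a]
   s[of c d a b] s[of d a c b] s[of a c d b] s[of d a b c] s[of a b d c] s[of b d a c]
   an[of a b c d] an[of b c a d] an[of c a b d] an[of c d a b] an[of d a c b] an[of a c d b] an[of d b c a]
   an[of a c b d] an[of b d a c] an[of d a b c] an[of b d c a] 
  by linarith
qed

subsection \<open>The full covariant derivative and the rough Laplacian\<close>

text \<open>The full covariant derivative, with the differentiation index in the first slot.\<close>

definition nab :: "'e tfield => 'e tfield" where
 "nab T x us = (case us of [] => 0 | v # vs => N v T x vs)"

lemma NN_pt: assumes "Ten j T" shows "NN V T x vs = N (V x) T x vs"
 by (simp add: NN_def DD_def)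

lemma NN_\<Gamma>_sym: assumes "Ten j T" shows "NN (%x. \<Gamma> x b c) T = NN (%x. \<Gamma> x c b) T"
proof (intro ext)
 fix x vs show "NN (%x. \<Gamma> x b c) T x vs = NN (%x. \<Gamma> x c b) T x vs"
  using \<Gamma>_sym[of x b c] Ten_off[OF assms] by (cases "x \<in> W") (simp_all add: NN_def DD_def)
qed

lemma ii_nab: assumes "Ten j T" shows "ii V (nab T) = NN V T"
 by (intro ext) (simp add: nab_def NN_pt[OF assms, of V])

lemma N_linear: assumes "Ten j T" shows "linear (%v. N v T x vs)"
proof -
 have e: "N v T x vs = (SUM b. (v \<bullet> b) * N b T x vs)" for v
  using fun_cong[OF fun_cong[OF NN_lin[OF assms cf_smooth[of v]]], of x vs] by simp
 show ?thesis
  by (subst e) (intro linear_compose_sum ballI, simp add: linear_iff inner_left_distrib algebra_simps)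
qed

lemma Ten_nab [tint]: assumes "Ten j T" shows "Ten (Suc j) (nab T)"
 unfolding Ten_def
proof (intro conjI allI impI)
  fix x show "ten (Suc j) (nab T x)"
   using N_linear[OF assms] Ten_ten[OF Ten_NN[OF assms cf_smooth]] by (auto simp: ten_Suc nab_def)
 next
  fix us show "smooth_on W (%x. nab T x us)"
   using Ten_smooth[OF Ten_NN[OF assms cf_smooth]] by (cases us) (auto simp: nab_def)
 next
  fix x us assume "x \<notin> W"
  thus "nab T x us = 0"
   using Ten_off[OF Ten_NN[OF assms cf_smooth]] by (cases us) (auto simp: nab_def)
qed

definition lap :: "'e tfield => 'e tfield" where "lap T = (SUM b. ii (sh b) (N b (nab T)))"

lemma Ten_lap [tint]: "Ten j T ==> Ten j (lap T)"
 unfolding lap_def by (auto intro!: tint smooth_intros)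

lemma ii_N_nab: assumes "Ten j T" "smooth_on W V"
 shows "ii V (N b (nab T)) = N b (NN V T) - NN (cv (cf b) V) T"
 using NN_ii[OF Ten_nab[OF assms(1)] assms(2), of "cf b"] by (simp add: ii_nab[OF assms(1)])

lemma lap_loc: assumes "Ten j T" "x \<in> W"
 shows "lap T x vs = (SUM b. nabla h (nabla h T) x (b # raise (h x) b # vs))"
proof -
 have "nabla h (nabla h T) x (b # us) = nabla h (nab T) x (b # us)" for b us
 proof -
  have eq: "nabla h T y us = nab T y us" if "y \<in> W" for y us
   by (cases us) (simp_all add: nab_def nabla_NN[OF assms(1) that, of "cf _"] nabla_def[of h T y "[]"])
  have "fd (%y. nabla h T y us) x = fd (%y. nab T y us) x"
   by (rule fd_cong[OF open_W assms(2) eq])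
  thus ?thesis by (simp add: nabla_def[of h "nabla h T"] nabla_def[of h "nab T"] dirderiv_def eq[OF assms(2)])
 qed
 thus ?thesis by (simp add: lap_def nabla_NN[OF Ten_nab[OF assms(1)] assms(2), of "cf _"])
qed

text \<open>Contraction with the metric commutes with covariant derivatives: what the derivative of one factor of
  \<open>\<Sum>b. b \<otimes> sh b\<close> contributes is cancelled by the other one.\<close>

lemma trace_par: assumes "x \<in> W" and l: "!!v. linear (%u. B u v)" "!!u. linear (%v. B u v)"
 shows "(SUM b. B (\<Gamma> x v b) (sh b x) + B b (cv (cf v) (sh b) x)) = (0::real)"
proof -
 have "(SUM b. B b (cv (cf v) (sh b) x)) = (SUM b c. - ((b \<bullet> \<Gamma> x v c) * B b (sh c x)))"
  by (simp add: cv_sh[OF assms(1)] linear_neg[OF l(2)] linear_sum[OF l(2)] linear_scale[OF l(2)] sum_negf)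
 also have "... = - (SUM c b. (b \<bullet> \<Gamma> x v c) * B b (sh c x))"
  by (subst sum.swap) (simp add: sum_negf)
 finally show ?thesis by (simp add: sum.distrib lin_basis[OF l(1)])
qed

lemma sum_cv_sh: assumes "Ten j T" 
 shows "(SUM b. ii (cv (cf a) (sh b)) (N b T)) = - (SUM c. ii (sh c) (NN (%x. \<Gamma> x a c) T))"
proof (intro ext)
 fix x vs
 have TN: "Ten j (N v T)" for v using assms by (auto intro: tint)
 show "(SUM b. ii (cv (cf a) (sh b)) (N b T)) x vs = (- (SUM c. ii (sh c) (NN (%x. \<Gamma> x a c) T))) x vs"
 proof (cases "x \<in> W")
  case True
  show ?thesis
   using trace_par[OF True N_linear[OF assms] Ten_linear[OF TN], of a _ vs]
   by (simp add: NN_pt[OF assms, of "%x. \<Gamma> x a _"] sum.distrib add_eq_0_iff2)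
 qed (simp add: NN_pt[OF assms, of "%x. \<Gamma> x a _"] Ten_off[OF TN])
qed

lemma sum_cw: assumes "Ten j T"
 shows "(SUM a. ep (cw (cf b) (cf a)) (N a T)) = - (SUM c. ep (cf c) (NN (%x. \<Gamma> x b c) T))"
proof -
 have "ep (cw (cf b) (cf a)) (N a T) = - (SUM c. ep (cf c) (sm (%x. \<Gamma> x b c \<bullet> a) (N a T)))" for a
 proof -
  have "ep (cw (cf b) (cf a)) (N a T) = ep (%x. (-1) *\<^sub>R (SUM c. (\<Gamma> x b c \<bullet> a) *\<^sub>R c)) (N a T)"
   by (simp add: cw_def[abs_def] inner_commute)
  also have "... = sm (%x. -1) (SUM c. sm (%x. \<Gamma> x b c \<bullet> a) (ep (cf c) (N a T)))"
   by (simp only: ep_scale_left ep_sum_left)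
  finally show ?thesis by (simp only: op_sm minus_sm[symmetric])
 qed
 hence "(SUM a. ep (cw (cf b) (cf a)) (N a T)) = - (SUM a c. ep (cf c) (sm (%x. \<Gamma> x b c \<bullet> a) (N a T)))"
  by (simp only: sum_negf)
 also have "(SUM a c. ep (cf c) (sm (%x. \<Gamma> x b c \<bullet> a) (N a T))) = (SUM c. ep (cf c) (NN (%x. \<Gamma> x b c) T))"
  by (subst sum.swap) (simp only: op_sum[symmetric] NN_lin[OF assms \<Gamma>_app[OF cf_smooth cf_smooth]])
 finally show ?thesis .
qed

text \<open>The second covariant derivative in constant directions.  Unlike iterated first derivatives, it
  commutes with contractions and with exterior multiplication.\<close>

definition HH :: "'e => 'e => 'e tfield => 'e tfield" where "HH a b T = N a (N b T) - NN (%x. \<Gamma> x a b) T"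

lemma N_nab: "Ten j T ==> N a (nab T) x (b # vs) = HH a b T x vs"
 using fun_cong[OF fun_cong[OF ii_N_nab[of j T "cf b" a]], of x vs] by (simp add: cv_def[abs_def] HH_def)

lemma HH_commute: "Ten j T ==> HH a b T - HH b a T = - dact (%x. RR a b x) T"
 unfolding HH_def NN_\<Gamma>_sym[of j T b a] using ricci_id[of j T a b] by simp

lemma Frm_HH: "Frm j T ==> Frm j (HH a b T)"
 unfolding HH_def by (auto intro!: Frm_diff Frm_NN smooth_intros)

lemma N_dl_HH: assumes T: "Ten j T" shows "N a (dl T) = - (SUM b. ii (sh b) (HH a b T))"
proof -
 have TN: "Ten j (N b T)" for b using T by (auto intro: tint)
 have t: "Ten (j - 1) (ii (sh b) (N b T))" for b by (rule Ten_ii'[OF TN sh_smooth])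
 show ?thesis
  by (simp only: dl_def NN_minus[OF Ten_sum[OF t]] NN_sum[OF t] NN_ii[OF TN sh_smooth] sum.distrib sum_cv_sh[OF T]
    HH_def op_diff sum_subtractf add_uminus_conv_diff)
qed

lemma N_dx_HH: assumes T: "Ten j T" shows "N b (dx T) = (SUM a. ep (cf a) (HH b a T))"
proof -
 have TN: "Ten j (N b T)" for b using T by (auto intro: tint)
 have t: "Ten (Suc j) (ep (cf a) (N a T))" for a by (intro Ten_ep TN smooth_const open_W)
 show ?thesis
  by (simp only: dx_def NN_sum[OF t] NN_ep[OF TN cf_smooth cf_smooth] sum.distrib sum_cw[OF T]
    HH_def op_diff sum_subtractf add_uminus_conv_diff)
qed

definition WW :: "'e tfield => 'e tfield" where
 "WW T = (SUM a b. ep (cf a) (ii (sh b) (dact (%x. RR a b x) T)))"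

lemma lap_as_sum: assumes "Ten j T"
 shows "lap T = (SUM b a. sm (%x. a \<bullet> sh b x) (HH b a T))"
proof -
 have "ii (sh b) (N b (nab T)) = (SUM a. sm (%x. a \<bullet> sh b x) (HH b a T))" for b
 proof -
  have 1: "Ten (Suc j) (N b (nab T))" using assms by (auto intro!: tint)
  have 2: "cv (cf b) (cf a) = (%x. \<Gamma> x b a)" for a by (intro ext) (simp add: cv_def)
  show ?thesis
   by (subst ii_expand[OF 1]) (simp only: ii_N_nab[OF assms cf_smooth] 2 inner_commute HH_def)
 qed
 thus ?thesis by (simp only: lap_def)
qed

text \<open>Both sides are sums of second covariant derivatives.  The part that is symmetric in the two directions gives
  the rough Laplacian and the antisymmetric part a curvature term.\<close>

lemma weitzenboeck: assumes "Frm j T" shows "dx (dl T) + dl (dx T) = WW T - lap T"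
proof -
 note T = Frm_Ten[OF assms]
 let ?i = "%b. ii (sh b)" and ?e = "%a. ep (cf a)"
 have 1: "dx (dl T) = - (SUM a b. ?e a (?i b (HH a b T)))"
  by (simp only: dx_def N_dl_HH[OF T] op_minus op_sum sum_negf)
 have "(SUM b a. ?e a (?i b (HH b a T))) = (SUM a b. ?e a (?i b (HH b a T)))" by (rule sum.swap)
 hence 2: "dl (dx T) = (SUM a b. ?e a (?i b (HH b a T))) - lap T"
  by (simp only: dl_def N_dx_HH[OF T] op_sum ii_ep sum_subtractf lap_as_sum[OF T] minus_diff_eq)
 have 3: "(SUM a b. ?e a (?i b (HH a b T))) - (SUM a b. ?e a (?i b (HH b a T))) = - WW T"
  by (simp only: sum_subtractf[symmetric] op_diff[symmetric] HH_commute[OF T] op_minus sum_negf WW_def)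
 have "- A + (A' - L) = - (A - A') - L" for A A' L :: "'e tfield" by simp
 thus ?thesis by (simp only: 1 2 3 minus_minus)
qed

end

context region begin

lemma
 assumes "Ten j T"
 shows Ten_lin2: "linear (%v. T x (u # v # vs))" and Ten_lin3: "linear (%w. T x (u # v # w # vs))"
 using Ten_linear[OF Ten_hd[OF assms, of u], of x vs] Ten_linear[OF Ten_hd[OF Ten_hd[OF assms], of v u], of x vs]
 by simp_all

end

section \<open>Ricci-flat metrics\<close>

locale rflat = pmetric +
 assumes ric: "!!x u v. x \<in> W ==> Ric h x u v = 0"
begin

lemma ric_trace: assumes "x \<in> W" shows "(SUM b. RR a b x (sh b x)) = 0"
proof (rule h_eqI[OF assms])
 fix w
 have "h x [RR a b x (sh b x), w] = b \<bullet> RR b a x w" for b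
  using curv_skew[OF assms, of a b "sh b x" w] h_sh[OF assms] curv_anti[of x a b w] by simp
 thus "h x [SUM b. RR a b x (sh b x), w] = h x [0, w]"
  using ric[OF assms, of a w] assms by (simp add: h_sum h_zero Ric_def)
qed

lemma ric_trace2: assumes "x \<in> W" shows "(SUM b. RR b a x (sh b x)) = 0"
proof -
 have "(SUM b. RR b a x (sh b x)) = (SUM b. - RR a b x (sh b x))"
  by (intro sum.cong refl curv_anti)
 thus ?thesis using ric_trace[OF assms, of a] by (simp add: sum_negf)
qed

text \<open>The first Bianchi identity, in the form in which it is contracted into an alternating tensor.\<close>

lemma curv_cyc_contract:
 assumes "Frm j T"
 shows "(SUM a b. ii (%x. RR a b x c) (ii (sh a) (ii (sh b) T))) = 0"
proof (intro ext)
 fix x vs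
 show "(SUM a b. ii (%x. RR a b x c) (ii (sh a) (ii (sh b) T))) x vs = 0 x vs"
 proof (cases "x \<in> W")
  case True
  have cyc: "h x [d, RR a b x c] + h x [a, RR b d x c] + h x [b, RR d a x c] = 0" for a b d
  proof -
   have 1: "h x [d, RR a b x c] = - h x [c, RR a b x d]" for a b d
    using curv_skew[OF True, of a b c d] h_sym[OF True, of d "RR a b x c"] by simp
   have "h x [c, RR a b x d + RR b d x a + RR d a x b] = 0"
    by (simp only: bianchi1[OF True] h_zero(2)[OF True])
   thus ?thesis by (simp add: 1 h_add(2)[OF True])
  qed
  have "T x (sh b x # sh a x # RR a b x c # vs) = (SUM d. h x [d, RR a b x c] * T x (sh b x # sh a x # sh d x # vs))" for a b
   by (rule sh_expand_lin[OF True Ten_lin3[OF Frm_Ten[OF assms]]])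
  moreover have "(SUM a b. SUM d. h x [d, RR a b x c] * T x (sh b x # sh a x # sh d x # vs)) = 0"
   by (rule cyc_contract[OF Frm_alt[OF assms]]) (rule cyc)
  ultimately show ?thesis by (simp only: sum_fun_app ii_app zero_fun_apply)
 qed (simp add: Ten_off[OF Frm_Ten[OF assms]])
qed

text \<open>Only the antisymmetric part of the second derivative enters, and it is a curvature term.  Of its three
  contractions two are Ricci curvatures, and one vanishes by the first Bianchi identity.\<close>

lemma dl_dl: assumes "Frm j T" shows "dl (dl T) = 0"
proof -
 note T = Frm_Ten[OF assms]
 let ?i = "%b. ii (sh b)"
 have 1: "dl (dl T) = (SUM a b. ?i a (?i b (HH a b T)))"
  by (simp only: dl_def[of "dl T"] N_dl_HH[OF T] op_minus op_sum sum_negf minus_minus)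
 have "(SUM a b. ?i a (?i b (HH b a T))) = (SUM b a. ?i a (?i b (HH b a T)))"
  by (rule sum.swap)
 also have "... = (SUM b a. - ?i b (?i a (HH b a T)))"
  by (intro sum.cong refl ii_ii[OF Frm_HH[OF assms]])
 finally have 2: "(SUM a b. ?i a (?i b (HH b a T))) = - dl (dl T)" by (simp only: 1 sum_negf)
 have C: "(SUM a b. ?i a (?i b (dact (%x. RR a b x) T))) = 0"
 proof -
  have mv: "ii V (dact A U) = dact A (ii V U) + ii (%x. A x (V x)) U" if "Ten i U" for i A V U
   using act_ii[OF that, of A V] by (metis diff_add_cancel)
  have e: "?i a (?i b (dact (%x. RR a b x) T)) = dact (%x. RR a b x) (?i a (?i b T))
    + ii (%x. RR a b x (sh a x)) (?i b T) + ?i a (ii (%x. RR a b x (sh b x)) T)" for a b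
  proof -
   have "?i a (?i b (dact (%x. RR a b x) T)) = ?i a (dact (%x. RR a b x) (?i b T)) + ?i a (ii (%x. RR a b x (sh b x)) T)"
    by (simp only: mv[OF T] op_add)
   thus ?thesis by (simp only: mv[OF Ten_ii'[OF T sh_smooth]])
  qed
  have s3: "(SUM a b. ?i a (ii (%x. RR a b x (sh b x)) T)) = 0"
  proof -
   have "(SUM b. ii (%x. RR a b x (sh b x)) T) = 0" for a
   proof -
    have "ii (%x. SUM b. RR a b x (sh b x)) T = ii (%x. 0) T"
     by (rule ii_cong[OF T]) (rule ric_trace)
    thus ?thesis by (simp only: ii_sum_left[OF T] ii_zero_left[OF T])
   qed
   thus ?thesis by (simp only: op_sum[symmetric] op_zero sum.neutral_const)
  qed
  have s2: "(SUM a b. ii (%x. RR a b x (sh a x)) (?i b T)) = 0"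
  proof -
   note t = Ten_ii'[OF T sh_smooth]
   have "(SUM a. ii (%x. RR a b x (sh a x)) (?i b T)) = 0" for b
   proof -
    have "ii (%x. SUM a. RR a b x (sh a x)) (?i b T) = ii (%x. 0) (?i b T)"
     by (rule ii_cong[OF t]) (rule ric_trace2)
    thus ?thesis by (simp only: ii_sum_left[OF t] ii_zero_left[OF t])
   qed
   thus ?thesis by (subst sum.swap) (simp only: sum.neutral_const)
  qed
  have s1: "(SUM a b. dact (%x. RR a b x) (?i a (?i b T))) = 0"
  proof -
   note F = Frm_ii'[OF Frm_ii'[OF assms sh_smooth] sh_smooth]
   have "(SUM a b. dact (%x. RR a b x) (?i a (?i b T)))
     = (SUM a b. SUM c. ep (cf c) (ii (%x. RR a b x c) (?i a (?i b T))))"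
    by (simp only: act_as_ep[OF F mf_curv])
   also have "... = (SUM a c. SUM b. ep (cf c) (ii (%x. RR a b x c) (?i a (?i b T))))"
    by (intro sum.cong refl sum.swap)
   also have "... = (SUM c a. SUM b. ep (cf c) (ii (%x. RR a b x c) (?i a (?i b T))))"
    by (rule sum.swap)
   also have "... = 0" by (simp only: op_sum[symmetric] curv_cyc_contract[OF assms] op_zero sum.neutral_const)
   finally show ?thesis .
  qed
  show ?thesis by (simp only: e sum.distrib s1 s2 s3 add_0_right)
 qed
 have "dl (dl T) - - dl (dl T) = (SUM a b. ?i a (?i b (HH a b T - HH b a T)))"
  by (simp only: op_diff sum_subtractf 1[symmetric] 2)
 thus ?thesis
  by (intro self_neg_zero) (simp only: HH_commute[OF T] op_minus sum_negf C minus_zero right_minus_eq)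
qed

text \<open>The diagonal terms, where both indices of the curvature meet the same slot, are Ricci curvatures and vanish.\<close>

lemma WW_loc: assumes "Frm j T" "x \<in> W" shows "WW T x vs = - curv_sharp h T x vs"
proof -
 note F = Frm_alt[OF assms(1), of x] and tn = Ten_ten[OF Frm_Ten[OF assms(1)], of x]
 have "WW T x vs = (SUM a b. \<Sum>i<length vs. (- 1) ^ i * (a \<bullet> vs ! i) * tact (RR a b x) (T x) (sh b x # omit i vs))"
  by (simp add: WW_def tep_def)
 also have "... = (SUM b. \<Sum>i<length vs. SUM a. (- 1) ^ i * (a \<bullet> vs ! i) * tact (RR a b x) (T x) (sh b x # omit i vs))"
  by (subst sum.swap) (intro sum.cong refl sum.swap)
 also have "... = (SUM b. \<Sum>i<length vs. (- 1) ^ i * (SUM a. (a \<bullet> vs ! i) * tact (RR a b x) (T x) (sh b x # omit i vs)))"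
  by (simp only: sum_distrib_left mult.assoc)
 also have "... = (SUM b. \<Sum>i<length vs. (- 1) ^ i * tact (RR (vs ! i) b x) (T x) (sh b x # omit i vs))"
  by (simp only: lin_basis[OF tact_lin[OF tn curv_lin1[OF assms(2)]]])
 also have "... = (SUM b. \<Sum>i<length vs. tact (RR (vs ! i) b x) (T x) (vs[i := sh b x]))"
  using alt_move[OF alt_tact[OF F curv_lin3[OF assms(2)]]] by simp
 also have "... = (\<Sum>i<length vs. SUM b. tact (RR (vs ! i) b x) (T x) (vs[i := sh b x]))"
  by (rule sum.swap)
 also have "... = (\<Sum>i<length vs. \<Sum>l\<in>{..<length vs} - {i}. SUM b. T x (vs[i := sh b x, l := RR (vs ! i) b x (vs ! l)]))"
 proof (rule sum.cong[OF refl])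
  fix i assume i: "i \<in> {..<length vs}"
  have "tact (RR (vs ! i) b x) (T x) (vs[i := sh b x]) = T x (vs[i := RR (vs ! i) b x (sh b x)]) +
   (\<Sum>l\<in>{..<length vs} - {i}. T x (vs[i := sh b x, l := RR (vs ! i) b x (vs ! l)]))" for b
   using i by (simp add: tact_def sum.remove[of "{..<length vs}" i])
  moreover have "(SUM b. T x (vs[i := RR (vs ! i) b x (sh b x)])) = 0"
   using linear_sum[OF ten_slot_linear[OF tn], of i vs "%b. RR (vs ! i) b x (sh b x)" Basis]
    linear_0[OF ten_slot_linear[OF tn], of i vs] i by (simp add: ric_trace[OF assms(2)])
  ultimately have "(SUM b. tact (RR (vs ! i) b x) (T x) (vs[i := sh b x])) =
    (SUM b. \<Sum>l\<in>{..<length vs} - {i}. T x (vs[i := sh b x, l := RR (vs ! i) b x (vs ! l)]))"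
   by (simp add: sum.distrib)
  also have "... = (\<Sum>l\<in>{..<length vs} - {i}. SUM b. T x (vs[i := sh b x, l := RR (vs ! i) b x (vs ! l)]))"
   by (rule sum.swap)
  finally show "(SUM b. tact (RR (vs ! i) b x) (T x) (vs[i := sh b x])) = ..." .
 qed
 also have "... = (\<Sum>i<length vs. \<Sum>l\<in>{..<length vs} - {i}. SUM p q.
   - (Riem h x (vs ! i) p (vs ! l) q * T x (vs[i := sh p x, l := sh q x])))"
 proof (intro sum.cong refl)
  fix i l and p :: 'a assume "l \<in> {..<length vs} - {i}"
  hence l: "l < length (vs[i := sh p x])" by simp
  have "h x [q, RR (vs ! i) p x (vs ! l)] = - Riem h x (vs ! i) p (vs ! l) q" for q
   using curv_skew[OF assms(2), of "vs ! i" p q "vs ! l"] by (simp add: Riem_def)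
  thus "T x (vs[i := sh p x, l := RR (vs ! i) p x (vs ! l)]) =
   (SUM q. - (Riem h x (vs ! i) p (vs ! l) q * T x (vs[i := sh p x, l := sh q x])))"
   using sh_expand_lin[OF assms(2) ten_slot_linear[OF tn l], of "RR (vs ! i) p x (vs ! l)"] by simp
 qed
 finally show ?thesis by (simp only: curv_sharp_def sum_negf)
qed

definition DL :: "'a tfield => 'a tfield" where "DL T = dx (dl T) + dl (dx T)"

lemma DL_weitz: "Frm j T ==> DL T = WW T - lap T"
 unfolding DL_def by (rule weitzenboeck)

lemma DL_loc: "Frm j T ==> x \<in> W ==> DL T x vs = Delta_sharp_loc h T x vs"
 by (simp add: DL_weitz WW_loc lap_loc[OF Frm_Ten] Delta_sharp_loc_def)

lemma Frm_dx_dl: assumes "Frm j T" shows "Frm j (dx (dl T))"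
 using dl_0[OF Frm_Ten] Frm_zero[of 0] Frm_dx[OF Frm_dl'[OF assms]] assms by (cases j) simp_all

lemma Frm_DL [tint]: "Frm j T ==> Frm j (DL T)"
 unfolding DL_def by (intro Frm_add Frm_dx_dl Frm_dl Frm_dx)

lemma dx_DL: assumes "Frm j T" shows "dx (DL T) = DL (dx T)"
 unfolding DL_def dx_add[OF Frm_Ten[OF Frm_dx_dl[OF assms]] Frm_Ten[OF Frm_dl[OF Frm_dx[OF assms]]]]
 by (simp only: dx_dx[OF assms] dx_dx[OF Frm_dl'[OF assms]] dl_zero add_0_left add_0_right)

lemma dl_DL: assumes "Frm (Suc j) T" shows "dl (DL T) = DL (dl T)"
 unfolding DL_def dl_add[OF Frm_Ten[OF Frm_dx_dl[OF assms]] Frm_Ten[OF Frm_dl[OF Frm_dx[OF assms]]]]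
 by (simp only: dl_dl[OF assms] dl_dl[OF Frm_dx[OF assms]] dx_zero add_0_left add_0_right)

lemma DL_add: "Frm j S ==> Frm j T ==> DL (S + T) = DL S + DL T"
proof -
 assume *: "Frm j S" "Frm j T"
 note t = Frm_Ten[OF *(1)] Frm_Ten[OF *(2)]
 have "(a + b) + (c + d) = (a + c) + (b + d)" for a b c d :: "'a tfield" by simp
 thus ?thesis
  unfolding DL_def dl_add[OF t] dx_add[OF t] dx_add[OF Ten_dl'[OF t(1)] Ten_dl'[OF t(2)]]
   dl_add[OF Frm_Ten[OF Frm_dx[OF *(1)]] Frm_Ten[OF Frm_dx[OF *(2)]]] .
qed

lemma DL_zero [simp]: "DL 0 = 0" by (simp only: DL_def dl_zero dx_zero add_0_left)

subsection \<open>Commuting the Laplacian with an interior product\<close>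

text \<open>The two second derivatives in \<open>\<delta>\<nabla>\<^sub>K\<close> and \<open>\<nabla>\<^sub>K\<delta>\<close> are taken in opposite order and differ by a curvature term.\<close>

lemma dl_NN: assumes T: "Ten j T" and K: "smooth_on W K"
 shows "dl (NN K T) - NN K (dl T) = (SUM b. ii (sh b) (dact (%x. RR b (K x) x) T))
   - (SUM b. ii (sh b) (NN (cv (cf b) K) T))"
proof (intro ext)
 fix x vs
 have 1: "N b (NN K T) x us = HH b (K x) T x us + NN (cv (cf b) K) T x us" for b us
  using pt[OF ii_N_nab[OF T K, of b], of x us] by (simp add: N_nab[OF T])
 have 2: "NN K (dl T) x vs = - (SUM b. HH (K x) b T x (sh b x # vs))"
  by (simp add: NN_pt[OF Ten_dl'[OF T], of K] N_dl_HH[OF T])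
 have 3: "dact (%x. RR b (K x) x) T x us = HH (K x) b T x us - HH b (K x) T x us" for b us
  using pt[OF HH_commute[OF T, of b "K x"], of x us] by simp
 show "(dl (NN K T) - NN K (dl T)) x vs = ((SUM b. ii (sh b) (dact (%x. RR b (K x) x) T))
   - (SUM b. ii (sh b) (NN (cv (cf b) K) T))) x vs"
  by (simp add: dl_def[of "NN K T"] 1 2 3 sum.distrib sum_subtractf del: act_app)
qed

text \<open>As \<open>\<delta>\<close> anticommutes with \<open>\<iota>\<^sub>K\<close>, only the commutator of \<open>\<delta>\<close> with the Lie derivative \<open>d\<iota>\<^sub>K + \<iota>\<^sub>Kd\<close> is left.\<close>

lemma DL_ii: assumes F: "Frm j U" and K: "smooth_on W K"
 and sa: "!!x u v. x \<in> W ==> h x [cv (cf u) K x, v] = h x [u, cv (cf v) K x]"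
 shows "DL (ii K U) = ii K (DL U) + (dl (NN K U) - NN K (dl U))
  + (dl (dact (%x v. cv (cf v) K x) U) - dact (%x v. cv (cf v) K x) (dl U))"
proof -
 let ?A = "dact (%x v. cv (cf v) K x)"
 note T = Frm_Ten[OF F]
 have t: "Ten j (NN K U)" "Ten j (?A U)" "Ten j (ii K (dx U))"
  by (intro Ten_NN Ten_act mf_cv Ten_ii T K Frm_Ten[OF Frm_dx[OF F]])+
 have c: "dx (ii K T) = NN K T + ?A T - ii K (dx T)" if "Frm j T" for j T
  using cartan[OF that K] by (metis add_diff_cancel_right')
 have 1: "dl (dx (ii K U)) = dl (NN K U) + dl (?A U) + ii K (dl (dx U))"
  by (simp only: c[OF F] dl_diff[OF Ten_add[OF t(1,2)] t(3)] dl_add[OF t(1,2)] dl_ii[OF Frm_dx[OF F] K sa] diff_minus_eq_add)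
 have 2: "dx (dl (ii K U)) = - (NN K (dl U) + ?A (dl U) - ii K (dx (dl U)))"
  by (simp only: dl_ii[OF F K sa] dx_minus[OF Ten_ii'[OF Ten_dl'[OF T] K]] c[OF Frm_dl'[OF F]])
 have "- (p + q - r) + (s + t + u) = r + u + (s - p) + (t - q)" for p q r s t u :: "'a tfield" by simp
 thus ?thesis by (simp only: DL_def 1 2 op_add)
qed

end

context pmetric begin

section \<open>The differential Bianchi identity\<close>

text \<open>The curvature as a tensor field; its slots are ordered as in \<open>h(R(a,b)c,d)\<close>.\<close>

definition RM :: "'e tfield" where
 "RM x vs = (if x \<in> W & length vs = 4 then h x [RR (vs ! 0) (vs ! 1) x (vs ! 2), vs ! 3] else 0)"

lemma RM_app: "x \<in> W ==> RM x [a, b, c, d] = h x [RR a b x c, d]" by (simp add: RM_def)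

lemma Ten_RM [tint]: "Ten 4 RM"
 unfolding Ten_def
proof (intro conjI allI impI)
 fix x
 show "ten 4 (RM x)"
  unfolding ten_def multilin_def
 proof (intro conjI allI impI)
  fix vs :: "'e list" and i :: nat assume *: "length vs = 4 & i < 4"
  then obtain a b c d where vs: "vs = [a, b, c, d]" by (auto simp: numeral_eq_Suc length_Suc_conv)
  have i: "i = 0 \<or> i = 1 \<or> i = 2 \<or> i = 3" using * by auto
  show "linear (%v. RM x (vs[i := v]))"
  proof (cases "x \<in> W")
   case True
   have l: "linear (%v. h x [f v, d])" if "linear f" for f d
    using linear_compose[OF that h_lin[OF True]] by (simp add: o_def)
   show ?thesis
    using i l[OF curv_lin1[OF True, of b c]] l[OF curv_lin2[OF True, of a c]] l[OF curv_lin3[OF True, of a b]] h_lin2[OF True]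
    by (auto simp: vs RM_def True)
  qed (simp add: RM_def linear_zero)
 qed (simp add: RM_def)
next
 fix vs :: "'e list"
 show "smooth_on W (%x. RM x vs)"
 proof (cases "length vs = 4")
  case True
  have "smooth_on W (%x. h x [RR (vs ! 0) (vs ! 1) x (vs ! 2), vs ! 3])"
   using mf_curv by (intro h_smooth_fields) (auto simp: mf_def)
  thus ?thesis by (subst smooth_on_cong[OF open_W]) (auto simp: RM_def True)
 qed (simp add: RM_def)
qed (simp add: RM_def)

lemma RM_anti: "RM x [a, b, c, d] = - RM x [b, a, c, d]"
 by (cases "x \<in> W") (simp_all add: RM_def curv_anti[of x a b] h_neg)
lemma RM_skew: "RM x [a, b, c, d] = - RM x [a, b, d, c]"
 using curv_skew[of x a b c d] h_sym[of x c] by (cases "x \<in> W") (simp_all add: RM_def)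
lemma RM_pair: "RM x [a, b, c, d] = RM x [c, d, a, b]"
 using curv_pair[of x a b c d] by (cases "x \<in> W") (simp_all add: RM_def)

lemma N4: "Ten j T ==> x \<in> W ==> N e T x [a, b, c, d] = fd (%y. T y [a, b, c, d]) x e - T x [\<Gamma> x e a, b, c, d]
 - T x [a, \<Gamma> x e b, c, d] - T x [a, b, \<Gamma> x e c, d] - T x [a, b, c, \<Gamma> x e d]"
 by (simp add: NN_def DD_def)
lemma N3: "Ten j T ==> x \<in> W ==> N e T x [a, b, c] = fd (%y. T y [a, b, c]) x e - T x [\<Gamma> x e a, b, c]
 - T x [a, \<Gamma> x e b, c] - T x [a, b, \<Gamma> x e c]"
 by (simp add: NN_def DD_def)
lemma N2: "Ten j T ==> x \<in> W ==> N e T x [a, b] = fd (%y. T y [a, b]) x e - T x [\<Gamma> x e a, b] - T x [a, \<Gamma> x e b]"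
 by (simp add: NN_def DD_def)

lemma NRM_off: "x \<notin> W ==> N e RM x vs = 0"
 using Ten_off[OF Ten_NN[OF Ten_RM cf_smooth]] by simp

lemma NRM_anti: "N e RM x [a, b, c, d] = - N e RM x [b, a, c, d]"
proof (cases "x \<in> W")
 case True
 have "fd (%y. RM y [a, b, c, d]) x e = - fd (%y. RM y [b, a, c, d]) x e"
  by (subst RM_anti) (rule fd_minus[OF Ten_smooth[OF Ten_RM] True])
 thus ?thesis
  using RM_anti[of x a b] RM_anti[of x "\<Gamma> x e a" b] RM_anti[of x a "\<Gamma> x e b"]
  by (simp add: N4[OF Ten_RM True])
qed (simp add: NRM_off)

lemma NRM_pair: "N e RM x [a, b, c, d] = N e RM x [c, d, a, b]"
proof (cases "x \<in> W")
 case True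
 have "fd (%y. RM y [a, b, c, d]) x e = fd (%y. RM y [c, d, a, b]) x e"
  by (subst RM_pair) simp
 thus ?thesis
  using RM_pair[of x "\<Gamma> x e a" b c d] RM_pair[of x a "\<Gamma> x e b" c d] RM_pair[of x a b "\<Gamma> x e c" d] RM_pair[of x a b c "\<Gamma> x e d"]
  by (simp add: N4[OF Ten_RM True])
qed (simp add: NRM_off)

text \<open>The covariant derivative of the curvature as an endomorphism, with constant \<open>a\<close> and \<open>b\<close>.  The terms from the
  derivatives of \<open>a\<close> and \<open>b\<close> cancel in the cyclic sum of the Bianchi identity.\<close>

definition DRv :: "'e => 'e => 'e => 'e => 'e => 'e" where
 "DRv e a b x v = fd (%y. RR a b y v) x e + \<Gamma> x e (RR a b x v) - RR a b x (\<Gamma> x e v)"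

lemma N_act_curv: "Ten j T ==> N e (dact (%x. RR a b x) T) = dact (%x. RR a b x) (N e T) + dact (DRv e a b) T"
 unfolding DRv_def[abs_def] by (rule NN_act[OF _ mf_curv])

text \<open>The Jacobi identity for the three derivatives \<^term>\<open>N e\<close>, \<^term>\<open>N a\<close> and \<^term>\<open>N b\<close>.\<close>

lemma jacobi_act: assumes T: "Ten j T"
 shows "dact (DRv e a b) T + dact (DRv a b e) T + dact (DRv b e a) T = 0"
proof -
 have TN: "Ten j (N a T)" for a using T by (auto intro: tint)
 have TNN: "Ten j (N a (N b T))" for a b using TN by (auto intro: tint)
 have TC: "Ten j (dact (%x. RR a b x) T)" for a b using T by (auto intro: tint)
 have e: "dact (DRv e a b) T = - (N e (N a (N b T)) - N e (N b (N a T))) + (N a (N b (N e T)) - N b (N a (N e T)))" for e a b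
 proof -
  have "N e (N a (N b T)) - N e (N b (N a T)) = N e (N a (N b T) - N b (N a T))"
   by (simp only: NN_diff[OF TNN TNN])
  also have "... = - (dact (%x. RR a b x) (N e T) + dact (DRv e a b) T)"
   by (simp only: ricci_id[OF T] NN_minus[OF TC] N_act_curv[OF T])
  finally have 1: "N e (N a (N b T)) - N e (N b (N a T)) = - (dact (%x. RR a b x) (N e T) + dact (DRv e a b) T)" .
  have 2: "N a (N b (N e T)) - N b (N a (N e T)) = - dact (%x. RR a b x) (N e T)" by (rule ricci_id[OF TN])
  have "D = - (- (C + D)) + (- C)" for C D :: "'e tfield" by simp
  thus ?thesis by (simp only: 1 2)
 qed
 have "(- (p - q) + (r - s)) + (- (r - t) + (u - q)) + (- (u - s) + (p - t)) = 0" for p q r s t u :: "'e tfield" by simp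
 thus ?thesis by (simp only: e)
qed

text \<open>A derivation is determined by its action on covectors, so this is the preceding lemma for \<open>T\<close> a coordinate covector.\<close>

lemma bianchi2: assumes "x \<in> W" shows "DRv e a b x v + DRv a b e x v + DRv b e a x v = 0"
proof (rule euclidean_eqI)
 fix c :: 'e
 define u :: "'e tfield" where "u x vs = (if x \<in> W & vs = [] then 1 else 0)" for x vs
 have "Ten 0 u" unfolding Ten_def
 proof (intro conjI allI impI)
  fix vs :: "'e list" show "smooth_on W (%x. u x vs)"
   by (subst smooth_on_cong[OF open_W, of _ "%_. if vs = [] then 1 else 0"]) (auto simp: u_def)
 qed (auto simp: u_def ten_0)
 hence T: "Ten 1 (ep (cf c) u)" using Ten_ep[of 0 u "cf c"] by simp
 have "(dact (DRv e a b) (ep (cf c) u) + dact (DRv a b e) (ep (cf c) u) + dact (DRv b e a) (ep (cf c) u)) x [v] = 0"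
  by (simp only: jacobi_act[OF T] zero_fun_apply)
 thus "(DRv e a b x v + DRv a b e x v + DRv b e a x v) \<bullet> c = 0 \<bullet> c"
  using assms by (simp add: u_def inner_add_right inner_commute[of _ c])
qed

lemma NRM_eq: assumes "x \<in> W"
 shows "N e RM x [a, b, v, w] = h x [DRv e a b x v, w] - h x [RR (\<Gamma> x e a) b x v, w] - h x [RR a (\<Gamma> x e b) x v, w]"
proof -
 have s: "smooth_on W (%x. RR a b x v)" using mf_curv[of a b] by (simp add: mf_def)
 have "fd (%y. RM y [a, b, v, w]) x = fd (%y. h y [RR a b y v, w]) x"
  by (rule fd_cong[OF open_W assms]) (simp add: RM_app)
 hence "fd (%y. RM y [a, b, v, w]) x e = h x [fd (%y. RR a b y v) x e + \<Gamma> x e (RR a b x v), w] + h x [RR a b x v, \<Gamma> x e w]"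
  using h_compat[OF assms s cf_smooth[of w], of e] by (simp add: cv_def)
 thus ?thesis
  by (simp add: N4[OF Ten_RM assms] RM_app[OF assms] DRv_def h_diff(1)[OF assms])
qed

lemma bianchi2_RM: "N e RM x [a, b, v, w] + N a RM x [b, e, v, w] + N b RM x [e, a, v, w] = 0"
proof (cases "x \<in> W")
 case True
 have 1: "h x [DRv e a b x v, w] + h x [DRv a b e x v, w] + h x [DRv b e a x v, w] = 0"
  using arg_cong[OF bianchi2[OF True, of e a b v], of "%z. h x [z, w]"] by (simp add: h_add(1)[OF True] h_zero[OF True])
 have anti: "h x [RR p q x v, w] = - h x [RR q p x v, w]" for p q
  by (subst curv_anti) (simp only: h_neg(1)[OF True])
 have "N e RM x [a, b, v, w] + N a RM x [b, e, v, w] + N b RM x [e, a, v, w] =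
   (h x [DRv e a b x v, w] + h x [DRv a b e x v, w] + h x [DRv b e a x v, w])
   - (h x [RR (\<Gamma> x e a) b x v, w] + h x [RR b (\<Gamma> x e a) x v, w])
   - (h x [RR (\<Gamma> x e b) a x v, w] + h x [RR a (\<Gamma> x e b) x v, w])
   - (h x [RR (\<Gamma> x a b) e x v, w] + h x [RR e (\<Gamma> x a b) x v, w])"
  by (simp only: NRM_eq[OF True] \<Gamma>_sym[OF True, of a e] \<Gamma>_sym[OF True, of b e] \<Gamma>_sym[OF True, of b a])
 thus ?thesis
  by (simp only: 1 anti[of "\<Gamma> x e a" b] anti[of "\<Gamma> x e b" a] anti[of "\<Gamma> x a b" e])
qed (simp add: NRM_off)

definition tr :: "'e tfield => 'e tfield" where "tr T = (SUM b. ii (sh b) (ii (cf b) T))"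

lemma tr_app: "tr T x vs = (SUM b. T x (b # sh b x # vs))" by (simp add: tr_def)

lemma Ten_tr: "Ten j T ==> Ten (j - 1 - 1) (tr T)"
 unfolding tr_def by (intro Ten_sum Ten_ii'[OF Ten_hd] sh_smooth)

text \<open>The contraction is taken in parallel dual bases, see \<open>trace_par\<close>.\<close>

lemma N_tr: assumes T: "Ten j T" shows "N u (tr T) = tr (N u T)"
proof -
 have 1: "Ten (j - 1) (ii (cf b) T)" for b by (rule Ten_hd[OF T])
 have 2: "Ten (j - 1 - 1) (ii (sh b) (ii (cf b) T))" for b by (rule Ten_ii'[OF 1 sh_smooth])
 note c = cf_smooth
 show ?thesis
 proof (rule Ten_eqI[OF Ten_NN[OF Ten_tr[OF T] c] Ten_tr[OF Ten_NN[OF T c]]])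
  fix x vs assume x: "x \<in> W"
  have "N u (tr T) x vs = (SUM b. N u T x (b # sh b x # vs) + (T x (\<Gamma> x u b # sh b x # vs) + T x (b # cv (cf u) (sh b) x # vs)))"
   unfolding tr_def NN_sum[OF 2]
   by (simp add: NN_ii[OF 1 sh_smooth] NN_ii[OF T] op_add cv_def[of _ "%_. _"] add.assoc)
  thus "N u (tr T) x vs = tr (N u T) x vs"
   using trace_par[OF x, of "%u v. T x (u # v # vs)" u, OF Ten_linear[OF T] Ten_lin2[OF T]] by (simp add: sum.distrib tr_app)
 qed
qed

end

context rflat begin

lemma trace_RM: "(SUM b. RM x [w, b, sh b x, u]) = 0"
 using ric_trace[of x w] h_sum(1)[of x "%b. RR w b x (sh b x)" Basis u] h_zero(1)[of x u]
 by (cases "x \<in> W") (simp_all add: RM_def)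

lemma trace_NRM: "(SUM b. N v RM x [w, b, sh b x, u]) = 0"
proof (cases "x \<in> W")
 case True
 have T: "Ten 3 (ii (cf w) RM)" using Ten_hd[OF Ten_RM, of w] by simp
 have "tr (ii (cf w) RM) = 0"
 proof (rule Ten_eqI[OF _ Ten_zero])
  show "Ten 1 (tr (ii (cf w) RM))" using Ten_tr[OF T] by simp
  fix y :: 'a and vs :: "'a list" assume "length vs = 1"
  then obtain z where "vs = [z]" by (auto simp: length_Suc_conv)
  thus "tr (ii (cf w) RM) y vs = 0 y vs" using trace_RM by (simp add: tr_app)
 qed
 hence "tr (N v (ii (cf w) RM)) = 0" by (simp only: N_tr[OF T, symmetric] NN_zero)
 hence "tr (N v (ii (cf w) RM)) x [u] = 0" by simp
 thus ?thesis by (simp add: tr_app NN_ii[OF Ten_RM] sum.distrib trace_RM)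
qed (simp add: NRM_off)

text \<open>Contracted once, the differential Bianchi identity expresses the divergence of the curvature by derivatives of the
  Ricci curvature.\<close>

lemma div_RM: "(SUM b. N b RM x [sh b x, u, v, w]) = 0"
proof -
 have "N b RM x [sh b x, u, v, w] = N w RM x [v, b, sh b x, u] - N v RM x [w, b, sh b x, u]" for b
  using NRM_pair[of b x "sh b x" u v w] bianchi2_RM[of b x v w "sh b x" u] NRM_anti[of v x w b "sh b x" u] NRM_anti[of w x v b "sh b x" u] by simp
 thus ?thesis by (simp add: sum_subtractf trace_NRM)
qed

text \<open>Commuting the derivatives of the Hessian \<open>S\<close> produces curvature terms.  Where the curvature itself is differentiated
  there is a divergence, which vanishes by \<open>div_RM\<close>; the other terms are algebraic in \<open>S\<close>.\<close>

lemma lap_hessian: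
 fixes I :: "'a => 'a"
 assumes I: "smooth_on W I" and S: "S = nab (ii I hT)"
  and sym: "!!x u v. S x [u, v] = S x [v, u]" and x: "x \<in> W"
 shows "lap S x [u, v] = nab (nab (tr S)) x [u, v]
   - (SUM b. S x [sh b x, RR b u x v]) - (SUM b c. S x [b, c] * RM x [sh c x, v, u, sh b x])"
proof -
 have A: "Ten 1 (ii I hT)" by (rule Ten_ii[OF _ I]) (use Ten_hT in \<open>simp add: numeral_eq_Suc\<close>)
 have TS: "Ten 2 S" using Ten_nab[OF A] by (simp add: S numeral_eq_Suc)
 have TnS: "Ten 3 (nab S)" using Ten_nab[OF TS] by (simp add: numeral_eq_Suc)
 have TR: "Ten 3 (ii I RM)" by (rule Ten_ii[OF _ I]) (use Ten_RM in \<open>simp add: numeral_eq_Suc\<close>)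
 have Sh: "S x [u, v] = h x [cv (cf u) I x, v]" if "x \<in> W" for x u v
  using that by (simp add: S nab_def NN_ii[OF Ten_hT I] NN_hT hT_eq)
 have E: "nab S x [c, u, v] - nab S x [u, c, v] + ii I RM x [v, u, c] = 0" if x: "x \<in> W" for x c u v
 proof -
  have "nab S x [c, u, v] - nab S x [u, c, v] = (HH c u (ii I hT) - HH u c (ii I hT)) x [v]"
   by (simp add: S nab_def[of "nab _"] N_nab[OF A])
  also have "... = - h x [I x, RR c u x v]" by (simp only: HH_commute[OF A]) (simp add: hT_eq[OF x])
  also have "h x [I x, RR c u x v] = RM x [c, u, v, I x]" by (simp add: RM_app[OF x] h_sym[OF x])
  also have "... = RM x [I x, v, u, c]"
   using RM_pair[of x c u v "I x"] RM_anti[of x v "I x" c u] RM_skew[of x "I x" v c u] by simp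
  finally show ?thesis by simp
 qed
 have NE: "N b (nab S) x [c, u, v] - N b (nab S) x [u, c, v] + N b (ii I RM) x [v, u, c] = 0" for b c u v
 proof -
  have 0: "fd (%y. nab S y [c, u, v] - nab S y [u, c, v] + ii I RM y [v, u, c]) x b = 0"
   by (simp only: fd_cong[OF open_W x E] fd_const)
  have "fd (%y. nab S y [c, u, v]) x b - fd (%y. nab S y [u, c, v]) x b + fd (%y. ii I RM y [v, u, c]) x b = 0"
   using 0 fd_add[OF smooth_diff[OF open_W Ten_smooth[OF TnS] Ten_smooth[OF TnS]] Ten_smooth[OF TR] x]
    fd_diff[OF Ten_smooth[OF TnS] Ten_smooth[OF TnS] x] by metis
  thus ?thesis
   using E[OF x, of "\<Gamma> x b c" u v] E[OF x, of c "\<Gamma> x b u" v] E[OF x, of c u "\<Gamma> x b v"]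
   by (simp only: N3[OF TnS x] N3[OF TR x])
 qed
 have R: "N b (nab S) x [u, c, v] = N u (nab S) x [b, c, v] - S x [RR b u x c, v] - S x [c, RR b u x v]" for b c
 proof -
  have "(HH b u S - HH u b S) x [c, v] = - (S x [RR b u x c, v] + S x [c, RR b u x v])"
   by (simp only: HH_commute[OF TS]) simp
  thus ?thesis by (simp add: N_nab[OF TS])
 qed
 have TdS: "Ten 1 (tr (nab S))" using Ten_tr[OF TnS] by simp
 have TtS: "Ten 0 (tr S)" using Ten_tr[OF TS] by simp
 have eq: "tr (nab S) = nab (tr S)"
 proof (rule Ten_eqI[OF TdS])
  show "Ten 1 (nab (tr S))" using Ten_nab[OF TtS] by simp
  fix x :: 'a and vs :: "'a list" assume x: "x \<in> W" and "length vs = 1"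
  then obtain v where vs: "vs = [v]" by (auto simp: length_Suc_conv)
  have symN: "N b S x [c, v] = N b S x [v, c]" for b c
  proof -
   have "(%y. S y [c, v]) = (%y. S y [v, c])" by (intro ext) (rule sym)
   thus ?thesis using sym[of x "\<Gamma> x b c" v] sym[of x c "\<Gamma> x b v"] by (simp add: N2[OF TS x])
  qed
  have "tr (nab S) x [v] = (SUM b. nab S x [b, v, sh b x])" by (simp add: tr_app) (simp add: nab_def symN)
  also have "... = (SUM b. nab S x [v, b, sh b x] - RM x [I x, sh b x, v, b])"
   using E[OF x] by (intro sum.cong refl) (simp add: eq_diff_eq diff_add_eq)
  also have "... = (SUM b. nab S x [v, b, sh b x])"
   using trace_RM[of x v "I x"] by (simp add: sum_subtractf RM_pair[of x "I x"] RM_skew[of x v _ "I x"] sum_negf sum.distrib)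
  finally show "tr (nab S) x vs = nab (tr S) x vs" by (simp add: vs nab_def N_tr[OF TS] tr_app)
 qed
 have "lap S x [u, v] = (SUM b. N b (nab S) x [sh b x, u, v])" by (simp add: lap_def)
 also have "... = (SUM b. N u (nab S) x [b, sh b x, v] - S x [RR b u x (sh b x), v] - S x [sh b x, RR b u x v] - N b (ii I RM) x [v, u, sh b x])"
  using NE R by (intro sum.cong refl) (simp add: algebra_simps)
 also have "... = (SUM b. N u (nab S) x [b, sh b x, v]) - (SUM b. S x [RR b u x (sh b x), v])
   - (SUM b. S x [sh b x, RR b u x v]) - (SUM b. N b (ii I RM) x [v, u, sh b x])"
  by (simp add: sum_subtractf)
 finally have 1: "lap S x [u, v] = (SUM b. N u (nab S) x [b, sh b x, v]) - (SUM b. S x [RR b u x (sh b x), v])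
   - (SUM b. S x [sh b x, RR b u x v]) - (SUM b. N b (ii I RM) x [v, u, sh b x])" .
 have "N u (tr (nab S)) x [v] = nab (nab (tr S)) x [u, v]" unfolding eq by (simp add: nab_def[of "nab _"])
 hence 2: "(SUM b. N u (nab S) x [b, sh b x, v]) = nab (nab (tr S)) x [u, v]" by (simp add: N_tr[OF TnS] tr_app)
 have 3: "(SUM b. S x [RR b u x (sh b x), v]) = 0"
 proof -
  note l = Ten_linear[OF TS, of x "[v]"]
  show ?thesis
   using linear_sum[OF l, of "%b. RR b u x (sh b x)" Basis] linear_0[OF l] by (simp add: ric_trace2[OF x])
 qed
 have 4: "(SUM b. N b (ii I RM) x [v, u, sh b x]) = (SUM b c. S x [b, c] * RM x [sh c x, v, u, sh b x])"
 proof -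
  have "N b RM x [I x, v, u, sh b x] = - N b RM x [sh b x, u, I x, v]" for b
   using NRM_pair[of b x "I x" v u "sh b x"] NRM_anti[of b x u "sh b x" "I x" v] by simp
  hence "(SUM b. N b RM x [I x, v, u, sh b x]) = 0" by (simp add: sum_negf div_RM)
  moreover have "RM x [cv (cf b) I x, v, u, sh b x] = (SUM c. S x [b, c] * RM x [sh c x, v, u, sh b x])" for b
   using sh_expand_lin[OF x Ten_linear[OF Ten_RM, of x "[v, u, sh b x]"], of "cv (cf b) I x"]
   by (simp add: Sh[OF x] h_sym[OF x])
  ultimately show ?thesis by (simp add: NN_ii[OF Ten_RM I] sum.distrib)
 qed
 show ?thesis by (simp only: 1 2 3 4 diff_0_right)
qed

end

abbreviation cs :: "real => 'e tfield => 'e tfield" where "cs c T == sm (%_. c) T"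

lemma tfield_eqI: "(!!x vs. S x vs = T x vs) ==> S = (T :: 'e tfield)" by (intro ext)

context pmetric begin

lemma NN_cs: "Ten j T ==> NN V (cs c T) = cs c (NN V T)"
 by (subst NN_sm) (auto intro!: tfield_eqI)
lemma dx_cs: "Ten j T ==> dx (cs c T) = cs c (dx T)"
proof -
 assume *: "Ten j T"
 have "dv (%_. c) = (%_. 0)" by (intro ext) (simp add: dv_def)
 thus ?thesis by (subst dx_sm[OF *]) (auto intro!: tfield_eqI)
qed
lemma dl_cs: "Ten j T ==> dl (cs c T) = cs c (dl T)"
proof -
 assume *: "Ten j T"
 have "gr (%_. c) = (%_. 0)" by (intro ext) (simp add: gr_def)
 thus ?thesis by (subst dl_sm[OF *]) (auto simp: ii_zero_left[OF *])
qed

lemma cv_cong: assumes "x \<in> W" "!!y. y \<in> W ==> V y = V' y" shows "cv U V x = cv U V' x"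
 using fd_cong[OF open_W assms(1), of V V'] assms by (simp add: cv_def)

lemma cv_lin: "smooth_on W V ==> x \<in> W ==> cv U V x = cv (cf (U x)) V x" by (simp add: cv_def)

lemma dact_id: "Ten j T ==> dact (%x v. v) T = cs (real j) T"
proof (rule tfield_eqI)
 fix x vs assume "Ten j T" thus "dact (%x v. v) T x vs = cs (real j) T x vs"
  using Ten_len[of j T vs x] by (cases "length vs = j") (auto simp: tact_def)
qed

lemma trace_id: assumes "Frm j T" shows "(SUM b. ep (cf b) (ii (cf b) T)) = cs (real j) T"
proof -
 have "mf (%x v. v)" by (simp add: mf_def linear_id[unfolded id_def])
 from act_as_ep[OF assms this] show ?thesis by (simp add: dact_id[OF Frm_Ten[OF assms]])
qed

lemma trace_id2: assumes "Frm j T" shows "(SUM b. ep (fl (cf b)) (ii (sh b) T)) = cs (real j) T"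
proof -
 note T = Frm_Ten[OF assms]
 have "(SUM b. ep (fl (cf b)) (ii (sh b) T)) = (SUM b c. ep (cf c) (sm (%x. h x [b, c]) (ii (sh b) T)))"
  unfolding Gm_def by (simp only: ep_sum_left ep_scale_left op_sm)
 also have "... = (SUM c. ep (cf c) (ii (%x. SUM b. h x [b, c] *\<^sub>R sh b x) T))"
  by (subst sum.swap) (simp only: ii_sum_left[OF T] ii_scale_left[OF T] op_sum)
 also have "... = (SUM c. ep (cf c) (ii (cf c) T))"
 proof (intro sum.cong refl arg_cong[where f="ep _"])
  fix c :: 'e
  show "ii (%x. SUM b. h x [b, c] *\<^sub>R sh b x) T = ii (cf c) T"
   by (rule ii_cong[OF T]) (rule sh_expand)
 qed
 finally show ?thesis by (simp only: trace_id[OF assms])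
qed

end

section \<open>Homothetic gradient fields on a Ricci-flat space\<close>

text \<open>The setting of the ambient space: \<open>X\<close> generates the dilations, and \<open>hadamard\<close> says that \<open>Q = h(X,X)\<close> is a
  defining function of its zero set, the cone.\<close>

locale homothety = rflat W h for W :: "'e::euclidean_space set" and h :: "'e tfield" +
 fixes X :: "'e => 'e" and n :: nat
 assumes X_smooth [smooth_intros]: "smooth_on W X"
  and cv_X: "!!x v. x \<in> W ==> cv (cf v) X x = v"
  and X_nz: "!!x. x \<in> W ==> X x ~= 0"
  and dim_n: "DIM('e) = n + 2"
  and hadamard: "!!f. smooth_on W f ==> (!!x. x \<in> W ==> h x [X x, X x] = 0 ==> f x = 0) ==>
    \<exists>g. smooth_on W g & (\<forall>x\<in>W. f x = h x [X x, X x] * g x)"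
begin

definition Q :: "'e => real" where "Q x = h x [X x, X x]"
abbreviation Qs :: "nat => 'e tfield => 'e tfield" where "Qs l == sm (%x. Q x ^ l)"
abbreviation E :: "'e tfield => 'e tfield" where "E == ep (fl X)"

lemma Q_smooth [smooth_intros]: "smooth_on W Q"
 unfolding Q_def[abs_def] by (intro smooth_intros)
lemma Qpow_smooth [smooth_intros]: "smooth_on W (%x. Q x ^ l)"
 by (intro smooth_intros)

lemma fd_Q: "x \<in> W ==> fd Q x v = 2 * h x [X x, v]"
 using h_compat[OF _ X_smooth X_smooth, of x v] by (simp add: Q_def[abs_def] cv_X h_sym)

lemma dv_Q: "x \<in> W ==> dv Q x = 2 *\<^sub>R fl X x"
 by (simp add: dv_def fd_Q Gm_def scaleR_sum_right)
lemma gr_Q: assumes "x \<in> W" shows "gr Q x = 2 *\<^sub>R X x"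
 by (rule h_eqI[OF assms]) (simp add: h_gr[OF Q_smooth assms] fd_Q[OF assms] h_scale[OF assms])

subsection \<open>Division by the defining function\<close>

text \<open>The differential of \<open>Q\<close> is \<open>2 h(X,.)\<close> and has no zeros, so \<open>Q\<close> does not vanish on a nonempty open set.\<close>

lemma Q_dense: assumes "smooth_on W f" "!!x. x \<in> W ==> Q x ~= 0 ==> f x = (0::real)" "x \<in> W" shows "f x = 0"
proof (rule ccontr)
 assume nz: "f x ~= 0"
 have "open (W \<inter> f -` (- {0}))"
  using continuous_on_open_vimage[OF open_W, of f] smooth_continuous[OF assms(1)] by (metis Int_commute open_Compl closed_singleton)
 moreover have "Q y = 0" if "y \<in> W \<inter> f -` (- {0})" for y using that assms(2) by auto
 ultimately have "fd Q x = fd (%_. 0) x"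
  using fd_cong[of "W \<inter> f -` (- {0})" x Q "%_. 0"] nz assms(3) by auto
 hence "h x [X x, v] = 0" for v using fd_Q[OF assms(3), of v] by simp
 thus False using h_nd[OF assms(3)] X_nz[OF assms(3)] by blast
qed

lemma Q_cancel:
 assumes "smooth_on W f" "smooth_on W g" "!!x. x \<in> W ==> Q x ^ l * f x = Q x ^ l * (g x :: real)" "x \<in> W" shows "f x = g x"
proof -
 have "f x - g x = 0"
  by (rule Q_dense[OF smooth_diff[OF open_W assms(1,2)] _ assms(4)]) (use assms(3) in force)
 thus ?thesis by simp
qed

lemma Q_cancel_Ten: assumes "Ten j S" "Ten j T" "Qs l S = Qs l T" shows "S = T"
proof (rule Ten_eqI[OF assms(1,2)])
 fix x vs assume x: "x \<in> W"
 show "S x vs = T x vs"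
  by (rule Q_cancel[OF Ten_smooth[OF assms(1)] Ten_smooth[OF assms(2)] _ x, of l])
   (use fun_cong[OF fun_cong[OF assms(3)], of _ vs] in simp)
qed

text \<open>The quotients of the components are the components of a tensor, because \<open>Q\<close> may be cancelled.\<close>

lemma Q_divide:
 assumes T: "Ten j T" and d: "!!vs. \<exists>f. smooth_on W f & (\<forall>x\<in>W. T x vs = Q x * f x)"
 shows "\<exists>U. Ten j U & T = sm Q U & (Frm j T --> Frm j U)"
proof -
 obtain f where f: "!!vs. smooth_on W (f vs)" "!!vs x. x \<in> W ==> T x vs = Q x * f vs x"
  using d by metis
 define U where "U x vs = (if x \<in> W & length vs = j then f vs x else 0)" for x vs
 have Us: "smooth_on W (%x. U x vs)" for vs
  by (cases "length vs = j") (use f(1) smooth_on_cong[OF open_W, of "%x. U x vs" "f vs"] in \<open>auto simp: U_def\<close>)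
 have UQ: "T x vs = Q x * U x vs" for x vs
  using f(2)[of x vs] Ten_len[OF T, of vs x] Ten_off[OF T, of x] by (auto simp: U_def)
 have lin: "linear (%v. U x (vs[i := v]))" if vi: "length vs = j" "i < j" for x vs i
 proof (cases "x \<in> W")
  case True
  have l: "linear (%v. T y (vs[i := v]))" for y by (rule ten_slot_linear[OF Ten_ten[OF T]]) (use vi in simp)
  note c = Q_cancel[OF Us _ _ True, where l=1]
  show ?thesis
  proof (rule linearI)
   fix a b show "U x (vs[i := a + b]) = U x (vs[i := a]) + U x (vs[i := b])"
    using linear_add[OF l, of _ a b] by (intro c smooth_add open_W Us) (simp add: UQ algebra_simps)
  next
   fix r a show "U x (vs[i := r *\<^sub>R a]) = r *\<^sub>R U x (vs[i := a])"
    unfolding real_scaleR_def using linear_scale[OF l, of _ r a]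
    by (intro c smooth_mult smooth_const open_W Us) (simp add: UQ algebra_simps)
  qed
 next
  case False
  thus ?thesis by (simp add: U_def linear_zero)
 qed
 have TU: "Ten j U"
  unfolding Ten_def ten_def multilin_def using lin Us by (auto simp: U_def)
 moreover have "T = sm Q U" by (rule tfield_eqI) (simp add: UQ)
 moreover have "Frm j U" if F: "Frm j T"
  unfolding Frm_def alt_def alternating_def
 proof (intro conjI allI impI)
  fix x and vs :: "'e list" and i k assume *: "length vs = j & i < k & k < j & vs ! i = vs ! k"
  have "T y vs = 0" for y using Frm_alt[OF F, of y] * unfolding alt_def alternating_def by blast
  thus "U x vs = 0"
   using Q_cancel[OF Us[of vs], of "%_. 0" 1 x] UQ[of _ vs] by (cases "x \<in> W") (auto simp: U_def[of x])
 qed (use TU Ten_ten[OF TU] in auto)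
 ultimately show ?thesis by blast
qed

lemma Q_divide_zero:
 assumes "Ten j T" "!!x vs. x \<in> W ==> Q x = 0 ==> T x vs = 0"
 shows "\<exists>U. Ten j U & T = sm Q U & (Frm j T --> Frm j U)"
 by (rule Q_divide[OF assms(1)])
  (use hadamard[OF Ten_smooth[OF assms(1)], folded Q_def] assms(2) in blast)

subsection \<open>Commutation relations\<close>

lemma Frm_E [tint]: "Frm j T ==> Frm (Suc j) (E T)" by (intro Frm_ep fl_smooth X_smooth)

lemma dl_E: assumes "Frm j T"
 shows "dl (E T) = - NN X T - E (dl T) - cs (real n + 2 - real j) T"
proof -
 note T = Frm_Ten[OF assms]
 have "(SUM b. ii (sh b) (ep (fl (cv (cf b) X)) T)) = (SUM b. ii (sh b) (ep (fl (cf b)) T))"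
  by (intro sum.cong refl arg_cong[where f="ii _"] ep_cong[OF T]) (simp add: cv_X)
 also have "... = (SUM b. sm (%x. fl (cf b) x \<bullet> sh b x) T) - (SUM b. ep (fl (cf b)) (ii (sh b) T))"
  by (simp only: ii_ep sum_subtractf)
 also have "(SUM b. sm (%x. fl (cf b) x \<bullet> sh b x) T) = (\<Sum>b\<in>(Basis::'e set). T)"
 proof (intro sum.cong refl)
  fix b :: 'e assume b: "b \<in> Basis"
  have "sm (%x. fl (cf b) x \<bullet> sh b x) T = sm (%x. 1) T"
   by (rule sm_cong[OF T]) (use b in \<open>simp add: Gm_inner h_sh2\<close>)
  thus "sm (%x. fl (cf b) x \<bullet> sh b x) T = T" by simp
 qed
 finally have e: "(SUM b. ii (sh b) (ep (fl (cv (cf b) X)) T)) = (\<Sum>b\<in>(Basis::'e set). T) - cs (real j) T"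
  by (simp only: trace_id2[OF assms])
 show ?thesis
  unfolding dl_fl[OF T X_smooth] e
  by (rule tfield_eqI) (simp add: dim_n algebra_simps del: ep_app)
qed

lemma dx_Q: assumes "Ten j T" shows "dx (sm Q T) = sm Q (dx T) + cs 2 (E T)"
proof -
 have "ep (dv Q) T = ep (%x. 2 *\<^sub>R fl X x) T" by (rule ep_cong[OF assms dv_Q])
 thus ?thesis by (simp only: dx_sm[OF assms Q_smooth] ep_scale_left)
qed

text \<open>By \<open>dx_Q\<close>, exterior multiplication by \<open>2X\<close> is the commutator of \<open>d\<close> with \<open>Q\<close>.\<close>

lemma dx_E: assumes "Frm j T" shows "dx (E T) = - E (dx T)"
proof -
 note T = Frm_Ten[OF Frm_dx[OF assms]] Frm_Ten[OF assms] and E = Frm_Ten[OF Frm_E[OF assms]]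
 have "dx (sm Q (dx T) + cs 2 (E T)) = 0"
  using dx_dx[OF Frm_sm[OF assms Q_smooth]] by (simp only: dx_Q[OF T(2)])
 hence "sm Q (dx (dx T)) + cs 2 (E (dx T)) + cs 2 (dx (E T)) = 0"
  by (simp only: dx_add[OF Ten_sm[OF T(1) Q_smooth] Ten_sm[OF E cf_smooth]] dx_Q[OF T(1)] dx_cs[OF E])
 hence "cs 2 (E (dx T)) + cs 2 (dx (E T)) = 0" by (simp only: dx_dx[OF assms] op_zero add_0_left)
 hence *: "(cs 2 (E (dx T)) + cs 2 (dx (E T))) x vs = 0" for x vs by simp
 show ?thesis
  by (rule tfield_eqI) (use * in \<open>simp add: add_eq_0_iff2 del: ep_app\<close>)
qed

lemma cartan_X: assumes "Frm j T" shows "dx (ii X T) + ii X (dx T) = NN X T + cs (real j) T"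
proof -
 have "dact (%x v. cv (cf v) X x) T = dact (%x v. v) T"
  by (rule act_cong[OF Frm_Ten[OF assms]]) (simp add: cv_X)
 thus ?thesis using cartan[OF assms X_smooth] by (simp add: dact_id[OF Frm_Ten[OF assms]])
qed

lemma cv_VX: "x \<in> W ==> cv V X x = V x" using cv_lin[OF X_smooth, of x V] by (simp add: cv_X)

lemma dl_iX: "Frm j T ==> dl (ii X T) = - ii X (dl T)"
 by (rule dl_ii) (simp_all add: cv_X X_smooth)

lemma iX_E: "Ten j T ==> ii X (E T) = sm Q T - E (ii X T)"
 by (subst ii_ep) (auto intro!: sm_cong simp: Gm_inner Q_def)

text \<open>\<open>R(a,b)X\<close> is the commutator of second derivatives of \<open>X\<close>, and \<open>\<nabla>X = id\<close> is parallel.\<close>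

lemma curv_X: assumes "x \<in> W" shows "RR a b x (X x) = 0"
proof -
 have e: "cv (cf a) (cv (cf b) X) x = \<Gamma> x a b" for a b
  using cv_cong[OF assms, of "cv (cf b) X" "cf b" "cf a"] by (simp add: cv_X) (simp add: cv_def)
 show ?thesis using ricci_vec[OF assms X_smooth, of a b] by (simp add: e \<Gamma>_sym[OF assms, of a b])
qed

lemma curv_X2: assumes "x \<in> W" shows "RR (X x) b x v = 0"
 by (rule h_eqI[OF assms]) (simp only: curv_pair[OF assms, of "X x"] curv_X[OF assms] h_zero[OF assms])

lemma N_dx: assumes F: "Frm j T" shows "NN X (dx T) = dx (NN X T) - dx T"
proof -
 note T = Frm_Ten[OF F]
 have t: "Ten j (NN X T)" "Ten j (cs (real j) T)" "Ten j (ii X (dx T))"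
  using T Frm_Ten[OF Frm_dx[OF F]] by (auto intro!: Ten_NN Ten_sm Ten_ii smooth_intros)
 have "dx (dx (ii X T)) = 0" by (rule dx_dx[OF Frm_ii'[OF F X_smooth]])
 moreover have "dx (ii X T) = NN X T + cs (real j) T - ii X (dx T)"
  using cartan_X[OF F] by (metis add_diff_cancel_right')
 ultimately have 1: "dx (NN X T) + cs (real j) (dx T) - dx (ii X (dx T)) = 0"
  by (simp only: dx_diff[OF Ten_add[OF t(1,2)] t(3)] dx_add[OF t(1,2)] dx_cs[OF T])
 have 2: "dx (ii X (dx T)) = NN X (dx T) + cs (real (Suc j)) (dx T)"
  using cartan_X[OF Frm_dx[OF F]] by (simp add: dx_dx[OF F] del: ii_app of_nat_Suc)
 from pt[OF 1] show ?thesis unfolding 2 by (intro tfield_eqI) (simp add: algebra_simps)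
qed

text \<open>The special case of \<open>dl_NN\<close> in which the curvature does not contribute.\<close>

lemma N_dl: assumes T: "Ten j T" shows "NN X (dl T) = dl (NN X T) - dl T"
proof -
 have 1: "dact (%x. RR b (X x) x) T = 0" for b
 proof -
  have "dact (%x. RR b (X x) x) T = dact (%x v. 0) T"
   by (rule act_cong[OF T], subst curv_anti) (simp add: curv_X2)
  thus ?thesis using act_scale_left[OF T, of "%_. 0" "%_ _. 0"] by simp
 qed
 have 2: "NN (cv (cf b) X) T = N b T" for b
 proof (rule Ten_eqI[OF Ten_NN[OF T] Ten_NN[OF T]])
  fix x vs assume "x \<in> W" thus "NN (cv (cf b) X) T x vs = N b T x vs" by (simp add: NN_pt[OF T, of "cv _ _"] cv_X)
 qed (intro cv_smooth X_smooth smooth_const open_W)+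
 have "dl (NN X T) - NN X (dl T) = dl T"
  unfolding dl_NN[OF T X_smooth] 1 2 by (simp only: dl_def op_zero sum.neutral_const diff_0)
 thus ?thesis by (metis diff_eq_eq add_diff_cancel_left')
qed

abbreviation wt :: "real => 'e tfield => bool" where "wt w T == NN X T = cs w T"

lemma wt_dx: "Frm j T ==> wt w T ==> wt (w - 1) (dx T)"
 by (rule tfield_eqI) (simp add: N_dx dx_cs[OF Frm_Ten] algebra_simps)
lemma wt_dl: "Frm (Suc j) T ==> wt w T ==> wt (w - 1) (dl T)"
 by (rule tfield_eqI) (simp add: N_dl[OF Frm_Ten] dl_cs[OF Frm_Ten] algebra_simps)
lemma wt_add: "Ten j S ==> Ten j T ==> wt w S ==> wt w T ==> wt w (S + T)"
 by (simp only: NN_add op_add)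
lemma wt_cs: "Ten j T ==> wt w T ==> wt w (cs c T)"
 by (rule tfield_eqI) (simp add: NN_cs)
lemma wt_DL: assumes F: "Frm (Suc j) T" and w: "wt w T" shows "wt (w - 2) (DL T)"
proof -
 have "wt (w - 1 - 1) (dx (dl T))" "wt (w - 1 - 1) (dl (dx T))"
  by (rule wt_dx[OF Frm_dl[OF F] wt_dl[OF F w]], rule wt_dl[OF Frm_dx[OF F] wt_dx[OF F w]])
 hence "wt (w - 1 - 1) (DL T)" unfolding DL_def
  by (intro wt_add[of "Suc j"]) (auto intro!: tint Frm_Ten F)
 thus ?thesis by simp
qed
lemma wt_sm: "Ten j T ==> smooth_on W \<phi> ==> (!!x. x \<in> W ==> fd \<phi> x (X x) = u * \<phi> x) ==> wt w T ==> wt (w + u) (sm \<phi> T)"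
proof (rule tfield_eqI)
 fix x vs assume *: "Ten j T" "smooth_on W \<phi>" "!!x. x \<in> W ==> fd \<phi> x (X x) = u * \<phi> x" "wt w T"
 show "NN X (sm \<phi> T) x vs = cs (w + u) (sm \<phi> T) x vs"
  using Ten_off[OF *(1), of x] *(3)[of x] by (cases "x \<in> W") (auto simp: NN_sm[OF *(1,2)] *(4) algebra_simps)
qed
lemma fd_Qpow_X: "x \<in> W ==> fd (%x. Q x ^ l) x (X x) = (2 * real l) * Q x ^ l"
proof -
 assume x: "x \<in> W"
 have "fd Q x (X x) = 2 * Q x" by (simp add: fd_Q[OF x]) (simp add: Q_def)
 hence "fd (%x. Q x ^ l) x (X x) = real l * Q x ^ (l - 1) * (2 * Q x)"
  by (simp only: fd_power[OF Q_smooth x])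
 thus ?thesis by (cases l) simp_all
qed
lemma wt_Qpow: "Ten j T ==> wt w T ==> wt (w + 2 * real l) (Qs l T)"
 by (rule wt_sm[OF _ Qpow_smooth fd_Qpow_X])
lemma wt_iX: assumes "Ten j T" "wt w T" shows "wt (w + 1) (ii X T)"
proof -
 have "ii (cv X X) T = ii X T"
  by (rule ii_cong[OF assms(1) cv_VX])
 thus ?thesis
  by (intro tfield_eqI) (simp add: NN_ii[OF assms(1) X_smooth] assms(2) algebra_simps)
qed
lemma wt_E: assumes "Ten j T" "wt w T" shows "wt (w + 1) (E T)"
proof -
 have "ep (fl (cv X X)) T = E T"
  by (rule ep_cong[OF assms(1)]) (simp add: cv_VX)
 thus ?thesis
  by (intro tfield_eqI) (simp add: NN_fl[OF assms(1) X_smooth X_smooth] assms(2) op_sm algebra_simps del: ep_app)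
qed

text \<open>A factor \<open>Q\<^sup>l\<close> has weight \<open>2l\<close>.\<close>

lemma wt_Q_divide: assumes "Ten j U" "wt w (Qs l U)" shows "wt (w - 2 * real l) U"
proof (rule Q_cancel_Ten[of j _ _ l])
 show "Ten j (NN X U)" "Ten j (cs (w - 2 * real l) U)" using assms(1) by (auto intro!: tint smooth_intros)
 show "Qs l (NN X U) = Qs l (cs (w - 2 * real l) U)"
 proof (rule tfield_eqI)
  fix x vs
  have "NN X (Qs l U) x vs = w * (Q x ^ l * U x vs)" using assms(2) by simp
  thus "Qs l (NN X U) x vs = Qs l (cs (w - 2 * real l) U) x vs"
   using Ten_off[OF assms(1), of x] fd_Qpow_X[of x l] Ten_off[OF Ten_NN[OF assms(1) X_smooth], of x]
   by (cases "x \<in> W") (auto simp: NN_sm[OF assms(1) Qpow_smooth] algebra_simps)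
 qed
qed

lemma dl_Q: assumes "Ten j T" shows "dl (sm Q T) = sm Q (dl T) - cs 2 (ii X T)"
proof -
 have "ii (gr Q) T = ii (%x. 2 *\<^sub>R X x) T" by (rule ii_cong[OF assms gr_Q])
 thus ?thesis by (simp only: dl_sm[OF assms Q_smooth] ii_scale_left[OF assms])
qed

lemma DL_Q: assumes F: "Frm (Suc j) T"
 shows "DL (sm Q T) = sm Q (DL T) - cs 4 (NN X T) - cs (2 * (real n + 2)) T"
proof -
 note T = Frm_Ten[OF F]
 have t1: "Ten (Suc (Suc j)) (sm Q (dx T))" "Ten (Suc (Suc j)) (cs 2 (E T))"
  by (intro Ten_sm Q_smooth smooth_const open_W Frm_Ten[OF Frm_dx[OF F]] Frm_Ten[OF Frm_E[OF F]])+
 have t2: "Ten j (sm Q (dl T))" "Ten j (cs 2 (ii X T))"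
  by (intro Ten_sm Q_smooth smooth_const open_W Frm_Ten[OF Frm_dl[OF F]] Frm_Ten[OF Frm_ii[OF F X_smooth]])+
 have 1: "dl (dx (sm Q T)) = sm Q (dl (dx T)) - cs 2 (ii X (dx T)) + cs 2 (dl (E T))"
  by (simp only: dx_Q[OF T] dl_add[OF t1] dl_Q[OF Frm_Ten[OF Frm_dx[OF F]]] dl_cs[OF Frm_Ten[OF Frm_E[OF F]]])
 have 2: "dx (dl (sm Q T)) = sm Q (dx (dl T)) + cs 2 (E (dl T)) - cs 2 (dx (ii X T))"
  by (simp only: dl_Q[OF T] dx_diff[OF t2] dx_Q[OF Frm_Ten[OF Frm_dl[OF F]]] dx_cs[OF Frm_Ten[OF Frm_ii[OF F X_smooth]]])
 show ?thesis
 proof (rule tfield_eqI)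
  fix x vs
  have "dx (ii X T) x vs + ii X (dx T) x vs = NN X T x vs + real (Suc j) * T x vs"
   using pt[OF cartan_X[OF F], of x vs] by simp
  thus "DL (sm Q T) x vs = (sm Q (DL T) - cs 4 (NN X T) - cs (2 * (real n + 2)) T) x vs"
   unfolding DL_def 1 2 dl_E[OF F] by (simp add: algebra_simps del: ep_app ii_app)
 qed
qed

lemma DL_E: assumes F: "Frm (Suc j) D" and z: "dl D = 0" shows "DL (E D) = E (DL D) - cs 2 (dx D)"
proof -
 note T = Frm_Ten[OF F]
 have t: "Ten (Suc j) (NN X D)" "Ten (Suc j) (cs (real n + 2 - real (Suc j)) D)"
  using T by (auto intro!: tint smooth_intros)
 have "dl (E D) = - NN X D - cs (real n + 2 - real (Suc j)) D" by (simp add: dl_E[OF F] z)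
 hence 1: "dx (dl (E D)) = - dx (NN X D) - cs (real n + 2 - real (Suc j)) (dx D)"
  by (simp only: dx_diff[OF Ten_minus[OF t(1)] t(2)] dx_minus[OF t(1)] dx_cs[OF T])
 have 2: "dl (dx (E D)) = NN X (dx D) + E (dl (dx D)) + cs (real n + 2 - real (Suc (Suc j))) (dx D)"
  unfolding dx_E[OF F] dl_minus[OF Frm_Ten[OF Frm_E[OF Frm_dx[OF F]]]] dl_E[OF Frm_dx[OF F]]
  by (rule tfield_eqI) (simp del: ep_app)
 show ?thesis
  unfolding DL_def 1 2 N_dx[OF F] z dx_zero add_0_left
  by (rule tfield_eqI) (simp add: algebra_simps del: ep_app)
qed

end

context homothety begin

section \<open>The Branson-Gover operator on a closed lift\<close>

text \<open>The forms \<open>(d\<delta>)\<^sup>l F\<close>.\<close>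

primrec CC :: "'e tfield => nat => 'e tfield" where
 "CC F 0 = F" | "CC F (Suc l) = dx (dl (CC F l))"

lemma Frm_CC: "Frm (Suc k) F ==> Frm (Suc k) (CC F l)"
 by (induction l) (auto intro: Frm_dx Frm_dl)

text \<open>\<open>\<iota>\<^sub>X\<close> and \<open>\<delta>\<close> anticommute and \<open>\<iota>\<^sub>X d + d \<iota>\<^sub>X\<close> is the weight plus the degree, which accumulates to \<open>- 2 l\<close>.\<close>

lemma CC_inv:
 assumes F: "Frm (Suc k) F" "dx F = 0" "ii X F = 0"
 shows "dx (CC F l) = 0 & wt (- (real (Suc k) + 2 * real l)) (CC F l) &
  ii X (CC F l) = cs (- (2 * real l)) (dl (CC F (l - 1)))"
proof (induction l)
 case 0
 have e: "0 = NN X F + cs (real (Suc k)) F"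
  by (simp only: cartan_X[OF F(1), symmetric] F(2,3) dx_zero op_zero add_0_right)
 have "NN X F = cs (- (real (Suc k))) F"
 proof (rule tfield_eqI)
  fix x vs
  show "NN X F x vs = cs (- (real (Suc k))) F x vs"
   using pt[OF e, of x vs] by (simp add: algebra_simps)
 qed
 thus ?case using F by (simp del: ii_app)
next
 case (Suc l)
 let ?C = "CC F l" and ?D = "dl (CC F l)"
 have FC: "Frm (Suc k) ?C" by (rule Frm_CC[OF F(1)])
 have FD: "Frm k ?D" by (rule Frm_dl[OF FC])
 have wD: "wt (- (real (Suc k) + 2 * real l) - 1) ?D" by (rule wt_dl[OF FC]) (use Suc in blast)
 have "dl (cs (- (2 * real l)) (dl (CC F (l - 1)))) = cs (- (2 * real l)) (dl (dl (CC F (l - 1))))"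
  by (rule dl_cs[OF Frm_Ten[OF Frm_dl[OF Frm_CC[OF F(1)]]]])
 hence z: "dl (ii X ?C) = 0" using Suc by (simp only: dl_dl[OF Frm_CC[OF F(1)]] op_zero)
 have iD: "ii X ?D = 0"
  by (rule tfield_eqI) (use pt[OF trans[OF dl_iX[OF FC, symmetric] z]] in \<open>simp del: ii_app\<close>)
 have e: "ii X (dx ?D) = NN X ?D + cs (real k) ?D"
  by (simp only: cartan_X[OF FD, symmetric] iD dx_zero add_0_left)
 have "ii X (dx ?D) = cs (- (2 * real (Suc l))) ?D"
  unfolding e wD by (rule tfield_eqI) (simp add: algebra_simps)
 moreover have "wt (- (real (Suc k) + 2 * real l) - 1 - 1) (dx ?D)" by (rule wt_dx[OF FD wD])
 moreover have "- (real (Suc k) + 2 * real l) - 1 - 1 = - (real (Suc k) + 2 * real (Suc l))" by simp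
 ultimately show ?case by (simp only: CC.simps dx_dx[OF FD] diff_Suc_1 simp_thms)
qed

lemma DL_closed: "dx T = 0 ==> DL T = dx (dl T)"
 by (simp only: DL_def dl_zero add_0_right)

lemma DL_cs: "Frm j T ==> DL (cs c T) = cs c (DL T)"
 by (simp only: DL_def dx_cs[OF Frm_Ten] dl_cs[OF Frm_Ten] dl_cs[OF Frm_Ten[OF Frm_dx]] dx_cs[OF Ten_dl'[OF Frm_Ten]] op_add)

text \<open>The contraction of \<open>D\<close> into a form of weight \<open>w\<close>, expressed by \<open>\<delta>\<close> and \<open>\<Delta>\<close>.\<close>

definition iotaD :: "real => 'e tfield => 'e tfield" where
 "iotaD w T = cs (- (real n + 2 * w - 2)) (dl T) + ii X (DL T)"

context
 fixes k m :: nat and F :: "'e tfield"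
 assumes F: "Frm (Suc (Suc k)) F" "dx F = 0" "ii X F = 0" and nm: "n = 2 * (Suc (Suc k) + m)"
begin

lemma CC_Frm: "Frm (Suc (Suc k)) (CC F l)" by (rule Frm_CC[OF F(1)])
lemma CC_closed: "dx (CC F l) = 0"
 and CC_wt: "wt (- (real (Suc (Suc k)) + 2 * real l)) (CC F l)"
 and CC_iX: "ii X (CC F (Suc l)) = cs (- (2 * real (Suc l))) (dl (CC F l))"
 using CC_inv[OF F, of l] CC_inv[OF F, of "Suc l"] by (simp_all only: diff_Suc_1)

lemma iotaD_EF: "iotaD (1 - real (Suc (Suc k))) (E F) =
  cs (4 * real m * (real m + 1)) F + cs (2 * real m + 2) (E (dl F)) + sm Q (CC F 1)"
proof -
 have FdF: "Frm (Suc k) (dl F)" by (rule Frm_dl[OF F(1)])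
 have wF: "NN X F = cs (- (real (Suc (Suc k)))) F" using CC_wt[of 0] by simp
 have 1: "dl (E F) = - cs (2 * real m + 2) F - E (dl F)"
  unfolding dl_E[OF F(1)] wF by (rule tfield_eqI) (simp add: nm algebra_simps del: ep_app)
 have "DL (E F) = dx (dl (E F))"
  by (rule DL_closed) (simp only: dx_E[OF F(1)] F(2) op_zero minus_zero)
 also have "... = E (CC F 1)"
 proof -
  have t: "Ten (Suc (Suc k)) (- cs (2 * real m + 2) F)" "Ten (Suc (Suc k)) (E (dl F))"
   by (intro Ten_minus Ten_sm Frm_Ten[OF F(1)] smooth_const open_W Frm_Ten[OF Frm_E[OF FdF]])+
  have "dx (- cs (2 * real m + 2) F) = 0"
   by (simp only: dx_minus[OF Ten_sm[OF Frm_Ten[OF F(1)] cf_smooth]] dx_cs[OF Frm_Ten[OF F(1)]] F(2) op_zero minus_zero)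
  thus ?thesis
   unfolding 1 dx_diff[OF t] dx_E[OF FdF] by simp
 qed
 finally have 2: "DL (E F) = E (CC F 1)" .
 have "ii X (E (CC F 1)) = sm Q (CC F 1) + cs 2 (E (dl F))"
 proof (rule tfield_eqI)
  fix x vs
  have "E (ii X (CC F 1)) = cs (- 2) (E (dl F))" using CC_iX[of 0] by (simp add: op_sm del: ii_app ep_app CC.simps(2))
  thus "ii X (E (CC F 1)) x vs = (sm Q (CC F 1) + cs 2 (E (dl F))) x vs"
   unfolding iX_E[OF Frm_Ten[OF CC_Frm]] by simp
 qed
 thus ?thesis
  unfolding iotaD_def 1 2
  by (intro tfield_eqI) (simp add: nm algebra_simps del: ep_app ii_app CC.simps(2))
qed

text \<open>Each Laplacian raises the index of the three terms by one; its commutators with exterior multiplication by \<open>X\<close>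
  and with \<open>Q\<close> lower the coefficient of \<open>C\<^sub>l\<close>, which is zero for \<open>l = m\<close>.\<close>

lemma DL_pow_iotaD:
 "(DL ^^ l) (iotaD (1 - real (Suc (Suc k))) (E F)) = cs (4 * (real m - real l) * (real m + 1 - real l)) (CC F l)
  + cs (2 * real m + 2) (E (dl (CC F l))) + sm Q (CC F (Suc l))"
proof (induction l)
 case 0
 show ?case unfolding funpow.simps id_apply iotaD_EF
  by (rule tfield_eqI) (simp del: ep_app CC.simps(2))
next
 case (Suc l)
 let ?C = "CC F l" and ?C' = "CC F (Suc l)" and ?C'' = "CC F (Suc (Suc l))"
 let ?A = "cs (4 * (real m - real l) * (real m + 1 - real l)) ?C" and ?B = "cs (2 * real m + 2) (E (dl ?C))" and ?D = "sm Q ?C'"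
 have FD: "Frm (Suc k) (dl ?C)" by (rule Frm_dl[OF CC_Frm])
 have d: "DL (CC F i) = CC F (Suc i)" for i using DL_closed[OF CC_closed[of i]] by simp
 have fr: "Frm (Suc (Suc k)) ?A" "Frm (Suc (Suc k)) ?B" "Frm (Suc (Suc k)) ?D"
  by (intro Frm_sm CC_Frm Frm_E FD smooth_const open_W Q_smooth)+
 have 1: "DL ?A = cs (4 * (real m - real l) * (real m + 1 - real l)) ?C'"
  by (simp only: DL_cs[OF CC_Frm] d)
 have "DL (dl ?C) = dl ?C'" using dl_DL[OF CC_Frm[of l]] by (simp only: d)
 hence 2: "DL ?B = cs (2 * real m + 2) (E (dl ?C') - cs 2 ?C')"
  by (simp only: DL_cs[OF Frm_E[OF FD]] DL_E[OF FD dl_dl[OF CC_Frm]] CC.simps(2))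
 have 3: "DL ?D = sm Q ?C'' - cs 4 (cs (- (real (Suc (Suc k)) + 2 * real (Suc l))) ?C') - cs (2 * (real n + 2)) ?C'"
  by (simp only: DL_Q[OF CC_Frm] d CC_wt)
 have "DL (?A + ?B + ?D) = DL ?A + DL ?B + DL ?D"
  by (simp only: DL_add[OF Frm_add[OF fr(1,2)] fr(3)] DL_add[OF fr(1,2)])
 note e = this[unfolded 1 2 3]
 show ?case
  unfolding funpow.simps o_apply Suc e
  by (rule tfield_eqI) (simp add: nm algebra_simps del: ep_app ii_app CC.simps(2))
qed

lemma DL_pow_iotaD_m:
 "(DL ^^ m) (iotaD (1 - real (Suc (Suc k))) (E F)) = cs (2 * real m + 2) (E (dl (CC F m))) + sm Q (CC F (Suc m))"
 unfolding DL_pow_iotaD by (rule tfield_eqI) (simp del: ep_app CC.simps(2))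

end

lemma Frm_DL_pow: "Frm j T ==> Frm j ((DL ^^ l) T)"
 by (induction l) (auto intro: Frm_DL)

lemma DL_pow_add: "Frm j S ==> Frm j T ==> (DL ^^ l) (S + T) = (DL ^^ l) S + (DL ^^ l) T"
proof (induction l)
 case (Suc l)
 thus ?case by (simp only: funpow.simps o_apply DL_add[OF Frm_DL_pow Frm_DL_pow])
qed simp

text \<open>The commutator of \<open>\<Delta>\<close> with \<open>Q\<close> acts on homogeneous forms as a number, which is summed up over the \<open>l\<close> factors.
  The sum vanishes for the weight and the power that matter here.\<close>

lemma DL_pow_Q: assumes Z: "Frm (Suc j) Z" "wt w Z"
 shows "(DL ^^ l) (sm Q Z) = sm Q ((DL ^^ l) Z) +
  cs (- (real l * (2 * real n + 4 + 4 * w) - 4 * real l * (real l - 1))) ((DL ^^ (l - 1)) Z)"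
proof (induction l)
 case 0
 show ?case by (rule tfield_eqI) simp
next
 case (Suc l)
 have w: "wt (w - 2 * real l) ((DL ^^ l) Z)"
 proof (induction l)
  case (Suc l)
  have "(w - 2 * real l) - 2 = w - 2 * real (Suc l)" by simp
  thus ?case using wt_DL[OF Frm_DL_pow[OF Z(1)] Suc] by (simp only: funpow.simps o_apply)
 qed (use Z in simp)
 note fr = Frm_DL_pow[OF Z(1)]
 have 1: "DL (sm Q ((DL ^^ l) Z)) = sm Q ((DL ^^ Suc l) Z) - cs 4 (cs (w - 2 * real l) ((DL ^^ l) Z)) - cs (2 * (real n + 2)) ((DL ^^ l) Z)"
  by (simp only: DL_Q[OF fr] w funpow.simps o_apply)
 let ?c = "- (real l * (2 * real n + 4 + 4 * w) - 4 * real l * (real l - 1))"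
 have 2: "DL (cs ?c ((DL ^^ (l - 1)) Z)) = cs ?c ((DL ^^ l) Z)"
  by (cases l) (simp_all add: DL_cs[OF fr])
 show ?case
  unfolding funpow.simps(2) o_apply Suc DL_add[OF Frm_sm[OF fr Q_smooth] Frm_sm[OF fr cf_smooth]] 1[unfolded funpow.simps o_apply] 2
  by (rule tfield_eqI) (simp add: algebra_simps)
qed

text \<open>Two lifts of the same form differ, after exterior multiplication by \<open>X\<close>, by a multiple of \<open>Q\<close>; it makes no
  contribution on the cone.\<close>

lemma iotaD_Q_zero:
 assumes U: "Frm (Suc (Suc (Suc k))) U" "wt (- 1 - real (Suc (Suc k))) U" and nm: "n = 2 * (Suc (Suc k) + m)"
 shows "\<exists>V. (DL ^^ m) (iotaD (1 - real (Suc (Suc k))) (sm Q U)) = sm Q V"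
proof -
 define Z where "Z = ii X (DL U) - cs (2 * real m) (dl U)"
 have fr: "Frm (Suc (Suc k)) (ii X (DL U))" "Frm (Suc (Suc k)) (dl U)"
  by (intro Frm_ii Frm_DL Frm_dl U X_smooth)+
 have FZ: "Frm (Suc (Suc k)) Z" unfolding Z_def by (intro Frm_diff Frm_sm fr smooth_const open_W)
 have w1: "wt (- real (Suc (Suc k)) - 2) (ii X (DL U))"
  using wt_iX[OF Frm_Ten[OF Frm_DL[OF U(1)]] wt_DL[OF U]] by simp
 have w2: "wt (- real (Suc (Suc k)) - 2) (dl U)"
  using wt_dl[OF U] by (simp add: algebra_simps)
 have wZ: "wt (- real (Suc (Suc k)) - 2) Z"
  unfolding Z_def
  by (rule tfield_eqI) (simp add: NN_diff[OF Frm_Ten[OF fr(1)] Ten_sm[OF Frm_Ten[OF fr(2)] cf_smooth]]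
    NN_cs[OF Frm_Ten[OF fr(2)]] w1 w2 algebra_simps del: ii_app)
 have "DL (sm Q U) = sm Q (DL U) - cs (4 * real m) U"
  unfolding DL_Q[OF U(1)] U(2) by (rule tfield_eqI) (simp add: nm algebra_simps)
 hence "iotaD (1 - real (Suc (Suc k))) (sm Q U) = cs (- (real n + 2 * (1 - real (Suc (Suc k))) - 2)) (sm Q (dl U) - cs 2 (ii X U))
   + ii X (sm Q (DL U) - cs (4 * real m) U)"
  by (simp only: iotaD_def dl_Q[OF Frm_Ten[OF U(1)]])
 also have "... = sm Q Z"
  by (rule tfield_eqI) (simp add: Z_def nm algebra_simps)
 finally have "iotaD (1 - real (Suc (Suc k))) (sm Q U) = sm Q Z" .
 moreover have "cs (- (real m * (2 * real n + 4 + 4 * (- real (Suc (Suc k)) - 2)) - 4 * real m * (real m - 1))) ((DL ^^ (m - 1)) Z) = 0"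
  by (rule tfield_eqI) (simp add: nm algebra_simps)
 ultimately show ?thesis using DL_pow_Q[OF FZ wZ, of m] by (metis add_0_right)
qed

section \<open>Fields vanishing to a given order\<close>

definition ord :: "nat => nat => 'e tfield => bool" where
 "ord l j T \<longleftrightarrow> (\<exists>V. Frm j V & T = Qs l V)"

lemma ordI: "Frm j V ==> T = Qs l V ==> ord l j T" by (auto simp: ord_def)
lemma ord_zero: "ord l j 0" by (rule ordI[OF Frm_zero]) simp
lemma ord_mono: "ord l j T ==> l' <= l ==> ord l' j T"
proof -
 assume "ord l j T" "l' <= l"
 then obtain V where V: "Frm j V" "T = Qs l V" by (auto simp: ord_def)
 show ?thesis
  by (rule ordI[of j "Qs (l - l') V"])
   (use V \<open>l' <= l\<close> in \<open>auto simp: sm_sm power_add[symmetric] intro: Frm_sm Qpow_smooth\<close>)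
qed
lemma ord_add: "ord l j S ==> ord l j T ==> ord l j (S + T)"
 unfolding ord_def by (metis Frm_add op_add(3))
lemma ord_minus: "ord l j T ==> ord l j (- T)"
 unfolding ord_def by (metis Frm_minus op_minus(3))
lemma ord_diff: "ord l j S ==> ord l j T ==> ord l j (S - T)"
 using ord_add[OF _ ord_minus, of l j S T] by (metis add_uminus_conv_diff)
lemma ord_sum: "(!!i. i \<in> A ==> ord l j (T i)) ==> ord l j (\<Sum>i\<in>A. T i)"
 by (induction A rule: infinite_finite_induct) (auto intro: ord_add ord_zero)
lemma ord_ep: "ord l j T ==> smooth_on W a ==> ord l (Suc j) (ep a T)"
 unfolding ord_def by (metis Frm_ep op_sm(1))
lemma ord_ii: "ord l (Suc j) T ==> smooth_on W V ==> ord l j (ii V T)"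
 unfolding ord_def by (metis Frm_ii op_sm(2))
lemma ord_ii_field: 
 assumes "Frm (Suc j) U" "smooth_on W V'" "!!x. x \<in> W ==> V x = Q x ^ l *\<^sub>R V' x"
 shows "ord l j (ii V U)"
proof (rule ordI[OF Frm_ii[OF assms(1,2)]])
 show "ii V U = Qs l (ii V' U)"
  by (rule trans[OF ii_cong[OF Frm_Ten[OF assms(1)] assms(3)] ii_scale_left[OF Frm_Ten[OF assms(1)]]])
qed

lemma ord_dl: "ord (Suc l) (Suc j) T ==> ord l j (dl T)"
proof -
 assume "ord (Suc l) (Suc j) T"
 then obtain V where V: "Frm (Suc j) V" "T = Qs (Suc l) V" by (auto simp: ord_def)
 have g: "gr (%x. Q x ^ Suc l) x = Q x ^ l *\<^sub>R ((2 * real (Suc l)) *\<^sub>R X x)" if "x \<in> W" for x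
  by (rule h_eqI[OF that])
   (simp add: h_gr[OF Qpow_smooth that] fd_power[OF Q_smooth that] fd_Q[OF that] h_scale[OF that] del: power_Suc)
 have "ord l j (ii (gr (%x. Q x ^ Suc l)) V)"
  by (rule ord_ii_field[OF V(1) _ g]) (intro smooth_intros)
 moreover have "ord l j (Qs (Suc l) (dl V))"
  by (rule ord_mono[of "Suc l"]) (auto intro!: ordI Frm_dl V(1))
 ultimately show ?thesis using ord_diff V(2) dl_sm[OF Frm_Ten[OF V(1)] Qpow_smooth] by metis
qed

text \<open>Only one order is lost under an operator of second order, because \<open>[\<Delta>, Q]\<close> involves no derivative but \<open>\<nabla>\<^sub>X\<close>,
  and this preserves the powers of \<open>Q\<close>.\<close>

lemma ord_DL: assumes "ord (Suc l) (Suc j) T" shows "ord l (Suc j) (DL T)"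
proof -
 obtain V where V: "Frm (Suc j) V" "T = Qs (Suc l) V" using assms by (auto simp: ord_def)
 have "ord l (Suc j) (DL (Qs (Suc l) V))"
 proof (induction l)
  case 0
  have "A = Qs 0 A" for A by (rule tfield_eqI) simp
  thus ?case by (rule ordI[OF Frm_DL[OF Frm_sm[OF V(1) Qpow_smooth]]])
 next
  case (Suc l)
  let ?P = "Qs (Suc l) V"
  have e: "sm (%x. Q x ^ Suc (Suc l)) V = sm Q ?P" by (simp add: sm_sm)
  have P: "Frm (Suc j) ?P" by (intro Frm_sm V Qpow_smooth)
  have o1: "ord (Suc l) (Suc j) (sm Q (DL ?P))"
  proof -
   obtain V' where V': "Frm (Suc j) V'" "DL ?P = Qs l V'" using Suc unfolding ord_def by blast
   show ?thesis by (rule ordI[OF V'(1)]) (subst V'(2), simp only: sm_sm power_Suc)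
  qed
  have "NN X ?P = Qs (Suc l) (NN X V) + sm (%x. fd (%x. Q x ^ Suc l) x (X x)) V"
   by (rule NN_sm[OF Frm_Ten[OF V(1)] Qpow_smooth])
  also have "sm (%x. fd (%x. Q x ^ Suc l) x (X x)) V = sm (%x. (2 * real (Suc l)) * Q x ^ Suc l) V"
   by (rule sm_cong[OF Frm_Ten[OF V(1)] fd_Qpow_X])
  finally have "NN X ?P = Qs (Suc l) (NN X V + cs (2 * real (Suc l)) V)"
   by (simp only: op_add sm_sm mult.commute)
  hence o2: "ord (Suc l) (Suc j) (NN X ?P)"
   by (rule ordI[rotated]) (intro Frm_add Frm_NN Frm_sm V X_smooth smooth_const open_W)
  have cso: "ord i (Suc j) (cs c T)" if "ord i (Suc j) T" for i c T
  proof -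
   note * = that
   obtain V' where V': "Frm (Suc j) V'" "T = Qs i V'" using * unfolding ord_def by blast
   show ?thesis unfolding V'(2)
    by (rule ordI[OF Frm_sm[OF V'(1) cf_smooth[of c]]]) (simp only: sm_sm mult.commute)
  qed
  have "ord (Suc l) (Suc j) ?P" by (rule ordI[OF V(1)]) simp
  thus ?case unfolding e DL_Q[OF P] by (intro ord_diff o1 cso o2)
 qed
 thus ?thesis using V(2) by simp
qed

text \<open>If the Hessian of a gradient field \<open>I\<close> vanishes to order \<open>q\<close>, then so does \<open>\<nabla>I\<close>, and the curvature applied to \<open>I\<close>
  vanishes to order \<open>q - 1\<close>.  These are the only ingredients of \<open>DL_ii\<close> and \<open>dl_NN\<close>.\<close>

lemma ord_commutator:
 assumes I: "smooth_on W I" and Z: "mf Z" and q: "q = Suc r"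
  and cvI: "!!b x. x \<in> W ==> cv (cf b) I x = Q x ^ q *\<^sub>R Z x b"
  and sa: "!!x u v. x \<in> W ==> h x [cv (cf u) I x, v] = h x [u, cv (cf v) I x]"
  and U: "Frm (Suc j) U"
 shows "ord r j (DL (ii I U) - ii I (DL U))"
proof -
 note T = Frm_Ten[OF U]
 define z where "z b x = Z x b" for b x
 have zs: "smooth_on W (z b)" for b using Z by (simp add: mf_def z_def[abs_def])
 have cvQ: "cv (cf a) (%x. Q x ^ q *\<^sub>R V x) x = Q x ^ r *\<^sub>R (Q x *\<^sub>R cv (cf a) V x + (real q * fd Q x a) *\<^sub>R V x)"
  if "x \<in> W" "smooth_on W V" for a x V
 proof -
  have "fd (%x. Q x ^ q *\<^sub>R V x) x a = Q x ^ q *\<^sub>R fd V x a + (real q * Q x ^ r * fd Q x a) *\<^sub>R V x"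
   by (simp only: fd_scaleR[OF Qpow_smooth that(2,1)] fd_power[OF Q_smooth that(1)]) (simp add: q)
  thus ?thesis
   by (simp add: cv_def linear_scale[OF \<Gamma>_lin2[OF that(1)]] q algebra_simps)
 qed
 \<comment> \<open>The curvature \<open>R(a,b)I\<close> without its factor \<open>Q\<^sup>r\<close>: the covariant derivative of \<open>Q\<^sup>q Z\<close>, skew-symmetrized.\<close>
 define z2 where "z2 a b x = (Q x *\<^sub>R cv (cf a) (z b) x + (real q * fd Q x a) *\<^sub>R z b x)
   - (Q x *\<^sub>R cv (cf b) (z a) x + (real q * fd Q x b) *\<^sub>R z a x)" for a b x
 have z2s: "smooth_on W (z2 a b)" for a b
  unfolding z2_def by (intro smooth_intros zs smooth_fd)
 have R1: "RR a b x (I x) = Q x ^ r *\<^sub>R z2 a b x" if x: "x \<in> W" for a b x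
 proof -
  have "cv (cf a) (cv (cf b) I) x = cv (cf a) (%x. Q x ^ q *\<^sub>R z b x) x" for a b
   by (rule cv_cong[OF x]) (simp add: cvI z_def)
  thus ?thesis using ricci_vec[OF x I, of a b] by (simp add: cvQ[OF x zs] z2_def scaleR_diff_right)
 qed
 define y where "y b v x = (SUM c. - h x [z2 v c x, b] *\<^sub>R sh c x)" for b v x
 have ys: "smooth_on W (y b v)" for b v unfolding y_def by (intro smooth_intros z2s)
 have R2: "RR b (I x) x v = Q x ^ r *\<^sub>R y b v x" if x: "x \<in> W" for b v x
 proof -
  have "RR b (I x) x v = (SUM c. h x [c, RR b (I x) x v] *\<^sub>R sh c x)" by (simp only: sh_expand[OF x])
  also have "... = (SUM c. (Q x ^ r * - h x [z2 v c x, b]) *\<^sub>R sh c x)"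
  proof (intro sum.cong refl arg_cong[where f="%z. z *\<^sub>R _"])
   fix c
   have "h x [c, RR b (I x) x v] = - h x [RR v c x (I x), b]"
    using curv_pair[OF x, of b "I x" v c] curv_skew[OF x, of v c b "I x"] h_sym[OF x] by simp
   thus "h x [c, RR b (I x) x v] = Q x ^ r * - h x [z2 v c x, b]" by (simp add: R1[OF x] h_scale[OF x])
  qed
  finally show ?thesis by (simp add: y_def scaleR_sum_right)
 qed
 have mfR: "mf (%x. RR b (I x) x)" for b
 proof -
  have "mf (%x a. RR b a x v)" for v using mf_curv by (simp add: mf_def curv_lin2)
  from mf_app[OF this I] show ?thesis by (simp add: mf_def curv_lin3)
 qed
 have o1: "ord r j (SUM b. ii (sh b) (dact (%x. RR b (I x) x) U))"
  unfolding act_as_ep[OF U mfR]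
  by (intro ord_sum ord_ii ord_ep sh_smooth smooth_const open_W ord_ii_field[OF U ys R2])
 have "NN (cv (cf b) I) U = Qs q (NN (z b) U)" for b
 proof (rule Ten_eqI[OF Ten_NN[OF T] Ten_sm[OF Ten_NN[OF T zs] Qpow_smooth]])
  fix x vs assume "x \<in> W"
  thus "NN (cv (cf b) I) U x vs = Qs q (NN (z b) U) x vs"
   by (simp add: NN_pt[OF T, of "cv _ _"] NN_pt[OF T, of "z b"] cvI z_def linear_scale[OF N_linear[OF T]])
 qed (intro cv_smooth I smooth_const open_W)
 hence "ord q (Suc j) (NN (cv (cf b) I) U)" for b by (rule ordI[OF Frm_NN[OF U zs]])
 hence o2: "ord r j (SUM b. ii (sh b) (NN (cv (cf b) I) U))"
  by (intro ord_sum ord_ii sh_smooth) (rule ord_mono, auto simp: q)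
 have A: "dact (%x v. cv (cf v) I x) T = Qs q (dact Z T)" if "Ten i T" for i T
  using act_cong[OF that, of "%x v. cv (cf v) I x" "%x v. Q x ^ q *\<^sub>R Z x v"] cvI
   act_scale_left[OF that, of "%x. Q x ^ q" Z] by simp
 have o3: "ord r j (dl (dact (%x v. cv (cf v) I x) U))"
  by (rule ord_dl[OF ordI[OF Frm_act[OF U Z] A[OF T, unfolded q]]])
 have o4: "ord r j (dact (%x v. cv (cf v) I x) (dl U))"
  by (rule ord_mono[OF ordI[OF Frm_act[OF Frm_dl[OF U] Z] A[OF Frm_Ten[OF Frm_dl[OF U]]]]]) (simp add: q)
 show ?thesis
  by (simp only: DL_ii[OF U I sa] dl_NN[OF T I] add.assoc add_diff_cancel_left')
   (intro ord_add ord_diff o1 o2 o3 o4)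
qed

end

context homothety begin

section \<open>The formal extension of the Einstein scale\<close>

text \<open>The induction on the exponent is the same for \<open>\<Delta>\<close> on functions and the rough Laplacian on tensors, which have
  opposite signs \<open>s\<close>.\<close>

lemma Qpow_step:
 assumes P: "!!U u. C U ==> wt u U ==> P (sm Q U) = sm Q (P U) + cs (s * (4 * u + 2 * real n + 4)) U"
  and C: "!!U. C U ==> C (sm Q U)" "!!U. C U ==> Ten j U" and T: "C T" "wt w T"
 shows "P (Qs l T) = Qs l (P T) +
  cs (s * (real l * (4 * w + 2 * real n + 4) + 4 * real l * (real l - 1))) (Qs (l - 1) T)"
proof (induction l)
 case 0
 show ?case unfolding power_0 sm_1 by (rule tfield_eqI) simp
next
 case (Suc l)
 have C': "C (Qs i T)" for i
 proof (induction i)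
  case (Suc i)
  thus ?case using C(1)[OF Suc] by (simp only: sm_sm power_Suc)
 qed (simp only: power_0 sm_1 T)
 have e: "Qs (Suc l) T = sm Q (Qs l T)" by (simp only: sm_sm power_Suc)
 show ?case
  unfolding e P[OF C' wt_Qpow[OF C(2)[OF T(1)] T(2)]] Suc
  by (rule tfield_eqI) (cases l; simp add: algebra_simps)
qed

lemma DL_0: "Frm 0 T ==> DL T = dl (dx T)"
 by (simp only: DL_def dl_0[OF Frm_Ten] dx_zero add_0_left)

lemma DL_Q_0: assumes "Frm 0 T" "wt w T"
 shows "DL (sm Q T) = sm Q (DL T) + cs (- 1 * (4 * w + 2 * real n + 4)) T"
proof -
 note T = Frm_Ten[OF assms(1)]
 have "ii X (dx T) = NN X T + cs (real 0) T"
  using cartan_X[OF assms(1)] by (simp only: ii_0[OF T] dx_zero add_0_left)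
 hence i: "ii X (dx T) = cs w T" unfolding assms(2) by (intro tfield_eqI) (simp del: ii_app)
 have "DL (sm Q T) = dl (sm Q (dx T)) + dl (cs 2 (E T))"
  by (simp only: DL_0[OF Frm_sm[OF assms(1) Q_smooth]] dx_Q[OF T]
    dl_add[OF Ten_sm[OF Frm_Ten[OF Frm_dx[OF assms(1)]] Q_smooth] Ten_sm[OF Frm_Ten[OF Frm_E[OF assms(1)]] cf_smooth]])
 also have "... = sm Q (DL T) - cs 2 (cs w T) + cs 2 (- cs w T - E 0 - cs (real n + 2 - real 0) T)"
  by (simp only: dl_Q[OF Frm_Ten[OF Frm_dx[OF assms(1)]]] i dl_cs[OF Frm_Ten[OF Frm_E[OF assms(1)]]] dl_E[OF assms(1)]
    dl_0[OF T] assms(2) DL_0[OF assms(1)])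
 also have "... = sm Q (DL T) + cs (- 1 * (4 * w + 2 * real n + 4)) T"
  by (rule tfield_eqI) (simp add: algebra_simps)
 finally show ?thesis .
qed

lemma DL_Qpow_0: assumes "Frm 0 T" "wt w T"
 shows "DL (Qs l T) = Qs l (DL T) +
  cs (- 1 * (real l * (4 * w + 2 * real n + 4) + 4 * real l * (real l - 1))) (Qs (l - 1) T)"
 by (rule Qpow_step[of "Frm 0" DL "- 1" 0]) (assumption | rule DL_Q_0 Frm_sm Q_smooth Frm_Ten assms)+

text \<open>The extension is corrected order by order.  If the Laplacian is \<open>Q\<^sup>N \<psi>\<close>, then adding a multiple of \<open>Q\<^sup>N\<^sup>+\<^sup>1 \<psi>\<close> removes
  the leading term, as long as \<open>N < n / 2\<close>.\<close>

lemma tau_exists: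
 assumes nq: "n = 2 * Suc q" and T0: "Frm 0 T0" "wt 1 T0"
 shows "\<exists>T \<phi> \<psi>. Frm 0 T & wt 1 T & T = T0 + sm Q \<phi> & Frm 0 \<phi> & Frm 0 \<psi> & DL T = Qs (Suc q) \<psi>"
proof -
 have "\<exists>T \<phi> \<psi>. Frm 0 T & wt 1 T & T = T0 + sm Q \<phi> & Frm 0 \<phi> & Frm 0 \<psi> &
   wt (- 1 - 2 * real N) \<psi> & DL T = Qs N \<psi>" if "N <= Suc q" for N
  using that
 proof (induction N)
  case 0
  have "wt (1 - 1 - 1) (DL T0)"
   unfolding DL_0[OF T0(1)] by (rule wt_dl[OF Frm_dx[OF T0(1)] wt_dx[OF T0]])
  moreover have "1 - 1 - 1 = - 1 - 2 * real 0" by simp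
  moreover have "T0 = T0 + sm Q 0" "DL T0 = Qs 0 (DL T0)" by (rule tfield_eqI, simp)+
  ultimately show ?case using T0 Frm_zero[of 0] Frm_DL[OF T0(1)] by metis
 next
  case (Suc N)
  obtain T \<phi> \<psi> where T: "Frm 0 T" "wt 1 T" "T = T0 + sm Q \<phi>" and f: "Frm 0 \<phi>" "Frm 0 \<psi>"
   and w: "wt (- 1 - 2 * real N) \<psi>" and d: "DL T = Qs N \<psi>" using Suc.IH[OF Suc_leD[OF Suc.prems]] by blast
  \<comment> \<open>The coefficient vanishes for \<open>N = n / 2\<close>, where the extension is obstructed.\<close>
  define c where "c = 1 / ((real N + 1) * (2 * real n - 4 * real N))"
  define T' where "T' = T + cs c (Qs (Suc N) \<psi>)"
  define \<phi>' where "\<phi>' = \<phi> + cs c (Qs N \<psi>)"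
  have nz: "(real N + 1) * (2 * real n - 4 * real N) ~= 0" using Suc.prems nq by simp
  have Fq: "Frm 0 (Qs i \<psi>)" "Frm 0 (cs c (Qs i \<psi>))" for i
   by (intro Frm_sm f Qpow_smooth smooth_const open_W)+
  have wq: "wt ((- 1 - 2 * real N) + 2 * real (Suc N)) (Qs (Suc N) \<psi>)"
   by (rule wt_Qpow[OF Frm_Ten[OF f(2)] w])
  have w1: "wt 1 T'"
  proof -
   have "(- 1 - 2 * real N) + 2 * real (Suc N) = 1" by simp
   hence "wt 1 (Qs (Suc N) \<psi>)" using wq by (simp only:)
   thus ?thesis
    unfolding T'_def by (rule wt_add[OF Frm_Ten[OF T(1)] Frm_Ten[OF Fq(2)] T(2) wt_cs[OF Frm_Ten[OF Fq(1)]]])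
  qed
  have e: "DL T' = Qs N \<psi> + cs c (Qs (Suc N) (DL \<psi>) +
    cs (- 1 * (real (Suc N) * (4 * (- 1 - 2 * real N) + 2 * real n + 4) + 4 * real (Suc N) * (real (Suc N) - 1))) (Qs (Suc N - 1) \<psi>))"
   by (simp only: T'_def DL_add[OF T(1) Fq(2)] DL_cs[OF Fq(1)] DL_Qpow_0[OF f(2) w] d)
  have dT: "DL T' = Qs (Suc N) (cs c (DL \<psi>))"
   unfolding e
  proof (rule tfield_eqI)
   fix x vs
   have "c * ((real N + 1) * (2 * real n - 4 * real N)) = 1" using nz by (simp add: c_def)
   hence "Q x ^ N * \<psi> x vs * (c * ((real N + 1) * (2 * real n - 4 * real N))) = Q x ^ N * \<psi> x vs" by simp
   thus "(Qs N \<psi> + cs c (Qs (Suc N) (DL \<psi>) +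
    cs (- 1 * (real (Suc N) * (4 * (- 1 - 2 * real N) + 2 * real n + 4) + 4 * real (Suc N) * (real (Suc N) - 1))) (Qs (Suc N - 1) \<psi>))) x vs
    = Qs (Suc N) (cs c (DL \<psi>)) x vs"
    by (simp add: algebra_simps)
  qed
  have "wt ((- 1 - 2 * real N) - 1 - 1) (DL \<psi>)"
   unfolding DL_0[OF f(2)] by (rule wt_dl[OF Frm_dx[OF f(2)] wt_dx[OF f(2) w]])
  moreover have "(- 1 - 2 * real N) - 1 - 1 = - 1 - 2 * real (Suc N)" by simp
  ultimately have w2: "wt (- 1 - 2 * real (Suc N)) (cs c (DL \<psi>))"
   using wt_cs[OF Frm_Ten[OF Frm_DL[OF f(2)]]] by simp
  have "T' = T0 + sm Q \<phi>'"
   unfolding T'_def T(3) \<phi>'_def by (rule tfield_eqI) (simp add: algebra_simps)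
  moreover have "Frm 0 T'" "Frm 0 \<phi>'" "Frm 0 (cs c (DL \<psi>))"
   unfolding T'_def \<phi>'_def by (intro Frm_add Fq T f Frm_sm Frm_DL smooth_const open_W)+
  ultimately show ?case using w1 w2 dT by blast
 qed
 from this[OF order_refl] show ?thesis by blast
qed

subsection \<open>Functions vanishing to a given order\<close>

text \<open>Smooth functions that are divisible by \<open>Q\<^sup>r\<close>.\<close>

definition vo :: "nat => ('e => real) => bool" where
 "vo r f \<longleftrightarrow> (\<exists>g. smooth_on W g & (\<forall>x\<in>W. f x = Q x ^ r * g x))"

lemma vo_add: "vo r f ==> vo r g ==> vo r (%x. f x + g x)"
proof -
 assume "vo r f" "vo r g"
 then obtain a b where ab: "smooth_on W a" "smooth_on W b" "\<forall>x\<in>W. f x = Q x ^ r * a x" "\<forall>x\<in>W. g x = Q x ^ r * b x"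
  unfolding vo_def by blast
 show ?thesis unfolding vo_def
  by (rule exI[of _ "%x. a x + b x"]) (use ab in \<open>auto intro!: smooth_add simp: algebra_simps\<close>)
qed
lemma vo_mult: "vo r f ==> smooth_on W g ==> vo r (%x. f x * g x)"
proof -
 assume "vo r f" and g: "smooth_on W g"
 then obtain a where ab: "smooth_on W a" "\<forall>x\<in>W. f x = Q x ^ r * a x" unfolding vo_def by blast
 show ?thesis unfolding vo_def
  by (rule exI[of _ "%x. a x * g x"]) (use ab g in \<open>auto intro!: smooth_mult\<close>)
qed
lemma vo_minus: "vo r f ==> vo r (%x. - f x)"
 using vo_mult[of r f "%_. -1"] by simp
lemma vo_diff: "vo r f ==> vo r g ==> vo r (%x. f x - g x)"
 using vo_add[OF _ vo_minus, of r f g] by simp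
lemma vo_zero: "vo r (%x. 0)" unfolding vo_def by (rule exI[of _ "%_. 0"]) simp
lemma vo_sum: "(!!i. i \<in> A ==> vo r (f i)) ==> vo r (%x. \<Sum>i\<in>A. f i x)"
 by (induction A rule: infinite_finite_induct) (simp_all add: vo_zero vo_add)
lemma vo_mono: "vo r f ==> s <= r ==> vo s f"
proof -
 assume "vo r f" "s <= r"
 then obtain a where a: "smooth_on W a" "\<forall>x\<in>W. f x = Q x ^ r * a x" unfolding vo_def by blast
 show ?thesis unfolding vo_def
  by (rule exI[of _ "%x. Q x ^ (r - s) * a x"])
   (use a \<open>s <= r\<close> in \<open>auto intro!: smooth_mult Qpow_smooth simp: mult.assoc[symmetric] power_add[symmetric]\<close>)
qed
lemma vo_fd: assumes "vo (Suc r) f" shows "vo r (%x. fd f x v)"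
proof -
 obtain g where g: "smooth_on W g" "!!x. x \<in> W ==> f x = Q x ^ Suc r * g x" using assms unfolding vo_def by blast
 have "fd f x v = Q x ^ r * (Q x * fd g x v + real (Suc r) * fd Q x v * g x)" if x: "x \<in> W" for x
 proof -
  have "fd f x v = fd (%x. Q x ^ Suc r * g x) x v" using fd_cong[OF open_W x, of f] g(2) by simp
  also have "... = fd (%x. Q x ^ Suc r) x v * g x + Q x ^ Suc r * fd g x v"
   using fd_mult[OF Qpow_smooth g(1) x, of "Suc r" v] by (simp only: add.commute)
  also have "fd (%x. Q x ^ Suc r) x v = real (Suc r) * Q x ^ r * fd Q x v"
   by (simp only: fd_power[OF Q_smooth x] diff_Suc_1)
  finally show ?thesis by (simp add: algebra_simps)
 qed
 moreover have "smooth_on W (%x. Q x * fd g x v + real (Suc r) * fd Q x v * g x)"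
  by (intro smooth_intros g smooth_fd)
 ultimately show ?thesis unfolding vo_def by blast
qed
lemma vo_cong: "vo r f ==> (!!x. x \<in> W ==> g x = f x) ==> vo r g" by (simp add: vo_def)
lemma vo_sm: "Ten j T ==> vo r (%x. Qs r T x vs)"
 unfolding vo_def by (rule exI[of _ "%x. T x vs"]) (simp add: Ten_smooth)

subsection \<open>The Hessian of a function\<close>

lemma N1: "Ten 1 T ==> x \<in> W ==> N e T x [a] = fd (%y. T y [a]) x e - T x [\<Gamma> x e a]"
 by (simp add: NN_def DD_def)
lemma nab_0: "Ten 0 T ==> x \<in> W ==> nab T x [v] = fd (%y. T y []) x v"
 by (simp add: nab_def NN_def DD_def)
lemma nab_nab_0: assumes "Ten 0 T" "x \<in> W"
 shows "nab (nab T) x [u, v] = fd (%y. fd (%z. T z []) y v) x u - fd (%z. T z []) x (\<Gamma> x u v)"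
proof -
 have "nab (nab T) x [u, v] = N u (nab T) x [v]" by (simp add: nab_def[of "nab T"])
 also have "... = fd (%y. nab T y [v]) x u - nab T x [\<Gamma> x u v]"
  by (rule N1) (use Ten_nab[OF assms(1)] assms(2) in simp_all)
 also have "fd (%y. nab T y [v]) x = fd (%y. fd (%z. T z []) y v) x"
  by (rule fd_cong[OF open_W assms(2)]) (rule nab_0[OF assms(1)])
 finally show ?thesis by (simp only: nab_0[OF assms])
qed

lemma nab_nab_sym: "Ten 0 T ==> nab (nab T) x [u, v] = nab (nab T) x [v, u]"
 using pt[OF HH_commute[of 0 T u v], of x "[]"] by (simp add: nab_def[of "nab T"] N_nab)

lemma dx_nab: assumes "Ten 0 T" shows "dx T = nab T"
proof (rule Ten_eqI[of 1])
 have F: "Frm 0 T" using assms by (simp add: Frm_def alt_def alternating_def Ten_ten)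
 show "Ten 1 (dx T)" "Ten 1 (nab T)" using Frm_Ten[OF Frm_dx[OF F]] Ten_nab[OF assms] by simp_all
 fix x and vs :: "'e list" assume "x \<in> W" "length vs = 1"
 thus "dx T x vs = nab T x vs"
  by (cases vs) (auto simp: dx_loc[OF F] ext_d_loc_def dirderiv_def omit_0 nab_0[OF assms])
qed

lemma gradient:
 assumes T: "Ten 0 T" defines "I == gr (%x. T x [])"
 shows "smooth_on W I" "ii I hT = dx T" "!!x v. x \<in> W ==> h x [I x, v] = fd (%x. T x []) x v"
  "!!x u v. x \<in> W ==> h x [cv (cf u) I x, v] = nab (nab T) x [u, v]"
  "tr (nab (nab T)) = - DL T"
proof -
 note s = Ten_smooth[OF T, of "[]"]
 show I: "smooth_on W I" unfolding I_def by (rule gr_smooth[OF s])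
 show hI: "h x [I x, v] = fd (%x. T x []) x v" if "x \<in> W" for x v
  unfolding I_def by (rule h_gr[OF s that])
 show d: "ii I hT = dx T"
 proof (rule Ten_eqI[of 1])
  show "Ten 1 (ii I hT)" by (rule Ten_ii[OF _ I]) (use Ten_hT in \<open>simp add: numeral_eq_Suc\<close>)
  show "Ten 1 (dx T)" using Ten_nab[OF T] by (simp add: dx_nab[OF T])
  fix x and vs :: "'e list" assume *: "x \<in> W" "length vs = 1"
  then obtain v where "vs = [v]" by (cases vs) auto
  thus "ii I hT x vs = dx T x vs" using * by (simp add: hT_eq hI dx_nab[OF T] nab_0[OF T])
 qed
 show "h x [cv (cf u) I x, v] = nab (nab T) x [u, v]" if "x \<in> W" for x u v
  unfolding dx_nab[OF T, symmetric] d[symmetric]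
  using that by (simp add: nab_def NN_ii[OF Ten_hT I] NN_hT hT_eq)
 have F: "Frm 0 T" using T by (simp add: Frm_def alt_def alternating_def Ten_ten)
 show "tr (nab (nab T)) = - DL T"
  by (simp only: tr_def DL_0[OF F] dl_def dx_nab[OF T] ii_nab[OF Ten_nab[OF T]] minus_minus)
qed

lemma NX_nab: assumes T: "Ten j T" shows "NN X (nab T) = nab (NN X T) - nab T"
proof (rule Ten_eqI[of "Suc j"])
 show "Ten (Suc j) (NN X (nab T))" "Ten (Suc j) (nab (NN X T) - nab T)"
  by (intro Ten_NN Ten_diff Ten_nab T X_smooth)+
 fix x and us :: "'e list" assume x: "x \<in> W" and "length us = Suc j"
 then obtain v vs where us: "us = v # vs" by (cases us) auto
 have "HH v (X x) T x vs = N v (NN X T) x vs - N v T x vs"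
  using pt[OF ii_N_nab[OF T X_smooth, of v], of x vs]
  by (simp add: NN_pt[OF T, of "cv _ _"] cv_X[OF x] N_nab[OF T])
 moreover have "HH (X x) v T x vs = HH v (X x) T x vs"
  using pt[OF HH_commute[OF T, of "X x" v], of x vs]
  by (simp add: tact_def curv_X2[OF x] linear_0[OF ten_slot_linear[OF Ten_ten[OF T]]])
 ultimately show "NN X (nab T) x us = (nab (NN X T) - nab T) x us"
  by (simp add: us NN_pt[OF Ten_nab[OF T], of X] N_nab[OF T]) (simp add: nab_def)
qed

lemma wt_nab: assumes "Ten j T" "wt w T" shows "wt (w - 1) (nab T)"
proof -
 have "nab (cs w T) = cs w (nab T)"
 proof (rule tfield_eqI)
  fix x us show "nab (cs w T) x us = cs w (nab T) x us"
   using NN_cs[OF assms(1), of _ w] by (cases us) (auto simp: nab_def)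
 qed
 thus ?thesis unfolding NX_nab[OF assms(1)] assms(2) by (intro tfield_eqI) (simp add: algebra_simps)
qed

lemma lap_Q: assumes T: "Ten j T" and w: "wt w T"
 shows "lap (sm Q T) = sm Q (lap T) + cs (1 * (4 * w + 2 * real n + 4)) T"
proof (rule Ten_eqI[of j])
 show "Ten j (lap (sm Q T))" "Ten j (sm Q (lap T) + cs (1 * (4 * w + 2 * real n + 4)) T)"
  by (intro Ten_lap Ten_add Ten_sm T Q_smooth smooth_const open_W)+
 fix x and vs :: "'e list" assume x: "x \<in> W"
 note c = cf_smooth
 note TN = Ten_NN[OF T c]
 have hess: "fd (%x. fd Q x b) x a = 2 * h x [a, b] + 2 * h x [X x, \<Gamma> x a b]" for a b
 proof -
  have "fd (%x. fd Q x b) x a = fd (%x. 2 * h x [X x, b]) x a"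
   by (rule fun_cong[OF fd_cong[OF open_W x fd_Q]])
  thus ?thesis
   using fd_mult[OF c h_smooth_fields[OF X_smooth c] x] h_compat[OF x X_smooth c, of b a]
   by (simp add: cv_X[OF x]) (simp add: cv_def)
 qed
 have s: "smooth_on W (%x. fd Q x b)" for b by (rule smooth_fd[OF Q_smooth])
 have "HH a b (sm Q T) x us = Q x * HH a b T x us + 2 * h x [X x, a] * N b T x us + 2 * h x [X x, b] * N a T x us
   + 2 * h x [a, b] * T x us" for a b us
  by (simp add: HH_def NN_sm[OF T Q_smooth] NN_add[OF Ten_sm[OF TN Q_smooth] Ten_sm[OF T s]] NN_sm[OF TN Q_smooth]
   NN_sm[OF T s] hess) (simp add: fd_Q[OF x] algebra_simps)
 hence "lap (sm Q T) x vs = (SUM b. Q x * HH b (sh b x) T x vs + 2 * (h x [b, X x] * N (sh b x) T x vs)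
    + 2 * ((b \<bullet> X x) * N b T x vs) + 2 * T x vs)"
  unfolding lap_def by (simp add: N_nab[OF Ten_sm[OF T Q_smooth]] h_sh[OF x] h_sh2[OF x] h_sym[OF x, of "X x"] ac_simps)
 also have "... = Q x * lap T x vs + 2 * N (X x) T x vs + 2 * N (X x) T x vs + 2 * (real n + 2) * T x vs"
  unfolding sum.distrib sum_distrib_left[symmetric] sh_expand_lin[OF x N_linear[OF T], symmetric] lin_basis[OF N_linear[OF T]]
  by (simp add: dim_n lap_def N_nab[OF T])
 finally show "lap (sm Q T) x vs = (sm Q (lap T) + cs (1 * (4 * w + 2 * real n + 4)) T) x vs"
  using NN_pt[OF T, of X x vs] w by (simp add: algebra_simps)
qed

lemma lap_Qpow: assumes "Ten j T" "wt w T"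
 shows "lap (Qs l T) = Qs l (lap T) +
  cs (1 * (real l * (4 * w + 2 * real n + 4) + 4 * real l * (real l - 1))) (Qs (l - 1) T)"
 by (rule Qpow_step[of "Ten j" lap 1 j]) (assumption | rule lap_Q Ten_sm Q_smooth assms)+

text \<open>The Hessian satisfies an equation of Laplace type, \<open>lap_hessian\<close>.  If it is \<open>Q\<^sup>l U\<close>, then the leading term of its
  Laplacian is a multiple of \<open>Q\<^sup>l\<^sup>-\<^sup>1 U\<close>, with a factor that is nonzero for \<open>0 < l < q\<close>, while all other terms of the equation
  are divisible by \<open>Q\<^sup>l\<close>.  Hence \<open>U\<close> is divisible by \<open>Q\<close>.\<close>

lemma vo_nab_nab: assumes D: "Ten 0 D" and v: "vo (Suc (Suc r)) (%x. D x [])"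
 shows "vo r (%x. nab (nab D) x [u, v])"
proof -
 note s = vo_fd[OF v]
 have "vo r (%x. fd (%y. fd (%z. D z []) y v) x u - (SUM b. fd (%z. D z []) x b * (\<Gamma> x u v \<bullet> b)))"
  by (intro vo_diff vo_sum vo_mult vo_fd[OF s] vo_mono[OF s] smooth_intros) simp
 thus ?thesis
 proof (rule vo_cong)
  fix x assume x: "x \<in> W"
  show "nab (nab D) x [u, v] = fd (%y. fd (%z. D z []) y v) x u - (SUM b. fd (%z. D z []) x b * (\<Gamma> x u v \<bullet> b))"
   unfolding nab_nab_0[OF D x] linear_expand[OF fd_linear[OF Ten_smooth[OF D] x], of "[]" "\<Gamma> x u v"]
   by (simp add: mult.commute)
 qed
qed

lemma hessian_order:
 assumes nq: "n = 2 * Suc q" and q: "q >= 1" and T: "Frm 0 T" "wt 1 T" and psi: "Frm 0 \<psi>" "DL T = Qs (Suc q) \<psi>"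
  and z: "!!x u v. x \<in> W ==> Q x = 0 ==> nab (nab T) x [u, v] = 0"
 shows "\<exists>U. Ten 2 U & nab (nab T) = Qs q U"
proof -
 note T0 = Frm_Ten[OF T(1)]
 define S where "S = nab (nab T)"
 have TS: "Ten 2 S" using Ten_nab[OF Ten_nab[OF T0]] by (simp add: S_def numeral_eq_Suc)
 have wS: "wt (- 1) S" using wt_nab[OF Ten_nab[OF T0] wt_nab[OF T0 T(2)]] by (simp add: S_def)
 note I = gradient[OF T0]
 define D where "D = tr S"
 have D: "Ten 0 D" using Ten_tr[OF TS] by (simp add: D_def)
 have lapS: "lap S x [u, v] = nab (nab D) x [u, v]
   - (SUM b. S x [sh b x, RR b u x v]) - (SUM b c. S x [b, c] * RM x [sh c x, v, u, sh b x])"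
  if x: "x \<in> W" for x u v
 proof -
  have "S = nab (ii (gr (%x. T x [])) hT)" by (simp only: S_def I(2) dx_nab[OF T0])
  from lap_hessian[OF I(1) this nab_nab_sym[OF T0, folded S_def] x] show ?thesis unfolding D_def .
 qed
 have "D = Qs (Suc q) (- \<psi>)" unfolding D_def S_def I(5) psi(2) op_minus ..
 hence vD: "vo (Suc q) (%x. D x [])" by (simp only: vo_sm[OF Ten_minus[OF Frm_Ten[OF psi(1)]]])
 have "\<exists>U. Ten 2 U & S = Qs l U" if "1 <= l" "l <= q" for l
  using that
 proof (induction l rule: dec_induct)
  case base
  have "S x vs = 0" if "x \<in> W" "Q x = 0" for x vs
  proof (cases "length vs = 2")
   case True
   then obtain u v where "vs = [u, v]" by (auto simp: numeral_eq_Suc length_Suc_conv)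
   thus ?thesis using z[OF that] by (simp add: S_def)
  qed (simp add: Ten_len[OF TS])
  then obtain U where U: "Ten 2 U" "S = sm Q U" using Q_divide_zero[OF TS] by blast
  moreover have "sm Q U = Qs 1 U" by (rule tfield_eqI) simp
  ultimately show ?case by metis
 next
  case (step l)
  obtain U where U: "Ten 2 U" "S = Qs l U" using step.IH Suc_leD[OF step.prems] by blast
  have wU: "wt (- 1 - 2 * real l) U" by (rule wt_Q_divide[OF U(1)]) (use wS U(2) in simp)
  define c where "c = 4 * real l * (real q - real l)"
  have c: "c ~= 0" using step by (simp add: c_def)
  have lp: "lap S = Qs l (lap U) + cs c (Qs (l - 1) U)"
   unfolding U(2) lap_Qpow[OF U(1) wU] by (rule tfield_eqI) (simp add: c_def nq algebra_simps)
  have "vo l (%x. c * Q x ^ (l - 1) * U x [u, v])" for u v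
  proof -
   have "vo (q - 1) (%x. nab (nab D) x [u, v])" by (rule vo_nab_nab[OF D]) (use q vD in simp)
   hence 1: "vo l (%x. nab (nab D) x [u, v])" by (rule vo_mono) (use step in simp)
   have Us: "smooth_on W (%x. U x [sh b x, RR b u x v])" for b
    using smooth_on_pullback[OF open_W smooth_id[OF open_W] _ U(1), of "[%x. sh b x, %x. RR b u x v]"] mf_curv[of b u] sh_smooth[of b]
    unfolding mf_def by fastforce
   have Rs: "smooth_on W (%x. RM x [sh c x, v, u, sh b x])" for b c
    using smooth_on_pullback[OF open_W smooth_id[OF open_W] _ Ten_RM, of "[%x. sh c x, %x. v, %x. u, %x. sh b x]"] sh_smooth cf_smooth
    by fastforce
   have vS: "vo l (%x. S x vs)" for vs unfolding U(2) by (rule vo_sm[OF U(1)])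
   have 2: "vo l (%x. S x [sh b x, RR b u x v])" for b
    unfolding vo_def by (rule exI[of _ "%x. U x [sh b x, RR b u x v]"]) (simp add: Us U(2))
   have 3: "vo l (%x. nab (nab D) x [u, v] - (SUM b. S x [sh b x, RR b u x v])
     - (SUM b c. S x [b, c] * RM x [sh c x, v, u, sh b x]) - Qs l (lap U) x [u, v])"
    by (intro vo_diff vo_sum vo_mult 1 2 vS Rs vo_sm[OF Ten_lap[OF U(1)]])
   have "c * Q x ^ (l - 1) * U x [u, v] = nab (nab D) x [u, v] - (SUM b. S x [sh b x, RR b u x v])
     - (SUM b c. S x [b, c] * RM x [sh c x, v, u, sh b x]) - Qs l (lap U) x [u, v]" if "x \<in> W" for x
    unfolding lapS[OF that, symmetric] lp by simp
   thus ?thesis by (rule vo_cong[OF 3])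
  qed note key = this
  have "\<exists>f. smooth_on W f & (\<forall>x\<in>W. U x vs = Q x * f x)" for vs
  proof (cases "length vs = 2")
   case True
   then obtain u v where vs: "vs = [u, v]" by (auto simp: numeral_eq_Suc length_Suc_conv)
   obtain g where g: "smooth_on W g" "!!x. x \<in> W ==> c * Q x ^ (l - 1) * U x [u, v] = Q x ^ l * g x"
    using key[of u v] unfolding vo_def by blast
   have Ql: "Q x ^ l = Q x ^ (l - 1) * Q x" for x using step by (cases l) auto
   have sg: "smooth_on W (%x. g x / c)" by (intro smooth_divide g(1) smooth_const open_W) (use c in simp)
   have "U x [u, v] = Q x * (g x / c)" if x: "x \<in> W" for x
    by (rule Q_cancel[OF Ten_smooth[OF U(1)] smooth_mult[OF open_W Q_smooth sg] _ x, of "l - 1"])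
     (use g(2) c in \<open>simp add: Ql field_simps\<close>)
   thus ?thesis unfolding vs using sg by blast
  next
   case False
   thus ?thesis using Ten_len[OF U(1) False] by (intro exI[of _ "%_. 0"]) simp
  qed
  then obtain V where V: "Ten 2 V" "U = sm Q V" using Q_divide[OF U(1)] by blast
  have "S = Qs (Suc l) V" unfolding U(2) V(2) by (rule tfield_eqI) simp
  thus ?case using V(1) by blast
 qed
 from this[OF q order_refl] show ?thesis unfolding S_def .
qed

text \<open>The Hessian with one index raised, as it is needed for \<open>ord_commutator\<close>.\<close>

lemma gradient_order:
 assumes T: "Frm 0 T" and U: "Ten 2 U" "nab (nab T) = Qs q U"
 shows "\<exists>Z. mf Z & (\<forall>b. \<forall>x\<in>W. cv (cf b) (gr (%x. T x [])) x = Q x ^ q *\<^sub>R Z x b)"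
proof -
 define Z where "Z x b = (SUM c. U x [b, c] *\<^sub>R sh c x)" for x b
 have "mf Z"
  unfolding mf_def
 proof (intro conjI ballI allI)
  show "linear (Z x)" if "x \<in> W" for x
   unfolding Z_def
   by (intro linear_compose_sum ballI) (use Ten_linear[OF U(1), of x] in \<open>auto simp: linear_iff algebra_simps\<close>)
  show "smooth_on W (%x. Z x b)" for b
   unfolding Z_def by (intro smooth_intros Ten_smooth[OF U(1)])
 qed
 moreover have "cv (cf b) (gr (%x. T x [])) x = Q x ^ q *\<^sub>R Z x b" if x: "x \<in> W" for b x
 proof -
  let ?V = "cv (cf b) (gr (%x. T x [])) x"
  have "?V = (SUM c. h x [c, ?V] *\<^sub>R sh c x)" by (simp only: sh_expand[OF x])
  also have "... = (SUM c. (Q x ^ q * U x [b, c]) *\<^sub>R sh c x)"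
   by (intro sum.cong refl arg_cong[where f="%z. z *\<^sub>R _"])
    (simp add: h_sym[OF x, of _ ?V] gradient(4)[OF Frm_Ten[OF T] x] U(2))
  finally show ?thesis by (simp add: Z_def scaleR_sum_right)
 qed
 ultimately show ?thesis by blast
qed

end

context homothety begin

section \<open>Lifts adapted to the scale\<close>

text \<open>Euler's relation for a homogeneous function.\<close>

lemma wt_gradient: assumes T: "Frm 0 T" "wt 1 T" and x: "x \<in> W"
 shows "h x [gr (%x. T x []) x, X x] = T x []" "cv (cf (X x)) (gr (%x. T x [])) x = 0"
  "nab (nab T) x [X x, v] = 0"
proof -
 note T0 = Frm_Ten[OF T(1)]
 have e: "nab T x [X x] = T x []"
  using pt[OF ii_nab[OF T0, of X], of x "[]"] T(2) by simp
 show "h x [gr (%x. T x []) x, X x] = T x []"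
  using e gradient(3)[OF T0 x] nab_0[OF T0 x] by simp
 have "wt (1 - 1) (nab T)" by (rule wt_nab[OF T0 T(2)])
 hence z: "nab (nab T) x [X x, v] = 0" for v
  using pt[OF ii_nab[OF Ten_nab[OF T0], of X], of x "[v]"] by simp
 thus "nab (nab T) x [X x, v] = 0" .
 show "cv (cf (X x)) (gr (%x. T x [])) x = 0"
  by (rule h_eqI[OF x]) (simp only: gradient(4)[OF T0 x] z h_zero[OF x])
qed

lemma dv_Qpow: assumes "x \<in> W" shows "dv (%x. Q x ^ Suc l) x = (2 * (real l + 1) * Q x ^ l) *\<^sub>R fl X x"
proof -
 have "fd (%x. Q x ^ Suc l) x b = ((real l + 1) * Q x ^ l) * fd Q x b" for b
  by (simp only: fd_power[OF Q_smooth assms] diff_Suc_1) simp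
 hence "dv (%x. Q x ^ Suc l) x = ((real l + 1) * Q x ^ l) *\<^sub>R dv Q x"
  by (simp only: dv_def scaleR_sum_right scaleR_scaleR)
 thus ?thesis by (simp add: dv_Q[OF assms] ac_simps)
qed

context
 fixes T0 T \<phi> :: "'e tfield" and I :: "'e => 'e" and Z :: "'e => 'e => 'e" and q :: nat
 assumes T0: "Frm 0 T0" "wt 1 T0" "!!x. x \<in> W ==> T0 x [] ~= 0"
  and T: "Frm 0 T" "wt 1 T" and \<phi>: "Frm 0 \<phi>" "T = T0 + sm Q \<phi>"
  and I_def: "I = gr (%x. T x [])"
  and Z: "mf Z" "!!b x. x \<in> W ==> cv (cf b) I x = Q x ^ q *\<^sub>R Z x b"
begin

lemma I_smooth: "smooth_on W I" unfolding I_def by (rule gradient(1)[OF Frm_Ten[OF T(1)]])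

lemma I_sa: "x \<in> W ==> h x [cv (cf u) I x, v] = h x [u, cv (cf v) I x]"
 using gradient(4)[OF Frm_Ten[OF T(1)], folded I_def, of x u v] gradient(4)[OF Frm_Ten[OF T(1)], folded I_def, of x v u]
  nab_nab_sym[OF Frm_Ten[OF T(1)], of x u v] h_sym[of x u "cv (cf v) I x"] by simp

lemma wt_iI: assumes "Ten j U" "wt w U" shows "wt w (ii I U)"
proof -
 have "ii (cv X I) U = ii (%_. 0) U"
  by (rule ii_cong[OF assms(1)])
   (simp add: cv_lin[OF I_smooth, of _ X] wt_gradient(2)[OF T, folded I_def])
 hence "NN X (ii I U) = ii I (cs w U)"
  by (simp only: NN_ii[OF assms(1) I_smooth] assms(2) ii_zero_left[OF assms(1)] add_0_right)
 thus ?thesis by (simp only: op_sm)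
qed

text \<open>On the cone \<open>\<iota>\<^sub>I\<close> maps \<open>d(Q\<^sup>l\<^sup>+\<^sup>1 R\<^sub>1)\<close> to \<open>2 (l+1) Q\<^sup>l \<tau> R\<^sub>1\<close>, since \<open>I\<close> and \<open>X\<close> have the inner product \<open>\<tau>\<close>.  This determines the
  \<open>R\<^sub>1\<close> that removes the leading term of \<open>\<iota>\<^sub>I F\<close>.  Dividing by the initial extension \<open>T0\<close> instead of \<open>\<tau>\<close> changes higher
  orders only and avoids zeros in the denominator.\<close>

lemma adapt_step:
 assumes F: "Frm (Suc k) F" "dx F = 0" "ii X F = 0" and R: "Frm k R" "ii I F = Qs l R"
 shows "\<exists>P R'. Frm k P & ii X (dx (sm Q P)) = 0 & Frm k R' & ii I (F - dx (sm Q P)) = Qs (Suc l) R'"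
proof -
 \<comment> \<open>The factor in \<open>d(Q\<^sup>l\<^sup>+\<^sup>1) = c Q\<^sup>l X\<close>.\<close>
 define c where "c = 2 * (real l + 1)"
 have c: "c > 0" by (simp add: c_def)
 have sT: "smooth_on W (%x. T0 x [])" "smooth_on W (%x. \<phi> x [])"
  by (rule Ten_smooth[OF Frm_Ten[OF T0(1)]], rule Ten_smooth[OF Frm_Ten[OF \<phi>(1)]])
 have s1: "smooth_on W (%x. 1 / (c * T0 x []))" "smooth_on W (%x. \<phi> x [] / T0 x [])"
  using T0(3) c by (auto intro!: smooth_divide smooth_mult smooth_const open_W sT)
 define R1 where "R1 = sm (%x. 1 / (c * T0 x [])) R"
 define P where "P = Qs l R1"
 define R2 where "R2 = - (ii I (dx R1) + sm (%x. \<phi> x [] / T0 x []) R)"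
 have FR: "Frm k R1" "Frm k R2" "Frm k P"
  unfolding R2_def R1_def P_def by (intro Frm_minus Frm_add Frm_ii Frm_dx Frm_sm R s1 I_smooth Qpow_smooth)+
 have QP: "sm Q P = Qs (Suc l) R1" unfolding P_def by (simp only: sm_sm power_Suc)
 have wF: "wt (- real (Suc k)) F" using CC_inv[OF F, of 0] by simp
 have wR: "wt (- real (Suc k) - 2 * real l) R"
  by (rule wt_Q_divide[OF Frm_Ten[OF R(1)]]) (use wt_iI[OF Frm_Ten[OF F(1)] wF] R(2) in simp)
 have "fd (%x. 1 / (c * T0 x [])) x (X x) = - 1 * (1 / (c * T0 x []))" if x: "x \<in> W" for x
 proof -
  have f: "fd (%x. T0 x []) x (X x) = T0 x []"
   using wt_gradient(1)[OF T0(1,2) x] gradient(3)[OF Frm_Ten[OF T0(1)] x] by simp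
  have "fd (%x. 1 / (c * T0 x [])) x (X x) * (c * T0 x []) + (1 / (c * T0 x [])) * (c * T0 x []) = 0"
  proof -
   have "fd (%x. (1 / (c * T0 x [])) * (c * T0 x [])) x (X x) = fd (%x. 1) x (X x)"
    by (rule fun_cong[OF fd_cong[OF open_W x]]) (use T0(3) c in simp)
   thus ?thesis
    using fd_mult[OF s1(1) smooth_mult[OF open_W cf_smooth[of c] sT(1)] x, of "X x"]
     fd_mult[OF cf_smooth[of c] sT(1) x, of "X x"] f by (simp add: algebra_simps)
  qed
  thus ?thesis using T0(3)[OF x] c by (simp add: field_simps)
 qed
 hence wR1: "wt (- real (Suc k) - 2 * real l + - 1) R1"
  unfolding R1_def by (rule wt_sm[OF Frm_Ten[OF R(1)] s1(1) _ wR])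
 have z0: "U = 0" if U: "Ten j U" "Qs l U = 0" for j U
  by (rule Q_cancel_Ten[OF U(1) Ten_zero, of l]) (simp only: U(2) op_zero)
 have t: "Ten (k - 1) (ii V R)" if "smooth_on W V" for V by (rule Ten_ii'[OF Frm_Ten[OF R(1)] that])
 have RF: "Qs l (ii V R) = ii V (ii I F)" for V by (simp only: R(2) op_sm)
 have "ii X R = 0"
  by (rule z0[OF t[OF X_smooth]]) (simp only: RF ii_ii[OF F(1), of X I] F(3) op_zero minus_zero)
 moreover have "ii I R = 0"
  by (rule z0[OF t[OF I_smooth]]) (simp only: RF self_neg_zero[OF ii_ii[OF F(1)]])
 ultimately have iXR: "ii X R1 = 0" and iIR: "ii I R1 = 0" by (simp_all only: R1_def op_sm op_zero)
 have wP: "wt (- real k) (sm Q P)"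
 proof -
  have "(- real (Suc k) - 2 * real l + - 1) + 2 * real (Suc l) = - real k" by simp
  thus ?thesis unfolding QP using wt_Qpow[OF Frm_Ten[OF FR(1)] wR1, of "Suc l"] by (simp only:)
 qed
 have FQ: "Frm k (sm Q P)" by (intro Frm_sm FR Q_smooth)
 have iXP: "ii X (dx (sm Q P)) = 0"
 proof -
  have "dx (ii X (sm Q P)) = 0" by (simp only: QP op_sm iXR op_zero dx_zero)
  hence "ii X (dx (sm Q P)) = cs (- real k) (sm Q P) + cs (real k) (sm Q P)"
   using cartan_X[OF FQ] by (simp only: wP add_0_left)
  thus ?thesis by (intro tfield_eqI) simp
 qed
 have 1: "dx (sm Q P) = Qs (Suc l) (dx R1) + sm (%x. c * Q x ^ l) (E R1)"
 proof -
  have "ep (dv (%x. Q x ^ Suc l)) R1 = ep (%x. (c * Q x ^ l) *\<^sub>R fl X x) R1"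
   by (rule ep_cong[OF Frm_Ten[OF FR(1)]]) (simp only: dv_Qpow c_def)
  thus ?thesis unfolding QP by (simp only: dx_sm[OF Frm_Ten[OF FR(1)] Qpow_smooth] ep_scale_left)
 qed
 have 2: "ii I (E R1) = sm (%x. T x []) R1"
 proof -
  have "sm (%x. fl X x \<bullet> I x) R1 = sm (%x. T x []) R1"
   by (rule sm_cong[OF Frm_Ten[OF FR(1)]])
    (simp add: Gm_inner h_sym[of _ "X _"] wt_gradient(1)[OF T, folded I_def])
  thus ?thesis by (simp only: ii_ep iIR op_zero diff_zero)
 qed
 have "ii I (F - dx (sm Q P)) = Qs l R - (Qs (Suc l) (ii I (dx R1)) + sm (%x. c * Q x ^ l) (sm (%x. T x []) R1))"
  by (simp only: op_diff op_add op_sm 1 2 R(2))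
 also have "... = Qs (Suc l) R2"
 proof (rule Ten_eqI[of k])
  show "Ten k (Qs l R - (Qs (Suc l) (ii I (dx R1)) + sm (%x. c * Q x ^ l) (sm (%x. T x []) R1)))"
   by (intro Ten_diff Ten_add Ten_sm Ten_ii Frm_Ten Frm_dx R FR Qpow_smooth I_smooth smooth_mult smooth_const open_W T)
    (rule Ten_smooth[OF Frm_Ten[OF T(1)]])
  show "Ten k (Qs (Suc l) R2)" by (intro Ten_sm Frm_Ten FR Qpow_smooth)
  fix x vs assume x: "x \<in> W"
  have "c * Q x ^ l * (T x [] * R1 x vs) = Q x ^ l * R x vs + Q x ^ Suc l * (\<phi> x [] / T0 x [] * R x vs)"
   using T0(3)[OF x] c by (simp add: \<phi>(2) R1_def field_simps)
  thus "(Qs l R - (Qs (Suc l) (ii I (dx R1)) + sm (%x. c * Q x ^ l) (sm (%x. T x []) R1))) x vs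
    = Qs (Suc l) R2 x vs"
   by (simp add: R2_def algebra_simps del: ii_app)
 qed
 finally show ?thesis using FR iXP by blast
qed

lemma adapted_lift:
 assumes E0: "Frm k E0" "ii X (dx E0) = 0"
 shows "\<exists>G R. Frm k G & ii X (dx (E0 + sm Q G)) = 0 & Frm k R & ii I (dx (E0 + sm Q G)) = Qs l R"
proof (induction l)
 case 0
 have "E0 = E0 + sm Q 0" by (simp only: op_zero add_0_right)
 moreover have "A = Qs 0 A" for A by (simp only: power_0 sm_1)
 ultimately show ?case using E0 Frm_zero Frm_ii[OF Frm_dx[OF E0(1)] I_smooth] by metis
next
 case (Suc l)
 then obtain G R where G: "Frm k G" "ii X (dx (E0 + sm Q G)) = 0" "Frm k R" "ii I (dx (E0 + sm Q G)) = Qs l R" by blast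
 let ?E = "E0 + sm Q G"
 have FE: "Frm k ?E" by (intro Frm_add Frm_sm E0 G Q_smooth)
 obtain P R' where P: "Frm k P" "ii X (dx (sm Q P)) = 0" "Frm k R'" "ii I (dx ?E - dx (sm Q P)) = Qs (Suc l) R'"
  using adapt_step[OF Frm_dx[OF FE] dx_dx[OF FE] G(2,3,4)] by blast
 have e: "E0 + sm Q (G - P) = ?E - sm Q P" by (rule tfield_eqI) (simp add: algebra_simps)
 have d: "dx (E0 + sm Q (G - P)) = dx ?E - dx (sm Q P)"
  unfolding e by (rule dx_diff[OF Frm_Ten[OF FE] Frm_Ten[OF Frm_sm[OF P(1) Q_smooth]]])
 have "ii X (dx (E0 + sm Q (G - P))) = 0" by (subst d) (simp only: op_diff G(2) P(2) diff_zero)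
 thus ?case using Frm_diff[OF G(1) P(1)] P(3,4) unfolding d[symmetric] by blast
qed

text \<open>\<open>C\<^sub>l\<^sub>+\<^sub>1 = \<Delta> C\<^sub>l\<close>, as \<open>C\<^sub>l\<close> is closed, so one order is lost in each step; \<open>\<delta>\<close> costs one more.\<close>

lemma CC_orders:
 assumes F: "Frm (Suc (Suc k)) F" "dx F = 0" "ii X F = 0" and R: "Frm (Suc k) R" "ii I F = Qs q R"
 shows "l <= q ==> ord (q - l) (Suc k) (ii I (CC F l))"
  and "l < q ==> ord (q - Suc l) k (ii I (dl (CC F l)))"
proof -
 have 1: "ord (q - l) (Suc k) (ii I (CC F l))" if "l <= q" for l
  using that
 proof (induction l)
  case 0
  show ?case unfolding CC.simps R(2) diff_zero by (rule ordI[OF R(1) refl])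
 next
  case (Suc l)
  then obtain r where r: "q = Suc r" by (cases q) auto
  have a: "Suc (q - Suc l) = q - l" using Suc.prems by simp
  have o1: "ord (q - Suc l) (Suc k) (DL (ii I (CC F l)))"
   by (rule ord_DL) (use Suc in \<open>simp only: a Suc_leD\<close>)
  have C: "dx (CC F l) = 0" using CC_inv[OF F, of l] by simp
  have "ord r (Suc k) (DL (ii I (CC F l)) - ii I (DL (CC F l)))"
   by (rule ord_commutator[OF I_smooth Z(1) r Z(2) I_sa Frm_CC[OF F(1)]])
  hence o2: "ord (q - Suc l) (Suc k) (DL (ii I (CC F l)) - ii I (DL (CC F l)))"
   by (rule ord_mono) (use r in simp)
  have e: "ii I (CC F (Suc l)) = DL (ii I (CC F l)) - (DL (ii I (CC F l)) - ii I (DL (CC F l)))"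
   unfolding CC.simps DL_closed[OF C, symmetric] by (rule tfield_eqI) simp
  show ?case unfolding e by (rule ord_diff[OF o1 o2])
 qed
 thus "l <= q ==> ord (q - l) (Suc k) (ii I (CC F l))" .
 assume l: "l < q"
 have d: "dl (ii I (CC F l)) = - ii I (dl (CC F l))"
  by (rule dl_ii[OF Frm_CC[OF F(1)] I_smooth I_sa])
 have e: "ii I (dl (CC F l)) = - dl (ii I (CC F l))" unfolding d by (rule tfield_eqI) simp
 have "Suc (q - Suc l) = q - l" using l by simp
 thus "ord (q - Suc l) k (ii I (dl (CC F l)))"
  unfolding e using 1[of l] l by (intro ord_minus ord_dl) simp
qed

end

end

section \<open>Pulling back along smooth maps\<close>

context region begin

context
 fixes U :: "'b::euclidean_space set" and e :: "'b => 'e"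
 assumes U: "open U" and e: "smooth_on U e" "!!x. x \<in> U ==> e x \<in> W"
begin

text \<open>The second derivatives of the map are symmetric and drop out by \<open>alt_symmetric_sum\<close>.\<close>

lemma ext_d_pullback:
 assumes C: "Frm j C" and x: "x \<in> U"
 shows "ext_d_loc (%x vs. C (e x) (map (fd e x) vs)) x vs = ext_d_loc C (e x) (map (fd e x) vs)"
proof -
 note T = Frm_Ten[OF C]
 let ?H = "%v y. fd e y v" and ?B = "%u v. fd (%y. fd e y v) x u"
 have om: "map (fd e x) (omit i vs) = omit i (map (fd e x) vs)" for i by (simp add: omit_def take_map drop_map)
 have d: "dirderiv (%x vs. C (e x) (map (fd e x) vs)) x u ws = dirderiv C (e x) (fd e x u) (map (fd e x) ws)
   + (\<Sum>i<length ws. C (e x) ((map (fd e x) ws)[i := ?B u (ws ! i)]))" for u ws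
 proof -
  have m: "map (%V. V y) (map ?H ws) = map (fd e y) ws" for y by simp
  have "fd (%y. C (e y) (map (fd e y) ws)) x u = DD (cf (fd e x u)) C (e x) (map (fd e x) ws)
    + (\<Sum>i<length ws. C (e x) ((map (fd e x) ws)[i := fd (map ?H ws ! i) x u]))"
   using fd_pullback[OF U e T _ x, of "map ?H ws" u] smooth_fd[OF e(1)] unfolding m by (auto simp: comp_def)
  thus ?thesis using e(2)[OF x] by (simp add: dirderiv_def DD_def)
 qed
 have "ext_d_loc (%x vs. C (e x) (map (fd e x) vs)) x vs
   = ext_d_loc C (e x) (map (fd e x) vs)
    + (\<Sum>i<length vs. (-1) ^ i * (\<Sum>l<length vs - 1. C (e x) ((map (fd e x) (omit i vs))[l := ?B (vs ! i) (omit i vs ! l)])))"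
  unfolding ext_d_loc_def d by (simp add: distrib_left sum.distrib om length_omit)
 also have "(\<Sum>i<length vs. (-1) ^ i * (\<Sum>l<length vs - 1. C (e x) ((map (fd e x) (omit i vs))[l := ?B (vs ! i) (omit i vs ! l)]))) = 0"
  by (rule alt_symmetric_sum[OF Frm_alt[OF C]]) (rule fd_symmetric_euclidean[OF U e(1) x])
 finally show ?thesis by simp
qed

end

end

context pmetric begin

text \<open>The covariant derivative of a vector field along the map \<open>e\<close>.\<close>

definition Dv :: "('b::euclidean_space => 'e) => 'b => ('b => 'e) => 'b => 'e" where
 "Dv e u V x = fd V x u + \<Gamma> (e x) (fd e x u) (V x)"

context
 fixes U :: "'b::euclidean_space set" and e :: "'b => 'e"
 assumes U: "open U" and e: "smooth_on U e" "!!x. x \<in> U ==> e x \<in> W"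
begin

lemma along_NN:
 assumes C: "Ten j C" and V: "!!V. V \<in> set Vs ==> smooth_on U V" and x: "x \<in> U"
 shows "fd (%x. C (e x) (map (%V. V x) Vs)) x u = N (fd e x u) C (e x) (map (%V. V x) Vs)
   + (\<Sum>i<length Vs. C (e x) ((map (%V. V x) Vs)[i := Dv e u (Vs ! i) x]))"
proof -
 have "C (e x) ((map (%V. V x) Vs)[i := Dv e u (Vs ! i) x]) = C (e x) ((map (%V. V x) Vs)[i := fd (Vs ! i) x u])
   + C (e x) ((map (%V. V x) Vs)[i := \<Gamma> (e x) (fd e x u) ((Vs ! i) x)])" if "i < length Vs" for i
  using linear_add[OF ten_slot_linear[OF Ten_ten[OF C], of i "map (%V. V x) Vs" "e x"]] that by (simp add: Dv_def)
 thus ?thesis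
  using fd_pullback[OF U e C V x, of Vs u] by (simp add: NN_def tact_def sum.distrib)
qed

lemma
 assumes P: "smooth_on U P" and V: "smooth_on U V"
 shows smooth_\<Gamma>_along: "smooth_on U (%y. \<Gamma> (e y) (P y) (V y))"
  and fd_\<Gamma>_along: "x \<in> U ==> fd (%y. \<Gamma> (e y) (P y) (V y)) x u = fd (%z. \<Gamma> z (P x) (V x)) (e x) (fd e x u)
   + \<Gamma> (e x) (fd P x u) (V x) + \<Gamma> (e x) (P x) (fd V x u)"
proof -
 note f1 = \<Gamma>_lin1 \<Gamma>_smooth e P
 have s: "smooth_on U (%y. \<Gamma> (e y) (P y) v)" for v by (rule smooth_family[OF U open_W f1])
 note f2 = \<Gamma>_lin2[OF e(2)] s smooth_id[OF U] _ V
 show "smooth_on U (%y. \<Gamma> (e y) (P y) (V y))" by (rule smooth_family[where e="%y. y", OF U U f2])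
 assume x: "x \<in> U"
 have "fd (%x. x) x u = u" using fd_eqI[of "%x. x" "%w. w" x] by simp
 thus "fd (%y. \<Gamma> (e y) (P y) (V y)) x u = fd (%z. \<Gamma> z (P x) (V x)) (e x) (fd e x u)
   + \<Gamma> (e x) (fd P x u) (V x) + \<Gamma> (e x) (P x) (fd V x u)"
  using fd_family[where e="%y. y", OF U U f2 x, of u] fd_family[OF U open_W f1 x, of "V x" u] by simp
qed

lemma smooth_Dv: "smooth_on U V ==> smooth_on U (Dv e u V)"
 unfolding Dv_def by (intro smooth_add smooth_\<Gamma>_along smooth_fd U e(1))

lemma Dv_field: assumes "smooth_on W K" "x \<in> U" shows "Dv e u (%x. K (e x)) x = cv (cf (fd e x u)) K (e x)"
 using fd_compose[OF e(1) assms(1,2) e(2)[OF assms(2)]] by (simp add: Dv_def cv_def)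

lemma Dv_compat: assumes V: "smooth_on U V" "smooth_on U Z" and x: "x \<in> U"
 shows "fd (%x. h (e x) [V x, Z x]) x u = h (e x) [Dv e u V x, Z x] + h (e x) [V x, Dv e u Z x]"
proof -
 have "fd (%x. h (e x) [V x, Z x]) x = fd (%x. hT (e x) [V x, Z x]) x"
  by (rule fd_cong[OF U x]) (simp add: hT_eq e(2))
 moreover have "V' \<in> set [V, Z] ==> smooth_on U V'" for V' using V by auto
 ultimately show ?thesis
  using along_NN[OF Ten_hT _ x, of "[V, Z]" u] x by (simp add: NN_hT hT_eq e(2) lessThan_Suc numeral_2_eq_2)
qed

lemma Dv_sym: assumes "x \<in> U" shows "Dv e u (%y. fd e y v) x = Dv e v (%y. fd e y u) x"
 unfolding Dv_def using fd_symmetric_euclidean[OF U e(1) assms, of v u] \<Gamma>_sym[OF e(2)[OF assms]] by simp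

text \<open>The curvature pulled back by a map is the commutator of the derivatives along the map.\<close>

lemma Dv_curv: assumes V: "smooth_on U V" and x: "x \<in> U"
 shows "Dv e u (Dv e v V) x - Dv e v (Dv e u V) x = RR (fd e x u) (fd e x v) (e x) (V x)"
proof -
 note W = e(2)[OF x]
 have 1: "Dv e u (Dv e v V) x = fd (%y. fd V y v) x u + (fd (%z. \<Gamma> z (fd e x v) (V x)) (e x) (fd e x u)
   + \<Gamma> (e x) (fd (%y. fd e y v) x u) (V x) + \<Gamma> (e x) (fd e x v) (fd V x u))
   + (\<Gamma> (e x) (fd e x u) (fd V x v) + \<Gamma> (e x) (fd e x u) (\<Gamma> (e x) (fd e x v) (V x)))" for u v
 proof -
  have "fd (Dv e v V) x u = fd (%y. fd V y v) x u + fd (%y. \<Gamma> (e y) (fd e y v) (V y)) x u"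
   using fd_add[OF smooth_fd[OF V] smooth_\<Gamma>_along[OF smooth_fd[OF e(1)] V] x, of v v u] by (simp add: Dv_def[abs_def])
  thus ?thesis
   by (simp only: Dv_def[of e u "Dv e v V"] fd_\<Gamma>_along[OF smooth_fd[OF e(1)] V x])
    (simp only: Dv_def linear_add[OF \<Gamma>_lin2[OF W]])
 qed
 show ?thesis
  unfolding 1 curv_def
  using fd_symmetric_euclidean[OF U V x, of u v] fd_symmetric_euclidean[OF U e(1) x, of u v] by simp
qed

end

end

section \<open>Sections of the cone\<close>

text \<open>A section of the cone over a coordinate domain \<open>U\<close> of the base that induces the Einstein metric \<open>g\<close>.\<close>

locale cone_section = homothety W h X n + G: pmetric U g
 for W :: "'e::euclidean_space set" and h X n and U :: "'b::euclidean_space set" and g +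
 fixes e :: "'b => 'e" and l :: real
 assumes e_smooth: "smooth_on U e" and e_W: "!!x. x \<in> U ==> e x \<in> W"
  and e_Q: "!!x. x \<in> U ==> Q (e x) = 0"
  and e_metric: "!!x u v. x \<in> U ==> g x [u, v] = h (e x) [fd e x u, fd e x v]"
  and dim_b: "DIM('b) = n" and n2: "n > 2"
  and einstein: "!!x u v. x \<in> U ==> Ric g x u v = l * g x [u, v]"
begin

abbreviation H :: "'b => 'b => 'e" where "H x v == fd e x v"
abbreviation B :: "'b => 'b => 'b => 'e" where "B u v x == Dv e u (%y. fd e y v) x"
abbreviation Xe :: "'b => 'e" where "Xe x == X (e x)"

text \<open>The vectors \<open>H x v\<close> tangent to the section, the null normal \<open>X\<close> and the second null normal \<open>Y\<close> span the ambient
  space.\<close>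

definition is_Y :: "'b => 'e => bool" where
 "is_Y x Y \<longleftrightarrow> h (e x) [Y, Y] = 0 & h (e x) [X (e x), Y] = 1 & (\<forall>v. h (e x) [Y, H x v] = 0)"

lemmas e = e_smooth e_W
lemmas H_lin = fd_linear[OF e_smooth]
lemmas hs [simp] = h_add h_diff h_scale h_neg h_zero

lemma hXH: assumes "x \<in> U" shows "h (e x) [Xe x, H x v] = 0" "h (e x) [H x v, Xe x] = 0"
proof -
 have "fd (%x. Q (e x)) x v = fd (%_. 0) x v"
  by (rule fun_cong[OF fd_cong[OF G.open_W assms]]) (rule e_Q)
 thus "h (e x) [Xe x, H x v] = 0"
  using fd_compose[OF e_smooth Q_smooth assms e_W[OF assms], of v] fd_Q[OF e_W[OF assms]] by simp
 thus "h (e x) [H x v, Xe x] = 0" using h_sym[OF e_W[OF assms]] by simp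
qed

lemma hXX: "x \<in> U ==> h (e x) [Xe x, Xe x] = 0" using e_Q by (simp add: Q_def)

lemma H_expand: assumes "x \<in> U" shows "H x v = (SUM c. (c \<bullet> v) *\<^sub>R H x c)"
 using linear_expand[OF H_lin[OF assms], of v] by (simp add: inner_commute)

lemma Y_exists: assumes x: "x \<in> U" shows "\<exists>Y. is_Y x Y"
proof -
 note W = e_W[OF x] note s = h_sym[OF W]
 obtain w where w: "h (e x) [Xe x, w] ~= 0" using h_nd[OF W] X_nz[OF W] by blast
 define w1 where "w1 = (1 / h (e x) [Xe x, w]) *\<^sub>R w"
 define w2 where "w2 = w1 - H x (SUM b. h (e x) [w1, H x b] *\<^sub>R G.sh b x)"
 define Y where "Y = w2 - (h (e x) [w2, w2] / 2) *\<^sub>R Xe x"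
 have 1: "h (e x) [Xe x, w2] = 1"
  using w W by (simp add: w2_def w1_def hXH[OF x])
 have 2: "h (e x) [w2, H x v] = 0" for v
 proof -
  have l: "linear (%v. h (e x) [w1, H x v])"
   using linear_compose[OF H_lin[OF x] h_lin2[OF W]] by (simp add: comp_def)
  have "h (e x) [H x (SUM b. h (e x) [w1, H x b] *\<^sub>R G.sh b x), H x v] = (SUM b. (b \<bullet> v) * h (e x) [w1, H x b])"
   by (simp add: e_metric[OF x, symmetric] G.h_sum[OF x] G.h_scale[OF x] G.h_sh[OF x] mult.commute)
  also have "... = h (e x) [w1, H x v]" by (rule lin_basis[OF l])
  finally show ?thesis using W by (simp add: w2_def)
 qed
 show ?thesis
  by (rule exI[of _ Y]) (use W 1 2 in \<open>simp add: is_Y_def Y_def hXX[OF x] hXH[OF x] s[of w2 "Xe x"]\<close>)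
qed

text \<open>The frame is injective because its Gram matrix is nondegenerate, so it is a basis by dimension.\<close>

lemma decomp: assumes x: "x \<in> U" and Y: "is_Y x Y"
 shows "Z = (SUM b. h (e x) [Z, H x (G.sh b x)] *\<^sub>R H x b) + h (e x) [Z, Y] *\<^sub>R Xe x + h (e x) [Z, Xe x] *\<^sub>R Y"
proof -
 note W = e_W[OF x] note s = h_sym[OF W]
 have Y': "h (e x) [Y, Y] = 0" "h (e x) [Xe x, Y] = 1" "h (e x) [Y, Xe x] = 1" "h (e x) [Y, H x v] = 0" "h (e x) [H x v, Y] = 0" for v
  using Y s[of Y "Xe x"] s[of Y "H x v"] by (simp_all add: is_Y_def)
 define L where "L = (%(v, a, b). H x v + a *\<^sub>R Xe x + b *\<^sub>R Y :: 'e)"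
 have p: "h (e x) [L (v, a, b), Xe x] = b" "h (e x) [L (v, a, b), Y] = a" "h (e x) [L (v, a, b), H x u] = g x [v, u]" for v a b u
  using W by (simp_all add: L_def Y' hXX[OF x] hXH[OF x] e_metric[OF x])
 have lin: "linear L"
  by (rule linearI) (auto simp: L_def linear_add[OF H_lin[OF x]] linear_scale[OF H_lin[OF x]] algebra_simps)
 have "inj L"
 proof (rule injI)
  fix p q assume "L p = L q"
  moreover obtain v a b v' a' b' where pq: "p = (v, a, b)" "q = (v', a', b')" by (cases p, cases q) auto
  ultimately have "b = b'" "a = a'" "!!u. g x [v, u] = g x [v', u]"
   using p[of v a b] p[of v' a' b'] by metis+
  thus "p = q" using G.h_eqI[OF x] pq by blast
 qed
 hence "surj L"
  by (intro linear_injective_imp_surjective[OF lin]) (simp_all add: dim_n dim_b)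
 then obtain v a b where Z: "Z = L (v, a, b)" by (metis surjD prod.exhaust)
 show ?thesis unfolding Z p G.h_sh2[OF x] H_expand[OF x, of v, symmetric] by (simp add: L_def)
qed

lemma Y_unique: assumes x: "x \<in> U" and Y: "is_Y x Y" "is_Y x Y'" shows "Y' = Y"
proof -
 note W = e_W[OF x] note s = h_sym[OF W]
 have "h (e x) [Y' - Y, H x v] = 0" "h (e x) [Y' - Y, Xe x] = 0" for v
  using Y W s[of Y "Xe x"] s[of Y' "Xe x"] by (simp_all add: is_Y_def)
 hence d: "Y' - Y = h (e x) [Y' - Y, Y] *\<^sub>R Xe x" using decomp[OF x Y(1), of "Y' - Y"] by simp
 have "h (e x) [Y' - Y, Y] = h (e x) [Y', Y]" "h (e x) [Y' - Y, Y'] = - h (e x) [Y, Y']"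
  using Y W by (simp_all add: is_Y_def)
 moreover have "h (e x) [Y' - Y, Y'] = h (e x) [Y' - Y, Y]"
  by (subst d) (use Y W in \<open>simp add: is_Y_def\<close>)
 ultimately have "h (e x) [Y' - Y, Y] = 0" using s[of Y Y'] by simp
 thus ?thesis using d by simp
qed

lemma frame_trace: assumes x: "x \<in> U" and Y: "is_Y x Y"
 and l: "!!v. linear (%u. F u v)" "!!u. linear (%v. F u v)"
 shows "(SUM b. F b (sh b (e x))) = (SUM b. F (H x b) (H x (G.sh b x))) + F (Xe x) Y + (F Y (Xe x) :: real)"
proof -
 let ?I = "Inl ` Basis \<union> {Inr True, Inr False} :: ('b + bool) set"
 let ?u = "case_sum (H x) (%c. if c then Xe x else Y)"
  and ?w = "case_sum (%b. H x (G.sh b x)) (%c. if c then Y else Xe x)"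
 have sum: "(\<Sum>i\<in>?I. f i) = (SUM b. f (Inl b)) + f (Inr True) + f (Inr False)" for f :: "'b + bool => 'z::comm_monoid_add"
 proof -
  have "(\<Sum>i\<in>?I. f i) = sum f (Inl ` Basis) + sum f {Inr True, Inr False}"
   by (rule sum.union_disjoint) auto
  thus ?thesis by (simp add: sum.reindex add.assoc)
 qed
 have "(SUM b. F b (sh b (e x))) = (\<Sum>i\<in>?I. F (?u i) (?w i))"
 proof (rule trace_dual[OF e_W[OF x] _ l])
  show "Z = (\<Sum>i\<in>?I. h (e x) [Z, ?w i] *\<^sub>R ?u i)" for Z unfolding sum using decomp[OF x Y, of Z] by simp
 qed
 thus ?thesis unfolding sum by simp
qed

subsection \<open>The Gauss formula\<close>

lemma B_sym: "x \<in> U ==> B u v x = B v u x" by (rule Dv_sym[OF G.open_W e])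

lemma B_lin: assumes x: "x \<in> U" shows "linear (%u. B u v x)" "linear (%v. B u v x)"
proof -
 have 1: "linear (%u. B u v x)" for v
  unfolding Dv_def
  by (intro linear_compose_add fd_linear[OF smooth_fd[OF e_smooth] x]
    linear_compose[OF H_lin[OF x] \<Gamma>_lin1[OF e_W[OF x]], unfolded comp_def])
 thus "linear (%u. B u v x)" .
 show "linear (%v. B u v x)" using 1[of u] B_sym[OF x, of u] by simp
qed

lemma h_B_X: assumes x: "x \<in> U" shows "h (e x) [B u v x, Xe x] = - g x [u, v]"
proof -
 have sX: "smooth_on U (%x. X (e x))"
  by (rule smooth_compose[OF G.open_W open_W e_smooth X_smooth]) (use e_W in auto)
 have "fd (%x. h (e x) [H x v, Xe x]) x u = fd (%_. 0) x u"
  by (rule fun_cong[OF fd_cong[OF G.open_W x]]) (rule hXH)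
 thus ?thesis
  using Dv_compat[OF G.open_W e smooth_fd[OF e_smooth] sX x, of v u]
  by (simp add: Dv_field[OF G.open_W e X_smooth x] cv_X[OF e_W[OF x]] e_metric[OF x] h_sym[OF e_W[OF x], of "H x v" "H x u"])
qed

text \<open>The tangential part of the second derivative of \<open>e\<close> is given by the Koszul formula for the induced metric.\<close>

lemma h_B_H: assumes x: "x \<in> U" shows "h (e x) [B u v x, H x w] = g x [G.\<Gamma> x u v, w]"
proof -
 have d: "G.Dh x u v w = h (e x) [B u v x, H x w] + h (e x) [B u w x, H x v]" for u v w
 proof -
  have "G.Dh x u v w = fd (%x. h (e x) [H x v, H x w]) x u"
   unfolding G.Dh_def by (rule fun_cong[OF fd_cong[OF G.open_W x]]) (rule e_metric)
  thus ?thesis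
   using Dv_compat[OF G.open_W e smooth_fd[OF e_smooth] smooth_fd[OF e_smooth] x, of v w u] h_sym[OF e_W[OF x], of "H x v" "B u w x"] by simp
 qed
 show ?thesis
  unfolding G.h_christoffel[OF x] d using B_sym[OF x, of u v] B_sym[OF x, of u w] B_sym[OF x, of v w] by simp
qed

lemma B_decomp: assumes x: "x \<in> U" and Y: "is_Y x Y"
 shows "B u v x = H x (G.\<Gamma> x u v) - g x [u, v] *\<^sub>R Y + h (e x) [B u v x, Y] *\<^sub>R Xe x"
proof -
 have *: "(SUM b. h (e x) [B u v x, H x (G.sh b x)] *\<^sub>R H x b) = H x (G.\<Gamma> x u v)"
  by (simp only: h_B_H[OF x] G.h_sh2[OF x] H_expand[OF x, symmetric])
 show ?thesis by (rule trans[OF decomp[OF x Y, of "B u v x", unfolded * h_B_X[OF x]]]) simp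
qed

text \<open>The second fundamental form has the null values \<open>-g\<close> along \<open>Y\<close> and \<open>a\<close> along \<open>X\<close>; products of the two enter.\<close>

lemma gauss: assumes x: "x \<in> U" and Y: "is_Y x Y" defines "a == %u v. h (e x) [B u v x, Y]"
 shows "h (e x) [RR (H x u) (H x v) (e x) (H x w), H x z] = g x [curv g x u v w, z] + g x [v, w] * a u z + a v w * g x [u, z]
   - g x [u, w] * a v z - a u w * g x [v, z]"
proof -
 note W = e_W[OF x] note s = h_sym[OF W]
 have sB: "smooth_on U (%x. B v w x)" for v w by (rule smooth_Dv[OF G.open_W e smooth_fd[OF e_smooth]])
 have BB: "h (e x) [B v w x, B u z x] = g x [G.\<Gamma> x v w, G.\<Gamma> x u z] - g x [v, w] * a u z - a v w * g x [u, z]" for v w u z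
 proof -
  have "h (e x) [B v w x, B u z x] = h (e x) [H x (G.\<Gamma> x v w), B u z x] - g x [v, w] * h (e x) [Y, B u z x] + a v w * h (e x) [Xe x, B u z x]"
   by (subst B_decomp[OF x Y, of v w]) (use W in \<open>simp add: a_def\<close>)
  thus ?thesis
   using h_B_H[OF x, of u z] h_B_X[OF x, of u z] G.h_sym[OF x, of "G.\<Gamma> x v w"]
   by (simp add: s[of "H x _" "B u z x"] s[of Y "B u z x"] s[of "Xe x" "B u z x"] a_def)
 qed
 have 1: "h (e x) [Dv e u (B v w) x, H x z] = g x [fd (%y. G.\<Gamma> y v w) x u + G.\<Gamma> x u (G.\<Gamma> x v w), z] + g x [v, w] * a u z + a v w * g x [u, z]" for u v
 proof -
  have "fd (%x. h (e x) [B v w x, H x z]) x u = fd (%y. g y [G.\<Gamma> y v w, z]) x u"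
   by (rule fun_cong[OF fd_cong[OF G.open_W x]]) (rule h_B_H)
  also have "... = g x [fd (%y. G.\<Gamma> y v w) x u + G.\<Gamma> x u (G.\<Gamma> x v w), z] + g x [G.\<Gamma> x v w, G.\<Gamma> x u z]"
   using G.h_compat[OF x G.\<Gamma>_smooth smooth_const[OF G.open_W], of v w z u] by (simp add: G.cv_def)
  finally show ?thesis
   using Dv_compat[OF G.open_W e sB smooth_fd[OF e_smooth] x, of v w z u] BB[of v w u z] by simp
 qed
 have "h (e x) [RR (H x u) (H x v) (e x) (H x w), H x z] = h (e x) [Dv e u (B v w) x, H x z] - h (e x) [Dv e v (B u w) x, H x z]"
  using arg_cong[OF Dv_curv[OF G.open_W e smooth_fd[OF e_smooth] x, of u v w], of "%V. h (e x) [V, H x z]"] W by simp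
 thus ?thesis unfolding 1 curv_def using x by (simp add: G.h_add G.h_diff)
qed

definition lam :: real where "lam = l / (2 * (real n - 1))"

text \<open>The transversal part of the second fundamental form is found by taking the trace of the Gauss equation.\<close>

lemma B_eq: assumes x: "x \<in> U" and Y: "is_Y x Y"
 shows "B u v x = H x (G.\<Gamma> x u v) - g x [u, v] *\<^sub>R (Y + lam *\<^sub>R Xe x)"
proof -
 note W = e_W[OF x]
 define a where "a u v = h (e x) [B u v x, Y]" for u v
 have al: "linear (%u. a u v)" "linear (%v. a u v)" for u v
  unfolding a_def using linear_compose[OF B_lin(1)[OF x] h_lin[OF W]] linear_compose[OF B_lin(2)[OF x] h_lin[OF W]]
  by (simp_all add: comp_def)
 define t where "t = (SUM b. a (G.sh b x) b)"
 have 1: "0 = l * g x [v, w] + g x [v, w] * t + (real n - 2) * a v w" for v w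
 proof -
  define F where "F p q = h (e x) [RR p (H x v) (e x) (H x w), q]" for p q
  have Fl: "linear (%p. F p q)" "linear (%q. F p q)" for p q
   unfolding F_def using linear_compose[OF curv_lin1[OF W] h_lin[OF W]] h_lin2[OF W] by (simp_all add: comp_def)
  have F0: "F (Xe x) Y = 0" "F Y (Xe x) = 0"
   using curv_skew[OF W, of Y "H x v" "H x w" "Xe x"] W by (simp_all add: F_def curv_X2[OF W] curv_X[OF W])
  have "0 = Ric h (e x) (H x v) (H x w)" using ric[OF W] by simp
  also have "... = (SUM b. F b (sh b (e x)))" unfolding Ric_def F_def by (simp only: h_sh2[OF W])
  also have "... = (SUM b. F (H x b) (H x (G.sh b x)))" unfolding frame_trace[OF x Y Fl] F0 by simp
  also have "... = (SUM b. g x [curv g x b v w, G.sh b x] + g x [v, w] * a b (G.sh b x) + a v w * g x [b, G.sh b x]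
    - g x [b, w] * a v (G.sh b x) - a b w * g x [v, G.sh b x])"
   unfolding F_def gauss[OF x Y] a_def ..
  also have "... = Ric g x v w + g x [v, w] * t + real n * a v w - a v w - a v w"
  proof -
   have i: "(SUM b. g x [curv g x b v w, G.sh b x]) = Ric g x v w" by (simp only: G.h_sh2[OF x] Ric_def)
   have ii: "(SUM b. g x [v, w] * a b (G.sh b x)) = g x [v, w] * t"
    unfolding t_def sum_distrib_left[symmetric] by (simp only: G.trace_flip[OF x al])
   have iii: "(SUM b. a v w * g x [b, G.sh b x]) = real n * a v w"
    by (simp add: G.h_sh2[OF x] dim_b)
   have iv: "(SUM b. g x [b, w] * a v (G.sh b x)) = a v w" by (rule G.sh_expand_lin[OF x al(2), symmetric])
   have v: "(SUM b. a b w * g x [v, G.sh b x]) = a v w"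
    using lin_basis[OF al(1), of v w] by (simp add: G.h_sh2[OF x] mult.commute)
   show ?thesis unfolding sum.distrib sum_subtractf i ii iii iv v ..
  qed
  finally show ?thesis by (simp add: einstein[OF x] algebra_simps)
 qed
 have "0 = (\<Sum>b\<in>(Basis::'b set). l * g x [G.sh b x, b] + g x [G.sh b x, b] * t + (real n - 2) * a (G.sh b x) b)"
  by (simp only: 1[symmetric] sum.neutral_const)
 also have "... = (\<Sum>b\<in>(Basis::'b set). l + t + (real n - 2) * a (G.sh b x) b)"
  by (intro sum.cong refl) (simp add: G.h_sh[OF x])
 also have "... = l * real n + real n * t + (real n - 2) * t"
  unfolding sum.distrib sum_distrib_left[symmetric] t_def[symmetric] by (simp add: dim_b)
 finally have t: "t = - (l * real n) / (2 * (real n - 1))" using n2 by (simp add: field_simps)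
 have "a u v = - lam * g x [u, v]"
 proof -
  have "(real n - 2) * (a u v + lam * g x [u, v]) = (l * g x [u, v] + g x [u, v] * t + (real n - 2) * a u v)"
   unfolding t lam_def using n2 by (simp add: field_simps)
  thus ?thesis using 1[of u v] n2 by simp
 qed
 thus ?thesis using B_decomp[OF x Y, of u v] by (simp add: a_def algebra_simps)
qed

lemma along_H:
 assumes C: "Ten j C" and x: "x \<in> U"
 shows "fd (%x. C (e x) (map (H x) vs)) x u = N (H x u) C (e x) (map (H x) vs)
  + (\<Sum>i<length vs. C (e x) ((map (H x) vs)[i := B u (vs ! i) x]))"
proof -
 have m: "map (%V. V x) (map (%v y. fd e y v) vs) = map (H x) vs" for x by simp
 have sV: "V \<in> set (map (%v y. fd e y v) vs) ==> smooth_on U V" for V using smooth_fd[OF e_smooth] by auto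
 have "fd (%x. C (e x) (map (%V. V x) (map (%v y. fd e y v) vs))) x u = N (H x u) C (e x) (map (%V. V x) (map (%v y. fd e y v) vs))
  + (\<Sum>i<length (map (%v y. fd e y v) vs). C (e x) ((map (%V. V x) (map (%v y. fd e y v) vs))[i := Dv e u (map (%v y. fd e y v) vs ! i) x]))"
  by (rule along_NN[OF G.open_W e C _ x]) (assumption, rule sV)
 thus ?thesis unfolding m by simp
qed

end

context cone_section begin

lemma frame_zero: assumes x: "x \<in> U" and Y: "is_Y x Y" and f: "linear f" "!!v. f (H x v) = 0" "f (Xe x) = 0" "f Y = 0"
 shows "f Z = (0::real)"
 by (subst decomp[OF x Y, of Z])
  (simp add: linear_add[OF f(1)] linear_sum[OF f(1)] linear_scale[OF f(1)] f(2-4))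

subsection \<open>The extended scale along the section\<close>

context
 fixes T \<psi> :: "'e tfield" and q :: nat and s :: real
 assumes T: "Frm 0 T" "wt 1 T" and psi: "Frm 0 \<psi>" "DL T = Qs (Suc q) \<psi>" "q >= 1"
  and Te: "!!x. x \<in> U ==> T (e x) [] = s" and s: "s ~= 0"
begin

abbreviation I :: "'e => 'e" where "I == gr (%x. T x [])"
abbreviation S :: "'e tfield" where "S == nab (nab T)"

lemma T0: "Ten 0 T" by (rule Frm_Ten[OF T(1)])
lemma T1: "Ten 1 (nab T)" using Ten_nab[OF T0] by simp
lemma T2: "Ten 2 S" using Ten_nab[OF T1] by (simp add: numeral_2_eq_2)

lemma hI: "x \<in> U ==> h (e x) [I (e x), H x v] = 0" "x \<in> U ==> h (e x) [I (e x), Xe x] = s"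
 "y \<in> W ==> nab T y [z] = h y [I y, z]"
proof -
 show "y \<in> W ==> nab T y [z] = h y [I y, z]" by (simp add: nab_0[OF T0] gradient(3)[OF T0])
 show "x \<in> U ==> h (e x) [I (e x), Xe x] = s" using wt_gradient(1)[OF T e_W] Te by simp
 assume x: "x \<in> U"
 have "fd (%x. T (e x) []) x v = fd (%_. s) x v"
  by (rule fun_cong[OF fd_cong[OF G.open_W x]]) (rule Te)
 thus "h (e x) [I (e x), H x v] = 0"
  using fd_compose[OF e_smooth Ten_smooth[OF T0] x e_W[OF x], of "[]" v] gradient(3)[OF T0 e_W[OF x]] by simp
qed

text \<open>The second derivatives of the constant \<open>\<tau>\<close> along the section show that the tangential part of the Hessian is a
  multiple of \<open>g\<close>; it has no trace, since \<open>\<tau>\<close> is harmonic on the cone.\<close>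

lemma S_HH: assumes x: "x \<in> U" and Y: "is_Y x Y"
 shows "h (e x) [I (e x), Y] = - lam * s" "S (e x) [H x u, H x v] = 0"
proof -
 note W = e_W[OF x]
 have 1: "S (e x) [H x u, H x v] = g x [u, v] * (h (e x) [I (e x), Y] + lam * s)" for u v
 proof -
  have "fd (%x. nab T (e x) [H x v]) x u = fd (%_. 0) x u"
   by (rule fun_cong[OF fd_cong[OF G.open_W x]]) (simp add: hI(3)[OF e_W] hI(1))
  hence "0 = N (H x u) (nab T) (e x) [H x v] + nab T (e x) [B u v x]"
   using along_H[OF T1 x, of "[v]" u] by simp
  hence "S (e x) [H x u, H x v] = - h (e x) [I (e x), B u v x]"
   by (simp add: nab_def[of "nab T"] hI(3)[OF W])
  thus ?thesis
   unfolding B_eq[OF x Y] using W by (simp add: hI(1,2)[OF x] algebra_simps)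
 qed
 have "0 = (SUM b. S (e x) [b, sh b (e x)])"
  using pt[OF gradient(5)[OF T0], of "e x" "[]"] psi(2) e_Q[OF x] by (simp add: tr_app)
 also have "... = (SUM b. g x [b, G.sh b x] * (h (e x) [I (e x), Y] + lam * s))"
  unfolding frame_trace[OF x Y, of "%u v. S (e x) [u, v]", OF Ten_linear[OF T2] Ten_lin2[OF T2]] 1
  using wt_gradient(3)[OF T W] nab_nab_sym[OF T0, of "e x" Y "Xe x"] by simp
 also have "... = real n * (h (e x) [I (e x), Y] + lam * s)" by (simp add: G.h_sh2[OF x] dim_b)
 finally show "h (e x) [I (e x), Y] = - lam * s" using n2 by simp
 thus "S (e x) [H x u, H x v] = 0" by (simp add: 1)
qed

lemma I_eq: assumes x: "x \<in> U" and Y: "is_Y x Y" shows "I (e x) = s *\<^sub>R (Y - lam *\<^sub>R Xe x)"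
 using decomp[OF x Y, of "I (e x)"] by (simp add: hI(1,2)[OF x] S_HH[OF x Y] algebra_simps)

text \<open>The length of the gradient is constant along the section by \<open>S_HH\<close>.\<close>

lemma S_H: assumes x: "x \<in> U" and Y: "is_Y x Y" shows "S (e x) [H x w, Z] = 0"
proof (rule frame_zero[OF x Y Ten_lin2[OF T2] S_HH(2)[OF x Y]])
 note W = e_W[OF x]
 show X0: "S (e x) [H x w, Xe x] = 0"
  using wt_gradient(3)[OF T W] nab_nab_sym[OF T0, of "e x" "H x w" "Xe x"] by simp
 \<comment> \<open>Differentiated along \<open>H x w\<close>, this gives the Hessian on \<open>H x w\<close> and the gradient, hence on \<open>H x w\<close> and \<open>Y\<close>.\<close>
 have II: "h (e y) [I (e y), I (e y)] = - 2 * lam * s\<^sup>2" if y: "y \<in> U" for y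
 proof -
  obtain Y' where Y': "is_Y y Y'" using Y_exists[OF y] by blast
  have "h (e y) [I (e y), I (e y)] = s * (h (e y) [I (e y), Y'] - lam * h (e y) [I (e y), Xe y])"
   by (subst (2) I_eq[OF y Y']) (use e_W[OF y] in simp)
  thus ?thesis by (simp add: hI(1,2)[OF y] S_HH(1)[OF y Y'] power2_eq_square)
 qed
 have sI: "smooth_on W I" by (rule gradient(1)[OF T0])
 have sIe: "smooth_on U (%y. I (e y))" by (rule smooth_compose[OF G.open_W open_W e_smooth sI]) (use e_W in auto)
 have "fd (%y. h (e y) [I (e y), I (e y)]) x w = fd (%_. - 2 * lam * s\<^sup>2) x w"
  by (rule fun_cong[OF fd_cong[OF G.open_W x]]) (rule II)
 hence "h (e x) [cv (cf (H x w)) I (e x), I (e x)] = 0"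
  using Dv_compat[OF G.open_W e sIe sIe x, of w] h_sym[OF W, of "I (e x)" "cv (cf (H x w)) I (e x)"]
  by (simp add: Dv_field[OF G.open_W e sI x])
 hence "S (e x) [H x w, I (e x)] = 0" by (simp add: gradient(4)[OF T0 W])
 hence "s * (S (e x) [H x w, Y] - lam * S (e x) [H x w, Xe x]) = 0"
  unfolding I_eq[OF x Y]
  by (simp add: linear_scale[OF Ten_lin2[OF T2]] linear_diff[OF Ten_lin2[OF T2]])
 thus "S (e x) [H x w, Y] = 0" using s X0 by simp
qed

text \<open>The last component is the one in the direction of \<open>Y\<close> twice.  It is found from the divergence of the Hessian,
  which vanishes on the cone because the Laplacian of \<open>\<tau>\<close> vanishes there to second order.\<close>

lemma hessian_section: assumes x: "x \<in> U" shows "S (e x) [u, v] = 0"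
proof -
 note W = e_W[OF x]
 obtain Y where Y: "is_Y x Y" using Y_exists[OF x] by blast
 have SX: "S (e x) [Xe x, Z] = 0" "S (e x) [Z, Xe x] = 0" for Z
  using wt_gradient(3)[OF T W] nab_nab_sym[OF T0, of "e x" Z "Xe x"] by simp_all
 have sI: "smooth_on W I" by (rule gradient(1)[OF T0])
 have sIe: "smooth_on U (%y. I (e y))" by (rule smooth_compose[OF G.open_W open_W e_smooth sI]) (use e_W in auto)
 define F where "F p r = N p S (e x) [r, I (e x)]" for p r
 have TS: "Ten 3 (nab S)" using Ten_nab[OF T2] by (simp add: numeral_3_eq_3 numeral_2_eq_2)
 have Fl: "linear (%p. F p r)" "linear (%r. F p r)" for p r
  using Ten_linear[OF TS, of "e x" "[r, I (e x)]"] Ten_lin2[OF TS, of "e x" p "[I (e x)]"] by (simp_all add: F_def nab_def[of S])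
 have FH: "F (H x b) (H x w) = g x [b, w] * S (e x) [Y, I (e x)]" for b w
 proof -
  let ?Vs = "[%y. H y w, %y. I (e y)]"
  have sV: "V \<in> set ?Vs ==> smooth_on U V" for V using smooth_fd[OF e_smooth] sIe by auto
  have "fd (%y. S (e y) (map (%V. V y) ?Vs)) x b = N (H x b) S (e x) (map (%V. V x) ?Vs)
   + (\<Sum>i<length ?Vs. S (e x) ((map (%V. V x) ?Vs)[i := Dv e b (?Vs ! i) x]))"
   by (rule along_NN[OF G.open_W e T2 _ x]) (assumption, rule sV)
  moreover have "fd (%y. S (e y) [H y w, I (e y)]) x b = fd (%_. 0) x b"
   by (rule fun_cong[OF fd_cong[OF G.open_W x]]) (use Y_exists S_H in blast)
  ultimately have "F (H x b) (H x w) = - S (e x) [B b w x, I (e x)]"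
   by (simp add: F_def lessThan_Suc S_H[OF x Y])
  thus ?thesis
   unfolding B_eq[OF x Y]
   by (simp add: linear_diff[OF Ten_linear[OF T2]] linear_scale[OF Ten_linear[OF T2]] linear_add[OF Ten_linear[OF T2]] S_H[OF x Y] SX)
 qed
 have wS: "wt (1 - 1 - 1) S" by (rule wt_nab[OF T1 wt_nab[OF T0 T(2)]])
 have FX: "F (Xe x) Y = - S (e x) [Y, I (e x)]"
  unfolding F_def NN_pt[OF T2, of X, symmetric] wS by simp
 have FY: "F Y (Xe x) = - S (e x) [Y, I (e x)]"
 proof -
  have z: "ii X S = 0"
  proof (rule Ten_eqI[of 1])
   show "Ten 1 (ii X S)" by (rule Ten_ii[OF _ X_smooth]) (use T2 in \<open>simp add: numeral_2_eq_2\<close>)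
   show "Ten 1 0" by (rule Ten_zero)
   fix x and vs :: "'e list" assume "x \<in> W" "length vs = 1"
   thus "ii X S x vs = 0 x vs" by (cases vs) (auto simp: wt_gradient(3)[OF T])
  qed
  have c: "ii (cv (cf Y) X) S (e x) = ii (cf Y) S (e x)" by (intro ext) (simp add: cv_X[OF W])
  have "0 = ii X (N Y S) + ii (cv (cf Y) X) S"
   using NN_ii[OF T2 X_smooth, of "cf Y"] by (simp only: z NN_zero)
  from pt[OF this, of "e x" "[I (e x)]"] show ?thesis
   using fun_cong[OF c, of "[I (e x)]"] by (simp add: F_def)
 qed
 have "0 = lap (nab T) (e x) [I (e x)]"
 proof -
  have F: "Frm 1 (dx T)" using Frm_dx[OF T(1)] by simp
  have "DL (dx T) (e x) [I (e x)] = 0"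
  proof -
   have vq: "vo (Suc q) (%x. DL T x [])" unfolding psi(2) by (rule vo_sm[OF Frm_Ten[OF psi(1)]])
   obtain a where "!!y. y \<in> W ==> fd (%x. DL T x []) y (I (e x)) = Q y ^ q * a y"
    using vo_fd[OF vq, of "I (e x)"] unfolding vo_def by blast
   hence "fd (%x. DL T x []) (e x) (I (e x)) = 0" using W e_Q[OF x] psi(3) by simp
   thus ?thesis
    unfolding dx_DL[OF T(1), symmetric] dx_nab[OF Frm_Ten[OF Frm_DL[OF T(1)]]]
    using nab_0[OF Frm_Ten[OF Frm_DL[OF T(1)]] W] by simp
  qed
  thus ?thesis
   using pt[OF DL_weitz[OF F], of "e x" "[I (e x)]"]
   by (simp add: WW_loc[OF F W, unfolded dx_nab[OF T0]] curv_sharp_def dx_nab[OF T0] lessThan_Suc)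
 qed
 also have "... = (SUM b. F b (sh b (e x)))" by (simp add: lap_def F_def)
 also have "... = (real n - 2) * S (e x) [Y, I (e x)]"
  unfolding frame_trace[OF x Y Fl] FH FX FY by (simp add: G.h_sh2[OF x] dim_b algebra_simps)
 finally have "S (e x) [Y, I (e x)] = 0" using n2 by simp
 hence "s * (S (e x) [Y, Y] - lam * S (e x) [Y, Xe x]) = 0"
  unfolding I_eq[OF x Y] by (simp add: linear_scale[OF Ten_lin2[OF T2]] linear_diff[OF Ten_lin2[OF T2]])
 hence YY: "S (e x) [Y, Y] = 0" using s SX by simp
 have YZ: "S (e x) [Y, v] = 0"
  by (rule frame_zero[OF x Y Ten_lin2[OF T2] _ SX(2) YY]) (use S_H[OF x Y] nab_nab_sym[OF T0] in metis)
 show ?thesis by (rule frame_zero[OF x Y Ten_linear[OF T2, of "e x" "[v]"] S_H[OF x Y] SX(1) YZ])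
qed

end

subsection \<open>The codifferential along the section\<close>

lemma alt_exchange: assumes "alt j t" "i < length us" shows "t (us ! i # us[i := P]) = - t (P # us)"
proof -
 have a: "alt (j - 1) (%vs. t (w # vs))" for w by (rule alt_hd[OF assms(1)])
 have "t (us ! i # us[i := P]) = (-1) ^ i * t (us ! i # P # omit i us)" by (rule alt_move[OF a assms(2)])
 also have "... = - ((-1) ^ i * t (P # us ! i # omit i us))" using alt_swap[OF assms(1), of "us ! i" P] by simp
 also have "(-1) ^ i * t (P # us ! i # omit i us) = t (P # us[i := us ! i])" by (rule alt_move[OF a assms(2), symmetric])
 finally show ?thesis by simp
qed

text \<open>By \<open>B_eq\<close> the connections of the ambient space and of the section differ by \<open>-g \<otimes> (Y + \<lambda>X)\<close>.\<close>

lemma codiff_pullback: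
 assumes C: "Frm (Suc k) C" and x: "x \<in> U" and Y: "is_Y x Y" and vs: "length vs = k"
 shows "codiff_loc g (%x vs. C (e x) (map (H x) vs)) x vs =
  - (SUM b. N (H x b) C (e x) (map (H x) (G.sh b x # vs))) + (real n - real k) * C (e x) ((Y + lam *\<^sub>R Xe x) # map (H x) vs)"
proof -
 note TC = Frm_Ten[OF C]
 let ?P = "Y + lam *\<^sub>R Xe x" and ?c = "%x vs. C (e x) (map (H x) vs)"
 have nb: "nabla g ?c x (b # ws) = N (H x b) C (e x) (map (H x) ws) - (\<Sum>i<length ws. g x [b, ws ! i] * C (e x) ((map (H x) ws)[i := ?P]))" for b ws
 proof -
  have "C (e x) ((map (H x) ws)[i := B b (ws ! i) x]) = C (e x) (map (H x) (ws[i := G.\<Gamma> x b (ws ! i)])) - g x [b, ws ! i] * C (e x) ((map (H x) ws)[i := ?P])"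
   if "i < length ws" for i
  proof -
   have l: "linear (%w. C (e x) ((map (H x) ws)[i := w]))" using ten_slot_linear[OF Ten_ten[OF TC]] that by simp
   show ?thesis unfolding B_eq[OF x Y] linear_diff[OF l] linear_scale[OF l] by (simp add: map_update)
  qed
  thus ?thesis
   by (simp add: nabla_def dirderiv_def along_H[OF TC x] sum_subtractf)
 qed
 have s: "(SUM b. \<Sum>i<Suc k. g x [b, (G.sh b x # vs) ! i] * C (e x) ((map (H x) (G.sh b x # vs))[i := ?P]))
   = (real n - real k) * C (e x) (?P # map (H x) vs)"
 proof -
  have l: "linear (%w. C (e x) (H x w # us))" for us
   using linear_compose[OF H_lin[OF x] Ten_linear[OF TC]] by (simp add: comp_def)
  have 1: "(SUM b. g x [b, vs ! i] * C (e x) (H x (G.sh b x) # (map (H x) vs)[i := ?P])) = - C (e x) (?P # map (H x) vs)"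
   if "i < k" for i
   using alt_exchange[OF Frm_alt[OF C, of "e x"], of i "map (H x) vs" ?P] G.sh_expand_lin[OF x l, of "vs ! i" "(map (H x) vs)[i := ?P]"] that vs
   by simp
  have "(SUM b. \<Sum>i<Suc k. g x [b, (G.sh b x # vs) ! i] * C (e x) ((map (H x) (G.sh b x # vs))[i := ?P]))
   = (\<Sum>b\<in>(Basis::'b set). C (e x) (?P # map (H x) vs)) + (SUM b. \<Sum>i<k. g x [b, vs ! i] * C (e x) (H x (G.sh b x) # (map (H x) vs)[i := ?P]))"
   unfolding sum.lessThan_Suc_shift sum.distrib by (simp add: G.h_sh2[OF x])
  also have "(SUM b. \<Sum>i<k. g x [b, vs ! i] * C (e x) (H x (G.sh b x) # (map (H x) vs)[i := ?P])) = (\<Sum>i<k. - C (e x) (?P # map (H x) vs))"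
   by (subst sum.swap) (intro sum.cong refl 1, simp)
  finally show ?thesis by (simp add: dim_b algebra_simps)
 qed
 show ?thesis
  unfolding codiff_loc_def nb sum_subtractf using s vs by simp
qed

text \<open>The codifferential is a trace over a null frame.  Its tangential part is the codifferential of the pullback up to
  zero order terms; the other two terms are derivatives along \<open>X\<close>, known from the weight, and along \<open>Y\<close>, known from \<open>\<iota>\<^sub>X C\<close>.\<close>

lemma dl_section:
 fixes p :: real
 assumes C: "Frm (Suc k) C" and x: "x \<in> U" and Y: "is_Y x Y" and vs: "length vs = k"
  and w: "wt (- (real k + 1 + p)) C" and X: "ii X C = cs (- p) D"
  and CY: "C (e x) (Y # map (H x) vs) = - lam * p * D (e x) (map (H x) vs)"
  and D: "Ten k D" "p * N Y D (e x) (map (H x) vs) = - p * lam * (real k + p) * D (e x) (map (H x) vs)"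
 shows "dl C (e x) (map (H x) vs) = codiff_loc g (%x vs. C (e x) (map (H x) vs)) x vs
  + 2 * lam * p * (real n - 1 - 2 * real k - p) * D (e x) (map (H x) vs)"
proof -
 note TC = Frm_Ten[OF C]  note W = e_W[OF x]
 let ?vs = "map (H x) vs"
 have CX: "C (e x) (Xe x # ?vs) = - p * D (e x) ?vs"
  using fun_cong[OF fun_cong[OF X, of "e x"], of ?vs] by simp
 define F where "F a b = N a C (e x) (b # ?vs)" for a b
 have TN: "Ten (Suc (Suc k)) (nab C)" by (rule Ten_nab[OF TC])
 have Fl: "linear (%a. F a b)" "linear (%b. F a b)" for a b
  using Ten_linear[OF TN, of "e x" "b # ?vs"] Ten_lin2[OF TN, of "e x" a ?vs] by (simp_all add: F_def nab_def)
 have FX: "F (Xe x) Y = (real k + 1 + p) * lam * p * D (e x) ?vs"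
  unfolding F_def NN_pt[OF TC, of X, symmetric] w using CY by (simp add: algebra_simps)
 have FY: "F Y (Xe x) = - p * N Y D (e x) ?vs + lam * p * D (e x) ?vs"
 proof -
  have c: "ii (cv (cf Y) X) C (e x) = ii (cf Y) C (e x)" by (intro ext) (simp add: cv_X[OF W])
  have "cs (- p) (N Y D) = ii X (N Y C) + ii (cv (cf Y) X) C"
   using NN_ii[OF TC X_smooth, of "cf Y"] by (simp only: X NN_cs[OF D(1)])
  from fun_cong[OF fun_cong[OF this, of "e x"], of ?vs] show ?thesis
   using fun_cong[OF c, of ?vs] CY by (simp add: F_def)
 qed
 have "- dl C (e x) ?vs = (SUM b. F b (sh b (e x)))" by (simp add: dl_def F_def)
 also have "... = (SUM b. N (H x b) C (e x) (map (H x) (G.sh b x # vs))) + F (Xe x) Y + F Y (Xe x)"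
  unfolding frame_trace[OF x Y Fl] by (simp add: F_def)
 finally have 1: "- dl C (e x) ?vs = (SUM b. N (H x b) C (e x) (map (H x) (G.sh b x # vs))) + F (Xe x) Y + F Y (Xe x)" .
 have P: "C (e x) ((Y + lam *\<^sub>R Xe x) # ?vs) = - 2 * lam * p * D (e x) ?vs"
  using CX CY by (simp add: linear_add[OF Ten_linear[OF TC]] linear_scale[OF Ten_linear[OF TC]])
 show ?thesis
  using 1 codiff_pullback[OF C x Y vs] D(2) unfolding P FX FY by (simp add: algebra_simps)
qed

end

section \<open>Local fields given by expressions with irrelevant values\<close>

context region begin

text \<open>Coordinate expressions of forms on a manifold are arbitrary off the domain and on lists of the wrong length.  The
  differential operators do not see these values.\<close>

definition agr :: "nat => 'e tfield => 'e tfield => bool" where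
 "agr j S T \<longleftrightarrow> (\<forall>x\<in>W. \<forall>vs. length vs = j --> S x vs = T x vs)"

lemma agr_dirderiv: "agr j S T ==> x \<in> W ==> length vs = j ==> dirderiv S x v vs = dirderiv T x v vs"
 unfolding dirderiv_def by (rule fun_cong[OF fd_cong[OF open_W]]) (auto simp: agr_def)

end

context pmetric begin

lemma agr_dx: "agr j S T ==> Frm j T ==> agr (Suc j) (ext_d_loc S) (dx T)"
 by (simp add: agr_def dx_loc) (simp add: ext_d_loc_def agr_dirderiv[of j S T] agr_def length_omit)

lemma agr_nab: "agr j S T ==> Ten j T ==> agr (Suc j) (nabla h S) (nab T)"
proof (unfold agr_def, intro ballI allI impI)
 fix x and us :: "'e list" assume *: "\<forall>x\<in>W. \<forall>vs. length vs = j --> S x vs = T x vs" "Ten j T" and x: "x \<in> W" and "length us = Suc j"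
 then obtain v vs where us: "us = v # vs" "length vs = j" by (cases us) auto
 have "nabla h S x us = nabla h T x us"
  using * x us agr_dirderiv[of j S T x vs v] by (simp add: nabla_def agr_def)
 also have "... = nab T x us" using nabla_NN[OF *(2) x refl, of "cf v" vs] us by (simp add: nab_def)
 finally show "nabla h S x us = nab T x us" .
qed

lemma agr_dl: "agr (Suc j) S T ==> Ten (Suc j) T ==> agr j (codiff_loc h S) (dl T)"
 using agr_nab[of "Suc j" S T] by (simp add: agr_def codiff_loc_def dl_def nab_def)

end

lemma (in rflat) agr_DL: assumes "agr j S T" "Frm j T" shows "agr j (Delta_sharp_loc h S) (DL T)"
proof -
 note T = Frm_Ten[OF assms(2)]
 have 1: "agr (Suc j) (nabla h S) (nab T)" "agr (Suc j) (nabla h T) (nab T)"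
  using agr_nab[OF assms(1) T] agr_nab[OF _ T, of T] by (simp_all add: agr_def)
 have "agr (Suc (Suc j)) (nabla h (nabla h S)) (nab (nab T))" "agr (Suc (Suc j)) (nabla h (nabla h T)) (nab (nab T))"
  by (rule agr_nab[OF 1(1) Ten_nab[OF T]], rule agr_nab[OF 1(2) Ten_nab[OF T]])
 thus ?thesis
  using assms(1) by (simp add: agr_def DL_loc[OF assms(2)] Delta_sharp_loc_def curv_sharp_def)
qed

context homothety begin

lemma agr_E: "agr j S T ==> agr (Suc j) (flat_wedge_loc h X S) (E T)"
 by (simp add: agr_def flat_wedge_loc_def tep_def Gm_inner length_omit)

lemma agr_iotaD: assumes "agr (Suc j) S T" "Frm (Suc j) T" shows "agr j (iota_D_sharp_loc n w h X S) (iotaD w T)"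
proof -
 note T = Frm_Ten[OF assms(2)]
 have "iota_D_sharp_loc n w h X S x vs = iotaD w T x vs" if x: "x \<in> W" "length vs = j" for x vs
 proof -
  have "iota_D_sharp_loc n w h X S x vs = (SUM b. (real n + 2 * w - 2) * nab T x (b # sh b x # vs) + h x [b, X x] * DL T x (sh b x # vs))"
   unfolding iota_D_sharp_loc_def D_sharp_loc_def list.case
   using agr_nab[OF assms(1) T] agr_DL[OF assms] x h_sym[OF x(1)] by (simp add: agr_def)
  also have "... = - (real n + 2 * w - 2) * dl T x vs + DL T x (X x # vs)"
   unfolding sum.distrib sh_expand_lin[OF x(1) Ten_linear[OF Frm_Ten[OF Frm_DL[OF assms(2)]]], symmetric]
   by (simp add: dl_def nab_def sum_distrib_left[symmetric]) (simp add: algebra_simps)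
  finally show ?thesis by (simp add: iotaD_def)
 qed
 thus ?thesis by (simp add: agr_def)
qed

lemma agr_bbL: assumes "agr j S T" "Frm j T"
 shows "agr j ((Delta_sharp_loc h ^^ m) (iota_D_sharp_loc n w h X (flat_wedge_loc h X S))) ((DL ^^ m) (iotaD w (E T)))"
proof (induction m)
 case 0
 show ?case using agr_iotaD[OF agr_E[OF assms(1)] Frm_E[OF assms(2)]] by (simp del: ep_app)
next
 case (Suc m)
 have "Frm j (iotaD w (E T))"
  unfolding iotaD_def by (intro Frm_add Frm_sm Frm_dl Frm_ii Frm_DL Frm_E assms smooth_const open_W X_smooth)
 thus ?case using agr_DL[OF Suc Frm_DL_pow] by (simp del: ep_app)
qed

end

section \<open>The product of the commuting factors\<close>

context pmetric begin

text \<open>A factor acts as the identity on fields that are not forms, so that any two factors commute.\<close>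

definition fac :: "nat => real => 'e tfield => 'e tfield" where
 "fac j c T = (if Frm j T then dl (dx T) + cs c T else T)"

lemma Frm_fac: "Frm j T ==> Frm j (fac j c T)"
 unfolding fac_def by (auto intro!: Frm_add Frm_sm Frm_dl Frm_dx smooth_const open_W)

lemma Frm_fold_fac: "Frm j T ==> Frm j (fold (fac j) as T)"
 by (induction as arbitrary: T) (simp_all add: Frm_fac)

lemma fac_commute: "fac j c (fac j c' T) = fac j c' (fac j c T)"
proof (cases "Frm j T")
 case True
 have A: "Frm j (dl (dx T))" using True by (intro Frm_dl Frm_dx)
 have "fac j c (fac j c' T) = dl (dx (dl (dx T))) + cs c' (dl (dx T)) + cs c (dl (dx T) + cs c' T)" for c c'
 proof -
  have t: "Ten j (dl (dx T))" "Ten j (cs c' T)" by (rule Frm_Ten[OF A], rule Frm_Ten[OF Frm_sm[OF True cf_smooth]])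
  have t2: "Ten (Suc j) (dx (dl (dx T)))" "Ten (Suc j) (cs c' (dx T))"
   by (intro Frm_Ten Frm_sm Frm_dx A True smooth_const open_W)+
  have "dl (dx (dl (dx T) + cs c' T)) = dl (dx (dl (dx T))) + cs c' (dl (dx T))"
   by (simp only: dx_add[OF t] dx_cs[OF Frm_Ten[OF True]] dl_add[OF t2] dl_cs[OF Frm_Ten[OF Frm_dx[OF True]]])
  thus ?thesis using True Frm_fac[OF True] by (simp add: fac_def)
 qed
 thus ?thesis by (simp only:) (rule tfield_eqI, simp add: algebra_simps)
qed (simp add: fac_def)

text \<open>The coefficients \<open>l (2m+1-l)\<close> are symmetric under \<open>l \<mapsto> 2m+1-l\<close>, so that the even numbers up to \<open>2m\<close>
  give the same coefficients as all numbers up to \<open>m\<close>.\<close>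

lemma fac_perm:
 assumes C: "!!i. i <= 2 * m + 1 ==> C (2 * m + 1 - i) = (C i :: real)"
 shows "fold (fac j) (map (%i. C (2 * i)) [1..<Suc m]) T = foldr (fac j) (map C [1..<Suc m]) T"
proof -
 \<comment> \<open>Even numbers above \<open>m\<close> are reflected to the odd ones below.\<close>
 define \<pi> where "\<pi> i = (if 2 * i <= m then 2 * i else 2 * m + 1 - 2 * i)" for i
 have "inj_on \<pi> {1..m}" by (auto simp: inj_on_def \<pi>_def split: if_splits) presburger+
 moreover have "\<pi> ` {1..m} <= {1..m}" by (auto simp: \<pi>_def)
 ultimately have "\<pi> ` {1..m} = {1..m}" by (intro endo_inj_surj) auto
 hence "set (map \<pi> [1..<Suc m]) = set [1..<Suc m]" by (simp add: atLeastLessThanSuc_atLeastAtMost del: upt_Suc)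
 moreover have "distinct (map \<pi> [1..<Suc m])"
  using \<open>inj_on \<pi> {1..m}\<close> by (simp add: distinct_map atLeastLessThanSuc_atLeastAtMost del: upt_Suc)
 ultimately have "mset (map \<pi> [1..<Suc m]) = mset [1..<Suc m]" by (metis set_eq_iff_mset_eq_distinct distinct_upt)
 hence "mset (map C (map \<pi> [1..<Suc m])) = mset (map C [1..<Suc m])" by (metis mset_map)
 moreover have "map C (map \<pi> [1..<Suc m]) = map (%i. C (2 * i)) [1..<Suc m]"
 proof -
  have "C (\<pi> i) = C (2 * i)" if "i <= m" for i using C[of "2 * i"] that by (simp add: \<pi>_def)
  thus ?thesis by (simp del: upt_Suc)
 qed
 ultimately have m: "mset (map (%i. C (2 * i)) [1..<Suc m]) = mset (map C [1..<Suc m])" by (simp only:)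
 have c: "fac j a \<circ> fac j b = fac j b \<circ> fac j a" for a b by (rule ext) (simp add: fac_commute)
 have "fold (fac j) (map (%i. C (2 * i)) [1..<Suc m]) = fold (fac j) (map C [1..<Suc m])"
  by (rule fold_multiset_equiv[OF c m])
 moreover have "fold (fac j) (map C [1..<Suc m]) = foldr (fac j) (map C [1..<Suc m])"
  by (rule foldr_fold[symmetric]) (rule c)
 ultimately show ?thesis by simp
qed

end

section \<open>The value of the operator along a section\<close>

text \<open>Splitting an argument into its \<open>Y\<close>-part and a part in the kernel of \<open>a\<close>; two arguments \<open>Y\<close> give zero.\<close>

lemma alt_vanish:
 assumes "alt j t" "a \<bullet> Y = 1"
  and "!!vs. (\<forall>v\<in>set vs. a \<bullet> v = 0) ==> t vs = 0" "!!vs. (\<forall>v\<in>set vs. a \<bullet> v = 0) ==> t (Y # vs) = 0"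
 shows "t us = 0"
 using assms
proof (induction us arbitrary: j t)
 case (Cons v us)
 have a: "alt (j - 1) (%vs. t (w # vs))" for w by (rule alt_hd[OF Cons.prems(1)])
 define v' where "v' = v - (a \<bullet> v) *\<^sub>R Y"
 have v': "a \<bullet> v' = 0" "v = v' + (a \<bullet> v) *\<^sub>R Y" using Cons.prems(2) by (auto simp: v'_def inner_diff_right)
 have l: "linear (%v. t (v # us))" using ten_linear[OF alt_ten[OF Cons.prems(1)]] .
 have "t (v' # us) = 0"
  by (rule Cons.IH[OF a Cons.prems(2)])
   (use Cons.prems(3,4) v'(1) alt_swap[OF Cons.prems(1), of v' Y] in simp_all)
 moreover have "t (Y # us) = 0"
  by (rule Cons.IH[OF a Cons.prems(2)]) (use Cons.prems(4) alt_rep[OF Cons.prems(1)] in simp_all)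
 ultimately show ?case by (subst v'(2)) (simp add: linear_add[OF l] linear_scale[OF l])
qed auto

text \<open>\<open>X \<and> F\<close> on the cone depends only on the restriction of \<open>F\<close> to tangent vectors of the cone.\<close>

lemma (in homothety) E_vanish:
 assumes F: "Frm j F" and z: "z \<in> W" "!!vs. (\<forall>v\<in>set vs. h z [X z, v] = 0) ==> F z vs = 0"
 shows "E F z us = 0"
proof -
 obtain w where w: "h z [X z, w] ~= 0" using h_nd[OF z(1)] X_nz[OF z(1)] by blast
 have K: "tep (fl X z) t vs = 0" if "\<forall>v\<in>set vs. fl X z \<bullet> v = 0" for t vs using that by (simp add: tep_def)
 show ?thesis
  by (rule alt_vanish[OF Frm_alt[OF Frm_E[OF F]], of "fl X z" "(1 / h z [X z, w]) *\<^sub>R w"])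
   (use w z in \<open>simp_all add: K Gm_inner[OF z(1)]\<close>)
qed

context cone_section begin

text \<open>The hypothesis on the cone provides a section through each of its points, so that the Hessian of \<open>\<tau>\<close> vanishes on
  the whole cone and not just along \<open>e\<close>.\<close>

lemma detour_value:
 fixes T0 E0 Fh :: "'e tfield" and \<omega> :: "'b tfield" and k' m :: nat
 defines "k == Suc k'"
 assumes nq: "n = 2 * (Suc k + m)"
  and T0: "Frm 0 T0" "wt 1 T0" "!!z. z \<in> W ==> T0 z [] ~= 0" "!!y. y \<in> U ==> T0 (e y) [] = 1"
  and cone: "!!z. z \<in> W ==> Q z = 0 ==> \<exists>U' g' (e' :: 'b => 'e) l' s x. cone_section W h X n U' g' e' l' & x \<in> U' & e' x = z &
   (\<forall>y\<in>U'. T0 (e' y) [] = s) & s ~= 0"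
  and E0: "Frm k E0" "ii X (dx E0) = 0"
  and \<omega>: "G.Frm k \<omega>" "!!y vs. y \<in> U ==> length vs = k ==> E0 (e y) (map (H y) vs) = \<omega> y vs"
  and Fh: "Frm (Suc k) Fh" "wt (- real (Suc k)) Fh"
   "!!z vs. z \<in> W ==> Q z = 0 ==> (\<forall>v\<in>set vs. h z [X z, v] = 0) ==> Fh z vs = dx E0 z vs"
  and x: "x \<in> U" and Y: "is_Y x Y" and vs: "length vs = k"
 shows "(DL ^^ m) (iotaD (1 - real (Suc k)) (E Fh)) (e x) (Y # map (H x) vs) =
  (2 * real m + 2) * fold (G.fac k) (map (%i. 2 * lam * real (2 * i) * (real n - 1 - 2 * real k - real (2 * i))) [1..<Suc m])
   (G.dl (G.dx \<omega>)) x vs"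
proof -
 define q where "q = k + m"
 have q: "n = 2 * Suc q" "q >= 1" by (simp_all add: q_def nq k_def)
 obtain T \<phi> \<psi> where T: "Frm 0 T" "wt 1 T" "T = T0 + sm Q \<phi>" "Frm 0 \<phi>" "Frm 0 \<psi>" "DL T = Qs (Suc q) \<psi>"
  using tau_exists[OF q(1) T0(1,2)] by blast
 note TT = Frm_Ten[OF T(1)]
 have Te: "T z [] = T0 z []" if "Q z = 0" for z using that by (simp add: T(3))
 have "nab (nab T) z [u, v] = 0" if z: "z \<in> W" "Q z = 0" for z u v
 proof -
  obtain U' g' l' s y and e' :: "'b => 'e" where c: "cone_section W h X n U' g' e' l'" "y \<in> U'" "e' y = z"
   "\<forall>y\<in>U'. T0 (e' y) [] = s" "s ~= 0" using cone[OF z] by blast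
  interpret C: cone_section W h X n U' g' e' l' by (rule c(1))
  have "T (e' y) [] = s" if "y \<in> U'" for y using Te[OF C.e_Q[OF that]] c(4) that by simp
  from C.hessian_section[OF T(1,2,5,6) q(2) this c(5,2)] show ?thesis by (simp add: c(3))
 qed
 then obtain Z' where "Ten 2 Z'" "nab (nab T) = Qs q Z'"
  using hessian_order[OF q T(1,2,5,6)] by blast
 then obtain Z where Z: "mf Z" "\<forall>b. \<forall>x\<in>W. cv (cf b) (gr (%x. T x [])) x = Q x ^ q *\<^sub>R Z x b"
  using gradient_order[OF T(1)] by blast
 define I where "I = gr (%x. T x [])"
 have Z2: "cv (cf b) I x = Q x ^ q *\<^sub>R Z x b" if "x \<in> W" for b x using Z(2) that by (simp add: I_def)
 note scale = T0(1-3) T(1,2,4,3) I_def Z(1) Z2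
 obtain G R where G: "Frm k G" "ii X (dx (E0 + sm Q G)) = 0" "Frm k R" "ii I (dx (E0 + sm Q G)) = Qs q R"
  using adapted_lift[OF scale E0, of q] by blast
 define F where "F = dx (E0 + sm Q G)"
 have FE: "Frm k (E0 + sm Q G)" by (intro Frm_add Frm_sm E0 G Q_smooth)
 have F: "Frm (Suc (Suc k')) F" "dx F = 0" "ii X F = 0" "ii I F = Qs q R"
  using Frm_dx[OF FE] dx_dx[OF FE] G by (simp_all only: F_def k_def)
 have orders: "l <= q ==> ord (q - l) (Suc k') (ii I (CC F l))" "l < q ==> ord (q - Suc l) k' (ii I (dl (CC F l)))" for l
  using CC_orders[OF scale F(1-3) G(3)[unfolded k_def] F(4)] by blast+
 have FF: "F z ws = dx E0 z ws + Q z * dx G z ws + 2 * E G z ws" for z ws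
 proof -
  have "F = dx E0 + (sm Q (dx G) + cs 2 (E G))"
   unfolding F_def by (simp only: dx_add[OF Frm_Ten[OF E0(1)] Ten_sm[OF Frm_Ten[OF G(1)] Q_smooth]] dx_Q[OF Frm_Ten[OF G(1)]])
  thus ?thesis by simp
 qed
 have EK: "E G z ws = 0" if "z \<in> W" "\<forall>v\<in>set ws. h z [X z, v] = 0" for z ws
  using that by (simp add: tep_def Gm_inner)
 have Fk: "Frm (Suc k) F" using F(1) by (simp only: k_def)
 \<comment> \<open>The given lift may be replaced by the adapted one.\<close>
 have "\<exists>V. Ten (Suc (Suc k)) V & E (Fh - F) = sm Q V & (Frm (Suc (Suc k)) (E (Fh - F)) --> Frm (Suc (Suc k)) V)"
 proof (rule Q_divide_zero)
  show "Ten (Suc (Suc k)) (E (Fh - F))" by (intro Frm_Ten Frm_E Frm_diff Fh Fk)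
  show "E (Fh - F) z us = 0" if z: "z \<in> W" "Q z = 0" for z us
   by (rule E_vanish[OF Frm_diff[OF Fh(1) Fk] z(1)]) (use z in \<open>simp add: Fh(3) FF EK del: ep_app\<close>)
 qed
 then obtain V where V: "Frm (Suc (Suc k)) V" "E (Fh - F) = sm Q V"
  using Frm_E[OF Frm_diff[OF Fh(1) Fk]] by blast
 have wF: "wt (- real (Suc k)) F" using CC_inv[OF F(1-3), of 0] by (simp add: k_def)
 have wV: "wt (- 1 - real (Suc k)) V"
 proof -
  have "wt (- real (Suc k)) (Fh - F)"
   by (rule tfield_eqI) (simp add: NN_diff[OF Frm_Ten[OF Fh(1)] Frm_Ten[OF Fk]] Fh(2) wF algebra_simps)
  hence "wt (- real (Suc k) + 1) (E (Fh - F))" by (rule wt_E[OF Frm_Ten[OF Frm_diff[OF Fh(1) Fk]]])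
  moreover have "sm Q V = Qs 1 V" by simp
  ultimately have "wt (- real (Suc k) + 1 - 2 * real 1) V" by (intro wt_Q_divide[OF Frm_Ten[OF V(1)]]) (simp only: V(2))
  moreover have "- real (Suc k) + 1 - 2 * real 1 = - 1 - real (Suc k)" by simp
  ultimately show ?thesis by (simp only:)
 qed
 have nk: "n = 2 * (Suc (Suc k') + m)" using nq by (simp add: k_def)
 let ?io = "iotaD (1 - real (Suc k))"
 have Fio: "Frm (Suc k) (?io (E F))" "Frm (Suc k) (?io (sm Q V))"
  unfolding iotaD_def by (intro Frm_add Frm_sm Frm_dl Frm_ii Frm_DL Frm_E Fk V Q_smooth smooth_const open_W X_smooth)+
 have "E Fh = E F + sm Q V" unfolding V(2)[symmetric] op_diff by (rule tfield_eqI) simp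
 hence "?io (E Fh) = ?io (E F) + ?io (sm Q V)"
  unfolding iotaD_def
  by (simp only: dl_add[OF Frm_Ten[OF Frm_E[OF Fk]] Frm_Ten[OF Frm_sm[OF V(1) Q_smooth]]]
    DL_add[OF Frm_E[OF Fk] Frm_sm[OF V(1) Q_smooth]] op_add) (rule tfield_eqI, simp)
 hence "(DL ^^ m) (?io (E Fh)) = (DL ^^ m) (?io (E F)) + (DL ^^ m) (?io (sm Q V))"
  by (simp only: DL_pow_add[OF Fio])
 moreover obtain V' where "(DL ^^ m) (?io (sm Q V)) = sm Q V'"
  using iotaD_Q_zero[OF V(1)[unfolded k_def] wV[unfolded k_def] nk] unfolding k_def by blast
 ultimately have "(DL ^^ m) (?io (E Fh)) (e x) (Y # map (H x) vs) = (2 * real m + 2) * E (dl (CC F m)) (e x) (Y # map (H x) vs)"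
  using DL_pow_iotaD_m[OF F(1-3) nk, folded k_def] e_Q[OF x] by simp
 also have "E (dl (CC F m)) (e x) (Y # map (H x) vs) = dl (CC F m) (e x) (map (H x) vs)"
 proof -
  have "tep (fl X (e x)) t (map (H x) vs) = 0" for t by (simp add: tep_def Gm_inner[OF e_W[OF x]] hXH[OF x])
  thus ?thesis using Y by (simp add: is_Y_def Gm_inner[OF e_W[OF x]])
 qed
 finally have val: "(DL ^^ m) (?io (E Fh)) (e x) (Y # map (H x) vs) = (2 * real m + 2) * dl (CC F m) (e x) (map (H x) vs)" .
 \<comment> \<open>The pullbacks to the section satisfy a recursion.\<close>
 let ?c = "%i. 2 * lam * real (2 * i) * (real n - 1 - 2 * real k - real (2 * i))"
 define P where "P l = fold (G.fac k) (map ?c [1..<Suc l]) (G.dl (G.dx \<omega>))" for l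
 have P: "G.Frm k (P l)" "P (Suc l) = G.dl (G.dx (P l)) + sm (%_. ?c (Suc l)) (P l)" for l
 proof -
  show 1: "G.Frm k (P l)" for l
   unfolding P_def by (intro G.Frm_fold_fac G.Frm_dl G.Frm_dx \<omega>)
  have "[1..<Suc (Suc l)] = [1..<Suc l] @ [Suc l]" by simp
  hence "P (Suc l) = G.fac k (?c (Suc l)) (P l)"
   by (simp only: P_def map_append fold_append list.map fold_simps o_apply)
  thus "P (Suc l) = G.dl (G.dx (P l)) + sm (%_. ?c (Suc l)) (P l)" using 1 by (simp only: G.fac_def if_True)
 qed
 have FC: "Frm (Suc k) (CC F l)" for l by (rule Frm_CC[OF Fk])
 have "G.agr k (%y ws. dl (CC F l) (e y) (map (H y) ws)) (P l)" if "l <= m" for l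
  using that
 proof (induction l)
  case 0
  have F0: "G.agr (Suc k) (%y ws. F (e y) (map (H y) ws)) (G.dx \<omega>)"
  proof -
   have a: "G.agr k (%y ws. E0 (e y) (map (H y) ws)) \<omega>" using \<omega>(2) by (simp add: G.agr_def)
   have "F (e y) (map (H y) ws) = ext_d_loc (%y ws. E0 (e y) (map (H y) ws)) y ws" if y: "y \<in> U" for y ws
    using ext_d_pullback[OF G.open_W e E0(1) y, of ws] e_Q[OF y] EK[OF e_W[OF y], of "map (H y) ws"] hXH[OF y] dx_loc[OF E0(1) e_W[OF y]]
    by (simp add: FF)
   thus ?thesis using G.agr_dx[OF a \<omega>(1)] by (simp add: G.agr_def)
  qed
  have CY: "F (e y) (Y # map (H y) ws) = 0" if y: "y \<in> U" and Y: "is_Y y Y" for y Y ws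
  proof -
   have i: "I (e y) = Y - lam *\<^sub>R Xe y"
    using I_eq[OF T(1,2,5,6) q(2) _ _ y Y, of 1] T0(4) Te e_Q by (simp add: I_def)
   have "F (e y) (I (e y) # map (H y) ws) = 0" "F (e y) (Xe y # map (H y) ws) = 0"
    using pt[OF F(4), of "e y" "map (H y) ws"] pt[OF F(3), of "e y" "map (H y) ws"] e_Q[OF y] q(2) by simp_all
   thus ?thesis unfolding i by (simp add: linear_diff[OF Ten_linear[OF Frm_Ten[OF Fk]]] linear_scale[OF Ten_linear[OF Frm_Ten[OF Fk]]])
  qed
  have "dl F (e y) (map (H y) ws) = codiff_loc g (%y ws. F (e y) (map (H y) ws)) y ws" if y: "y \<in> U" "length ws = k" for y ws
  proof -
   obtain Y where Y: "is_Y y Y" using Y_exists[OF y(1)] by blast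
   have "wt (- (real k + 1 + 0)) F" using wF by (simp add: add.commute)
   moreover have "ii X F = cs (- 0) (0::'e tfield)" using F(3) by (simp only: op_zero)
   ultimately show ?thesis
    using dl_section[OF Fk y(1) Y y(2), of 0 0] CY[OF y(1) Y] Ten_zero[of k] by (simp del: ii_app)
  qed
  thus ?case using G.agr_dl[OF F0 G.Frm_Ten[OF G.Frm_dx[OF \<omega>(1)]]] by (simp add: G.agr_def P_def)
 next
  case (Suc l)
  let ?C = "CC F (Suc l)" and ?D = "dl (CC F l)" and ?p = "real (2 * Suc l)"
  have FD: "Frm k ?D" by (rule Frm_dl[OF FC])
  have ih: "G.agr k (%y ws. ?D (e y) (map (H y) ws)) (P l)" using Suc by simp
  have "?C (e y) (map (H y) ws) = ext_d_loc (%y ws. ?D (e y) (map (H y) ws)) y ws" if y: "y \<in> U" for y ws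
   using ext_d_pullback[OF G.open_W e FD y, of ws] dx_loc[OF FD e_W[OF y]] by simp
  hence C: "G.agr (Suc k) (%y ws. ?C (e y) (map (H y) ws)) (G.dx (P l))"
   using G.agr_dx[OF ih P(1)] by (simp add: G.agr_def)
  have iX: "ii X ?C = cs (- ?p) ?D" using CC_iX[OF F(1-3) nk, of l] by (simp add: mult.commute del: ii_app CC.simps)
  have wC: "wt (- (real k + 1 + ?p)) ?C"
   using CC_inv[OF F(1-3), of "Suc l"] by (simp add: k_def algebra_simps del: CC.simps ii_app)
  have wD: "wt (- (real k + ?p)) ?D"
  proof -
   have "wt (- (real (Suc k) + 2 * real l) - 1) ?D"
    by (rule wt_dl[OF FC]) (use CC_inv[OF F(1-3), of l] in \<open>simp only: k_def\<close>)
   moreover have "- (real (Suc k) + 2 * real l) - 1 = - (real k + ?p)" by simp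
   ultimately show ?thesis by (simp only:)
  qed
  have "dl ?C (e y) (map (H y) ws) = codiff_loc g (%y ws. ?C (e y) (map (H y) ws)) y ws + ?c (Suc l) * ?D (e y) (map (H y) ws)"
   if y: "y \<in> U" "length ws = k" for y ws
  proof -
   let ?ws = "map (H y) ws"
   obtain Y where Y: "is_Y y Y" using Y_exists[OF y(1)] by blast
   have i: "I (e y) = Y - lam *\<^sub>R Xe y"
    using I_eq[OF T(1,2,5,6) q(2) _ _ y(1) Y, of 1] T0(4) Te e_Q by (simp add: I_def)
   hence Yi: "Y = I (e y) + lam *\<^sub>R Xe y" by simp
   note W = e_W[OF y(1)]
   have lC: "linear (%v. ?C (e y) (v # ?ws))" and lN: "linear (%v. N v ?D (e y) ?ws)"
    using Ten_linear[OF Frm_Ten[OF FC[of "Suc l"]]] Ten_linear[OF Ten_nab[OF Frm_Ten[OF FD]], of "e y" ?ws] by (simp_all add: nab_def)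
   have lq: "Suc l < q" using Suc.prems by (simp add: q_def k_def)
   have CI: "?C (e y) (I (e y) # ?ws) = 0"
   proof -
    have "ord 1 (Suc k') (ii I ?C)" by (rule ord_mono[OF orders(1)]) (use lq in auto)
    then obtain V where V: "ii I ?C = Qs 1 V" unfolding ord_def by blast
    show ?thesis using fun_cong[OF fun_cong[OF V, of "e y"], of ?ws] e_Q[OF y(1)] by simp
   qed
   have CX: "?C (e y) (Xe y # ?ws) = - ?p * ?D (e y) ?ws"
    using fun_cong[OF fun_cong[OF iX, of "e y"], of ?ws] by simp
   have NI: "N (I (e y)) ?D (e y) ?ws = 0"
   proof -
    have sI: "smooth_on W I" unfolding I_def by (rule gradient(1)[OF TT])
    have c: "dx (ii I ?D) + ii I ?C = NN I ?D + dact (%x v. cv (cf v) I x) ?D"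
     using cartan[OF FD sI] by simp
    have "ord 1 k' (ii I ?D)" by (rule ord_mono[OF orders(2)]) (use lq in auto)
    then obtain V where V: "Frm k' V" "ii I ?D = Qs 1 V" unfolding ord_def by blast
    have "Qs 1 V = sm Q V" by simp
    hence "dx (ii I ?D) = sm Q (dx V) + cs 2 (E V)" unfolding V(2) by (simp only: dx_Q[OF Frm_Ten[OF V(1)]])
    hence 1: "dx (ii I ?D) (e y) ?ws = 0"
     using e_Q[OF y(1)] hXH[OF y(1)] by (simp add: tep_def Gm_inner[OF W])
    have 2: "dact (%x v. cv (cf v) I x) ?D (e y) ?ws = 0"
    proof -
     have "cv (cf b) I (e y) = 0" for b using Z2[OF W] e_Q[OF y(1)] q(2) by (cases q) auto
     thus ?thesis using linear_0[OF ten_slot_linear[OF Ten_ten[OF Frm_Ten[OF FD]]]] by (simp add: tact_def)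
    qed
    show ?thesis
     using fun_cong[OF fun_cong[OF c, of "e y"], of ?ws] 1 2 CI NN_pt[OF Frm_Ten[OF FD], of I] by simp
   qed
   have NY: "N Y ?D (e y) ?ws = - lam * (real k + ?p) * ?D (e y) ?ws"
   proof -
    have NX: "N (Xe y) ?D (e y) ?ws = - (real k + ?p) * ?D (e y) ?ws"
     unfolding NN_pt[OF Frm_Ten[OF FD], of X, symmetric] wD by (simp only: sm_app)
    have "N Y ?D (e y) ?ws = N (I (e y)) ?D (e y) ?ws + lam * N (Xe y) ?D (e y) ?ws"
     by (subst Yi) (simp add: linear_add[OF lN] linear_scale[OF lN])
    thus ?thesis unfolding NI NX by (simp only: mult_minus_left mult_minus_right mult.assoc add_0_left)
   qed
   have CY: "?C (e y) (Y # ?ws) = - lam * ?p * ?D (e y) ?ws"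
   proof -
    have "?C (e y) (Y # ?ws) = ?C (e y) (I (e y) # ?ws) + lam * ?C (e y) (Xe y # ?ws)"
     by (subst Yi) (simp add: linear_add[OF lC] linear_scale[OF lC] del: CC.simps)
    thus ?thesis unfolding CI CX by (simp only: mult_minus_left mult_minus_right mult.assoc add_0_left)
   qed
   show ?thesis
   proof -
    have "?p * N Y ?D (e y) ?ws = - ?p * lam * (real k + ?p) * ?D (e y) ?ws"
     unfolding NY by (simp only: mult_minus_left mult_minus_right mult.assoc)
    from dl_section[OF FC y(1) Y y(2) wC iX CY Frm_Ten[OF FD] this] show ?thesis
     by (simp only: diff_diff_eq add.commute add.left_commute)
   qed
  qed
  thus ?case
   using G.agr_dl[OF C G.Frm_Ten[OF G.Frm_dx[OF P(1)]]] ih unfolding P(2) by (simp add: G.agr_def del: CC.simps)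
 qed
 hence "dl (CC F m) (e x) (map (H x) vs) = P m x vs" using x vs by (simp add: G.agr_def)
 thus ?thesis unfolding val P_def by simp
qed

end

section \<open>Division with smooth quotient and smooth inverse functions\<close>

text \<open>One may differentiate under the integral, and the derivative is of the same kind.\<close>

lemma smooth_integral:
 fixes G :: "'a::euclidean_space \<times> real => real"
 assumes D: "open D" and B: "open B" "D \<times> {0..1} <= B" and G: "smooth_on B G"
 shows "smooth_on D (%z. integral {0..1} (%s. G (z, s)))"
proof -
 have "C_on r D (%z. integral {0..1} (%s. G (z, s)))" if "smooth_on B G" for r and G :: "'a \<times> real => real"
  using that
 proof (induction r arbitrary: G)
  case 0
  have "continuous_on (D \<times> cbox 0 (1::real)) (%(z, s). G (z, s))"
   using continuous_on_subset[OF smooth_continuous[OF 0] B(2)] by simp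
  hence "continuous_on D (%z. integral (cbox 0 1) (%s. G (z, s)))"
   by (intro integral_continuous_on_param[where f="%z s. G (z, s)"])
  thus ?case by simp
 next
  case (Suc r)
  let ?F = "%z s. Blinfun (%v. fd G (z, s) (v, 0))"
  have bl: "bounded_linear (%v. fd G (z, s) (v, 0))" if "z \<in> D" "s \<in> {0..1}" for z s
  proof -
   have zs: "(z, s) \<in> B" using that B(2) by auto
   show ?thesis
    by (rule bounded_linear_compose[OF has_derivative_bounded_linear[OF smooth_has_fd[OF Suc.prems zs]]])
     (intro bounded_linear_Pair bounded_linear_ident bounded_linear_zero)
  qed
  have sG: "smooth_on B (%p. fd G p (v, 0))" for v by (rule smooth_fd[OF Suc.prems])
  show ?case
  proof (rule C_on_SucI[OF D])
   show "C_on r D (%z. integral {0..1} (%s. fd G (z, s) (v, 0)))" for v by (rule Suc.IH[OF sG])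
   fix x0 assume x0: "x0 \<in> D"
   then obtain \<epsilon> where \<epsilon>: "\<epsilon> > 0" "ball x0 \<epsilon> <= D" using D openE by blast
   have cont: "continuous_on (ball x0 \<epsilon> \<times> cbox 0 1) (%(z, s). ?F z s)"
   proof (rule continuous_on_blinfun_componentwise)
    fix i :: 'a
    have "continuous_on (ball x0 \<epsilon> \<times> cbox 0 1) (%p. fd G p (i, 0))"
     by (rule continuous_on_subset[OF smooth_continuous[OF sG]]) (use B(2) \<epsilon>(2) in auto)
    thus "continuous_on (ball x0 \<epsilon> \<times> cbox 0 1) (%p. blinfun_apply (case p of (z, s) => ?F z s) i)"
     by (rule continuous_on_eq) (use bl \<epsilon>(2) in \<open>auto simp: bounded_linear_Blinfun_apply\<close>)
   qed
   have "((%z. integral (cbox 0 1) (%s. G (z, s))) has_derivative integral (cbox 0 1) (?F x0)) (at x0 within ball x0 \<epsilon>)"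
   proof (rule leibniz_rule[OF _ _ cont])
    fix z s assume z: "z \<in> ball x0 \<epsilon>" and s: "s \<in> cbox (0::real) 1"
    have zs: "z \<in> D" "s \<in> {0..1}" using z s \<epsilon>(2) by (blast, simp)
    have zB: "(z, s) \<in> B" using zs B(2) by blast
    have "((%z. G (z, s)) has_derivative (%v. fd G (z, s) (v, 0))) (at z)"
     by (rule has_derivative_compose[where g=G and f="%z. (z, s)" and g'="fd G (z, s)"], (auto intro!: derivative_eq_intros)[1])
      (rule smooth_has_fd[OF Suc.prems zB])
    thus "((%z. G (z, s)) has_derivative blinfun_apply (?F z s)) (at z within ball x0 \<epsilon>)"
     by (simp add: bounded_linear_Blinfun_apply[OF bl[OF zs(1,2)]] has_derivative_at_withinI)
   next
    fix z assume "z \<in> ball x0 \<epsilon>"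
    hence "continuous_on (cbox 0 1) (%s. G (z, s))"
     using B(2) \<epsilon>(2) by (intro continuous_on_compose2[OF smooth_continuous[OF Suc.prems]] continuous_intros) auto
    thus "(%s. G (z, s)) integrable_on cbox 0 1" by (rule integrable_continuous)
   qed (use \<epsilon> in auto)
   hence d: "((%z. integral {0..1} (%s. G (z, s))) has_derivative integral {0..1} (?F x0)) (at x0)"
    using at_within_open[of x0 "ball x0 \<epsilon>"] \<epsilon>(1) by simp
   have i: "?F x0 integrable_on {0..1}"
   proof -
    have "continuous_on (cbox 0 1) (%s. ?F x0 s)"
    proof -
     have "continuous_on {0..1} (%s::real. (x0, s))" by (intro continuous_intros)
     moreover have "(%s. (x0, s)) ` {0..1} <= ball x0 \<epsilon> \<times> {0..1}" using \<epsilon>(1) by auto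
     ultimately show ?thesis using continuous_on_compose2[OF cont, of "cbox 0 1" "%s. (x0, s)"] by simp
    qed
    thus ?thesis using integrable_continuous by fastforce
   qed
   have "blinfun_apply (integral {0..1} (?F x0)) = (%v. integral {0..1} (%s. fd G (x0, s) (v, 0)))"
    by (rule ext, subst blinfun_apply_integral[OF i], rule integral_cong)
     (use bounded_linear_Blinfun_apply[OF bl[OF x0]] in simp)
   thus "((%z. integral {0..1} (%s. G (z, s))) has_derivative (%v. integral {0..1} (%s. fd G (x0, s) (v, 0)))) (at x0)"
    using d by simp
  qed
 qed
 thus ?thesis using G by (simp add: smooth_on_def)
qed

text \<open>\<open>f(z) = f(z) - f(z - \<rho>(z) N)\<close> is the integral of the derivative along the segment.\<close>

lemma hadamard_division:
 fixes f :: "'a::euclidean_space => real"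
 assumes D: "open D" "!!z s. z \<in> D ==> s \<in> {0..1} ==> z - (s * \<rho> z) *\<^sub>R N \<in> D" and \<rho>: "linear \<rho>" "\<rho> N = 1"
  and f: "smooth_on D f" "!!z. z \<in> D ==> \<rho> z = 0 ==> f z = 0"
 shows "\<exists>g. smooth_on D g & (\<forall>z\<in>D. f z = \<rho> z * g z)"
proof -
 let ?p = "%p. fst p - (snd p * \<rho> (fst p)) *\<^sub>R N"
 have sp: "smooth_on S ?p" if "open S" for S :: "('a \<times> real) set"
  by (intro smooth_diff smooth_scaleR smooth_mult smooth_const smooth_fst smooth_snd smooth_id that
    smooth_compose[OF that open_UNIV smooth_fst[OF that smooth_id[OF that]] smooth_linear[OF open_UNIV \<rho>(1)]]) auto
 define B where "B = ?p -` D"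
 have B: "open B" unfolding B_def using D(1) smooth_continuous[OF sp[OF open_UNIV]] by (rule open_vimage)
 define g where "g z = integral {0..1} (%s. fd f (?p (z, s)) N)" for z
 have "smooth_on D g"
  unfolding g_def
 proof (rule smooth_integral[OF D(1) B])
  show "D \<times> {0..1} <= B" using D(2) by (auto simp: B_def)
  show "smooth_on B (%p. fd f (?p p) N)"
   by (rule smooth_compose[OF B D(1) sp[OF B] smooth_fd[OF f(1)]]) (auto simp: B_def)
 qed
 moreover have "f z = \<rho> z * g z" if z: "z \<in> D" for z
 proof -
  have "((%s. f (?p (z, s))) has_vector_derivative - \<rho> z * fd f (?p (z, s)) N) (at s within {0..1})" if s: "s \<in> {0..1}" for s
  proof -
   have W: "?p (z, s) \<in> D" using D(2)[OF z s] by simp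
   have "((%s. f (?p (z, s))) has_derivative (%r. fd f (?p (z, s)) (- (r * \<rho> z) *\<^sub>R N))) (at s within {0..1})"
    by (rule has_derivative_compose[where g=f and f="%s. ?p (z, s)" and g'="fd f (?p (z, s))"], (auto intro!: derivative_eq_intros)[1])
     (rule smooth_has_fd[OF f(1) W])
   thus ?thesis
    by (simp add: has_vector_derivative_def linear_scale[OF fd_linear[OF f(1) W[simplified]]] linear_neg[OF fd_linear[OF f(1) W[simplified]]] algebra_simps)
  qed
  hence "((%s. - \<rho> z * fd f (?p (z, s)) N) has_integral f (?p (z, 1)) - f (?p (z, 0))) {0..1}"
   by (intro fundamental_theorem_of_calculus) auto
  hence "integral {0..1} (%s. - \<rho> z * fd f (?p (z, s)) N) = f (?p (z, 1)) - f (?p (z, 0))" by (rule integral_unique)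
  moreover have "f (?p (z, 1)) = 0"
   by (rule f(2)) (use D(2)[OF z, of 1] \<rho> in \<open>auto simp: linear_diff linear_scale\<close>)
  ultimately show ?thesis by (simp add: g_def)
 qed
 ultimately show ?thesis by blast
qed

text \<open>The derivative of the inverse is the inverse of the derivative at the preimage, so smoothness is inherited order by
  order.\<close>

lemma smooth_inverse_function:
 fixes f :: "'a::euclidean_space => 'a"
 assumes S: "open S" "smooth_on S f" "x0 \<in> S" and inj: "inj (fd f x0)"
 shows "\<exists>D V g. open D & x0 \<in> D & D <= S & open V & homeomorphism D V f g & smooth_on V g"
proof -
 let ?f' = "%x. Blinfun (fd f x)"
 have bl: "bounded_linear (fd f x)" if "x \<in> S" for x using smooth_has_fd[OF S(2) that] by (rule has_derivative_bounded_linear)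
 have ap: "blinfun_apply (?f' x) = fd f x" if "x \<in> S" for x using bounded_linear_Blinfun_apply[OF bl[OF that]] .
 note li = linear_inj_inv[OF fd_linear[OF S(2,3)] inj]
 have cont: "continuous_on S ?f'"
  by (rule continuous_on_blinfun_componentwise, rule continuous_on_eq[OF smooth_continuous[OF smooth_fd[OF S(2)]]]) (simp add: ap)
 have inv: "Blinfun (inv (fd f x0)) o\<^sub>L ?f' x0 = id_blinfun"
  by (rule blinfun_eqI) (simp add: ap[OF S(3)] bounded_linear_Blinfun_apply linear_conv_bounded_linear[THEN iffD1, OF li(1)] li(3))
 have der: "(f has_derivative blinfun_apply (?f' x)) (at x)" if "x \<in> S" for x using smooth_has_fd[OF S(2) that] by (simp add: ap[OF that])
 obtain D V g g' where D: "open D" "D <= S" "x0 \<in> D" "open V" "f x0 \<in> V" "homeomorphism D V f g"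
  and g: "!!y. y \<in> V ==> (g has_derivative (g' y)) (at y)" "!!y. y \<in> V ==> g' y = inv (blinfun_apply (?f' (g y)))"
   "!!y. y \<in> V ==> bij (blinfun_apply (?f' (g y)))"
  using inverse_function_theorem[OF S(1) der cont S(3) inv] by metis
 have gV: "g ` V <= D" "f ` D = V" and gf: "!!x. x \<in> D ==> g (f x) = x" using D(6) by (auto simp: homeomorphism_def)
 have "inj (fd f x)" if "x \<in> D" for x
  using g(3)[of "f x"] gf[OF that] gV that D(2) ap[of x] by (auto simp: bij_def)
 hence si: "smooth_on D (%x. inv (fd f x) v)" for v
  using fd_linear[OF S(2)] D(2) smooth_subset[OF smooth_fd[OF S(2)] D(2)] by (intro smooth_linear_inverse[OF D(1)]) auto
 have "C_on r V g" for r
 proof (induction r)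
  case 0
  show ?case using D(6) by (simp add: homeomorphism_def)
 next
  case (Suc r)
  show ?case
  proof (rule C_on_SucI[OF D(4)])
   show "(g has_derivative inv (fd f (g y))) (at y)" if y: "y \<in> V" for y
    using g(1,2)[OF y] ap[of "g y"] gV(1) y D(2) by (metis image_subset_iff subsetD)
   show "C_on r V (%y. inv (fd f (g y)) v)" for v
    using C_on_compose[OF D(4,1) gV(1) Suc, of "%x. inv (fd f x) v"] si by (simp add: smooth_on_def)
  qed
 qed
 thus ?thesis using D by (auto simp: smooth_on_def)
qed

section \<open>Local models of the ambient space\<close>

lemma alt_map: assumes t: "alt j t" and L: "linear L" shows "alt j (%vs. t (map L vs))"
proof -
 have "linear (%v. t (map L (vs[i := v])))" if "length vs = j" "i < j" for vs i
  using linear_compose[OF L ten_slot_linear[OF alt_ten[OF t], of i "map L vs"]] that by (simp add: comp_def map_update)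
 moreover have "t (map L vs) = 0" if "length vs = j" "i < k" "k < j" "vs ! i = vs ! k" for vs i k
 proof -
  have "length (map L vs) = j & i < k & k < j & map L vs ! i = map L vs ! k" using that by simp
  thus ?thesis using t unfolding alt_def alternating_def by blast
 qed
 ultimately show ?thesis using t by (auto simp: alt_def ten_def multilin_def alternating_def)
qed

lemma (in region) Frm_pullback:
 assumes U: "open U" and e: "smooth_on U e" "!!x. x \<in> U ==> e x \<in> W" and C: "Frm j C"
 shows "region.Frm U j (%x vs. if x \<in> U then C (e x) (map (fd e x) vs) else 0)"
proof -
 interpret U: region U by unfold_locales (rule U)
 note T = Frm_Ten[OF C]
 have "smooth_on U (%x. C (e x) (map (fd e x) vs))" for vs
 proof -
  have "smooth_on U (%x. C (e x) (map (%V. V x) (map (%v y. fd e y v) vs)))"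
   by (rule smooth_on_pullback[OF U e T], assumption) (use smooth_fd[OF e(1)] in auto)
  thus ?thesis by (simp add: comp_def)
 qed
 hence s: "smooth_on U (%x. if x \<in> U then C (e x) (map (fd e x) vs) else 0)" for vs
  by (rule iffD2[OF smooth_on_cong[OF U], rotated]) simp
 have a: "alt j (%vs. C (e x) (map (fd e x) vs))" if "x \<in> U" for x
  by (rule alt_map[OF Frm_alt[OF C] fd_linear[OF e(1) that]])
 have "alt j (%vs. 0)" by (auto simp: alt_def ten_def multilin_def alternating_def linear_zero)
 hence a': "alt j (%vs. if x \<in> U then C (e x) (map (fd e x) vs) else 0)" for x using a[of x] by (cases "x \<in> U") auto
 thus ?thesis using s alt_ten[OF a'] by (simp add: U.Frm_def U.Ten_def)
qed

text \<open>Along the orbits of the dilations a pullback from the base is invariant, which fixes its weight.\<close>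

lemma (in pmetric) basic_pullback:
 fixes U :: "'b::euclidean_space set" and r :: "'e => 'b"
 defines "P == %\<omega> y vs. if y \<in> W then \<omega> (r y) (map (fd r y) vs) else (0::real)"
 assumes U: "pmetric U g" and r: "smooth_on W r" "!!y. y \<in> W ==> r y \<in> U" "!!y. y \<in> W ==> fd r y (X y) = 0"
  and X: "smooth_on W X" "!!x v. x \<in> W ==> cv (cf v) X x = v" and \<omega>: "region.Frm U k \<omega>"
 shows "Frm k (P \<omega>)" "dx (P \<omega>) = P (pmetric.dx U g \<omega>)" "ii X (P \<omega>) = 0" "NN X (P \<omega>) = cs (- real k) (P \<omega>)"
proof -
 interpret G: pmetric U g by (rule U)
 have F: "Frm j (P \<omega>)" if "G.Frm j \<omega>" for j \<omega>
  using G.Frm_pullback[OF open_W r(1,2) that] by (simp add: P_def)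
 show 1: "Frm k (P \<omega>)" by (rule F[OF \<omega>])
 show d: "dx (P \<omega>) = P (G.dx \<omega>)"
 proof (rule Ten_eqI[of "Suc k"])
  show "Ten (Suc k) (dx (P \<omega>))" "Ten (Suc k) (P (G.dx \<omega>))"
   using Frm_dx[OF 1] F[OF G.Frm_dx[OF \<omega>]] Frm_Ten by blast+
  fix y and vs :: "'e list" assume y: "y \<in> W"
  have "dirderiv (P \<omega>) y v ws = dirderiv (%y vs. \<omega> (r y) (map (fd r y) vs)) y v ws" for v ws
   unfolding dirderiv_def by (rule fun_cong[OF fd_cong[OF open_W y]]) (simp add: P_def)
  hence "dx (P \<omega>) y vs = ext_d_loc (%y vs. \<omega> (r y) (map (fd r y) vs)) y vs"
   using dx_loc[OF 1 y, of vs] by (simp add: ext_d_loc_def)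
  also have "... = P (G.dx \<omega>) y vs"
   using G.ext_d_pullback[OF open_W r(1,2) \<omega> y, of vs] G.dx_loc[OF \<omega> r(2)[OF y]] y by (simp add: P_def)
  finally show "dx (P \<omega>) y vs = P (G.dx \<omega>) y vs" .
 qed
 have i: "ii X (P \<omega>) = 0" if "G.Frm k \<omega>" for k \<omega>
  by (rule tfield_eqI) (simp add: P_def r(3) linear_0[OF G.Ten_linear[OF G.Frm_Ten[OF that]]])
 show "ii X (P \<omega>) = 0" by (rule i[OF \<omega>])
 have c: "dact (%x v. cv (cf v) X x) (P \<omega>) = cs (real k) (P \<omega>)"
  unfolding dact_id[OF Frm_Ten[OF 1], symmetric] by (rule act_cong[OF Frm_Ten[OF 1] X(2)])
 have "ii X (dx (P \<omega>)) = 0" unfolding d by (rule i[OF G.Frm_dx[OF \<omega>]])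
 hence z: "NN X (P \<omega>) + cs (real k) (P \<omega>) = 0"
  using cartan[OF 1 X(1)] unfolding c i[OF \<omega>] by (simp only: dx_zero add_0_left)
 show "NN X (P \<omega>) = cs (- real k) (P \<omega>)"
 proof (rule tfield_eqI)
  fix x vs show "NN X (P \<omega>) x vs = cs (- real k) (P \<omega>) x vs"
   using pt[OF z, of x vs] by simp
 qed
qed

context pmetric begin

lemma raise_scale: assumes "x \<in> W" "c ~= 0" shows "raise (%vs. c * h x vs) b = (1 / c) *\<^sub>R sh b x"
 unfolding raise_def[of "%vs. c * h x vs"]
proof (rule the_equality)
 show "\<forall>u. c * h x [(1 / c) *\<^sub>R sh b x, u] = b \<bullet> u" using assms by (simp add: h_scale h_sh)
 fix z assume z: "\<forall>u. c * h x [z, u] = b \<bullet> u"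
 show "z = (1 / c) *\<^sub>R sh b x"
  by (rule h_eqI[OF assms(1)]) (use z assms in \<open>simp add: h_scale h_sh field_simps\<close>)
qed

lemma Ric_scale: assumes c: "c ~= 0" and x: "x \<in> W" shows "Ric (%x vs. c * h x vs) x u v = Ric h x u v"
proof -
 have ch: "christoffel (%x vs. c * h x vs) x v w = \<Gamma> x v w" if x: "x \<in> W" for x v w
 proof -
  have d: "dirderiv (%x vs. c * h x vs) x v [a, b] = c * dirderiv h x v [a, b]" for v a b
   unfolding dirderiv_def using fd_mult[OF cf_smooth[of c] _ x, of "%y. h y [a, b]" v] h_smooth_fields[of "%_. a" "%_. b"] by simp
  show ?thesis
   unfolding christoffel_def raise_scale[OF x c] d using c by (intro sum.cong refl) (simp add: field_simps)
 qed
 have "fd (%y. christoffel (%x vs. c * h x vs) y v w) x = fd (%y. \<Gamma> y v w) x" for v w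
  by (rule fd_cong[OF open_W x ch])
 thus ?thesis unfolding Ric_def curv_def ch[OF x] by simp
qed

end

text \<open>Coordinates \<open>r\<close> and \<open>\<tau>\<close> on the ambient space, the first invariant and the second homogeneous of degree one, and a
  parametrization \<open>EM\<close> of the cone by the base and the scale \<open>t\<close>.\<close>

locale local_cone = homothety W h X n + G: pmetric U g
 for W :: "'e::euclidean_space set" and h X n and U :: "'b::euclidean_space set" and g +
 fixes l :: real and T :: "real set" and EM :: "'b \<times> real => 'e" and r :: "'e => 'b" and \<tau> :: "'e => real"
 assumes dim_b: "DIM('b) = n" and n2: "n > 2"
  and einstein: "!!x u v. x \<in> U ==> Ric g x u v = l * g x [u, v]"
  and T: "open T" "1 \<in> T" "T <= {0<..}"
  and r: "smooth_on W r" "!!y. y \<in> W ==> r y \<in> U" "!!y. y \<in> W ==> fd r y (X y) = 0"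
  and \<tau>: "smooth_on W \<tau>" "!!y. y \<in> W ==> \<tau> y \<in> T" "!!y. y \<in> W ==> fd \<tau> y (X y) = \<tau> y"
  and E_smooth: "smooth_on (U \<times> T) EM" and E_W: "!!p. p \<in> U \<times> T ==> EM p \<in> W"
  and E_Q: "!!p. p \<in> U \<times> T ==> h (EM p) [X (EM p), X (EM p)] = 0"
  and E_metric: "!!p u v. p \<in> U \<times> T ==> h (EM p) [fd EM p u, fd EM p v] = (snd p)\<^sup>2 * g (fst p) [fst u, fst v]"
  and E_X: "!!p. p \<in> U \<times> T ==> fd EM p (0, snd p) = X (EM p)"
  and r_E: "!!p. p \<in> U \<times> T ==> r (EM p) = fst p" "!!p. p \<in> U \<times> T ==> \<tau> (EM p) = snd p"
  and E_surj: "!!z. z \<in> W ==> h z [X z, X z] = 0 ==> \<exists>p\<in>U \<times> T. z = EM p"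
begin

lemma fd_section: assumes "x \<in> U" "t \<in> T" shows "fd (%x. EM (x, t)) x v = fd EM (x, t) (v, 0)"
proof -
 have "smooth_on U (%x. (x, t))" by (intro smooth_Pair smooth_id smooth_const G.open_W)
 moreover have "fd (%x. (x, t)) x = (%v. (v, 0))" by (rule fd_eqI) (auto intro!: derivative_eq_intros)
 ultimately show ?thesis using fd_compose[OF _ E_smooth, of U "%x. (x, t)" x v] assms by simp
qed

text \<open>The metric \<open>t\<^sup>2 g\<close> has the Einstein constant \<open>l / t\<^sup>2\<close>.\<close>

lemma cone_section_at: assumes t: "t \<in> T" shows "cone_section W h X n U (%x vs. t\<^sup>2 * g x vs) (%x. EM (x, t)) (l / t\<^sup>2)"
proof -
 have t0: "t\<^sup>2 ~= 0" using t T(3) by auto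
 show ?thesis
 proof (unfold_locales)
  show "multilin 2 (%vs. t\<^sup>2 * g x vs)" if "x \<in> U" for x
   using G.h_mult[OF that] unfolding multilin_def by (auto intro!: linear_compose_scale_right[where 'b=real, simplified])
  show "smooth_on U (%x. t\<^sup>2 * g x vs)" if "length vs = 2" for vs
   by (intro smooth_mult smooth_const G.open_W G.h_smooth that)
  show "t\<^sup>2 * g x [u, v] = t\<^sup>2 * g x [v, u]" if "x \<in> U" for x u v using G.h_sym[OF that, of u v] by simp
  show "u = 0" if "x \<in> U" "!!v. t\<^sup>2 * g x [u, v] = 0" for x u using G.h_nd[OF that(1)] that(2) t0 by auto
  show "smooth_on U (%x. EM (x, t))"
   by (rule smooth_compose[OF G.open_W open_Times[OF G.open_W T(1)] _ E_smooth])
    (use t in \<open>auto intro!: smooth_Pair smooth_id smooth_const G.open_W\<close>)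
  fix x assume x: "x \<in> U"
  hence p: "(x, t) \<in> U \<times> T" using t by simp
  show "EM (x, t) \<in> W" by (rule E_W[OF p])
  show "Q (EM (x, t)) = 0" using E_Q[OF p] by (simp add: Q_def)
  show "t\<^sup>2 * g x [u, v] = h (EM (x, t)) [fd (%x. EM (x, t)) x u, fd (%x. EM (x, t)) x v]" for u v
   unfolding fd_section[OF x t] E_metric[OF p] by simp
  show "Ric (%x vs. t\<^sup>2 * g x vs) x u v = l / t\<^sup>2 * (t\<^sup>2 * g x [u, v])" for u v
   using G.Ric_scale[OF t0 x] einstein[OF x] t0 by simp
 qed (use dim_b n2 in auto)
qed

definition T00 :: "'e tfield" where "T00 y vs = (if y \<in> W & vs = [] then \<tau> y else 0)"

lemma T0: "Frm 0 T00" "wt 1 T00"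
proof -
 have s: "smooth_on W (%y. T00 y vs)" for vs
  by (cases "vs = []", rule iffD2[OF smooth_on_cong[OF open_W] \<tau>(1)]) (auto simp: T00_def)
 thus F: "Frm 0 T00" by (auto simp: Frm_def Ten_def alt_def alternating_def ten_0 T00_def)
 show "wt 1 T00"
 proof (rule Ten_eqI[of 0])
  show "Ten 0 (NN X T00)" "Ten 0 (cs 1 T00)" by (intro Ten_NN Ten_sm Frm_Ten F X_smooth smooth_const open_W)+
  fix x and vs :: "'e list" assume x: "x \<in> W" "length vs = 0"
  have "fd (%y. T00 y []) x = fd \<tau> x" by (rule fd_cong[OF open_W x(1)]) (simp add: T00_def)
  thus "NN X T00 x vs = cs 1 T00 x vs" using x \<tau>(3)[OF x(1)] by (simp add: NN_def DD_def T00_def)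
 qed
qed

definition pb :: "'b tfield => 'e tfield" where "pb \<omega> y vs = (if y \<in> W then \<omega> (r y) (map (fd r y) vs) else 0)"

lemma pb: assumes "G.Frm k \<omega>" shows "Frm k (pb \<omega>)" "dx (pb \<omega>) = pb (G.dx \<omega>)" "ii X (pb \<omega>) = 0"
proof -
 note * = basic_pullback[OF G.pmetric_axioms r X_smooth cv_X assms]
 show "Frm k (pb \<omega>)" "dx (pb \<omega>) = pb (G.dx \<omega>)" "ii X (pb \<omega>) = 0"
  unfolding pb_def[abs_def] by (rule *(1), assumption+) (rule *(2), assumption+, rule *(3), assumption+)
qed

lemma r_E_fd: assumes p: "p \<in> U \<times> T" shows "fd r (EM p) (fd EM p u) = fst u"
proof -
 have o: "open (U \<times> T)" by (intro open_Times G.open_W T)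
 have "fd (%p. r (EM p)) p u = fd fst p u" by (rule fun_cong[OF fd_cong[OF o p]]) (rule r_E)
 moreover have "fd fst p = fst" by (rule fd_eqI) (auto intro!: derivative_eq_intros)
 ultimately show ?thesis using fd_compose[OF E_smooth r(1) p E_W[OF p]] by simp
qed

text \<open>Counting dimensions with the null frame: the orthogonal space of \<open>X\<close> is spanned by the section and \<open>X\<close>.\<close>

lemma tangent: assumes z: "z \<in> W" "Q z = 0" and v: "h z [X z, v] = 0"
 shows "EM (r z, \<tau> z) = z & (\<exists>u. v = fd EM (r z, \<tau> z) u)"
proof -
 obtain p where p: "p \<in> U \<times> T" "z = EM p" using E_surj[OF z(1)] z(2) by (auto simp: Q_def)
 hence rp: "p = (r z, \<tau> z)" using r_E[OF p(1)] by (cases p) auto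
 let ?x = "r z" and ?t = "\<tau> z"
 have x: "?x \<in> U" "?t \<in> T" using r(2) \<tau>(2) z(1) by auto
 have zE: "EM (?x, ?t) = z" unfolding rp[symmetric] by (rule p(2)[symmetric])
 interpret S: cone_section W h X n U "%x vs. ?t\<^sup>2 * g x vs" "%x. EM (x, ?t)" "l / ?t\<^sup>2" by (rule cone_section_at[OF x(2)])
 obtain Y where Y: "S.is_Y ?x Y" using S.Y_exists[OF x(1)] by blast
 have o: "(?x, ?t) \<in> U \<times> T" using x by simp
 note lE = fd_linear[OF E_smooth o]
 have t0: "?t ~= 0" using x(2) T(3) by auto
 define a where "a = h z [v, Y]"
 define w where "w = (SUM b. h z [v, S.H ?x (S.G.sh b ?x)] *\<^sub>R b)"
 have vX: "h z [v, X z] = 0" using v h_sym[OF z(1)] by simp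
 have "v = (SUM b. h z [v, S.H ?x (S.G.sh b ?x)] *\<^sub>R S.H ?x b) + a *\<^sub>R X z"
  using S.decomp[OF x(1) Y, of v] unfolding zE vX a_def[symmetric] scaleR_zero_left add_0_right .
 also have "(SUM b. h z [v, S.H ?x (S.G.sh b ?x)] *\<^sub>R S.H ?x b) = S.H ?x w"
  by (simp only: w_def linear_sum[OF S.H_lin[OF x(1)]] linear_scale[OF S.H_lin[OF x(1)]])
 also have "S.H ?x w = fd EM (?x, ?t) (w, 0)" by (rule fd_section[OF x])
 also have "X z = fd EM (?x, ?t) (0, ?t)" using E_X[OF o] zE by simp
 also have "fd EM (?x, ?t) (w, 0) + a *\<^sub>R fd EM (?x, ?t) (0, ?t) = fd EM (?x, ?t) (w, a * ?t)"
  unfolding linear_scale[OF lE, symmetric] linear_add[OF lE, symmetric] by simp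
 finally show ?thesis using zE by blast
qed

text \<open>A lift is known only on vectors tangent to the cone.  By \<open>tangent\<close> these are the ones coming from the
  parametrization.\<close>

lemma local_value:
 assumes k: "k >= 1" and nq: "n = 2 * (Suc k + m)" and \<omega>: "G.Frm k \<omega>"
  and Fh: "Frm (Suc k) Fh" "wt (- real (Suc k)) Fh"
   "!!p us. p \<in> U \<times> T ==> length us = Suc k ==> Fh (EM p) (map (fd EM p) us) = G.dx \<omega> (fst p) (map fst us)"
  and x: "x \<in> U" and vs: "length vs = k"
  and Y: "h (EM (x, 1)) [Y, Y] = 0" "h (EM (x, 1)) [X (EM (x, 1)), Y] = 1" "!!v. h (EM (x, 1)) [Y, fd EM (x, 1) (v, 0)] = 0"
 shows "(DL ^^ m) (iotaD (1 - real (Suc k)) (E Fh)) (EM (x, 1)) (Y # map (%v. fd EM (x, 1) (v, 0)) vs) =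
  (2 * real m + 2) * foldr (G.fac k) (map (%i. 2 * (l / (2 * (real n - 1))) * real i * (real n - 1 - 2 * real k - real i)) [1..<Suc m])
   (G.dl (G.dx \<omega>)) x vs"
proof -
 obtain k' where k': "k = Suc k'" using k by (cases k) auto
 have "(%x vs. 1\<^sup>2 * g x vs) = g" by simp
 hence "cone_section W h X n U g (%x. EM (x, 1)) (l / 1\<^sup>2)" using cone_section_at[OF T(2)] by simp
 then interpret S: cone_section W h X n U g "%x. EM (x, 1)" l by simp
 have H: "S.H y = (%v. fd EM (y, 1) (v, 0))" if "y \<in> U" for y using fd_section[OF that T(2)] by (rule ext)
 have p1: "(y, 1) \<in> U \<times> T" if "y \<in> U" for y using that T(2) by simp
 have Y': "S.is_Y x Y" using Y by (simp add: S.is_Y_def H[OF x])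
 have lam: "S.lam = l / (2 * (real n - 1))" by (simp add: S.lam_def)
 have Fpb: "Fh z us = dx (pb \<omega>) z us" if z: "z \<in> W" "Q z = 0" and us: "\<forall>v\<in>set us. h z [X z, v] = 0" for z us
 proof (cases "length us = Suc k")
  case True
  have zE: "EM (r z, \<tau> z) = z" using tangent[OF z, of "0"] z(1) by (simp add: h_zero)
  have p: "(r z, \<tau> z) \<in> U \<times> T" using z r \<tau> by simp
  have "\<forall>v\<in>set us. \<exists>u. v = fd EM (r z, \<tau> z) u" using tangent[OF z] us by blast
  then obtain us' where us': "us = map (fd EM (r z, \<tau> z)) us'" by (metis (full_types) ex_map_conv)
  have "Fh z us = G.dx \<omega> (r z) (map fst us')"
   using Fh(3)[OF p, of us'] True zE by (simp add: us')
  moreover have "map (fd r z) us = map fst us'"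
   using r_E_fd[OF p] zE by (simp add: us')
  ultimately show ?thesis using z(1) by (simp add: pb(2)[OF \<omega>]) (simp add: pb_def)
 next
  case False
  thus ?thesis using Ten_len[OF Frm_Ten[OF Fh(1)]] Ten_len[OF Frm_Ten[OF Frm_dx[OF pb(1)[OF \<omega>]]]] by simp
 qed
 have e: "pb \<omega> (EM (y, 1)) (map (S.H y) ws) = \<omega> y ws" if "y \<in> U" for y ws
  using E_W[OF p1[OF that]] r_E(1)[OF p1[OF that]] r_E_fd[OF p1[OF that]] by (simp add: pb_def H[OF that] comp_def)
 have cone: "\<exists>U' g' (e' :: 'b => 'e) l' s x. cone_section W h X n U' g' e' l' & x \<in> U' & e' x = z & (\<forall>y\<in>U'. T00 (e' y) [] = s) & s ~= 0"
  if z: "z \<in> W" "Q z = 0" for z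
 proof -
  have zE: "EM (r z, \<tau> z) = z" using tangent[OF z, of "0"] z(1) by (simp add: h_zero)
  have "T00 (EM (y, \<tau> z)) [] = \<tau> z" if "y \<in> U" for y
   using r_E(2)[of "(y, \<tau> z)"] E_W[of "(y, \<tau> z)"] that \<tau>(2)[OF z(1)] by (simp add: T00_def)
  moreover have "\<tau> z ~= 0" using \<tau>(2)[OF z(1)] T(3) by auto
  ultimately show ?thesis
   using cone_section_at[OF \<tau>(2)[OF z(1)]] r(2)[OF z(1)] zE
   by (intro exI[of _ U] exI[of _ "%x vs. (\<tau> z)\<^sup>2 * g x vs"] exI[of _ "%x. EM (x, \<tau> z)"] exI[of _ "l / (\<tau> z)\<^sup>2"] exI[of _ "\<tau> z"] exI[of _ "r z"]) simp
 qed
 have nz: "T00 z [] ~= 0" if "z \<in> W" for z using \<tau>(2)[OF that] T(3) that by (auto simp: T00_def)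
 have T1: "T00 (EM (y, 1)) [] = 1" if "y \<in> U" for y using r_E(2)[OF p1[OF that]] E_W[OF p1[OF that]] by (simp add: T00_def)
 have iX: "ii X (dx (pb \<omega>)) = 0" by (simp only: pb(2)[OF \<omega>] pb(3)[OF G.Frm_dx[OF \<omega>]])
 define C where "C = (%i. 2 * (l / (2 * (real n - 1))) * real i * (real n - 1 - 2 * real k - real i))"
 have 1: "(DL ^^ m) (iotaD (1 - real (Suc k)) (E Fh)) (EM (x, 1)) (Y # map (S.H x) vs) =
  (2 * real m + 2) * fold (G.fac k) (map (%i. C (2 * i)) [1..<Suc m]) (G.dl (G.dx \<omega>)) x vs"
  unfolding C_def lam[symmetric] unfolding k'
  by (rule S.detour_value[OF nq[unfolded k'] T0 nz T1 cone pb(1)[OF \<omega>[unfolded k']] iX \<omega>[unfolded k'] e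
    Fh(1,2)[unfolded k'] Fpb x Y' vs[unfolded k']])
 have "C (2 * m + 1 - i) = C i" if "i <= 2 * m + 1" for i
 proof -
  have "real (2 * m + 1 - i) = real n - 1 - 2 * real k - real i" using that by (simp add: nq of_nat_diff)
  thus ?thesis by (simp add: C_def)
 qed
 from G.fac_perm[of m C k "G.dl (G.dx \<omega>)", OF this] 1 show ?thesis by (simp only: H[OF x] C_def)
qed

end

section \<open>Charts of the base and of the ambient manifold\<close>

lemma chart:
 assumes "smooth_manifold M" "c \<in> atlas M"
 shows "fst c <= topspace (mtop M)" "open (chart_dom c)" "p \<in> fst c ==> chart_pt c (snd c p) = p"
  "x \<in> chart_dom c ==> chart_pt c x \<in> fst c" "x \<in> chart_dom c ==> snd c (chart_pt c x) = x"
  "p \<in> fst c ==> snd c p \<in> chart_dom c" "snd c ` (fst c \<inter> topspace (mtop M)) = chart_dom c"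
  "openin (mtop M) S ==> open (snd c ` (fst c \<inter> S))"
  "open B ==> B <= chart_dom c ==> openin (mtop M) (chart_pt c ` B)"
proof -
 have o: "openin (mtop M) (fst c)" and d: "open (chart_dom c)"
  and hm: "homeomorphic_map (subtopology (mtop M) (fst c)) (top_of_set (chart_dom c)) (snd c)"
  using assms by (auto simp: smooth_manifold_def)
 show sub: "fst c <= topspace (mtop M)" using o by (rule openin_subset)
 hence t: "topspace (subtopology (mtop M) (fst c)) = fst c" by auto
 have inj: "inj_on (snd c) (fst c)" using hm t unfolding homeomorphic_map_def by simp
 show "open (chart_dom c)" by (rule d)
 show 1: "p \<in> fst c ==> chart_pt c (snd c p) = p" for p unfolding chart_pt_def by (rule inv_into_f_f[OF inj])
 show 2: "x \<in> chart_dom c ==> chart_pt c x \<in> fst c" for x unfolding chart_pt_def chart_dom_def by (rule inv_into_into)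
 show 3: "x \<in> chart_dom c ==> snd c (chart_pt c x) = x" for x unfolding chart_pt_def chart_dom_def by (rule f_inv_into_f)
 show "p \<in> fst c ==> snd c p \<in> chart_dom c" by (auto simp: chart_dom_def)
 show "snd c ` (fst c \<inter> topspace (mtop M)) = chart_dom c" using sub by (auto simp: chart_dom_def)
 show "open (snd c ` (fst c \<inter> S))" if "openin (mtop M) S"
 proof -
  have "openin (subtopology (mtop M) (fst c)) (fst c \<inter> S)" using that by (metis Int_commute openin_subtopology_Int)
  hence "openin (top_of_set (chart_dom c)) (snd c ` (fst c \<inter> S))"
   using homeomorphic_imp_open_map[OF hm] by (simp add: open_map_def)
  thus ?thesis using d openin_open_trans by blast
 qed
 show "openin (mtop M) (chart_pt c ` B)" if B: "open B" "B <= chart_dom c"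
 proof -
  have "openin (subtopology (mtop M) (fst c)) {p \<in> topspace (subtopology (mtop M) (fst c)). snd c p \<in> B}"
   using homeomorphic_imp_continuous_map[OF hm] B openin_subset[of "top_of_set (chart_dom c)" B]
   by (intro openin_continuous_map_preimage[of _ "top_of_set (chart_dom c)"]) (auto simp: openin_open_eq[OF d])
  moreover have "{p \<in> topspace (subtopology (mtop M) (fst c)). snd c p \<in> B} = chart_pt c ` B"
   unfolding t using 1 2 3 B(2) by (auto simp: image_iff) (metis 1)
  ultimately show ?thesis using o openin_trans_full by metis
 qed
qed

lemma pmetric_chart:
 assumes "smooth_manifold M" "pseudo_metric M g" "c \<in> atlas M"
 shows "pmetric (chart_dom c) (g c)"
proof -
 note d = chart(7)[OF assms(1,3)]
 have "\<forall>vs. length vs = 2 --> smooth_on (chart_dom c) (%x. g c x vs)" "\<forall>x\<in>chart_dom c. multilin 2 (g c x)"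
  using assms(2,3) unfolding pseudo_metric_def tensor_field_def d[symmetric] by blast+
 moreover have "\<forall>x\<in>chart_dom c. (\<forall>u v. g c x [u, v] = g c x [v, u]) & (\<forall>u. (\<forall>v. g c x [u, v] = 0) --> u = 0)"
  using assms(2,3) unfolding pseudo_metric_def by blast
 ultimately show ?thesis using chart(2)[OF assms(1,3)] by unfold_locales auto
qed

lemma pmetric_mono: "pmetric W h ==> open W' ==> W' <= W ==> pmetric W' h"
 unfolding pmetric_def pmetric_axioms_def region_def using smooth_subset by blast

text \<open>The symmetric part of \<open>\<nabla>X\<close> is half of the Lie derivative of the metric; the antisymmetric part vanishes as \<open>X\<close>
  is the gradient of \<open>Q / 2\<close>.\<close>

lemma (in pmetric) cv_homothety:
 assumes X: "smooth_on W X" and a: "!!y u v. y \<in> W ==> lie_deriv_loc X h y [u, v] = 2 * h y [u, v]"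
  and b: "!!y v. y \<in> W ==> 2 * h y [X y, v] = fd (%z. h z [X z, X z]) y v" and x: "x \<in> W"
 shows "cv (cf u) X x = u"
proof (rule h_eqI[OF x])
 fix v
 have s: "smooth_on W (%z. h z [X z, X z])" by (intro smooth_intros X)
 have "fd (%z. 2 * h z [X z, v]) x u = 2 * (h x [cv (cf u) X x, v] + h x [X x, \<Gamma> x u v])" for u v
  using fd_mult[OF cf_smooth[of 2] h_smooth_fields[OF X cf_smooth[of v]] x, of u]
   h_compat[OF x X cf_smooth[of v], of u] by (simp add: cv_def[of _ "%_. _"])
 moreover have "fd (%z. 2 * h z [X z, v]) x = fd (%y. fd (%z. h z [X z, X z]) y v) x" for v
  by (rule fd_cong[OF open_W x b])
 ultimately have k: "2 * (h x [cv (cf u) X x, v] + h x [X x, \<Gamma> x u v]) = fd (%y. fd (%z. h z [X z, X z]) y v) x u" for u v by metis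
 have sym: "h x [cv (cf u) X x, v] = h x [cv (cf v) X x, u]"
  using k[of u v] k[of v u] fd_symmetric[OF open_W s x, of v u] \<Gamma>_sym[OF x, of u v] by simp
 have "lie_deriv_loc X h x [u, v] = Dh x (X x) u v + (h x [fd X x u, v] + h x [u, fd X x v])"
  by (simp add: lie_deriv_loc_def dirderiv_def Dh_def lessThan_Suc numeral_2_eq_2)
 also have "... = h x [cv (cf u) X x, v] + h x [u, cv (cf v) X x]"
  unfolding h_compat_const[OF x] cv_def using x \<Gamma>_sym[OF x, of "X x" u] \<Gamma>_sym[OF x, of "X x" v] by (simp add: h_add)
 finally show "h x [cv (cf u) X x, v] = h x [u, v]" using a[OF x] sym h_sym[OF x, of u "cv (cf v) X x"] by simp
qed

lemma smooth_abs: "smooth_on (- {0}) (abs :: real => real)"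
proof -
 have "smooth_on {0<..} (abs :: real => real)"
  by (rule iffD2[OF smooth_on_cong[of _ _ "%x. x"]]) auto
 moreover have "smooth_on {..<0} (abs :: real => real)"
  by (rule iffD2[OF smooth_on_cong[of _ _ "%x. - x"]]) (auto intro: smooth_minus)
 ultimately show ?thesis
  by (intro smooth_local) (metis Compl_iff greaterThan_iff lessThan_iff linorder_neqE_linordered_idom open_greaterThan open_lessThan singletonI smooth_subset Compl_iff)
qed

locale ambient_setting =
 fixes M :: "('p, 'b::euclidean_space) mfd" and g \<sigma> and A :: "('p, 'b, 'q, 'f::euclidean_space) ambient"
 assumes M: "smooth_manifold M" and g: "pseudo_metric M g" and es: "einstein_scale M g \<sigma>"
  and amb: "ricci_flat_ambient_space M g A" and dim2: "DIM('b) > 2"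
begin

abbreviation "gh == scale_metric M g \<sigma>"
abbreviation "hm == hmet A"
abbreviation "XX == gen_X A"
abbreviation "EE == emb_coord M gh A"
abbreviation "cone_pt c z == emb A (ray_param M gh c z)"

lemma amb_mfd: "ambient_manifold M g A" and amb_met: "ambient_metric M g A"
 using amb by (simp_all add: ricci_flat_ambient_space_def)
lemma Mt: "smooth_manifold (tot A)" using amb_mfd by (simp add: ambient_manifold_def)
lemma pm: "pmetric (chart_dom c) (gh c)" if "c \<in> atlas M"
 using pmetric_chart[OF M _ that, of gh] es by (simp add: einstein_scale_def einstein_metric_def)
lemma pmt: "pmetric (chart_dom c) (hm c)" if "c \<in> atlas (tot A)"
 using pmetric_chart[OF Mt _ that, of hm] amb_met by (simp add: ambient_metric_def)
lemmas ch = chart[OF M] and cht = chart[OF Mt]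

lemma action: assumes "p \<in> topspace (mtop (tot A))"
 shows "act A 1 p = p" "s > 0 ==> t > 0 ==> act A s (act A t p) = act A (s * t) p"
 using amb_mfd assms by (auto simp: ambient_manifold_def)

subsection \<open>The flow and its generator\<close>

text \<open>The dilations in a chart, and the set on which they stay in it.\<close>

definition flw :: "('q, 'f) chart => real \<times> ('f) => 'f" where
 "flw c z = snd c (act A (fst z) (chart_pt c (snd z)))"
definition dom_flw :: "('q, 'f) chart => (real \<times> ('f)) set" where
 "dom_flw c = {z \<in> {0<..} \<times> chart_dom c. act A (fst z) (chart_pt c (snd z)) \<in> fst c}"

context
 fixes c assumes c: "c \<in> atlas (tot A)"
begin

lemma flw_smooth: "open (dom_flw c)" "smooth_on (dom_flw c) (flw c)"
proof -
 have "smooth_into (tot A) ({0<..} \<times> chart_dom c) (%z. act A (fst z) (chart_pt c (snd z)))"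
  using amb_mfd c by (simp add: ambient_manifold_def)
 thus "open (dom_flw c)" "smooth_on (dom_flw c) (flw c)"
  using c by (simp_all add: smooth_into_def dom_flw_def flw_def[abs_def])
qed

lemma flw_pt: "z \<in> dom_flw c ==> flw c z \<in> chart_dom c" "z \<in> dom_flw c ==> chart_pt c (flw c z) = act A (fst z) (chart_pt c (snd z))"
 using cht[OF c] by (auto simp: dom_flw_def flw_def)

lemma flw_1: assumes "y \<in> chart_dom c" shows "(1, y) \<in> dom_flw c" "flw c (1, y) = y"
 using action(1)[OF subsetD[OF cht(1)[OF c] cht(4)[OF c assms]]] cht(4,5)[OF c assms] assms by (simp_all add: dom_flw_def flw_def)

lemma flw_flw: assumes "(t, y) \<in> dom_flw c" "s > 0" shows "flw c (s, flw c (t, y)) = flw c (s * t, y)"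
proof -
 have y: "y \<in> chart_dom c" "t > 0" using assms by (auto simp: dom_flw_def)
 show ?thesis
  using action(2)[OF subsetD[OF cht(1)[OF c] cht(4)[OF c y(1)]] assms(2) y(2)] flw_pt(2)[OF assms(1)]
  by (simp add: flw_def[of c "(s, _)"] flw_def[of c "(s * t, y)"])
qed

lemma flw_deriv: assumes "(t, y) \<in> dom_flw c"
 shows "((%s. flw c (s, y)) has_vector_derivative fd (flw c) (t, y) (1, 0)) (at t)"
proof -
 have "((%s. flw c (s, y)) has_derivative (%a. fd (flw c) (t, y) (a, 0))) (at t)"
  by (rule has_derivative_compose[where g="flw c" and f="%s. (s, y)" and g'="fd (flw c) (t, y)"], (auto intro!: derivative_eq_intros)[1])
   (rule smooth_has_fd[OF flw_smooth(2) assms])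
 moreover have "(%a. fd (flw c) (t, y) (a, 0)) = (%a. a *\<^sub>R fd (flw c) (t, y) (1, 0))"
  by (rule ext, rule trans[OF _ linear_scale[OF fd_linear[OF flw_smooth(2) assms]]]) simp
 ultimately show ?thesis unfolding has_vector_derivative_def by (simp only:)
qed

lemma XX_eq: "y \<in> chart_dom c ==> XX c y = fd (flw c) (1, y) (1, 0)"
 using vector_derivative_at[OF flw_deriv[OF flw_1(1)]] by (simp add: gen_X_def flw_def)

lemma XX_smooth: "smooth_on (chart_dom c) (XX c)"
proof -
 have "smooth_on (chart_dom c) (%y. fd (flw c) (1, y) (1, 0))"
  by (rule smooth_fd_compose[OF cht(2)[OF c] flw_smooth(1) _ _ flw_smooth(2)])
   (auto intro!: smooth_Pair smooth_const smooth_id flw_1 cht(2)[OF c])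
 thus ?thesis by (rule iffD2[OF smooth_on_cong[OF cht(2)[OF c]], rotated]) (rule XX_eq)
qed

text \<open>The velocity of an orbit may be computed from any description of it.\<close>

lemma XX_curve:
 assumes y: "y \<in> chart_dom c" and f: "(f has_vector_derivative v) (at 1)" "!!s. s > 0 ==> f s = flw c (s, y)" shows "XX c y = v"
proof -
 have "((%s. flw c (s, y)) has_vector_derivative v) (at 1)"
  by (rule has_vector_derivative_transform_within_open[OF f(1), of "{0<..}"]) (auto simp: f(2))
 thus ?thesis using vector_derivative_unique_at flw_deriv[OF flw_1(1)[OF y]] XX_eq[OF y] by metis
qed

lemma XX_flw: assumes "(t, y) \<in> dom_flw c" shows "XX c (flw c (t, y)) = t *\<^sub>R fd (flw c) (t, y) (1, 0)"
proof (rule XX_curve[OF flw_pt(1)[OF assms]])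
 have "((%s. s * t) has_vector_derivative t) (at 1)"
  by (auto intro!: derivative_eq_intros simp: has_vector_derivative_def)
 hence "((%s. flw c (s, y)) \<circ> (%s. s * t) has_vector_derivative t *\<^sub>R fd (flw c) (t, y) (1, 0)) (at 1)"
  by (rule vector_diff_chain_at) (use flw_deriv[OF assms] in simp)
 thus "((%s. flw c (s * t, y)) has_vector_derivative t *\<^sub>R fd (flw c) (t, y) (1, 0)) (at 1)" by (simp add: comp_def)
qed (simp add: flw_flw[OF assms])

lemma cone_metric:
 assumes "y \<in> chart_dom c"
 shows "lie_deriv_loc (XX c) (hm c) y [u, v] = 2 * hm c y [u, v]"
  "2 * hm c y [XX c y, v] = fd (%z. hm c z [XX c z, XX c z]) y v" "Ric (hm c) y u v = 0"
  "hm c y [XX c y, XX c y] = 0 \<longleftrightarrow> chart_pt c y \<in> emb A ` ray_bundle M g"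
  "hm c y [XX c y, XX c y] = 0 ==> \<exists>v. fd (%z. hm c z [XX c z, XX c z]) y v ~= 0"
 using amb_met c assms by (auto simp: ambient_metric_def)

lemma cv_XX: "y \<in> chart_dom c ==> pmetric.cv (hm c) (%_. v) (XX c) y = v"
 by (rule pmetric.cv_homothety[OF pmt[OF c] XX_smooth cone_metric(1,2)])

lemma XX_nz: assumes "y \<in> chart_dom c" shows "XX c y ~= 0"
proof
 interpret P: pmetric "chart_dom c" "hm c" by (rule pmt[OF c])
 assume "XX c y = 0"
 hence "hm c y [XX c y, v] = 0" for v using P.h_zero[OF assms] by simp
 thus False using cone_metric(2,5)[OF assms] by (metis mult_zero_right)
qed

end

subsection \<open>The cone in the scale\<close>

text \<open>The metric of the scale is \<open>g\<close> divided by \<open>\<sigma>\<^sup>2\<close>, which reparametrizes the rays.\<close>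

lemma ray_gh: "ray_pt M gh t p = ray_pt M g (t / \<bar>\<sigma> (ray_pt M g 1 p)\<bar>) p"
proof -
 have "t\<^sup>2 * gh c (snd c p) vs = (t / \<bar>\<sigma> (ray_pt M g 1 p)\<bar>)\<^sup>2 * g c (snd c p) vs" if "c \<in> atlas M" "p \<in> fst c" for c vs
  by (simp only: scale_metric_def ray_param_def fst_conv snd_conv ch(3)[OF that] power_divide power2_abs times_divide_eq_left times_divide_eq_right)
 thus ?thesis by (auto simp: ray_pt_def intro!: ext)
qed

lemma \<sigma>: "u \<in> ray_bundle M g ==> \<sigma> u ~= 0" "c \<in> atlas M ==> smooth_on (chart_dom c) (%x. \<sigma> (ray_param M g c (x, 1)))"
 using es by (auto simp: einstein_scale_def density_def)

lemma ray_in: "c \<in> atlas M ==> x \<in> chart_dom c ==> t > 0 ==> ray_param M g c (x, t) \<in> ray_bundle M g"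
 unfolding ray_bundle_def ray_param_def using ch(1)[of c] ch(4)[of c x] by auto

definition sg :: "('p, 'b) chart => 'b => real" where "sg c x = 1 / \<bar>\<sigma> (ray_param M g c (x, 1))\<bar>"

context
 fixes c assumes c: "c \<in> atlas M"
begin

lemma sg: "smooth_on (chart_dom c) (sg c)" "x \<in> chart_dom c ==> sg c x > 0"
proof -
 have nz: "\<sigma> (ray_param M g c (x, 1)) ~= 0" if "x \<in> chart_dom c" for x using \<sigma>(1) ray_in[OF c that] by simp
 have "smooth_on (chart_dom c) (%x. \<bar>\<sigma> (ray_param M g c (x, 1))\<bar>)"
  by (rule smooth_compose[OF ch(2)[OF c] _ \<sigma>(2)[OF c] smooth_abs]) (use nz in auto)
 from smooth_divide[OF ch(2)[OF c] smooth_const[OF ch(2)[OF c]] this, of 1] show "smooth_on (chart_dom c) (sg c)"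
  unfolding sg_def[abs_def] using nz by simp
 show "x \<in> chart_dom c ==> sg c x > 0" using nz by (simp add: sg_def)
qed

lemma ray_param_gh: "ray_param M gh c (x, t) = ray_param M g c (x, t * sg c x)"
 by (simp add: ray_param_def ray_gh sg_def)

lemma emb_smooth: "smooth_into (tot A) (chart_dom c \<times> {0<..}) (%z. emb A (ray_param M g c z))"
 using amb_mfd c unfolding ambient_manifold_def by blast

lemma cone_in: assumes "x \<in> chart_dom c" "t > 0" shows "ray_param M gh c (x, t) \<in> ray_bundle M g" "cone_pt c (x, t) \<in> topspace (mtop (tot A))"
proof -
 have t: "t * sg c x > 0" using sg(2)[OF assms(1)] assms(2) by simp
 show "ray_param M gh c (x, t) \<in> ray_bundle M g" unfolding ray_param_gh by (rule ray_in[OF c assms(1) t])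
 from emb_smooth show "cone_pt c (x, t) \<in> topspace (mtop (tot A))" unfolding ray_param_gh smooth_into_def using assms(1) t by (auto simp: image_subset_iff)
qed

lemma act_cone: assumes "x \<in> chart_dom c" "t > 0" "s > 0" shows "act A s (cone_pt c (x, t)) = cone_pt c (x, s * t)"
proof -
 have "ray_act s (ray_param M gh c (x, t)) = ray_param M gh c (x, s * t)"
  by (auto simp: ray_act_def ray_param_def ray_pt_def power_mult_distrib intro!: ext)
 moreover have "\<forall>u\<in>ray_bundle M g. \<forall>s>0. emb A (ray_act s u) = act A s (emb A u)" using amb_mfd by (simp add: ambient_manifold_def)
 ultimately show ?thesis using cone_in(1)[OF assms(1,2)] assms(3) by metis
qed

context
 fixes c' assumes c': "c' \<in> atlas (tot A)"
begin

definition dom_E :: "('b \<times> real) set" where "dom_E = {z \<in> chart_dom c \<times> {0<..}. cone_pt c z \<in> fst c'}"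

lemma E_pt: "z \<in> dom_E ==> EE c c' z \<in> chart_dom c'" "z \<in> dom_E ==> chart_pt c' (EE c c' z) = cone_pt c z"
 using cht(3,6)[OF c'] by (auto simp: dom_E_def emb_coord_def)

text \<open>The embedding of the cone is given in terms of \<open>g\<close>; the reparametrization by \<open>sg\<close> turns it into one for the scale.\<close>

lemma E_all:
 "open dom_E" "smooth_on dom_E (EE c c')"
 "z \<in> dom_E ==> hm c' (EE c c' z) [fd (EE c c') z u, fd (EE c c') z v] = (snd z)\<^sup>2 * gh c (fst z) [fst u, fst v]"
proof -
 let ?k = "%z. (fst z, snd z * sg c (fst z))" and ?S = "chart_dom c \<times> {0<..} :: ('b \<times> real) set"
 let ?D = "{z \<in> ?S. emb A (ray_param M g c z) \<in> fst c'}" and ?E = "emb_coord M g A c c'"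
 have S: "open ?S" by (intro open_Times ch(2)[OF c] open_greaterThan)
 have kS: "?k z \<in> ?S" if "z \<in> ?S" for z using that sg(2) by auto
 have sk: "smooth_on ?S ?k"
  by (intro smooth_Pair smooth_mult smooth_fst smooth_snd smooth_id S smooth_compose[OF S ch(2)[OF c] _ sg(1)]) auto
 have D: "open ?D" "smooth_on ?D ?E"
  using emb_smooth c' unfolding smooth_into_def emb_coord_def[abs_def] by blast+
 have dE: "dom_E = ?k -` ?D \<inter> ?S" using kS by (auto simp: dom_E_def ray_param_gh)
 show o: "open dom_E" unfolding dE using continuous_on_open_vimage[OF S] smooth_continuous[OF sk] D(1) by blast
 have E: "EE c c' z = ?E (?k z)" for z by (cases z) (simp add: emb_coord_def ray_param_gh)
 have sk': "smooth_on dom_E ?k" by (rule smooth_subset[OF sk]) (auto simp: dE)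
 show "smooth_on dom_E (EE c c')" unfolding E[abs_def] by (rule smooth_compose[OF o D(1) sk' D(2)]) (auto simp: dE)
 assume z: "z \<in> dom_E"
 hence kz: "?k z \<in> ?D" "fst z \<in> chart_dom c" "snd z * sg c (fst z) > 0" using kS by (auto simp: dE)
 have f: "fst (fd ?k z u) = fst u" for u
 proof -
  have "fd (%z. fst (?k z)) z u = fst (fd ?k z u)"
   using fd_eqI[OF has_derivative_fst[OF smooth_has_fd[OF sk' z]]] by simp
  moreover have "fd fst z = fst" by (rule fd_eqI) (auto intro!: derivative_eq_intros)
  ultimately show ?thesis by simp
 qed
 have dE': "fd (EE c c') z u = fd ?E (?k z) (fd ?k z u)" for u
  unfolding E[abs_def] by (rule fd_compose[OF sk' D(2) z kz(1)])
 have "\<forall>u v. hm c' (?E (x, t)) (map (fd ?E (x, t)) [u, v]) = t\<^sup>2 * g c x [fst u, fst v]"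
  if "x \<in> chart_dom c" "t > 0" "emb A (ray_param M g c (x, t)) \<in> fst c'" for x t
  using amb_met c c' that unfolding ambient_metric_def by blast
 moreover have "emb A (ray_param M g c (?k z)) \<in> fst c'" using kz(1) by blast
 ultimately have "\<forall>u v. hm c' (?E (?k z)) (map (fd ?E (?k z)) [u, v]) = (snd z * sg c (fst z))\<^sup>2 * g c (fst z) [fst u, fst v]"
  using kz(2,3) by blast
 from this[rule_format, of "fd ?k z u" "fd ?k z v"]
 have "hm c' (?E (?k z)) [fd ?E (?k z) (fd ?k z u), fd ?E (?k z) (fd ?k z v)] = (snd z * sg c (fst z))\<^sup>2 * g c (fst z) [fst u, fst v]"
  unfolding f list.map .
 also have "... = (snd z)\<^sup>2 * gh c (fst z) [fst u, fst v]"
  by (simp add: scale_metric_def sg_def power_mult_distrib power_divide)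
 finally show "hm c' (EE c c' z) [fd (EE c c') z u, fd (EE c c') z v] = (snd z)\<^sup>2 * gh c (fst z) [fst u, fst v]"
  unfolding dE' E .
qed

lemma E_flow: assumes "(x, t) \<in> dom_E" "s > 0" shows "flw c' (s, EE c c' (x, t)) = EE c c' (x, s * t)"
 unfolding flw_def using E_pt(2)[OF assms(1)] act_cone[of x t s] assms by (simp add: dom_E_def emb_coord_def)

lemma E_X: assumes "(x, t) \<in> dom_E" shows "fd (EE c c') (x, t) (0, t) = XX c' (EE c c' (x, t))"
proof (rule XX_curve[OF c' E_pt(1)[OF assms], symmetric])
 have "((%s. EE c c' (x, s * t)) has_derivative (%a. fd (EE c c') (x, t) (0, a * t))) (at 1)"
  by (rule has_derivative_compose[where g="EE c c'" and f="%s. (x, s * t)" and g'="fd (EE c c') (x, t)"], (auto intro!: derivative_eq_intros)[1])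
   (use smooth_has_fd[OF E_all(2) assms] in simp)
 moreover have "(%a. fd (EE c c') (x, t) (0, a * t)) = (%a. a *\<^sub>R fd (EE c c') (x, t) (0, t))"
  by (rule ext, rule trans[OF _ linear_scale[OF fd_linear[OF E_all(2) assms]]]) simp
 ultimately show "((%s. EE c c' (x, s * t)) has_vector_derivative fd (EE c c') (x, t) (0, t)) (at 1)"
  unfolding has_vector_derivative_def by (simp only:)
qed (simp add: E_flow[OF assms])

lemma E_Q: "z \<in> dom_E ==> hm c' (EE c c' z) [XX c' (EE c c' z), XX c' (EE c c' z)] = 0"
 using cone_metric(4)[OF c' E_pt(1)] E_pt(2)[of z] cone_in(1) by (auto simp: dom_E_def)

end

end

end

section \<open>Existence of local models\<close>

lemma open_box:
 fixes D :: "('b::euclidean_space \<times> real \<times> real) set"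
 assumes "open D" "(x0, t0, 0) \<in> D"
 shows "\<exists>U T r. open U & open T & r > 0 & x0 \<in> U & t0 \<in> T & U \<times> T \<times> ball 0 r <= D"
proof -
 obtain U B where U: "open U" "open B" "(x0, t0, 0) \<in> U \<times> B" "U \<times> B <= D" by (rule open_prod_elim[OF assms])
 have "(t0, 0) \<in> B" using U(3) by (rule SigmaD2)
 from open_prod_elim[OF U(2) this] obtain T R where T: "open T" "open R" "(t0, 0) \<in> T \<times> R" "T \<times> R <= B" .
 from openE[OF T(2) SigmaD2[OF T(3)]] obtain r where r: "r > 0" "ball 0 r <= R" .
 have "U \<times> T \<times> ball 0 r <= D"
  using order_trans[OF Sigma_mono[OF order_refl order_trans[OF Sigma_mono[OF order_refl r(2)] T(4)]] U(4)] .
 thus ?thesis using U(1) T(1) r(1) SigmaD1[OF U(3)] SigmaD1[OF T(3)] by metis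
qed

locale ambient_setting3 = ambient_setting M g \<sigma> A
 for M :: "('p, 'b::euclidean_space) mfd" and g and \<sigma> and A :: "('p, 'b, 'q, 'b \<times> real \<times> real) ambient"
begin

text \<open>Put \<open>\<Psi>(x,t,\<rho>) = t \<cdot> (e(x) + \<rho> N)\<close> with the dilation by \<open>t\<close> and a vector \<open>N\<close> transversal to the cone at one point.
  This is a local diffeomorphism, in which \<open>Q\<close> is \<open>\<rho>\<close> times a function without zeros.\<close>

lemma local_model:
 assumes c: "c \<in> atlas M" and c': "c' \<in> atlas (tot A)" and x0: "(x0, 1) \<in> dom_E c c'"
  and B: "open B" "EE c c' (x0, 1) \<in> B" "B <= chart_dom c'"
  and l: "!!x u v. x \<in> chart_dom c ==> Ric (gh c) x u v = l * gh c x [u, v]"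
 shows "\<exists>W U T r \<tau>. local_cone W (hm c') (XX c') DIM('b) U (gh c) l T (EE c c') r \<tau> & W <= B & x0 \<in> U & U <= chart_dom c &
  U \<times> T <= dom_E c c'"
proof -
 interpret P: pmetric "chart_dom c'" "hm c'" by (rule pmt[OF c'])
 interpret Gh: pmetric "chart_dom c" "gh c" by (rule pm[OF c])
 let ?E = "EE c c'" and ?h = "hm c'" and ?X = "XX c'" and ?fl = "flw c'"
 define y0 where "y0 = ?E (x0, 1)"
 note E = E_all[OF c c'] and Ep = E_pt[OF c c'] and fl = flw_smooth[OF c']
 have y0: "y0 \<in> chart_dom c'" "y0 \<in> B" using B by (auto simp: y0_def)
 have x0c: "x0 \<in> chart_dom c" using x0 by (simp add: dom_E_def[OF c c'])
 obtain N where N: "?h y0 [?X y0, N] ~= 0" using P.h_nd[OF y0(1)] XX_nz[OF c' y0(1)] by blast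
 define S0 where "S0 = {z :: 'b \<times> real \<times> real. (fst z, 1) \<in> dom_E c c'}"
 have "S0 = (%z. (fst z, 1)) -` dom_E c c'" by (simp add: S0_def vimage_def)
 hence S0: "open S0" using open_vimage[OF E(1), of "%z :: 'b \<times> real \<times> real. (fst z, 1)"] by (simp add: continuous_intros)
 define q where "q z = (fst (snd z), ?E (fst z, 1) + snd (snd z) *\<^sub>R N)" for z :: "'b \<times> real \<times> real"
 have sE: "smooth_on S0 (%z. ?E (fst z, 1))"
 proof (rule smooth_compose[OF S0 E(1) _ E(2)])
  show "smooth_on S0 (%z. (fst z, 1::real))" by (intro smooth_Pair smooth_const smooth_fst smooth_id S0)
  show "(%z. (fst z, 1)) ` S0 <= dom_E c c'" unfolding S0_def by blast
 qed
 have sq: "smooth_on S0 q"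
  unfolding q_def[abs_def]
  by (rule smooth_Pair[OF S0 _ smooth_add[OF S0 sE]]) (intro smooth_fst smooth_snd smooth_scaleR smooth_const smooth_id S0)+
 have dq: "fd q z w = (fst (snd w), fd ?E (fst z, 1) (fst w, 0) + snd (snd w) *\<^sub>R N)" if "z \<in> S0" for z w
 proof -
  have "((%z :: 'b \<times> real \<times> real. ?E (fst z, 1)) has_derivative (%w. fd ?E (fst z, 1) (fst w, 0))) (at z)"
   by (rule has_derivative_compose[OF has_derivative_Pair[OF has_derivative_fst[OF has_derivative_ident] has_derivative_const]])
    (rule smooth_has_fd[OF E(2)], use that in \<open>simp add: S0_def\<close>)
  hence "(q has_derivative (%w. (fst (snd w), fd ?E (fst z, 1) (fst w, 0) + snd (snd w) *\<^sub>R N))) (at z)"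
   unfolding q_def[abs_def]
   by (intro has_derivative_Pair has_derivative_add has_derivative_scaleR_left has_derivative_fst has_derivative_snd has_derivative_ident)
  from fd_eqI[OF this] show ?thesis by (simp only:)
 qed
 define Om where "Om = ?fl -` B \<inter> dom_flw c'"
 have Om: "open Om" unfolding Om_def using continuous_on_open_vimage[OF fl(1)] smooth_continuous[OF fl(2)] B(1) by blast
 define S where "S = q -` Om \<inter> S0"
 have S: "open S" unfolding S_def using continuous_on_open_vimage[OF S0] smooth_continuous[OF sq] Om by blast
 have SD: "z \<in> S0" "q z \<in> dom_flw c'" "?fl (q z) \<in> B" if "z \<in> S" for z using that by (simp_all add: S_def Om_def)
 have SS: "S <= S0" "q ` S <= dom_flw c'" using SD by blast+
 define \<Psi> where "\<Psi> z = ?fl (q z)" for z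
 have s\<Psi>: "smooth_on S \<Psi>"
  unfolding \<Psi>_def[abs_def] by (rule smooth_compose[OF S fl(1) smooth_subset[OF sq SS(1)] fl(2) SS(2)])
 have d\<Psi>: "fd \<Psi> z w = fd ?fl (q z) (fd q z w)" if "z \<in> S" for z w
  unfolding \<Psi>_def[abs_def] by (rule fd_compose[OF sq fl(2) SD(1,2)[OF that]])
 define z0 :: "'b \<times> real \<times> real" where "z0 = (x0, 1, 0)"
 have q0: "q z0 = (1, y0)" by (simp add: q_def z0_def y0_def)
 have z0: "z0 \<in> S" using x0 flw_1[OF c' y0(1)] y0 q0 by (simp add: S_def Om_def S0_def) (simp add: z0_def)
 have dfl: "fd ?fl (1, y0) (a, w) = a *\<^sub>R ?X y0 + w" for a w
 proof -
  note W = flw_1(1)[OF c' y0(1)]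
  have l: "linear (fd ?fl (1, y0))" by (rule fd_linear[OF fl(2) W])
  have sp: "smooth_on (chart_dom c') (%y. (1::real, y))" by (intro smooth_Pair smooth_const smooth_id P.open_W)
  have "fd (%y. ?fl (1, y)) y0 w = fd (%y. y) y0 w"
   by (rule fun_cong[OF fd_cong[OF P.open_W y0(1)]]) (rule flw_1(2)[OF c'])
  moreover have "fd (%y. y) y0 = (%w. w)" by (rule fd_eqI) simp
  moreover have "fd (%y. (1::real, y)) y0 = (%w. (0, w))" by (rule fd_eqI) (auto intro!: derivative_eq_intros)
  ultimately have "fd ?fl (1, y0) (0, w) = w" using fd_compose[OF sp fl(2) y0(1) W, of w] by simp
  moreover have "fd ?fl (1, y0) (a, w) = a *\<^sub>R fd ?fl (1, y0) (1, 0) + fd ?fl (1, y0) (0, w)"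
   by (simp add: linear_scale[OF l, symmetric] linear_add[OF l, symmetric])
  ultimately show ?thesis by (simp add: XX_eq[OF c' y0(1)])
 qed
 have 00: "((0::'b), (0::real)) = 0" by (simp add: zero_prod_def)
 have d0: "fd \<Psi> z0 w = fst (snd w) *\<^sub>R ?X y0 + (fd ?E (x0, 1) (fst w, 0) + snd (snd w) *\<^sub>R N)" for w
  unfolding d\<Psi>[OF z0] q0 dq[OF SD(1)[OF z0]] dfl by (simp add: z0_def)
 have XE: "?X y0 = fd ?E (x0, 1) (0, 1)" using E_X[OF c c' x0] by (simp add: y0_def)
 note lE = fd_linear[OF E(2) x0]
 have hE: "?h y0 [fd ?E (x0, 1) u, fd ?E (x0, 1) v] = gh c x0 [fst u, fst v]" for u v using E(3)[OF x0, of u v] by (simp add: y0_def)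
 have "inj (fd \<Psi> z0)"
 proof (subst linear_injective_0[OF fd_linear[OF s\<Psi> z0]], intro allI impI)
  fix w assume "fd \<Psi> z0 w = 0"
  hence e: "fd ?E (x0, 1) (fst w, fst (snd w)) + snd (snd w) *\<^sub>R N = 0"
   unfolding d0 XE using linear_add[OF lE, of "(0, fst (snd w))" "(fst w, 0)"] linear_scale[OF lE, of "fst (snd w)" "(0, 1)"]
   by (simp add: add.assoc)
  have "?h y0 [?X y0, fd ?E (x0, 1) (fst w, fst (snd w)) + snd (snd w) *\<^sub>R N] = snd (snd w) * ?h y0 [?X y0, N]"
   unfolding XE using y0(1) x0c by (simp add: P.h_add P.h_scale hE Gh.h_zero)
  hence w3: "snd (snd w) = 0" unfolding e using N y0(1) by (simp add: P.h_zero)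
  hence "gh c x0 [fst w, v] = 0" for v
   using hE[of "(fst w, fst (snd w))" "(v, 0)"] e y0(1) by (simp add: P.h_zero)
  hence w1: "fst w = 0" using Gh.h_nd[OF x0c] by blast
  have "fst (snd w) *\<^sub>R ?X y0 = 0" using e w1 w3 linear_scale[OF lE, of "fst (snd w)" "(0, 1)"] by (simp add: XE)
  hence "fst (snd w) = 0" using XX_nz[OF c' y0(1)] by simp
  thus "w = 0" using w1 w3 by (simp add: prod_eq_iff)
 qed
 then obtain D V G where D: "open D" "z0 \<in> D" "D <= S" "open V" and hom: "homeomorphism D V \<Psi> G" and sG: "smooth_on V G"
  using smooth_inverse_function[OF S s\<Psi> z0] by blast
 have GP: "!!z. z \<in> D ==> G (\<Psi> z) = z" "!!z. z \<in> D ==> \<Psi> z \<in> V" "!!y. y \<in> V ==> \<Psi> (G y) = y"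
  using hom by (auto simp: homeomorphism_def)
 have \<Psi>0: "(x, t) \<in> dom_E c c' & \<Psi> (x, t, 0) = ?E (x, t)" if "(x, t, 0) \<in> S" for x t
 proof -
  have m: "(x, 1) \<in> dom_E c c'" "(t, ?E (x, 1)) \<in> dom_flw c'" using SD(1,2)[OF that] by (simp_all add: S0_def q_def)
  hence t: "t > 0" "x \<in> chart_dom c" by (simp_all add: dom_flw_def dom_E_def[OF c c'])
  have "cone_pt c (x, t) \<in> fst c'"
   using m(2) act_cone[OF c t(2) zero_less_one t(1)] Ep(2)[OF m(1)] by (simp add: dom_flw_def)
  thus ?thesis using E_flow[OF c c' m(1) t(1)] t by (simp add: \<Psi>_def q_def dom_E_def[OF c c'])
 qed
 obtain U1 T1 r1 where b1: "open U1" "open T1" "r1 > 0" "x0 \<in> U1" "1 \<in> T1" "U1 \<times> T1 \<times> ball 0 r1 <= D"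
  using open_box[OF D(1) D(2)[unfolded z0_def]] by blast
 define D1 where "D1 = U1 \<times> T1 \<times> ball (0::real) r1"
 define Qh where "Qh y = ?h y [?X y, ?X y]" for y
 have sQh: "smooth_on (chart_dom c') Qh" unfolding Qh_def[abs_def] by (intro P.h_smooth_fields XX_smooth[OF c'])
 have D1: "open D1" "D1 <= D" "z0 \<in> D1" using b1 by (simp_all add: D1_def open_Times z0_def)
 have s1: "smooth_on D1 \<Psi>" using D1(2) D(3) by (intro smooth_subset[OF s\<Psi>]) blast
 have \<Psi>B: "\<Psi> z \<in> B" "\<Psi> z \<in> chart_dom c'" if "z \<in> S" for z using SD(3)[OF that] B(3) by (auto simp: \<Psi>_def)
 have sQ: "smooth_on D1 (%z. Qh (\<Psi> z))"
  by (rule smooth_compose[OF D1(1) P.open_W s1 sQh]) (use \<Psi>B D1(2) D(3) in blast)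
 define \<rho> where "\<rho> z = snd (snd z)" for z :: "'b \<times> real \<times> real"
 have \<rho>: "linear \<rho>" "\<rho> (0, 0, 1) = 1" by (simp_all add: \<rho>_def linear_iff)
 have star: "z - (s * \<rho> z) *\<^sub>R (0, 0, 1) \<in> U' \<times> T' \<times> ball 0 r'" if z: "z \<in> U' \<times> T' \<times> ball 0 r'" and s: "s \<in> {0..1}" for z s U' T' r'
 proof -
  obtain x t p where zz: "z = (x, t, p)" by (cases z)
  have "\<bar>p - s * p\<bar> = (1 - s) * \<bar>p\<bar>" using s abs_mult[of "1 - s" p] by (simp add: left_diff_distrib)
  also have "... <= \<bar>p\<bar>" using s by (simp add: mult_left_le_one_le)
  finally show ?thesis using z by (simp add: zz \<rho>_def)
 qed
 have z\<rho>: "z = (fst z, fst (snd z), 0)" if "\<rho> z = 0" for z using that by (simp add: \<rho>_def prod_eq_iff)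
 have "\<exists>g. smooth_on D1 g & (\<forall>z\<in>D1. Qh (\<Psi> z) = \<rho> z * g z)"
 proof (rule hadamard_division[OF D1(1) _ \<rho> sQ])
  show "z - (s * \<rho> z) *\<^sub>R (0, 0, 1) \<in> D1" if "z \<in> D1" "s \<in> {0..1}" for z s
   unfolding D1_def by (rule star[OF that(1)[unfolded D1_def] that(2)])
  show "Qh (\<Psi> z) = 0" if "z \<in> D1" "\<rho> z = 0" for z
  proof -
   have e: "(fst z, fst (snd z), 0) = z" using z\<rho>[OF that(2)] by (rule sym)
   have "z \<in> S" using that(1) D1(2) D(3) by blast
   thus ?thesis using \<Psi>0[of "fst z" "fst (snd z)"] E_Q[OF c c'] unfolding e Qh_def by metis
  qed
 qed
 then obtain Q1 where Q1: "smooth_on D1 Q1" "!!z. z \<in> D1 ==> Qh (\<Psi> z) = \<rho> z * Q1 z" by blast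
 \<comment> \<open>The derivative of \<open>Q\<close> along \<open>N\<close> is \<open>2 h(X,N)\<close>.\<close>
 have "Q1 z0 ~= 0"
 proof -
  have sr: "smooth_on D1 \<rho>" by (rule smooth_linear[OF D1(1) \<rho>(1)])
  have r: "fd \<rho> z0 = \<rho>" by (rule fd_eqI) (rule linear_imp_has_derivative[OF \<rho>(1)])
  have "fd (%z. Qh (\<Psi> z)) z0 (0, 0, 1) = fd (%z. \<rho> z * Q1 z) z0 (0, 0, 1)"
   by (rule fun_cong[OF fd_cong[OF D1(1,3)]]) (rule Q1(2))
  also have "... = Q1 z0" using fd_mult[OF sr Q1(1) D1(3), of "(0, 0, 1)"] by (simp add: r \<rho>) (simp add: \<rho>_def z0_def)
  finally have "fd Qh y0 N = Q1 z0"
   using fd_compose[OF s1 sQh D1(3), of "(0, 0, 1)"] y0(1) d0[of "(0, 0, 1)"] linear_0[OF lE] flw_1(2)[OF c' y0(1)] q0 00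
   by (simp add: \<Psi>_def)
  thus ?thesis using cone_metric(2)[OF c' y0(1), of N] N by (simp add: Qh_def[abs_def])
 qed
 hence "z0 \<in> Q1 -` (- {0}) \<inter> D1" using D1(3) by simp
 moreover have "open (Q1 -` (- {0}) \<inter> D1)"
  using iffD1[OF continuous_on_open_vimage[OF D1(1)] smooth_continuous[OF Q1(1)]] open_Compl[OF closed_singleton] by blast
 ultimately obtain U T r2 where b2: "open U" "open T" "r2 > 0" "x0 \<in> U" "1 \<in> T" "U \<times> T \<times> ball 0 r2 <= Q1 -` (- {0}) \<inter> D1"
  using open_box[of "Q1 -` (- {0}) \<inter> D1" x0 1] unfolding z0_def by blast
 define D3 where "D3 = U \<times> T \<times> ball (0::real) r2"
 have D3: "open D3" "D3 <= D1" "D3 <= D" "D3 <= S" "!!z. z \<in> D3 ==> Q1 z ~= 0"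
 proof -
  show "open D3" unfolding D3_def by (intro open_Times b2 open_ball)
  have *: "D3 <= Q1 -` (- {0}) \<inter> D1" using b2(6) unfolding D3_def .
  thus "D3 <= D1" "D3 <= D" "D3 <= S" using D1(2) D(3) by blast+
  show "Q1 z ~= 0" if "z \<in> D3" for z using * that by blast
 qed
 have z3: "(x, t, 0) \<in> D3" if "(x, t) \<in> U \<times> T" for x t using that b2(3) by (simp add: D3_def)
 define W where "W = G -` D3 \<inter> V"
 have W: "open W" unfolding W_def using continuous_on_open_vimage[OF D(4)] smooth_continuous[OF sG] D3(1) by blast
 have WD: "G y \<in> D3" "\<Psi> (G y) = y" "y \<in> V" if "y \<in> W" for y using that GP(3) by (simp_all add: W_def)
 have PW: "\<Psi> z \<in> W" if "z \<in> D3" for z unfolding W_def using that GP(1,2)[OF subsetD[OF D3(3) that]] by (intro IntI vimageI2) metis+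
 have WB: "W <= B" using \<Psi>B(1) WD D3(4) by (metis subsetD subsetI)
 have WS: "W <= chart_dom c'" using WB B(3) by blast
 have sGW: "smooth_on W G" by (rule smooth_subset[OF sG]) (auto simp: W_def)
 have UT: "(x, t) \<in> dom_E c c'" "\<Psi> (x, t, 0) = ?E (x, t)" "?E (x, t) \<in> W" "G (?E (x, t)) = (x, t, 0)" if "(x, t) \<in> U \<times> T" for x t
 proof -
  have z: "(x, t, 0) \<in> S" "(x, t, 0) \<in> D" using z3[OF that] D3(3,4) by blast+
  show 1: "(x, t) \<in> dom_E c c'" "\<Psi> (x, t, 0) = ?E (x, t)" using \<Psi>0[OF z(1)] by blast+
  show "?E (x, t) \<in> W" using PW[OF z3[OF that]] unfolding 1 .
  show "G (?E (x, t)) = (x, t, 0)" using GP(1)[OF z(2)] unfolding 1 .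
 qed
 have dom: "U \<times> T <= dom_E c c'" using UT(1) by auto
 have U: "U <= chart_dom c" "T <= {0<..}" using dom b2(4,5) by (auto simp: dom_E_def[OF c c'])
 \<comment> \<open>The generator is the Euler field in the second coordinate.\<close>
 have GX: "fd G y (?X y) = (0, fst (snd (G y)), 0)" if y: "y \<in> W" for y
 proof -
  let ?z = "G y" and ?t = "fst (snd (G y))"
  have z: "?z \<in> S" "?z \<in> D" using WD(1)[OF y] D3(3,4) by blast+
  have qz: "q ?z = (?t, snd (q ?z))" by (simp add: q_def)
  have l: "linear (fd ?fl (q ?z))" by (rule fd_linear[OF fl(2) SD(2)[OF z(1)]])
  have "(fst ?z, 1) \<in> dom_E c c'" using SD(1)[OF z(1)] unfolding S0_def by blast
  from linear_0[OF fd_linear[OF E(2) this]] have "fd q ?z (0, ?t, 0) = (?t, 0)"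
   using dq[OF SD(1)[OF z(1)], of "(0, ?t, 0)"] 00 by simp
  hence "fd \<Psi> ?z (0, ?t, 0) = fd ?fl (q ?z) (?t *\<^sub>R (1, 0))" by (simp add: d\<Psi>[OF z(1)])
  also have "... = ?X y"
   unfolding linear_scale[OF l] using XX_flw[OF c', of ?t "snd (q ?z)"] SD(2)[OF z(1)] WD(2)[OF y] qz by (simp add: \<Psi>_def)
  finally have X: "?X y = fd \<Psi> ?z (0, ?t, 0)" by simp
  have "fd (%z. G (\<Psi> z)) ?z (0, ?t, 0) = fd (%z. z) ?z (0, ?t, 0)"
   by (rule fun_cong[OF fd_cong[OF D(1) z(2)]]) (rule GP(1))
  moreover have "fd (%z. z) ?z = (%w. w)" by (rule fd_eqI) simp
  ultimately show ?thesis
   using fd_compose[OF s\<Psi> sG z(1), of "(0, ?t, 0)"] WD(2,3)[OF y] by (simp add: X)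
 qed
 have dG: "fd (%y. f (G y)) y v = f (fd G y v)" if "bounded_linear f" "y \<in> W" for f :: "'b \<times> real \<times> real => 'z::real_normed_vector" and y v
  by (rule fun_cong[OF fd_eqI]) (rule bounded_linear.has_derivative[OF that(1) smooth_has_fd[OF sGW that(2)]])
 have pW: "pmetric W ?h" by (rule pmetric_mono[OF pmt[OF c'] W WS])
 have "homothety W ?h ?X DIM('b)"
  unfolding homothety_def rflat_def rflat_axioms_def homothety_axioms_def
 proof (intro conjI allI impI pW)
  show "smooth_on W ?X" by (rule smooth_subset[OF XX_smooth[OF c'] WS])
  show "Ric ?h x u v = 0" "pmetric.cv ?h (%_. v) ?X x = v" "?X x ~= 0" if "x \<in> W" for x u v
   using cone_metric(3)[OF c'] cv_XX[OF c'] XX_nz[OF c'] that WS by blast+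
  fix f :: "'b \<times> real \<times> real => real" assume f: "smooth_on W f" "\<forall>x. x \<in> W --> ?h x [?X x, ?X x] = 0 --> f x = 0"
  have s3: "smooth_on D3 \<Psi>" by (rule smooth_subset[OF s\<Psi> D3(4)])
  have "\<exists>g. smooth_on D3 g & (\<forall>z\<in>D3. f (\<Psi> z) = \<rho> z * g z)"
  proof (rule hadamard_division[OF D3(1) _ \<rho>])
   show "z - (s * \<rho> z) *\<^sub>R (0, 0, 1) \<in> D3" if "z \<in> D3" "s \<in> {0..1}" for z s
    unfolding D3_def by (rule star[OF that(1)[unfolded D3_def] that(2)])
   show "smooth_on D3 (%z. f (\<Psi> z))" by (rule smooth_compose[OF D3(1) W s3 f(1)]) (use PW in blast)
   show "f (\<Psi> z) = 0" if "z \<in> D3" "\<rho> z = 0" for z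
    using f(2)[rule_format, OF PW[OF that(1)]] Q1(2)[OF subsetD[OF D3(2) that(1)]] that(2) by (simp add: Qh_def)
  qed
  then obtain g1 where g1: "smooth_on D3 g1" "!!z. z \<in> D3 ==> f (\<Psi> z) = \<rho> z * g1 z" by blast
  have GD: "G ` W <= D3" using WD(1) by blast
  have "f x = ?h x [?X x, ?X x] * (g1 (G x) / Q1 (G x))" if x: "x \<in> W" for x
   using g1(2)[OF WD(1)[OF x]] Q1(2)[OF subsetD[OF D3(2) WD(1)[OF x]]] WD(2)[OF x] D3(5)[OF WD(1)[OF x]] by (simp add: Qh_def)
  moreover have "smooth_on W (%x. g1 (G x) / Q1 (G x))"
   by (rule smooth_divide[OF W smooth_compose[OF W D3(1) sGW g1(1) GD] smooth_compose[OF W D3(1) sGW smooth_subset[OF Q1(1) D3(2)] GD]])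
    (rule D3(5)[OF WD(1)])
  ultimately show "\<exists>g. smooth_on W g & (\<forall>x\<in>W. f x = ?h x [?X x, ?X x] * g x)" by blast
 qed simp
 moreover have "pmetric U (gh c)" by (rule pmetric_mono[OF pm[OF c] b2(1) U(1)])
 moreover have "local_cone_axioms W ?h ?X DIM('b) U (gh c) l T ?E (%y. fst (G y)) (%y. fst (snd (G y)))"
  unfolding local_cone_axioms_def
 proof (intro conjI allI impI)
  show "DIM('b) = DIM('b)" "2 < DIM('b)" "open T" "1 \<in> T" "T <= {0<..}" using dim2 b2 U by simp_all
  show "Ric (gh c) x u v = l * gh c x [u, v]" if "x \<in> U" for x u v using l that U(1) by blast
  show "smooth_on W (%y. fst (G y))" "smooth_on W (%y. fst (snd (G y)))"
   by (intro smooth_fst smooth_snd W sGW)+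
  show "fst (G y) \<in> U" "fst (snd (G y)) \<in> T" if "y \<in> W" for y using WD(1)[OF that] by (auto simp: D3_def)
  show "fd (%y. fst (G y)) y (?X y) = 0" "fd (%y. fst (snd (G y))) y (?X y) = fst (snd (G y))" if "y \<in> W" for y
   using dG[OF bounded_linear_fst that] dG[OF bounded_linear_compose[OF bounded_linear_fst bounded_linear_snd] that] GX[OF that] by simp_all
  show "smooth_on (U \<times> T) ?E" by (rule smooth_subset[OF E(2) dom])
  fix p assume p: "p \<in> U \<times> T"
  obtain x t where pp: "p = (x, t)" by (cases p)
  note p' = p[unfolded pp]
  show "?E p \<in> W" "fst (G (?E p)) = fst p" "fst (snd (G (?E p))) = snd p" using UT[OF p'] by (simp_all add: pp)
  show "?h (?E p) [?X (?E p), ?X (?E p)] = 0" unfolding pp by (rule E_Q[OF c c' UT(1)[OF p']])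
  show "?h (?E p) [fd ?E p u, fd ?E p v] = (snd p)\<^sup>2 * gh c (fst p) [fst u, fst v]" for u v
   using E(3)[OF UT(1)[OF p']] by (simp add: pp)
  show "fd ?E p (0, snd p) = ?X (?E p)" using E_X[OF c c' UT(1)[OF p']] by (simp add: pp)
 next
  fix z assume z: "z \<in> W" "?h z [?X z, ?X z] = 0"
  hence "\<rho> (G z) = 0" using Q1(2)[OF subsetD[OF D3(2) WD(1)[OF z(1)]]] WD(2)[OF z(1)] D3(5)[OF WD(1)[OF z(1)]] by (simp add: Qh_def)
  hence e: "G z = (fst (G z), fst (snd (G z)), 0)" by (rule z\<rho>)
  have m: "(fst (G z), fst (snd (G z))) \<in> U \<times> T" using WD(1)[OF z(1)] by (auto simp: D3_def)
  show "\<exists>p\<in>U \<times> T. z = ?E p"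
   using UT(2)[OF m] WD(2)[OF z(1)] m e by metis
 qed
 ultimately have "local_cone W ?h ?X DIM('b) U (gh c) l T ?E (%y. fst (G y)) (%y. fst (snd (G y)))"
  by (simp add: local_cone_def)
 thus ?thesis using WB b2(4) U(1) dom by blast
qed

end

section \<open>Existence of lifts\<close>

text \<open>Forms in a chart are made into fields of the kind considered above.\<close>

definition restr :: "'e set => nat => 'e tfield => 'e tfield" where
 "restr S j T x vs = (if x \<in> S & length vs = j then T x vs else 0)"

lemma restr_Frm:
 assumes f: "form_on M V j f" "c \<in> atlas M" and S: "open S" "S <= snd c ` (fst c \<inter> V)"
 shows "region.Frm S j (restr S j (f c))"
proof -
 interpret region S by unfold_locales (rule S(1))
 have "\<forall>c\<in>atlas M. (\<forall>vs. length vs = j --> smooth_on (snd c ` (fst c \<inter> V)) (%x. f c x vs)) &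
   (\<forall>x\<in>snd c ` (fst c \<inter> V). multilin j (f c x))" "\<forall>c\<in>atlas M. \<forall>x\<in>snd c ` (fst c \<inter> V). alternating j (f c x)"
  using f(1) unfolding form_on_def tensor_field_def by - (elim conjE, assumption)+
 note * = bspec[OF this(1) f(2)] bspec[OF this(2) f(2)]
 have s: "smooth_on (snd c ` (fst c \<inter> V)) (%x. f c x vs)" if "length vs = j" for vs using *(1) that by blast
 have m: "multilin j (f c x)" "alternating j (f c x)" if "x \<in> S" for x using * subsetD[OF S(2) that] by blast+
 have a: "alt j (restr S j (f c) x)" for x
 proof (cases "x \<in> S")
  case True
  hence "restr S j (f c) x vs = f c x vs" if "length vs = j" for vs using that by (simp add: restr_def)
  hence "multilin j (restr S j (f c) x)" "alternating j (restr S j (f c) x)"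
   using m[OF True] by (simp_all add: multilin_def alternating_def)
  thus ?thesis by (simp add: alt_def ten_def restr_def)
 next
  case False
  hence "restr S j (f c) x = (%vs. 0)" by (simp add: restr_def fun_eq_iff)
  thus ?thesis by (simp add: alt_def ten_def multilin_def alternating_def linear_zero)
 qed
 have "smooth_on S (%x. restr S j (f c) x vs)" for vs
 proof (cases "length vs = j")
  case True
  have "smooth_on S (%x. f c x vs)" by (rule smooth_subset[OF s[OF True] S(2)])
  thus ?thesis by (rule iffD2[OF smooth_on_cong[OF S(1)], rotated]) (simp add: restr_def True)
 qed (simp add: restr_def smooth_const S(1))
 thus ?thesis using a alt_ten[OF a] by (simp add: Frm_def Ten_def restr_def)
qed

lemma chart_change:
 assumes M: "smooth_manifold M" and c: "c \<in> atlas M" "c' \<in> atlas M"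
 defines "D == snd c ` (fst c \<inter> fst c')" and "t == %x. snd c' (chart_pt c x)"
 shows "open D" "smooth_on D t" "x \<in> D ==> chart_pt c x \<in> fst c \<inter> fst c'" "x \<in> D ==> t x \<in> chart_dom c'"
  "x \<in> D ==> chart_pt c' (t x) = chart_pt c x" "x \<in> D ==> x \<in> chart_dom c"
  "p \<in> fst c ==> p \<in> fst c' ==> snd c p \<in> D" "p \<in> fst c ==> t (snd c p) = snd c' p"
proof -
 note ch = chart[OF M c(1)] and ch' = chart[OF M c(2)]
 have "openin (mtop M) (fst c')" using M c(2) by (simp add: smooth_manifold_def)
 thus "open D" unfolding D_def by (rule ch(8))
 show "smooth_on D t" using M c unfolding smooth_manifold_def D_def t_def comp_def by blast
 show p: "x \<in> D ==> chart_pt c x \<in> fst c \<inter> fst c'" using ch(3) by (auto simp: D_def)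
 show "x \<in> D ==> t x \<in> chart_dom c'" "x \<in> D ==> chart_pt c' (t x) = chart_pt c x" using p ch'(3,6) by (auto simp: t_def)
 show "x \<in> D ==> x \<in> chart_dom c" by (auto simp: D_def chart_dom_def)
 show "p \<in> fst c ==> p \<in> fst c' ==> snd c p \<in> D" by (auto simp: D_def)
 show "p \<in> fst c ==> t (snd c p) = snd c' p" by (simp add: t_def ch(3))
qed

lemma form_change:
 assumes f: "form_on M V j f" "c \<in> atlas M" "c' \<in> atlas M" and p: "p \<in> fst c" "p \<in> fst c'" "p \<in> V" and "length vs = j"
 shows "f c (snd c p) vs = f c' (snd c' p) (map (fd (%x. snd c' (chart_pt c x)) (snd c p)) vs)"
proof -
 have "\<forall>c\<in>atlas M. \<forall>c'\<in>atlas M. \<forall>p\<in>fst c \<inter> fst c' \<inter> V. \<forall>vs. length vs = j -->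
   f c (snd c p) vs = f c' (snd c' p) (map (fd (snd c' \<circ> chart_pt c) (snd c p)) vs)"
  using f(1) unfolding form_on_def tensor_field_def by (elim conjE)
 from this[rule_format, OF f(2,3) IntI[OF IntI[OF p(1,2)] p(3)] assms(7)] show ?thesis unfolding comp_def .
qed

context ambient_setting begin

text \<open>The dilations are defined on the manifold, so their velocity fields in two charts are related by the transition map.\<close>

lemma XX_change:
 assumes d: "d \<in> atlas (tot A)" "d' \<in> atlas (tot A)" and y: "y \<in> snd d ` (fst d \<inter> fst d')"
 shows "XX d' (snd d' (chart_pt d y)) = fd (%y. snd d' (chart_pt d y)) y (XX d y)"
proof -
 note t = chart_change[OF Mt d]
 let ?t = "%y. snd d' (chart_pt d y)" and ?D = "snd d ` (fst d \<inter> fst d')"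
 have yd: "y \<in> chart_dom d" by (rule t(6)[OF y])
 note f = flw_1[OF d(1) yd] and fs = flw_smooth[OF d(1)]
 define S where "S = flw d -` ?D \<inter> dom_flw d"
 have S: "open S" unfolding S_def using continuous_on_open_vimage[OF fs(1)] smooth_continuous[OF fs(2)] t(1) by blast
 define S' where "S' = (%s. (s, y)) -` S"
 have S': "open S'" unfolding S'_def by (rule open_vimage[OF S]) (auto intro!: continuous_intros)
 have 1: "1 \<in> S'" using f y by (simp add: S'_def S_def)
 have yD: "flw d (1, y) \<in> ?D" using f(2) y by simp
 have "((%s. ?t (flw d (s, y))) has_derivative (%a. fd ?t (flw d (1, y)) (a *\<^sub>R fd (flw d) (1, y) (1, 0)))) (at 1)"
  by (rule has_derivative_compose[OF flw_deriv[OF d(1) f(1), unfolded has_vector_derivative_def] smooth_has_fd[OF t(2) yD]])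
 hence "((%s. ?t (flw d (s, y))) has_vector_derivative fd ?t y (XX d y)) (at 1)"
  unfolding has_vector_derivative_def f(2) XX_eq[OF d(1) yd, symmetric] linear_scale[OF fd_linear[OF t(2) y]] .
 hence "((%s. snd d' (act A s (chart_pt d' (?t y)))) has_vector_derivative fd ?t y (XX d y)) (at 1)"
 proof (rule has_vector_derivative_transform_within_open[OF _ S' 1])
  fix s assume "s \<in> S'"
  thus "?t (flw d (s, y)) = snd d' (act A s (chart_pt d' (?t y)))"
   using flw_pt(2)[OF d(1), of "(s, y)"] t(5)[OF y] by (simp add: S'_def S_def)
 qed
 thus ?thesis unfolding gen_X_def by (rule vector_derivative_at)
qed

end

context ambient_setting3 begin

text \<open>On the image of a local model the form is pulled back by the projection to the base.  As the lift has to be a form on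
  a manifold, this is done in all ambient charts.\<close>

lemma lift_exists:
 assumes c: "c \<in> atlas M" and x0: "x0 \<in> chart_dom c" and f: "kform M j f"
 shows "\<exists>F V. cone_pt c (x0, 1) \<in> V & ambient_lift M gh A j f V F"
proof -
 have "(\<Union>c\<in>atlas (tot A). fst c) = topspace (mtop (tot A))" using Mt unfolding smooth_manifold_def by (elim conjE)
 then obtain c' where c': "c' \<in> atlas (tot A)" "cone_pt c (x0, 1) \<in> fst c'" using cone_in(2)[OF c x0 zero_less_one] by blast
 hence d0: "(x0, 1) \<in> dom_E c c'" using x0 by (simp add: dom_E_def[OF c c'(1)])
 obtain l where l: "Ric (gh c) x u v = l * gh c x [u, v]" if "x \<in> chart_dom c" for x u v
  using es c unfolding einstein_scale_def einstein_metric_def by blast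
 obtain W U T r \<tau> where "local_cone W (hm c') (XX c') DIM('b) U (gh c) l T (EE c c') r \<tau>"
  and W: "W <= chart_dom c'" and U: "x0 \<in> U" "U <= chart_dom c" "U \<times> T <= dom_E c c'"
  using local_model[OF c c'(1) d0 cht(2)[OF c'(1)] E_pt(1)[OF c c'(1) d0] order_refl l] by blast
 then interpret L: local_cone W "hm c'" "XX c'" "DIM('b)" U "gh c" l T "EE c c'" r \<tau> by simp
 define V where "V = chart_pt c' ` W"
 have V: "openin (mtop (tot A)) V" unfolding V_def by (rule cht(9)[OF c'(1) L.open_W W])
 have Vc: "p \<in> fst c' & snd c' p \<in> W" if "p \<in> V" for p
  using that W cht(4,5)[OF c'(1)] by (auto simp: V_def)
 have u0: "cone_pt c (x0, 1) \<in> V"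
  unfolding V_def by (rule image_eqI[OF _ L.E_W[of "(x0, 1)"]]) (use E_pt(2)[OF c c'(1) d0] U(1) L.T(2) in simp_all)
 define S where "S d = snd d ` (fst d \<inter> V)" for d :: "('q, 'b \<times> real \<times> real) chart"
 define \<rho> where "\<rho> d z = r (snd c' (chart_pt d z))" for d :: "('q, 'b \<times> real \<times> real) chart" and z
 define \<omega> where "\<omega> = restr (chart_dom c) j (f c)"
 define F where "F d z vs = (if z \<in> S d then \<omega> (\<rho> d z) (map (fd (\<rho> d) z) vs) else 0)" for d z vs
 have w: "region.Frm (chart_dom c) j \<omega>"
  unfolding \<omega>_def by (rule restr_Frm[OF f c ch(2)[OF c]]) (simp only: ch(7)[OF c] order_refl)
 have chart_V: "open (S d)" "S d <= chart_dom d" "smooth_on (S d) (\<rho> d)" "!!z. z \<in> S d ==> \<rho> d z \<in> chart_dom c"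
  "!!z. z \<in> S d ==> fd (\<rho> d) z (XX d z) = 0" if d: "d \<in> atlas (tot A)" for d
 proof -
  note t = chart_change[OF Mt d c'(1)]
  let ?D = "snd d ` (fst d \<inter> fst c')" and ?t = "%x. snd c' (chart_pt d x)"
  show o: "open (S d)" unfolding S_def by (rule cht(8)[OF d V])
  show "S d <= chart_dom d" by (auto simp: S_def chart_dom_def)
  have SD: "S d <= ?D" unfolding S_def using Vc by blast
  have tW: "?t z \<in> W" if "z \<in> S d" for z using that Vc cht(3)[OF d] by (auto simp: S_def)
  have st: "smooth_on (S d) ?t" by (rule smooth_subset[OF t(2) SD])
  show "smooth_on (S d) (\<rho> d)"
   unfolding \<rho>_def[abs_def] by (rule smooth_compose[OF o L.open_W st L.r(1)]) (use tW in blast)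
  show "\<rho> d z \<in> chart_dom c" if "z \<in> S d" for z unfolding \<rho>_def using L.r(2)[OF tW[OF that]] U(2) by blast
  show "fd (\<rho> d) z (XX d z) = 0" if z: "z \<in> S d" for z
   unfolding \<rho>_def[abs_def] fd_compose[OF st L.r(1) z tW[OF z]] XX_change[OF d c'(1) subsetD[OF SD z], symmetric]
   by (rule L.r(3)[OF tW[OF z]])
 qed
 have pS: "pmetric (S d) (hm d)" if d: "d \<in> atlas (tot A)" for d by (rule pmetric_mono[OF pmt[OF d] chart_V(1,2)[OF d]])
 have lift: "region.Frm (S d) j (F d)" "pmetric.NN (S d) (hm d) (XX d) (F d) = cs (- real j) (F d)" if d: "d \<in> atlas (tot A)" for d
 proof -
  interpret P: pmetric "S d" "hm d" by (rule pS[OF d])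
  have cv: "P.cv (%_. v) (XX d) z = v" if "z \<in> S d" for z v using cv_XX[OF d subsetD[OF chart_V(2)[OF d] that]] .
  note * = P.basic_pullback[OF pm[OF c] chart_V(3-5)[OF d] smooth_subset[OF XX_smooth[OF d] chart_V(2)[OF d]] cv w]
  have F: "F d = (%y vs. if y \<in> S d then \<omega> (\<rho> d y) (map (fd (\<rho> d) y) vs) else 0)" by (simp add: F_def fun_eq_iff)
  show "P.Frm j (F d)" "P.NN (XX d) (F d) = cs (- real j) (F d)" unfolding F by (rule *(1), assumption+) (rule *(4), assumption+)
 qed
 have val: "F d z vs = f c (\<rho> d z) (map (fd (\<rho> d) z) vs)" if "d \<in> atlas (tot A)" "z \<in> S d" "length vs = j" for d z vs
  using that chart_V(4)[OF that(1,2)] by (simp add: F_def \<omega>_def restr_def)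
 have "form_on (tot A) V j F"
  unfolding form_on_def tensor_field_def
 proof (intro conjI ballI allI impI V)
  fix d :: "('q, 'b \<times> real \<times> real) chart" assume d: "d \<in> atlas (tot A)"
  interpret P: pmetric "S d" "hm d" by (rule pS[OF d])
  show "smooth_on (snd d ` (fst d \<inter> V)) (%z. F d z vs)" for vs
   unfolding S_def[symmetric] by (rule P.Ten_smooth[OF P.Frm_Ten[OF lift(1)[OF d]]])
  show "multilin j (F d z)" "alternating j (F d z)" for z
   using P.Frm_alt[OF lift(1)[OF d], of z] by (simp_all add: alt_def ten_def)
  fix d' p and vs :: "('b \<times> real \<times> real) list" assume d': "d' \<in> atlas (tot A)" and p: "p \<in> fst d \<inter> fst d' \<inter> V" and vs: "length vs = j"
  let ?t = "%x. snd d' (chart_pt d x)" and ?z = "snd d p"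
  note t = chart_change[OF Mt d d']
  define N where "N = S d \<inter> snd d ` (fst d \<inter> fst d')"
  have N: "open N" "?z \<in> N" using chart_V(1)[OF d] t(1) p by (auto simp: N_def S_def)
  have tz: "?t ?z = snd d' p" using p by (intro t(8)) simp
  have S': "snd d' p \<in> S d'" "?z \<in> S d" using p by (auto simp: S_def)
  have "fd (\<rho> d) ?z v = fd (%y. \<rho> d' (?t y)) ?z v" for v
   by (rule fun_cong[OF fd_cong[OF N]]) (simp add: \<rho>_def t(5) N_def)
  also have "!!v. ... v = fd (\<rho> d') (snd d' p) (fd ?t ?z v)"
   using fd_compose[OF t(2) chart_V(3)[OF d'], of ?z] N(2) S'(1) by (simp add: N_def tz)
  finally have "map (fd (\<rho> d) ?z) vs = map (fd (\<rho> d') (snd d' p)) (map (fd ?t ?z) vs)" by simp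
  moreover have "\<rho> d ?z = \<rho> d' (snd d' p)" using t(5)[of ?z] N(2) tz by (simp add: \<rho>_def N_def)
  ultimately show "F d (snd d p) vs = F d' (snd d' p) (map (fd (snd d' \<circ> chart_pt d) (snd d p)) vs)"
   unfolding comp_def val[OF d S'(2) vs] val[OF d' S'(1) trans[OF length_map vs]] by (simp only:)
 qed
 moreover have "has_weight A V j (- real j) F"
  unfolding has_weight_def S_def[symmetric]
 proof (intro ballI allI impI)
  fix d z and vs :: "('b \<times> real \<times> real) list" assume d: "d \<in> atlas (tot A)" and z: "z \<in> S d"
  interpret P: pmetric "S d" "hm d" by (rule pS[OF d])
  show "nabla (hm d) (F d) z (XX d z # vs) = - real j * F d z vs"
   using P.nabla_NN[where V="XX d", OF P.Frm_Ten[OF lift(1)[OF d]] z refl] lift(2)[OF d] by simp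
 qed
 moreover have "F d (EE c2 d (x, t)) (map (fd (EE c2 d) (x, t)) us) = f c2 x (map fst us)"
  if c2: "c2 \<in> atlas M" and d: "d \<in> atlas (tot A)" and x: "x \<in> chart_dom c2" "t > 0"
   and q: "cone_pt c2 (x, t) \<in> fst d \<inter> V" and us: "length us = j" for c2 d x t us
 proof -
  let ?t = "%x. snd c (chart_pt c2 x)" and ?E = "EE c2 d"
  note tr = chart_change[OF M c2 c] and E = E_all[OF c2 d]
  define N where "N = ?E -` S d \<inter> dom_E c2 d"
  have N: "open N" unfolding N_def using continuous_on_open_vimage[OF E(1)] smooth_continuous[OF E(2)] chart_V(1)[OF d] by blast
  have xN: "(x, t) \<in> N" using q x by (auto simp: N_def S_def dom_E_def[OF c2 d] emb_coord_def)
  \<comment> \<open>A point of the cone over any chart of \<open>M\<close> that lies in \<open>V\<close> is also parametrized by the chart \<open>c\<close> of the local model.\<close>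
  have K: "fst z \<in> snd c2 ` (fst c2 \<inter> fst c) & \<rho> d (?E z) = ?t (fst z)" if z: "z \<in> N" for z
  proof -
   let ?q = "cone_pt c2 z"
   have zE: "z \<in> dom_E c2 d" "?E z \<in> S d" using z by (auto simp: N_def)
   hence zc: "fst z \<in> chart_dom c2" "snd z > 0" by (auto simp: dom_E_def[OF c2 d])
   have "?q \<in> V" using zE(2) E_pt(2)[OF c2 d zE(1)] cht(3)[OF d] by (auto simp: S_def)
   hence y: "?q \<in> fst c'" "snd c' ?q \<in> W" using Vc by blast+
   have ray: "ray_param M gh c2 z \<in> ray_bundle M g" using cone_in(1)[OF c2 zc] by simp
   have "hm c' (snd c' ?q) [XX c' (snd c' ?q), XX c' (snd c' ?q)] = 0"
    using cone_metric(4)[OF c'(1), of "snd c' ?q"] y W cht(3)[OF c'(1) y(1)] ray by auto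
   from L.E_surj[OF y(2) this] obtain p where p: "p \<in> U \<times> T" "snd c' ?q = EE c c' p" by blast
   hence pE: "p \<in> dom_E c c'" using U(3) by blast
   have "cone_pt c p = ?q" using E_pt(2)[OF c c'(1) pE] p(2) cht(3)[OF c'(1) y(1)] by simp
   moreover have "ray_param M gh c p \<in> ray_bundle M g"
    using cone_in(1)[OF c, of "fst p" "snd p"] pE by (auto simp: dom_E_def[OF c c'(1)])
   moreover have "inj_on (emb A) (ray_bundle M g)" using amb_mfd by (simp add: ambient_manifold_def)
   ultimately have "ray_param M gh c p = ray_param M gh c2 z" using ray by (blast dest: inj_onD)
   hence e: "chart_pt c (fst p) = chart_pt c2 (fst z)" by (simp add: ray_param_def ray_pt_def)
   have pc: "fst p \<in> chart_dom c" using p(1) U(2) by auto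
   have "chart_pt c2 (fst z) \<in> fst c2 \<inter> fst c" using ch(4)[OF c pc] ch(4)[OF c2 zc(1)] e by simp
   moreover have "\<rho> d (?E z) = fst p" using E_pt(2)[OF c2 d zE(1)] L.r_E(1)[OF p(1)] p(2) by (simp add: \<rho>_def)
   ultimately show ?thesis
    using ch(5)[OF c2 zc(1)] ch(5)[OF c pc] e by (metis imageI)
  qed
  have sN: "smooth_on N ?E" "smooth_on N (%z. fst z)"
   using smooth_subset[OF E(2), of N] smooth_fst[OF N smooth_id[OF N]] by (simp_all add: N_def)
  have "fd (\<rho> d) (?E (x, t)) (fd ?E (x, t) u) = fd ?t x (fst u)" for u
  proof -
   have "fd (%z. \<rho> d (?E z)) (x, t) u = fd (%z. ?t (fst z)) (x, t) u"
    by (rule fun_cong[OF fd_cong[OF N xN]]) (use K in blast)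
   moreover have "fd (%z. fst z) (x, t) = fst" by (rule fd_eqI) (auto intro!: derivative_eq_intros)
   ultimately show ?thesis
    using fd_compose[OF sN(1) chart_V(3)[OF d] xN, of u] fd_compose[OF sN(2) tr(2) xN, of u] K[OF xN] xN by (simp add: N_def)
  qed
  hence "map (fd (\<rho> d) (?E (x, t))) (map (fd ?E (x, t)) us) = map (fd ?t x) (map fst us)" by simp
  moreover have "?E (x, t) \<in> S d" using xN by (simp add: N_def)
  moreover have "\<rho> d (?E (x, t)) = ?t x" using K[OF xN] by simp
  ultimately have "F d (?E (x, t)) (map (fd ?E (x, t)) us) = f c (?t x) (map (fd ?t x) (map fst us))"
   using val[OF d _ trans[OF length_map us], of "?E (x, t)"] by (simp only:)
  moreover have "chart_pt c2 x \<in> fst c2" "chart_pt c2 x \<in> fst c" using tr(3) K[OF xN] by auto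
  ultimately show ?thesis
   using form_change[OF f c2 c, of "chart_pt c2 x" "map fst us"] ch(1)[OF c] us ch(5)[OF c2 x(1)] by auto
 qed
 ultimately have "ambient_lift M gh A j f V F" unfolding ambient_lift_def by blast
 thus ?thesis using u0 by blast
qed

end

section \<open>The detour operator in the scale\<close>

lemma (in local_cone) null_frame:
 assumes x: "x \<in> U"
 shows "\<exists>!Y. h (EM (x, 1)) [Y, Y] = 0 & h (EM (x, 1)) [X (EM (x, 1)), Y] = 1 & (\<forall>v. h (EM (x, 1)) [Y, fd EM (x, 1) (v, 0)] = 0)"
proof -
 have "(%x vs. 1\<^sup>2 * g x vs) = g" by simp
 hence "cone_section W h X n U g (%x. EM (x, 1)) (l / 1\<^sup>2)" using cone_section_at[OF T(2)] by simp
 then interpret S: cone_section W h X n U g "%x. EM (x, 1)" l by simp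
 have "S.H x = (%v. fd EM (x, 1) (v, 0))" using fd_section[OF x T(2)] by (rule ext)
 hence "S.is_Y x Y \<longleftrightarrow> h (EM (x, 1)) [Y, Y] = 0 & h (EM (x, 1)) [X (EM (x, 1)), Y] = 1 & (\<forall>v. h (EM (x, 1)) [Y, fd EM (x, 1) (v, 0)] = 0)" for Y
  unfolding S.is_Y_def by simp
 moreover obtain Y where "S.is_Y x Y" using S.Y_exists[OF x] by blast
 ultimately show ?thesis using S.Y_unique[OF x] by (intro ex1I[of _ Y]) blast+
qed

lemma (in region) agr_restr: "S <= W ==> W <= S ==> agr j T (restr S j T)"
 by (auto simp: agr_def restr_def)

lemma (in pmetric) dl_factor: assumes "Frm (Suc j) T" shows "dl (dx (dl T) + cs c T) = fac j c (dl T)"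
proof -
 have t: "Ten (Suc j) (dx (dl T))" "Ten (Suc j) (cs c T)" by (intro Frm_Ten Frm_dx Frm_dl Frm_sm assms smooth_const open_W)+
 show ?thesis using Frm_dl[OF assms(1)] by (simp add: fac_def dl_add[OF t] dl_cs[OF Frm_Ten[OF assms(1)]])
qed

lemma (in pmetric) einstein_J:
 assumes "!!u v. Ric h x u v = l * h x [u, v]" "x \<in> W"
 shows "schouten_J h x = real DIM('e) * l / (2 * (real DIM('e) - 1))"
proof -
 have "h x [b, raise (h x) b] = 1" if "b \<in> Basis" for b using h_sh2[OF assms(2), of b b] that by (simp add: inner_Basis)
 hence "Scal h x = (\<Sum>b\<in>(Basis :: 'e set). l)" unfolding Scal_def assms(1) by (intro sum.cong) auto
 thus ?thesis by (simp add: schouten_J_def)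
qed

text \<open>\<open>\<delta>\<close> is moved through the product from the left, so that only factors \<open>\<delta>d + c\<close> on \<open>\<delta>\<close>-exact forms are left.\<close>

lemma (in pmetric) einstein_foldr:
 fixes G :: "('p, 'e) mfield"
 assumes G: "G c = h" and Ric: "!!x u v. x \<in> W ==> Ric h x u v = l * h x [u, v]"
  and T: "agr (Suc k) (T c) S" "Frm (Suc k) S"
 defines "C == %i. 2 * (l / (2 * (real DIM('e) - 1))) * real i * (real DIM('e) - 1 - 2 * real k - real i)"
 shows "\<exists>S'. agr (Suc k) (foldr (einstein_factor G k) is T c) S' & Frm (Suc k) S' & dl S' = foldr (fac k) (map C is) (dl S)"
proof (induction "is")
 case Nil
 thus ?case using T by auto
next
 case (Cons i "is")
 then obtain S' where S': "agr (Suc k) (foldr (einstein_factor G k) is T c) S'" "Frm (Suc k) S'" "dl S' = foldr (fac k) (map C is) (dl S)"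
  by blast
 let ?S = "dx (dl S') + cs (C i) S'"
 have c: "2 * real i * (real DIM('e) - 2 * real k - real i - 1) / real DIM('e) * schouten_J h x = C i" if "x \<in> W" for x
 proof -
  have "2 * real i * a / N * (N * l / D) = 2 * (l / D) * real i * a" if "N ~= 0" for N D a :: real using that by simp
  from this[of "real DIM('e)" "real DIM('e) - 2 * real k - real i - 1" "2 * (real DIM('e) - 1)"] show ?thesis
   unfolding einstein_J[OF Ric[OF that] that] C_def by (simp add: algebra_simps)
 qed
 have d: "agr (Suc k) (ext_d_loc (codiff_loc h (foldr (einstein_factor G k) is T c))) (dx (dl S'))"
  by (rule agr_dx[OF agr_dl[OF S'(1) Frm_Ten[OF S'(2)]] Frm_dl[OF S'(2)]])
 have "agr (Suc k) (foldr (einstein_factor G k) (i # is) T c) ?S"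
  unfolding agr_def
 proof (intro ballI allI impI)
  fix x and vs :: "'e list" assume x: "x \<in> W" and vs: "length vs = Suc k"
  show "foldr (einstein_factor G k) (i # is) T c x vs = ?S x vs"
   using d S'(1) x vs unfolding foldr.simps comp_def einstein_factor_def[of G k i] ext_d_def codiff_def G c[OF x] agr_def by simp
 qed
 moreover have "Frm (Suc k) ?S" by (intro Frm_add Frm_dx Frm_dl Frm_sm S'(2) smooth_const open_W)
 moreover have "dl ?S = foldr (fac k) (map C (i # is)) (dl S)" unfolding dl_factor[OF S'(2)] unfolding S'(3) by simp
 ultimately show ?case by blast
qed

text \<open>In charts this is the compatibility of the exterior derivative with pullback along transition maps.\<close>

lemma ext_d_kform:
 assumes M: "smooth_manifold M" and g: "pseudo_metric M g" and f: "kform M k f"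
 shows "kform M (Suc k) (ext_d f)"
proof -
 have w: "region.Frm (chart_dom c) k (restr (chart_dom c) k (f c))" if c: "c \<in> atlas M" for c
  by (rule restr_Frm[OF f c chart(2)[OF M c]]) (simp only: chart(7)[OF M c] order_refl)
 have e: "region.Frm (chart_dom c) (Suc k) (pmetric.dx (chart_dom c) (g c) (restr (chart_dom c) k (f c)))"
  "!!x vs. x \<in> chart_dom c ==> length vs = Suc k ==> ext_d f c x vs = pmetric.dx (chart_dom c) (g c) (restr (chart_dom c) k (f c)) x vs"
  "!!x vs. x \<in> chart_dom c ==> length vs = Suc k ==> ext_d f c x vs = ext_d_loc (restr (chart_dom c) k (f c)) x vs"
  if c: "c \<in> atlas M" for c
 proof -
  interpret P: pmetric "chart_dom c" "g c" by (rule pmetric_chart[OF M g c])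
  show "P.Frm (Suc k) (P.dx (restr (chart_dom c) k (f c)))" by (rule P.Frm_dx[OF w[OF c]])
  show *: "ext_d f c x vs = P.dx (restr (chart_dom c) k (f c)) x vs" if "x \<in> chart_dom c" "length vs = Suc k" for x vs
   using P.agr_dx[OF P.agr_restr[OF order_refl order_refl] w[OF c]] that by (simp add: P.agr_def ext_d_def)
  show "ext_d f c x vs = ext_d_loc (restr (chart_dom c) k (f c)) x vs" if "x \<in> chart_dom c" "length vs = Suc k" for x vs
   using *[OF that] P.dx_loc[OF w[OF c] that(1)] by simp
 qed
 show ?thesis
  unfolding form_on_def tensor_field_def
 proof (intro conjI ballI allI impI openin_topspace)
  fix c assume c: "c \<in> atlas M"
  interpret P: pmetric "chart_dom c" "g c" by (rule pmetric_chart[OF M g c])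
  note eq = chart(7)[OF M c]
  show "smooth_on (snd c ` (fst c \<inter> topspace (mtop M))) (%x. ext_d f c x vs)" if "length vs = Suc k" for vs
   unfolding eq by (rule iffD2[OF smooth_on_cong[OF P.open_W] P.Ten_smooth[OF P.Frm_Ten[OF e(1)[OF c]]]]) (rule e(2)[OF c _ that])
  fix x assume "x \<in> snd c ` (fst c \<inter> topspace (mtop M))"
  hence x: "x \<in> chart_dom c" unfolding eq .
  show "multilin (Suc k) (ext_d f c x)" "alternating (Suc k) (ext_d f c x)"
   using P.Frm_alt[OF e(1)[OF c], of x] e(2)[OF c x] by (simp_all add: alt_def ten_def multilin_def alternating_def)
 next
  fix c c' p and vs :: "'b list" assume c: "c \<in> atlas M" "c' \<in> atlas M" and p: "p \<in> fst c \<inter> fst c' \<inter> topspace (mtop M)" and vs: "length vs = Suc k"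
  let ?t = "%x. snd c' (chart_pt c x)" and ?D = "snd c ` (fst c \<inter> fst c')" and ?w = "restr (chart_dom c') k (f c')"
  note t = chart_change[OF M c]
  interpret D: region ?D by unfold_locales (rule t(1))
  interpret P: pmetric "chart_dom c'" "g c'" by (rule pmetric_chart[OF M g c(2)])
  have pD: "snd c p \<in> ?D" "snd c p \<in> chart_dom c" "?t (snd c p) = snd c' p" "snd c' p \<in> chart_dom c'"
   using p t(7,8)[of p] chart(6)[OF M c(1), of p] chart(6)[OF M c(2), of p] by auto
  have "D.agr k (f c) (%x vs. ?w (?t x) (map (fd ?t x) vs))"
   unfolding D.agr_def
  proof (intro ballI allI impI)
   fix x and vs :: "'b list" assume x: "x \<in> ?D" and "length vs = k"
   thus "f c x vs = ?w (?t x) (map (fd ?t x) vs)"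
    using form_change[OF f c, of "chart_pt c x" vs] t(3)[OF x] chart(5)[OF M c(1) t(6)[OF x]] t(4)[OF x] chart(1)[OF M c(1)]
    by (auto simp: restr_def)
  qed
  hence "ext_d f c (snd c p) vs = ext_d_loc (%x vs. ?w (?t x) (map (fd ?t x) vs)) (snd c p) vs"
   using pD(1) vs D.agr_dirderiv by (simp add: ext_d_def ext_d_loc_def length_omit)
  also have "... = ext_d_loc ?w (snd c' p) (map (fd ?t (snd c p)) vs)"
   using P.ext_d_pullback[OF t(1,2,4) w[OF c(2)] pD(1), of vs] pD(3) by simp
  also have "... = ext_d f c' (snd c' p) (map (fd ?t (snd c p)) vs)" by (rule e(3)[OF c(2) pD(4), symmetric]) (simp add: vs)
  finally show "ext_d f c (snd c p) vs = ext_d f c' (snd c' p) (map (fd (snd c' \<circ> chart_pt c) (snd c p)) vs)" by (simp add: comp_def)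
 qed
qed

text \<open>The chart, the lift and \<open>Y\<close> are those chosen in \<^const>\<open>G_op\<close>; any choice is covered by \<open>local_value\<close>.\<close>

lemma (in ambient_setting3) G_op_ext_d:
 assumes c: "c \<in> atlas M" and x: "x \<in> chart_dom c" and f: "kform M k f" and vs: "length vs = k"
  and k: "k >= 1" "DIM('b) = 2 * (Suc k + m)"
 shows "G_op M gh A \<kappa> (Suc k) (ext_d f) c x vs = \<kappa> * (2 * real m + 2) * codiff gh (einstein_product gh k (ext_d f)) c x vs"
proof -
 have eh: "einstein_metric M gh" using es by (simp add: einstein_scale_def)
 hence gh: "pseudo_metric M gh" by (simp add: einstein_metric_def)
 have df: "kform M (Suc k) (ext_d f)" by (rule ext_d_kform[OF M gh f])
 obtain l where l: "Ric (gh c) x u v = l * gh c x [u, v]" if "x \<in> chart_dom c" for x u v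
  using eh c unfolding einstein_metric_def by blast
 define u where "u = cone_pt c (x, 1)"
 define c' where "c' = (SOME c'. c' \<in> atlas (tot A) & u \<in> fst c')"
 define F where "F = (SOME F. \<exists>V. u \<in> V & ambient_lift M gh A (Suc k) (ext_d f) V F)"
 have "(\<Union>c\<in>atlas (tot A). fst c) = topspace (mtop (tot A))" using Mt unfolding smooth_manifold_def by (elim conjE)
 hence "\<exists>c'. c' \<in> atlas (tot A) & u \<in> fst c'" using cone_in(2)[OF c x zero_less_one] unfolding u_def by blast
 from someI_ex[OF this] have c': "c' \<in> atlas (tot A)" "u \<in> fst c'" unfolding c'_def by blast+
 from someI_ex[OF lift_exists[OF c x df]] obtain V where V: "u \<in> V" "ambient_lift M gh A (Suc k) (ext_d f) V F"
  unfolding F_def u_def by blast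
 have d0: "(x, 1) \<in> dom_E c c'" using x c'(2) by (simp add: dom_E_def[OF c c'(1)] u_def)
 have FV: "form_on (tot A) V (Suc k) F" "has_weight A V (Suc k) (- real (Suc k)) F" using V(2) unfolding ambient_lift_def by blast+
 hence oV: "openin (mtop (tot A)) V" unfolding form_on_def tensor_field_def by blast
 define B where "B = snd c' ` (fst c' \<inter> V)"
 have B: "open B" "EE c c' (x, 1) \<in> B" "B <= chart_dom c'"
  using cht(8)[OF c'(1) oV] V(1) c'(2) by (auto simp: B_def emb_coord_def u_def chart_dom_def)
 obtain W U T r \<tau> where "local_cone W (hm c') (XX c') DIM('b) U (gh c) l T (EE c c') r \<tau>"
  and W: "W <= B" and U: "x \<in> U" "U <= chart_dom c" "U \<times> T <= dom_E c c'"
  using local_model[OF c c'(1) d0 B l] by blast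
 then interpret L: local_cone W "hm c'" "XX c'" "DIM('b)" U "gh c" l T "EE c c'" r \<tau> by simp
 let ?h = "hm c'" and ?X = "XX c'" and ?y = "EE c c' (x, 1)" and ?H = "%v. fd (EE c c') (x, 1) (v, 0)"
 define \<omega> where "\<omega> = restr U k (f c)"
 define Fh where "Fh = restr W (Suc k) (F c')"
 have w: "L.G.Frm k \<omega>"
  unfolding \<omega>_def by (rule restr_Frm[OF f c L.G.open_W]) (simp only: ch(7)[OF c] U(2))
 have Fh: "L.Frm (Suc k) Fh" unfolding Fh_def by (rule restr_Frm[OF FV(1) c'(1) L.open_W W[unfolded B_def]])
 have aF: "L.agr (Suc k) (F c') Fh" unfolding Fh_def by (rule L.agr_restr[OF order_refl order_refl])
 have aw: "L.G.agr (Suc k) (ext_d f c) (L.G.dx \<omega>)"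
  unfolding \<omega>_def ext_d_def using L.G.agr_dx[OF L.G.agr_restr[OF order_refl order_refl]] w[unfolded \<omega>_def] by blast
 have wt: "L.wt (- real (Suc k)) Fh"
 proof (rule L.Ten_eqI[of "Suc k"])
  show "L.Ten (Suc k) (L.NN ?X Fh)" "L.Ten (Suc k) (cs (- real (Suc k)) Fh)"
   by (rule L.Ten_NN[OF L.Frm_Ten[OF Fh] L.X_smooth]) (rule L.Frm_Ten[OF L.Frm_sm[OF Fh smooth_const[OF L.open_W]]])
  fix y and us :: "('b \<times> real \<times> real) list" assume y: "y \<in> W"
  show "L.NN ?X Fh y us = cs (- real (Suc k)) Fh y us"
  proof (cases "length us = Suc k")
   case True
   have "L.NN ?X Fh y us = nabla ?h Fh y (?X y # us)"
    by (rule L.nabla_NN[OF L.Frm_Ten[OF Fh] y refl, symmetric])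
   also have "... = nabla ?h (F c') y (?X y # us)"
    using L.agr_nab[OF aF L.Frm_Ten[OF Fh]] L.agr_nab[OF _ L.Frm_Ten[OF Fh], of Fh] y True by (simp add: L.agr_def)
   also have "... = - real (Suc k) * F c' y us"
    using FV(2) c'(1) True y W unfolding has_weight_def B_def by blast
   finally show ?thesis using y True by (simp add: Fh_def restr_def)
  next
   case False
   thus ?thesis using L.Ten_len[OF L.Frm_Ten[OF Fh], of us y] L.Ten_len[OF L.Ten_NN[OF L.Frm_Ten[OF Fh] L.X_smooth], of us y] by simp
  qed
 qed
 have Fp: "Fh (EE c c' p) (map (fd (EE c c') p) us) = L.G.dx \<omega> (fst p) (map fst us)" if p: "p \<in> U \<times> T" and us: "length us = Suc k" for p us
 proof -
  obtain x t where pp: "p = (x, t)" by (cases p)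
  have pE: "p \<in> dom_E c c'" "x \<in> chart_dom c" "t > 0" using p U(2,3) L.T(3) by (auto simp: pp)
  have "EE c c' p \<in> B" using L.E_W[OF p] W by blast
  hence "cone_pt c p \<in> fst c' \<inter> V" using E_pt(2)[OF c c'(1) pE(1)] cht(3)[OF c'(1)] by (auto simp: B_def)
  hence "F c' (EE c c' p) (map (fd (EE c c') p) us) = ext_d f c x (map fst us)"
   using V(2) c c'(1) pE us unfolding ambient_lift_def pp by blast
  thus ?thesis using aw L.E_W[OF p] p us by (simp add: Fh_def restr_def L.G.agr_def pp)
 qed
 define Y where "Y = (THE Y. ?h ?y [Y, Y] = 0 & ?h ?y [?X ?y, Y] = 1 & (\<forall>v. ?h ?y [Y, ?H v] = 0))"
 have Y: "?h ?y [Y, Y] = 0" "?h ?y [?X ?y, Y] = 1" "!!v. ?h ?y [Y, ?H v] = 0"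
  using theI'[OF L.null_frame[OF U(1)]] unfolding Y_def by blast+
 have y: "snd c' u = ?y" by (simp add: emb_coord_def u_def)
 have mdiv: "DIM('b) div 2 - Suc k = m" using k(2) by simp
 have yW: "?y \<in> W" using L.E_W[of "(x, 1)"] U(1) L.T(2) by simp
 define C where "C = (%i. 2 * (l / (2 * (real DIM('b) - 1))) * real i * (real DIM('b) - 1 - 2 * real k - real i))"
 have "G_op M gh A \<kappa> (Suc k) (ext_d f) c x vs = \<kappa> * bbL DIM('b) A (Suc k) F c' ?y (Y # map ?H vs)"
  unfolding G_op_def Let_def u_def[symmetric] c'_def[symmetric] F_def[symmetric] y Y_def[symmetric] ..
 also have "bbL DIM('b) A (Suc k) F c' ?y (Y # map ?H vs) = (L.DL ^^ m) (L.iotaD (1 - real (Suc k)) (L.E Fh)) ?y (Y # map ?H vs)"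
  unfolding bbL_def mdiv using L.agr_bbL[OF aF Fh, of m "1 - real (Suc k)"] yW vs by (simp add: L.agr_def)
 also have "... = (2 * real m + 2) * foldr (L.G.fac k) (map C [1..<Suc m]) (L.G.dl (L.G.dx \<omega>)) x vs"
  unfolding C_def by (rule L.local_value[OF k w Fh wt Fp U(1) vs Y])
 also have "foldr (L.G.fac k) (map C [1..<Suc m]) (L.G.dl (L.G.dx \<omega>)) x vs = codiff gh (einstein_product gh k (ext_d f)) c x vs"
 proof -
  have m: "(DIM('b) - 2 * k - 2) div 2 + 1 = Suc m" using k(2) by simp
  obtain S where S: "L.G.agr (Suc k) (einstein_product gh k (ext_d f) c) S" "L.G.Frm (Suc k) S"
   "L.G.dl S = foldr (L.G.fac k) (map C [1..<Suc m]) (L.G.dl (L.G.dx \<omega>))"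
   using L.G.einstein_foldr[of gh c l k "ext_d f", OF refl L.einstein aw L.G.Frm_dx[OF w]] unfolding einstein_product_def m C_def by blast
  show ?thesis using L.G.agr_dl[OF S(1) L.G.Frm_Ten[OF S(2)]] U(1) vs by (simp add: codiff_def L.G.agr_def S(3))
 qed
 finally show ?thesis by simp
qed

theorem corollary4p4:
  fixes \<kappa> :: "nat \<Rightarrow> real"
  assumes "even CARD('n::finite)" and "CARD('n) \<ge> 4" and "\<And>j. \<kappa> j \<noteq> 0"
  shows "(\<forall>k\<in>{1..CARD('n) div 2 - 1}. \<exists>a. a \<noteq> 0 \<and>
      (\<forall>(M :: ('p, real ^ 'n) mfd) g \<sigma>
         (A :: ('p, real ^ 'n, 'q, (real ^ 'n) \<times> real \<times> real) ambient) Q.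
         smooth_manifold M \<and> pseudo_metric M g \<and> einstein_scale M g \<sigma> \<and>
         ricci_flat_ambient_space M g A \<and>
         branson_gover_Q M (scale_metric M g \<sigma>) A (\<kappa> (k + 1)) (k + 1) (Q (k + 1)) \<longrightarrow>
         (\<forall>f. kform M k f \<longrightarrow>
            form_eq M k (detour_L (scale_metric M g \<sigma>) Q k f)
              (\<lambda>c x vs. a * codiff (scale_metric M g \<sigma>)
                 (einstein_product (scale_metric M g \<sigma>) k (ext_d f)) c x vs)))) \<and>
    (\<forall>(M :: ('p, real ^ 'n) mfd) g \<sigma> Q f.
       smooth_manifold M \<and> pseudo_metric M g \<and> einstein_scale M g \<sigma> \<and> kform M (CARD('n) div 2) f \<longrightarrow>
         form_eq M (CARD('n) div 2) (detour_L (scale_metric M g \<sigma>) Q (CARD('n) div 2) f)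
           (\<lambda>c x vs. 0))"
proof (intro conjI ballI allI impI)
 fix k assume k: "k \<in> {1..CARD('n) div 2 - 1}"
 define m where "m = CARD('n) div 2 - Suc k"
 have n: "DIM(real ^ 'n) = CARD('n)" by simp
 have nm: "CARD('n) = 2 * (Suc k + m)" "k >= 1" using k assms(1,2) by (auto simp: m_def elim!: evenE)
 show "\<exists>a. a ~= 0 &
   (\<forall>(M :: ('p, real ^ 'n) mfd) g \<sigma>
     (A :: ('p, real ^ 'n, 'q, (real ^ 'n) \<times> real \<times> real) ambient) Q.
     smooth_manifold M & pseudo_metric M g & einstein_scale M g \<sigma> &
     ricci_flat_ambient_space M g A &
     branson_gover_Q M (scale_metric M g \<sigma>) A (\<kappa> (k + 1)) (k + 1) (Q (k + 1)) -->
     (\<forall>f. kform M k f -->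
      form_eq M k (detour_L (scale_metric M g \<sigma>) Q k f)
       (%c x vs. a * codiff (scale_metric M g \<sigma>)
         (einstein_product (scale_metric M g \<sigma>) k (ext_d f)) c x vs)))"
 proof (intro exI[of _ "\<kappa> (Suc k) * (2 * real m + 2)"] conjI allI impI)
  show "\<kappa> (Suc k) * (2 * real m + 2) ~= 0" using assms(3)[of "Suc k"] by (simp add: add_nonneg_eq_0_iff)
  fix M :: "('p, real ^ 'n) mfd" and g \<sigma> and A :: "('p, real ^ 'n, 'q, (real ^ 'n) \<times> real \<times> real) ambient" and Q f
  assume H: "smooth_manifold M & pseudo_metric M g & einstein_scale M g \<sigma> & ricci_flat_ambient_space M g A &
     branson_gover_Q M (scale_metric M g \<sigma>) A (\<kappa> (k + 1)) (k + 1) (Q (k + 1))" and f: "kform M k f"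
  interpret ambient_setting3 M g \<sigma> A
  proof unfold_locales
   show "smooth_manifold M" "pseudo_metric M g" "einstein_scale M g \<sigma>" "ricci_flat_ambient_space M g A" using H by blast+
   show "DIM(real ^ 'n) > 2" unfolding n using assms(2) by simp
  qed
  have "kform M (Suc k) (ext_d f)"
   using ext_d_kform[OF M _ f, of gh] es unfolding einstein_scale_def einstein_metric_def by blast
  hence G: "form_eq M k (G_op M gh A (\<kappa> (Suc k)) (Suc k) (ext_d f)) (codiff gh (Q (Suc k) (ext_d f)))"
   using H unfolding branson_gover_Q_def Suc_eq_plus1[symmetric] diff_Suc_1 by blast
  have "detour_L gh Q k f c x vs = \<kappa> (Suc k) * (2 * real m + 2) * codiff gh (einstein_product gh k (ext_d f)) c x vs"
   if c: "c \<in> atlas M" and x: "x \<in> chart_dom c" and vs: "length vs = k" for c x vs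
  proof -
   have "2 * k ~= DIM(real ^ 'n)" unfolding n nm(1) by simp
   hence "detour_L gh Q k f = codiff gh (Q (Suc k) (ext_d f))" by (simp add: detour_L_def)
   hence "detour_L gh Q k f c x vs = G_op M gh A (\<kappa> (Suc k)) (Suc k) (ext_d f) c x vs"
    using G c x vs unfolding form_eq_def by simp
   thus ?thesis using G_op_ext_d[OF c x f vs nm(2) trans[OF n nm(1)]] by simp
  qed
  thus "form_eq M k (detour_L gh Q k f)
       (%c x vs. \<kappa> (Suc k) * (2 * real m + 2) * codiff gh (einstein_product gh k (ext_d f)) c x vs)"
   unfolding form_eq_def by blast
 qed
next
 fix M :: "('p, real ^ 'n) mfd" and g \<sigma> Q f
 have "detour_L (scale_metric M g \<sigma>) Q (CARD('n) div 2) f = (%c x vs. 0)" using assms(1) by (simp add: detour_L_def)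
 thus "form_eq M (CARD('n) div 2) (detour_L (scale_metric M g \<sigma>) Q (CARD('n) div 2) f) (%c x vs. 0)"
  by (simp add: form_eq_def)
qed

end
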